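(* The space $\{(v,\boldsymbol\sigma)\in C^\infty(\overline Q)^{1+d}\mid v|_{J\times\partial\Omega}=0\}$ is dense in $V_0$ with respect to the norm $\|\cdot\|_V$.
   Context: $\Omega\subset\mathbb{R}^d$ is a bounded polygonal Lipschitz domain, $T>0$, $J=(0,T)$, $Q=J\times\Omega$; $L^2(Q)$ is identified with $L^2(J;L^2(\Omega))$; $(\cdot,\cdot)_Q,(\cdot,\cdot)_\Omega$ are $L^2$ inner products. $H^{-1}(\Omega)$ is the dual of $H^1_0(\Omega)$. $\partial_t,\nabla_x,\mathrm{div}_x,\Delta_x$ are distributional derivatives on $Q$. $\widetilde V=\{(v,\boldsymbol\sigma)\in L^2(Q)\times L^2(Q)^d\mid \partial_t v-\mathrm{div}_x\boldsymbol\sigma\in L^2(Q),\ \partial_t\boldsymbol\sigma-\nabla_x v\in L^2(Q)^d\}$ with graph norm $\|(v,\boldsymbol\sigma)\|_{\widetilde V}^2=\|v\|^2_{L^2(Q)}+\|\boldsymbol\sigma\|^2_{L^2(Q)^d}+\|\partial_t v-\mathrm{div}_x\boldsymbol\sigma\|^2_{L^2(Q)}+\|\partial_t\boldsymbol\sigma-\nabla_x v\|^2_{L^2(Q)^d}$. Elements of $\widetilde V$ satisfy $v\in H^1(J;H^{-1}(\Omega))$, $\boldsymbol\sigma\in H^1(J;H^{-1}(\Omega)^d)$, so $v(0),\boldsymbol\sigma(0)$ are defined. $V=\{(v,\boldsymbol\sigma)\in\widetilde V\mid v(0)\in L^2(\Omega),\ \boldsymbol\sigma(0)\in L^2(\Omega)^d\}$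 with $\|(v,\boldsymbol\sigma)\|_V^2=\|(v,\boldsymbol\sigma)\|_{\widetilde V}^2+\|v(0)\|_{L^2(\Omega)}^2+\|\boldsymbol\sigma(0)\|_{L^2(\Omega)^d}^2$. $Y=\{\varphi\in H^1(J;H^1_0(\Omega))\cap H^2(J;L^2(\Omega))\mid\Delta_x\varphi\in L^2(Q),\ \varphi(T)=0,\ \partial_t\varphi(T)=0\}$, and for $(v,\boldsymbol\sigma)\in V$, $\varphi\in Y$: $D(v,\boldsymbol\sigma)(\varphi)=(\partial_t\boldsymbol\sigma-\nabla_x v,\nabla_x\varphi)_Q+(\boldsymbol\sigma,\nabla_x\partial_t\varphi)_Q-(v,\Delta_x\varphi)_Q+(\boldsymbol\sigma(0),\nabla_x\varphi(0))_\Omega$. $V_0=\{(v,\boldsymbol\sigma)\in V\mid D(v,\boldsymbol\sigma)(\varphi)=0\ \forall\varphi\in Y\}$. *)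

theory Defs
  imports "HOL-Analysis.Analysis"
begin

fun Ck :: "nat \<Rightarrow> ('a::euclidean_space \<Rightarrow> real) \<Rightarrow> bool" where
  "Ck 0 f = continuous_on UNIV f"
| "Ck (Suc k) f = (f differentiable_on UNIV \<and>
      (\<forall>u. Ck k (\<lambda>x. frechet_derivative f (at x) u)))"

definition smooth :: "('a::euclidean_space \<Rightarrow> real) \<Rightarrow> bool" where
  "smooth f \<longleftrightarrow> (\<forall>k. Ck k f)"

definition test_fun :: "'a::euclidean_space set \<Rightarrow> ('a \<Rightarrow> real) \<Rightarrow> bool" where
  "test_fun U f \<longleftrightarrow> smooth f \<and> compact (closure {x. f x \<noteq> 0}) \<and> closure {x. f x \<noteq> 0} \<subseteq> U"

definition dt :: "(real \<times> (real^'d) \<Rightarrow> real) \<Rightarrow> real \<times> (real^'d) \<Rightarrow> real" where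
  "dt f z = frechet_derivative f (at z) (1, 0)"

definition dx :: "'d::finite \<Rightarrow> (real \<times> (real^'d) \<Rightarrow> real) \<Rightarrow> real \<times> (real^'d) \<Rightarrow> real" where
  "dx i f z = frechet_derivative f (at z) (0, axis i 1)"

definition L2 :: "'a::euclidean_space set \<Rightarrow> ('a \<Rightarrow> real) \<Rightarrow> bool" where
  "L2 S f \<longleftrightarrow> set_borel_measurable lborel S f \<and> set_integrable lborel S (\<lambda>z. (f z)^2)"

definition L2v :: "'a::euclidean_space set \<Rightarrow> ('a \<Rightarrow> real^'d) \<Rightarrow> bool" where
  "L2v S F \<longleftrightarrow> (\<forall>i. L2 S (\<lambda>z. F z $ i))"

definition ip :: "'a::euclidean_space set \<Rightarrow> ('a \<Rightarrow> real) \<Rightarrow> ('a \<Rightarrow> real) \<Rightarrow> real" where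
  "ip S f g = (LINT z:S|lborel. f z * g z)"

definition ipv :: "'a::euclidean_space set \<Rightarrow> ('a \<Rightarrow> real^'d) \<Rightarrow> ('a \<Rightarrow> real^'d) \<Rightarrow> real" where
  "ipv S F G = (\<Sum>i\<in>UNIV. ip S (\<lambda>z. F z $ i) (\<lambda>z. G z $ i))"

definition cyl :: "real \<Rightarrow> (real^'d) set \<Rightarrow> (real \<times> (real^'d)) set" where
  "cyl T \<Omega> = {0<..<T} \<times> \<Omega>"

definition lipschitz_domain :: "(real^'d) set \<Rightarrow> bool" where
  "lipschitz_domain \<Omega> \<longleftrightarrow> open \<Omega> \<and>
     (\<forall>p\<in>frontier \<Omega>. \<exists>U A (k::'d) (g::real^'d \<Rightarrow> real) (L::real). open U \<and> p \<in> U \<and> orthogonal_transformation A \<and>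
        L-lipschitz_on UNIV g \<and> (\<forall>y z. (\<forall>j. j \<noteq> k \<longrightarrow> y $ j = z $ j) \<longrightarrow> g y = g z) \<and>
        (\<forall>y\<in>U. y \<in> \<Omega> \<longleftrightarrow> (A y) $ k < g (A y)))"

definition polygonal_lipschitz_domain :: "(real^'d) set \<Rightarrow> bool" where
  "polygonal_lipschitz_domain \<Omega> \<longleftrightarrow> \<Omega> \<noteq> {} \<and> bounded \<Omega> \<and> connected \<Omega> \<and> lipschitz_domain \<Omega> \<and>
     (\<exists>P::(real^'d) set set. finite P \<and> (\<forall>S\<in>P. polytope S) \<and> closure \<Omega> = \<Union>P)"

text \<open>(v,sigma) in V with g = dt v - div sigma, h = dt sigma - grad v, v0 = v(0), s0 = sigma(0),
  all characterised weakly (integration by parts against smooth test functions supported in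
  (-inf,T) x Omega).\<close>
definition isV :: "(real^'d) set \<Rightarrow> real \<Rightarrow> (real \<times> (real^'d) \<Rightarrow> real) \<Rightarrow> (real \<times> (real^'d) \<Rightarrow> real^'d)
   \<Rightarrow> (real \<times> (real^'d) \<Rightarrow> real) \<Rightarrow> (real \<times> (real^'d) \<Rightarrow> real^'d) \<Rightarrow> (real^'d \<Rightarrow> real) \<Rightarrow> (real^'d \<Rightarrow> real^'d) \<Rightarrow> bool" where
  "isV \<Omega> T v \<sigma> g h v0 s0 \<longleftrightarrow>
     L2 (cyl T \<Omega>) v \<and> L2v (cyl T \<Omega>) \<sigma> \<and> L2 (cyl T \<Omega>) g \<and> L2v (cyl T \<Omega>) h \<and> L2 \<Omega> v0 \<and> L2v \<Omega> s0 \<and>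
     (\<forall>\<phi>. test_fun ({..<T} \<times> \<Omega>) \<phi> \<longrightarrow>
        ip (cyl T \<Omega>) g \<phi> = - ip (cyl T \<Omega>) v (dt \<phi>) + (\<Sum>i\<in>UNIV. ip (cyl T \<Omega>) (\<lambda>z. \<sigma> z $ i) (dx i \<phi>))
                          - ip \<Omega> v0 (\<lambda>x. \<phi> (0, x)) \<and>
        (\<forall>i. ip (cyl T \<Omega>) (\<lambda>z. h z $ i) \<phi> = - ip (cyl T \<Omega>) (\<lambda>z. \<sigma> z $ i) (dt \<phi>) + ip (cyl T \<Omega>) v (dx i \<phi>)
                          - ip \<Omega> (\<lambda>x. s0 x $ i) (\<lambda>x. \<phi> (0, x))))"

definition inV :: "(real^'d) set \<Rightarrow> real \<Rightarrow> (real \<times> (real^'d) \<Rightarrow> real) \<Rightarrow> (real \<times> (real^'d) \<Rightarrow> real^'d) \<Rightarrow> bool" where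
  "inV \<Omega> T v \<sigma> \<longleftrightarrow> (\<exists>g h v0 s0. isV \<Omega> T v \<sigma> g h v0 s0)"

text \<open>The V-norm (independent of the a.e.-unique witnesses).\<close>
definition V_norm :: "(real^'d) set \<Rightarrow> real \<Rightarrow> (real \<times> (real^'d) \<Rightarrow> real) \<Rightarrow> (real \<times> (real^'d) \<Rightarrow> real^'d) \<Rightarrow> real" where
  "V_norm \<Omega> T v \<sigma> = sqrt (SOME r. \<exists>g h v0 s0. isV \<Omega> T v \<sigma> g h v0 s0 \<and>
      r = ip (cyl T \<Omega>) v v + ipv (cyl T \<Omega>) \<sigma> \<sigma> + ip (cyl T \<Omega>) g g + ipv (cyl T \<Omega>) h h
          + ip \<Omega> v0 v0 + ipv \<Omega> s0 s0)"

text \<open>phi in Y with p = dt phi, pp = dt^2 phi, G = grad phi, Gt = grad dt phi, L = Laplace phi,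
  G0 = grad phi(0).  H^1(J;H^1_0(Omega)) is the closure of smooth functions with compact support
  in R x Omega in the norm of L2 of (phi, dt phi, grad phi, grad dt phi).\<close>
definition isY :: "(real^'d) set \<Rightarrow> real \<Rightarrow> (real \<times> (real^'d) \<Rightarrow> real) \<Rightarrow> (real \<times> (real^'d) \<Rightarrow> real)
   \<Rightarrow> (real \<times> (real^'d) \<Rightarrow> real) \<Rightarrow> (real \<times> (real^'d) \<Rightarrow> real^'d) \<Rightarrow> (real \<times> (real^'d) \<Rightarrow> real^'d)
   \<Rightarrow> (real \<times> (real^'d) \<Rightarrow> real) \<Rightarrow> (real^'d \<Rightarrow> real^'d) \<Rightarrow> bool" where
  "isY \<Omega> T \<phi> p pp G Gt L G0 \<longleftrightarrow>
     L2 (cyl T \<Omega>) \<phi> \<and> L2 (cyl T \<Omega>) p \<and> L2 (cyl T \<Omega>) pp \<and> L2v (cyl T \<Omega>) G \<and> L2v (cyl T \<Omega>) Gt \<and>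
     L2 (cyl T \<Omega>) L \<and> L2v \<Omega> G0 \<and>
     (\<exists>\<psi>. (\<forall>k. test_fun (UNIV \<times> \<Omega>) (\<psi> k)) \<and>
        (\<lambda>k. ip (cyl T \<Omega>) (\<lambda>z. \<phi> z - \<psi> k z) (\<lambda>z. \<phi> z - \<psi> k z)
           + ip (cyl T \<Omega>) (\<lambda>z. p z - dt (\<psi> k) z) (\<lambda>z. p z - dt (\<psi> k) z)
           + (\<Sum>i\<in>UNIV. ip (cyl T \<Omega>) (\<lambda>z. G z $ i - dx i (\<psi> k) z) (\<lambda>z. G z $ i - dx i (\<psi> k) z)
                 + ip (cyl T \<Omega>) (\<lambda>z. Gt z $ i - dx i (dt (\<psi> k)) z) (\<lambda>z. Gt z $ i - dx i (dt (\<psi> k)) z)))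
        \<longlonglongrightarrow> 0) \<and>
     (\<forall>\<psi>. test_fun (cyl T \<Omega>) \<psi> \<longrightarrow> ip (cyl T \<Omega>) pp \<psi> = - ip (cyl T \<Omega>) p (dt \<psi>)) \<and>
     (\<forall>\<psi>. test_fun (cyl T \<Omega>) \<psi> \<longrightarrow>
        ip (cyl T \<Omega>) L \<psi> = ip (cyl T \<Omega>) \<phi> (\<lambda>z. \<Sum>i\<in>UNIV. dx i (dx i \<psi>) z)) \<and>
     (\<forall>\<psi>. test_fun ({0<..} \<times> \<Omega>) \<psi> \<longrightarrow>
        ip (cyl T \<Omega>) p \<psi> = - ip (cyl T \<Omega>) \<phi> (dt \<psi>) \<and> ip (cyl T \<Omega>) pp \<psi> = - ip (cyl T \<Omega>) p (dt \<psi>)) \<and>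
     (\<forall>\<psi>. test_fun ({..<T} \<times> \<Omega>) \<psi> \<longrightarrow> (\<forall>i.
        ip (cyl T \<Omega>) (\<lambda>z. Gt z $ i) \<psi> = - ip (cyl T \<Omega>) (\<lambda>z. G z $ i) (dt \<psi>) - ip \<Omega> (\<lambda>x. G0 x $ i) (\<lambda>x. \<psi> (0, x))))"

definition D_form :: "(real^'d) set \<Rightarrow> real \<Rightarrow> (real \<times> (real^'d) \<Rightarrow> real) \<Rightarrow> (real \<times> (real^'d) \<Rightarrow> real^'d)
   \<Rightarrow> (real \<times> (real^'d) \<Rightarrow> real^'d) \<Rightarrow> (real^'d \<Rightarrow> real^'d)
   \<Rightarrow> (real \<times> (real^'d) \<Rightarrow> real^'d) \<Rightarrow> (real \<times> (real^'d) \<Rightarrow> real^'d) \<Rightarrow> (real \<times> (real^'d) \<Rightarrow> real) \<Rightarrow> (real^'d \<Rightarrow> real^'d) \<Rightarrow> real" where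
  "D_form \<Omega> T v \<sigma> h s0 G Gt L G0 =
     ipv (cyl T \<Omega>) h G + ipv (cyl T \<Omega>) \<sigma> Gt - ip (cyl T \<Omega>) v L + ipv \<Omega> s0 G0"

definition inV0 :: "(real^'d) set \<Rightarrow> real \<Rightarrow> (real \<times> (real^'d) \<Rightarrow> real) \<Rightarrow> (real \<times> (real^'d) \<Rightarrow> real^'d) \<Rightarrow> bool" where
  "inV0 \<Omega> T v \<sigma> \<longleftrightarrow> (\<exists>g h v0 s0. isV \<Omega> T v \<sigma> g h v0 s0 \<and>
      (\<forall>\<phi> p pp G Gt L G0. isY \<Omega> T \<phi> p pp G Gt L G0 \<longrightarrow> D_form \<Omega> T v \<sigma> h s0 G Gt L G0 = 0))"

text \<open>Pairs in C^infty(closure Q)^(1+d) (restrictions of smooth functions on R^(1+d)) with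
  w = 0 on J x boundary(Omega).\<close>
definition smooth_pair_bc :: "(real^'d) set \<Rightarrow> real \<Rightarrow> (real \<times> (real^'d) \<Rightarrow> real) \<Rightarrow> (real \<times> (real^'d) \<Rightarrow> real^'d) \<Rightarrow> bool" where
  "smooth_pair_bc \<Omega> T w \<tau> \<longleftrightarrow> smooth w \<and> (\<forall>i. smooth (\<lambda>z. \<tau> z $ i)) \<and>
     (\<forall>t x. t \<in> {0<..<T} \<and> x \<in> frontier \<Omega> \<longrightarrow> w (t, x) = 0)"

end

(*
  A pair (v, sigma) with its derivatives and initial values becomes a vector of a Hilbert space;
  V_0 is then the orthogonal complement of a set of test vectors, and the smooth pairs lie in it.
  By the projection theorem it suffices that a vector of V_0 orthogonal to all smooth pairs is zero.
  Let (v, s, g, h, v0, s0) be such a vector, where g = dt v - div s and h = dt s - grad v.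
  Orthogonality says, weakly, that dt g - div h = v and dt h - grad g = s, with g(0) = v0,
  h(0) = s0, g(T) = 0, h(T) = 0 and g = 0 on the lateral boundary; the constraint D = 0 gives v = 0
  there.  Hence (a, b) = (g - v, h - s) solves dt a - div b = -a, dt b - grad a = -b with zero
  initial and boundary values, so that it vanishes by an energy estimate; then (v, s) solves a
  system of the same kind with zero final values and vanishes too.  The estimates are applied to
  averages of the unknowns against smooth functions of time, which are regular enough in space for
  Green's formula; on a Lipschitz domain this formula follows by mollifying with kernels supported
  in a cone of inward directions.
*)

theory Submission
  imports Defs
begin

section \<open>Smooth functions\<close>

text \<open>Mollifying a pair of \<open>V0\<close> would have to respect a lateral condition that is
  known only weakly, through \<open>D\<close>, and to control both ends of the time interval.
  Duality turns density into uniqueness. The differences (g - v, h - s) come from a symmetry: in dt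
  v - div s = g and dt g - div h = v the pairs (v, s) and (g, h) change roles, so subtraction
  decouples them. The difference has zero initial data because g(0) = v0 = v(0); once it vanishes,
  (v, s) inherits the final data of (g, h). One estimate therefore uses the initial and the other
  the final values. The obstacle is regularity: only the combinations dt v - div s and dt s - grad v
  are square integrable, not their single terms. Averaging in time moves dt to the weight and leaves
  the spatial derivative alone in L2. The lateral conditions have different origins. For g the
  condition comes from testing with fields that are free on the boundary. For v it comes from the
  constraint, and an elliptic problem is needed to pass from tests in \<open>Y\<close> to tests with
  all smooth functions.\<close>

definition dd :: "'a::euclidean_space \<Rightarrow> ('a \<Rightarrow> real) \<Rightarrow> 'a \<Rightarrow> real" where
  "dd u f x = frechet_derivative f (at x) u"

lemma dt_eq_dd: "dt f = dd (1, 0) f"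
  by (auto simp: dt_def dd_def fun_eq_iff)

lemma dx_eq_dd: "dx i f = dd (0, axis i 1) f"
  by (auto simp: dx_def dd_def fun_eq_iff)

lemma dd_eqI: "(f has_derivative D) (at x) \<Longrightarrow> dd u f x = D u"
  unfolding dd_def using frechet_derivative_at by metis

section \<open>Closure properties of \<open>Ck\<close> and of smooth functions\<close>

lemma Ck_Suc_imp: "Ck (Suc k) f \<Longrightarrow> Ck k f"
proof (induction k arbitrary: f)
  case 0
  then show ?case by (simp add: differentiable_imp_continuous_on)
next
  case (Suc k)
  then show ?case by (metis Ck.simps(2))
qed

lemma Ck_has_derivative: "Ck (Suc k) f \<Longrightarrow> (f has_derivative (\<lambda>u. dd u f x)) (at x)"
  by (auto simp: dd_def differentiable_on_def frechet_derivative_works[symmetric])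

lemma Ck_dd: "Ck (Suc k) f \<Longrightarrow> Ck k (dd u f)"
  by (simp add: dd_def[abs_def])

text \<open>Derivatives are unique, so each closure proof below may name its own candidate
  \<open>D\<close> for the directional derivatives and apply the induction hypothesis to it, without
  handling the chosen \<open>frechet_derivative\<close>.\<close>

lemma Ck_SucI:
  assumes "\<And>x. (f has_derivative (\<lambda>u. D u x)) (at x)" and "\<And>u. Ck k (D u)"
  shows "Ck (Suc k) f"
proof -
  have "(\<lambda>x. frechet_derivative f (at x) u) = D u" for u
    by (rule ext, subst frechet_derivative_at[OF assms(1), symmetric], rule refl)
  with assms show ?thesis
    by (auto simp: differentiable_on_def differentiable_def intro: has_derivative_at_withinI)
qed

lemma smooth_Ck: "smooth f \<Longrightarrow> Ck k f"
  by (simp add: smooth_def)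

lemma smooth_has_derivative: "smooth f \<Longrightarrow> (f has_derivative (\<lambda>u. dd u f x)) (at x)"
  using Ck_has_derivative[OF smooth_Ck[of f "Suc 0"]] .

lemma smooth_dd [intro]: "smooth f \<Longrightarrow> smooth (dd u f)"
  unfolding smooth_def by (meson Ck_dd)

lemma smooth_dt [intro]: "smooth f \<Longrightarrow> smooth (dt f)"
  and smooth_dx [intro]: "smooth f \<Longrightarrow> smooth (dx i f)"
  by (auto simp: dt_eq_dd dx_eq_dd)

lemma smooth_continuous: "smooth f \<Longrightarrow> continuous_on A f"
  by (metis Ck.simps(1) continuous_on_subset smooth_Ck subset_UNIV)

lemma smooth_isCont: "smooth f \<Longrightarrow> isCont f x"
  using smooth_continuous[of f UNIV] by (simp add: continuous_on_eq_continuous_at)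

lemma smooth_borel: "smooth f \<Longrightarrow> f \<in> borel_measurable borel"
  by (simp add: borel_measurable_continuous_onI smooth_continuous)

lemma dd_linear: "smooth f \<Longrightarrow> linear (\<lambda>u. dd u f x)"
  using smooth_has_derivative has_derivative_linear by blast

lemma Ck_const: "Ck k (\<lambda>x::'a::euclidean_space. c)"
proof (induction k arbitrary: c)
  case (Suc k)
  show ?case by (rule Ck_SucI[where D="\<lambda>u x. 0"]) (auto simp: Suc)
qed (simp)

lemma Ck_add: "Ck k f \<Longrightarrow> Ck k g \<Longrightarrow> Ck k (\<lambda>x. f x + g x)"
proof (induction k arbitrary: f g)
  case (Suc k)
  show ?case
    by (rule Ck_SucI[where D="\<lambda>u x. dd u f x + dd u g x"])
      (auto intro!: has_derivative_add Ck_has_derivative Suc.IH Suc.prems Ck_dd)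
qed (auto intro: continuous_intros)

lemma Ck_mult: "Ck k f \<Longrightarrow> Ck k g \<Longrightarrow> Ck k (\<lambda>x. f x * g x)"
proof (induction k arbitrary: f g)
  case (Suc k)
  show ?case
  proof (rule Ck_SucI[where D="\<lambda>u x. f x * dd u g x + dd u f x * g x"])
    show "((\<lambda>x. f x * g x) has_derivative (\<lambda>u. f x * dd u g x + dd u f x * g x)) (at x)" for x
      by (rule has_derivative_mult[OF Ck_has_derivative Ck_has_derivative]) (rule Suc.prems)+
    show "Ck k (\<lambda>x. f x * dd u g x + dd u f x * g x)" for u
      by (rule Ck_add[OF Suc.IH Suc.IH]; rule Ck_dd Ck_Suc_imp; rule Suc.prems)
  qed
qed (auto intro: continuous_intros)

text \<open>The derivative of 1/f is a product of factors 1/f and a derivative of f, so the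
  induction on k supplies the regularity of the factors 1/f itself.\<close>

lemma Ck_inverse: "Ck k f \<Longrightarrow> (\<And>x. f x \<noteq> 0) \<Longrightarrow> Ck k (\<lambda>x. inverse (f x))"
proof (induction k arbitrary: f)
  case (Suc k)
  show ?case
  proof (rule Ck_SucI[where D="\<lambda>u x. (- 1) * (inverse (f x) * dd u f x * inverse (f x))"])
    show "((\<lambda>x. inverse (f x)) has_derivative
         (\<lambda>u. - 1 * (inverse (f x) * dd u f x * inverse (f x)))) (at x)" for x
      using Deriv.has_derivative_inverse[OF Suc.prems(2)[of x] Ck_has_derivative[OF Suc.prems(1), of x]] by simp
    show "Ck k (\<lambda>x. - 1 * (inverse (f x) * dd u f x * inverse (f x)))" for u
      by (intro Ck_mult Ck_const Suc.IH Suc.prems Ck_dd Ck_Suc_imp[OF Suc.prems(1)])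
  qed
qed (auto intro: continuous_intros)

lemma Ck_affine:
  assumes "bounded_linear A"
  shows "Ck k f \<Longrightarrow> Ck k (\<lambda>x. f (A x + c))"
proof (induction k arbitrary: f)
  case 0
  then have f: "continuous_on UNIV f" by simp
  have "continuous_on UNIV (\<lambda>x. A x + c)"
    using assms by (intro continuous_intros linear_continuous_on)
  then show ?case
    using continuous_on_compose2[OF f, of UNIV "\<lambda>x. A x + c"] by simp
next
  case (Suc k)
  show ?case
  proof (rule Ck_SucI[where D="\<lambda>u x. dd (A u) f (A x + c)"])
    show "((\<lambda>x. f (A x + c)) has_derivative (\<lambda>u. dd (A u) f (A x + c))) (at x)" for x
      by (rule has_derivative_compose[of "\<lambda>x. A x + c" A, OF _ Ck_has_derivative[OF Suc.prems]])
        (use bounded_linear_imp_has_derivative[OF assms] in \<open>auto intro!: derivative_eq_intros\<close>)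
    show "Ck k (\<lambda>x. dd (A u) f (A x + c))" for u
      by (intro Suc.IH Ck_dd Suc.prems)
  qed
qed

lemma Ck_compose_real:
  fixes g :: "real \<Rightarrow> real"
  shows "smooth g \<Longrightarrow> Ck k f \<Longrightarrow> Ck k (\<lambda>x. g (f x))"
proof (induction k arbitrary: f g)
  case 0
  then show ?case
    using continuous_on_compose2[OF smooth_continuous[of g UNIV], of UNIV f] by simp
next
  case (Suc k)
  show ?case
  proof (rule Ck_SucI[where D="\<lambda>u x. dd u f x * dd 1 g (f x)"])
    show "((\<lambda>x. g (f x)) has_derivative (\<lambda>u. dd u f x * dd 1 g (f x))) (at x)" for x
    proof -
      have "((\<lambda>x. g (f x)) has_derivative (\<lambda>u. dd (dd u f x) g (f x))) (at x)"
        by (rule has_derivative_compose[OF Ck_has_derivative[OF Suc.prems(2)] smooth_has_derivative[OF Suc.prems(1)]])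
      moreover have "dd (dd u f x) g (f x) = dd u f x * dd 1 g (f x)" for u
        using linear_scale[OF dd_linear[OF Suc.prems(1), of "f x"], of "dd u f x" 1] by simp
      ultimately show ?thesis by simp
    qed
    show "Ck k (\<lambda>x. dd u f x * dd 1 g (f x))" for u
      by (rule Ck_mult[OF Ck_dd[OF Suc.prems(2)]
            Suc.IH[OF smooth_dd[OF Suc.prems(1)] Ck_Suc_imp[OF Suc.prems(2)]]])
  qed
qed

lemma smooth_const [intro, simp]: "smooth (\<lambda>x. c)"
  by (simp add: smooth_def Ck_const)

lemma smooth_add [intro]: "smooth f \<Longrightarrow> smooth g \<Longrightarrow> smooth (\<lambda>x. f x + g x)"
  and smooth_mult [intro]: "smooth f \<Longrightarrow> smooth g \<Longrightarrow> smooth (\<lambda>x. f x * g x)"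
  by (simp_all add: smooth_def Ck_add Ck_mult)

lemma smooth_inverse: "smooth f \<Longrightarrow> (\<And>x. f x \<noteq> 0) \<Longrightarrow> smooth (\<lambda>x. inverse (f x))"
  by (simp add: smooth_def Ck_inverse)

lemma smooth_divide: "smooth f \<Longrightarrow> smooth g \<Longrightarrow> (\<And>x. g x \<noteq> 0) \<Longrightarrow> smooth (\<lambda>x. f x / g x)"
  unfolding divide_inverse by (intro smooth_mult smooth_inverse)

lemma smooth_minus [intro]: "smooth f \<Longrightarrow> smooth (\<lambda>x. - f x)"
  using smooth_mult[OF smooth_const[of "-1"], of f] by simp

lemma smooth_diff [intro]: "smooth f \<Longrightarrow> smooth g \<Longrightarrow> smooth (\<lambda>x. f x - g x)"
  using smooth_add[OF _ smooth_minus, of f g] by simp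

lemma smooth_sum [intro]: "(\<And>i. i \<in> I \<Longrightarrow> smooth (f i)) \<Longrightarrow> smooth (\<lambda>x. \<Sum>i\<in>I. f i x)"
  by (induction I rule: infinite_finite_induct) auto

lemma smooth_prod [intro]: "(\<And>i. i \<in> I \<Longrightarrow> smooth (f i)) \<Longrightarrow> smooth (\<lambda>x. \<Prod>i\<in>I. f i x)"
  by (induction I rule: infinite_finite_induct) auto

lemma smooth_power [intro]: "smooth f \<Longrightarrow> smooth (\<lambda>x. f x ^ n)"
  by (induction n) auto

lemma smooth_affine: "bounded_linear A \<Longrightarrow> smooth f \<Longrightarrow> smooth (\<lambda>x. f (A x + c))"
  by (simp add: smooth_def Ck_affine)

lemma smooth_compose_real: "smooth g \<Longrightarrow> smooth f \<Longrightarrow> smooth (\<lambda>x. (g::real \<Rightarrow> real) (f x))"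
  by (simp add: smooth_def Ck_compose_real)

lemma smooth_linear:
  assumes "bounded_linear f" shows "smooth f"
  unfolding smooth_def
proof
  fix k show "Ck k f"
  proof (cases k)
    case 0
    then show ?thesis using assms linear_continuous_on by auto
  next
    case (Suc m)
    show ?thesis unfolding Suc
      by (rule Ck_SucI[where D="\<lambda>u x. f u"])
        (auto intro: bounded_linear_imp_has_derivative[OF assms] Ck_const)
  qed
qed

text \<open>Meant for a function whose successive derivatives are known in closed form, such as the
  flat exponential below.\<close>

lemma smooth_chain:
  fixes h :: "nat \<Rightarrow> real \<Rightarrow> real"
  assumes "\<And>n x. (h n has_field_derivative h (Suc n) x) (at x)"
  shows "smooth (h n)"
proof -
  \<comment> \<open>The factor c makes the induction close: the derivative of \<open>h n\<close> in
    direction u is u times \<open>h (Suc n)\<close>.\<close>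
  have "Ck k (\<lambda>x. c * h n x)" for k n c
  proof (induction k arbitrary: n c)
    case 0
    have "continuous_on UNIV (h n)"
      using assms by (meson DERIV_continuous_on UNIV_I has_field_derivative_at_within)
    then show ?case by (auto intro: continuous_intros)
  next
    case (Suc k)
    show ?case
    proof (rule Ck_SucI[where D="\<lambda>u x. (c * u) * h (Suc n) x"])
      show "((\<lambda>x. c * h n x) has_derivative (\<lambda>u. c * u * h (Suc n) x)) (at x)" for x
        using assms[of n x] unfolding has_field_derivative_def
        by (auto intro!: derivative_eq_intros simp: mult_ac)
    qed (rule Suc)
  qed
  from this[of _ 1] show ?thesis by (simp add: smooth_def)
qed

section \<open>Rules for directional derivatives\<close>

lemma dd_const [simp]: "dd u (\<lambda>x. c) = (\<lambda>x. 0)"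
  by (rule ext) (rule dd_eqI, rule has_derivative_const)

lemma dd_add: "smooth f \<Longrightarrow> smooth g \<Longrightarrow> dd u (\<lambda>x. f x + g x) = (\<lambda>x. dd u f x + dd u g x)"
  by (rule ext, rule dd_eqI[OF has_derivative_add[OF smooth_has_derivative smooth_has_derivative]])

lemma dd_mult: "smooth f \<Longrightarrow> smooth g \<Longrightarrow> dd u (\<lambda>x. f x * g x) = (\<lambda>x. f x * dd u g x + dd u f x * g x)"
  by (rule ext, rule dd_eqI[OF has_derivative_mult[OF smooth_has_derivative smooth_has_derivative]])

lemma dd_cmult: "smooth f \<Longrightarrow> dd u (\<lambda>x. c * f x) = (\<lambda>x. c * dd u f x)"
  by (simp add: dd_mult)

lemma dd_sum: "(\<And>i. i \<in> I \<Longrightarrow> smooth (f i)) \<Longrightarrow> dd u (\<lambda>x. \<Sum>i\<in>I. f i x) = (\<lambda>x. \<Sum>i\<in>I. dd u (f i) x)"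
  by (rule ext, rule dd_eqI[OF has_derivative_sum[OF smooth_has_derivative]])

lemma dd_affine:
  assumes "bounded_linear A" "smooth f"
  shows "dd u (\<lambda>x. f (A x + c)) = (\<lambda>x. dd (A u) f (A x + c))"
proof
  fix x
  have "((\<lambda>x. f (A x + c)) has_derivative (\<lambda>u. dd (A u) f (A x + c))) (at x)"
    by (rule has_derivative_compose[of "\<lambda>x. A x + c" A, OF _ smooth_has_derivative[OF assms(2)]])
      (use bounded_linear_imp_has_derivative[OF assms(1)] in \<open>auto intro!: derivative_eq_intros\<close>)
  then show "dd u (\<lambda>x. f (A x + c)) x = dd (A u) f (A x + c)" by (rule dd_eqI)
qed

lemma dd_compose_real:
  fixes g :: "real \<Rightarrow> real"
  assumes "smooth g" "smooth f"
  shows "dd u (\<lambda>x. g (f x)) = (\<lambda>x. dd 1 g (f x) * dd u f x)"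
proof
  fix x
  have "((\<lambda>x. g (f x)) has_derivative (\<lambda>u. dd (dd u f x) g (f x))) (at x)"
    by (rule has_derivative_compose[OF smooth_has_derivative[OF assms(2)] smooth_has_derivative[OF assms(1)]])
  then have "dd u (\<lambda>x. g (f x)) x = dd (dd u f x) g (f x)"
    by (rule dd_eqI)
  also have "\<dots> = dd 1 g (f x) * dd u f x"
    using linear_scale[OF dd_linear[OF assms(1), of "f x"], of "dd u f x" 1] by simp
  finally show "dd u (\<lambda>x. g (f x)) x = dd 1 g (f x) * dd u f x" .
qed

lemma dd_uminus: "smooth f \<Longrightarrow> dd (- u) f x = - dd u f x"
  using linear_neg[OF dd_linear] by blast

lemma dd_zero: "smooth f \<Longrightarrow> dd 0 f x = 0"
  using linear_0[OF dd_linear] by blast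

text \<open>Functions that agree near x have the same derivative relation at x, and
  \<open>frechet_derivative\<close> chooses from this relation. Hence the values agree even where
  neither function is differentiable.\<close>

lemma dd_open_cong:
  assumes "open S" "x \<in> S" "\<And>y. y \<in> S \<Longrightarrow> f y = g y"
  shows "dd u f x = dd u g x"
proof -
  have "(f has_derivative D) (at x) \<longleftrightarrow> (g has_derivative D) (at x)" for D
    using has_derivative_transform_within_open[OF _ assms(1,2), where f=f and g=g and f'=D]
      has_derivative_transform_within_open[OF _ assms(1,2), where f=g and g=f and f'=D] assms(3) by auto
  then show ?thesis by (simp add: dd_def frechet_derivative_def)
qed

text \<open>Used to extend by zero a function that is smooth on an open set and vanishes near the
  boundary of that set.\<close>

lemma smooth_locally:
  assumes "\<And>x. \<exists>S g. open S \<and> x \<in> S \<and> smooth g \<and> (\<forall>y\<in>S. f y = g y)"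
  shows "smooth f"
proof -
  have "Ck k f" if *: "\<And>x. \<exists>S g. open S \<and> x \<in> S \<and> smooth g \<and> (\<forall>y\<in>S. f y = g y)" for k f
    using *
  proof (induction k arbitrary: f)
    case 0
    have "isCont f x" for x
    proof -
      obtain S g where S: "open S" "x \<in> S" "smooth g" "\<forall>y\<in>S. f y = g y" using 0 by blast
      have "\<forall>\<^sub>F y in nhds x. f y = g y" using S eventually_nhds by blast
      from isCont_cong[OF this] show ?thesis using smooth_isCont[OF S(3), of x] by simp
    qed
    then show ?case by (simp add: continuous_on_eq_continuous_at)
  next
    case (Suc k)
    show ?case
    proof (rule Ck_SucI[where D="\<lambda>u. dd u f"])
      fix x
      obtain S g where S: "open S" "x \<in> S" "smooth g" "\<forall>y\<in>S. f y = g y" using Suc.prems by blast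
      have "(f has_derivative (\<lambda>u. dd u g x)) (at x)"
        using has_derivative_transform_within_open[OF smooth_has_derivative[OF S(3)] S(1,2), of f] S(4) by simp
      moreover have "dd u g x = dd u f x" for u
        by (rule dd_open_cong[OF S(1,2)]) (use S in auto)
      ultimately show "(f has_derivative (\<lambda>u. dd u f x)) (at x)" by simp
    next
      fix u
      show "Ck k (dd u f)"
      proof (rule Suc.IH)
        fix x
        obtain S g where S: "open S" "x \<in> S" "smooth g" "\<forall>y\<in>S. f y = g y" using Suc.prems by blast
        then have "\<forall>y\<in>S. dd u f y = dd u g y" by (auto intro: dd_open_cong)
        with S(1,2) smooth_dd[OF S(3), of u]
        show "\<exists>S g. open S \<and> x \<in> S \<and> smooth g \<and> (\<forall>y\<in>S. dd u f y = g y)"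
          by blast
      qed
    qed
  qed
  from this[OF assms] show ?thesis unfolding smooth_def by blast
qed

lemma dd_support: "{x. dd u f x \<noteq> 0} \<subseteq> closure {x. f x \<noteq> 0}"
proof
  fix x assume x: "x \<in> {x. dd u f x \<noteq> 0}"
  show "x \<in> closure {x. f x \<noteq> 0}"
  proof (rule ccontr)
    assume "x \<notin> closure {x. f x \<noteq> 0}"
    then have "dd u f x = dd u (\<lambda>x. 0) x"
      using closure_subset[of "{x. f x \<noteq> 0}"] by (intro dd_open_cong[of "- closure {x. f x \<noteq> 0}"]) auto
    with x show False by simp
  qed
qed

section \<open>Test functions\<close>

lemma test_fun_smooth: "test_fun U f \<Longrightarrow> smooth f"
  by (simp add: test_fun_def)

lemma test_fun_mono: "test_fun U f \<Longrightarrow> U \<subseteq> V \<Longrightarrow> test_fun V f"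
  by (auto simp: test_fun_def)

lemma test_funI:
  assumes "smooth f" "compact K" "K \<subseteq> U" "\<And>x. x \<notin> K \<Longrightarrow> f x = 0"
  shows "test_fun U f"
proof -
  have "closure {x. f x \<noteq> 0} \<subseteq> K"
    using assms by (intro closure_minimal) (auto simp: compact_imp_closed)
  moreover from this have "compact (closure {x. f x \<noteq> 0})"
    using assms(2) by (metis closed_closure closed_Int_compact inf.absorb_iff1)
  ultimately show ?thesis
    using assms unfolding test_fun_def by blast
qed

lemma test_funE:
  assumes "test_fun U f"
  obtains K where "compact K" "K \<subseteq> U" "\<And>x. x \<notin> K \<Longrightarrow> f x = 0" "\<And>x u. x \<notin> K \<Longrightarrow> dd u f x = 0"
proof
  let ?K = "closure {x. f x \<noteq> 0}"
  show "compact ?K" "?K \<subseteq> U" using assms by (auto simp: test_fun_def)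
  show "f x = 0" if "x \<notin> ?K" for x using that closure_subset[of "{x. f x \<noteq> 0}"] by auto
  show "dd u f x = 0" if "x \<notin> ?K" for x u using that dd_support[of u f] by auto
qed

lemma test_fun_outside: "test_fun U f \<Longrightarrow> x \<notin> U \<Longrightarrow> f x = 0"
  by (metis subsetD test_funE)

lemma test_fun_dd [intro]: assumes "test_fun U f" shows "test_fun U (dd u f)"
proof -
  obtain K where "compact K" "K \<subseteq> U" "\<And>x u. x \<notin> K \<Longrightarrow> dd u f x = 0"
    using test_funE[OF assms] by metis
  then show ?thesis
    using test_fun_smooth[OF assms] by (intro test_funI[of _ K]) auto
qed

lemma test_fun_mult:
  assumes "test_fun U f" "smooth g" shows "test_fun U (\<lambda>x. f x * g x)"
proof -
  obtain K where "compact K" "K \<subseteq> U" "\<And>x. x \<notin> K \<Longrightarrow> f x = 0"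
    using test_funE[OF assms(1)] by metis
  then show ?thesis
    using test_fun_smooth[OF assms(1)] assms(2) by (intro test_funI[of _ K]) auto
qed

lemma test_fun_mult_left: "test_fun U f \<Longrightarrow> smooth g \<Longrightarrow> test_fun U (\<lambda>x. g x * f x)"
  using test_fun_mult[of U f g] by (simp add: mult.commute)

lemma test_fun_add:
  assumes "test_fun U f" "test_fun U g" shows "test_fun U (\<lambda>x. f x + g x)"
proof -
  obtain K where "compact K" "K \<subseteq> U" "\<And>x. x \<notin> K \<Longrightarrow> f x = 0"
    using test_funE[OF assms(1)] by metis
  moreover obtain L where "compact L" "L \<subseteq> U" "\<And>x. x \<notin> L \<Longrightarrow> g x = 0"
    using test_funE[OF assms(2)] by metis
  ultimately show ?thesis
    using test_fun_smooth[OF assms(1)] test_fun_smooth[OF assms(2)]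
    by (intro test_funI[of _ "K \<union> L"]) auto
qed

lemma test_fun_dt: "test_fun U f \<Longrightarrow> test_fun U (dt f)"
  and test_fun_dx: "test_fun U f \<Longrightarrow> test_fun U (dx i f)"
  by (auto simp: dt_eq_dd dx_eq_dd)

lemma test_fun_bounded:
  assumes "test_fun U f" obtains B where "\<And>x. \<bar>f x\<bar> \<le> B" "B \<ge> 0"
proof -
  obtain K where K: "compact K" "\<And>x. x \<notin> K \<Longrightarrow> f x = 0"
    using test_funE[OF assms] by metis
  have "bounded (f ` K)"
    using K(1) assms by (intro compact_imp_bounded compact_continuous_image smooth_continuous test_fun_smooth)
  then obtain B where B: "\<And>x. x \<in> K \<Longrightarrow> \<bar>f x\<bar> \<le> B"
    by (auto simp: bounded_iff)
  have "\<bar>f x\<bar> \<le> max B 0" for x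
    using B[of x] K(2)[of x] by (cases "x \<in> K") auto
  then show ?thesis using that[of "max B 0"] by auto
qed

section \<open>Bump functions and the fundamental lemma\<close>

text \<open>The family p(1/x) exp(-1/x), for all polynomials p, is closed under differentiation.
  This gives all derivatives of the flat function at once.\<close>

definition exp_poly :: "real poly \<Rightarrow> real \<Rightarrow> real" where
  "exp_poly p x = (if x > 0 then poly p (inverse x) * exp (- inverse x) else 0)"

lemma exp_poly_tendsto: "(exp_poly p \<longlongrightarrow> 0) (at 0)"
proof -
  have "((\<lambda>y. \<Sum>i\<le>degree p. coeff p i * (y ^ i / exp y)) \<longlongrightarrow> (\<Sum>i\<le>degree p. coeff p i * 0)) at_top"
    by (intro tendsto_intros tendsto_power_div_exp_0)
  then have "((\<lambda>y. poly p y * exp (- y)) \<longlongrightarrow> 0) at_top"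
    by (simp add: poly_altdef sum_distrib_right exp_minus divide_inverse mult.assoc)
  from filterlim_compose[OF this filterlim_inverse_at_top_right]
  have "((\<lambda>x. poly p (inverse x) * exp (- inverse x)) \<longlongrightarrow> 0) (at_right 0)" .
  then have "(exp_poly p \<longlongrightarrow> 0) (at_right 0)"
    by (rule Lim_transform_eventually) (auto simp: exp_poly_def eventually_at_right_less eventually_at_filter)
  moreover have "(exp_poly p \<longlongrightarrow> 0) (at_left 0)"
    by (rule tendsto_eventually) (auto simp: exp_poly_def eventually_at_filter)
  ultimately show ?thesis by (simp add: filterlim_at_split)
qed

text \<open>With y = 1/x one has d/dx = - y^2 d/dy. Applied to p(y) exp(-y) this gives the factor
  y^2, written \<open>[:0, 0, 1:]\<close>, and the operator p - p'.\<close>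

lemma exp_poly_deriv:
  "(exp_poly p has_field_derivative exp_poly ([:0, 0, 1:] * (p - pderiv p)) x) (at x)"
proof -
  consider "x > 0" | "x < 0" | "x = 0" by linarith
  then show ?thesis
  proof cases
    case 1
    have "((\<lambda>x. poly p (inverse x) * exp (- inverse x)) has_field_derivative
        exp_poly ([:0, 0, 1:] * (p - pderiv p)) x) (at x)"
      using 1 by (auto intro!: derivative_eq_intros DERIV_chain2[OF poly_DERIV]
          simp: exp_poly_def field_simps power2_eq_square)
    moreover have "\<forall>\<^sub>F y in nhds x. exp_poly p y = poly p (inverse y) * exp (- inverse y)"
      using eventually_nhds_in_open[of "{0<..}" x] 1 by (auto elim!: eventually_mono simp: exp_poly_def)
    ultimately show ?thesis by (subst DERIV_cong_ev[OF refl _ refl])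
  next
    case 2
    have "\<forall>\<^sub>F y in nhds x. exp_poly p y = 0"
      using eventually_nhds_in_open[of "{..<0}" x] 2 by (auto elim!: eventually_mono simp: exp_poly_def)
    then show ?thesis by (subst DERIV_cong_ev[OF refl _ refl]) (use 2 in \<open>auto simp: exp_poly_def\<close>)
  next
    case 3
    \<comment> \<open>Division by h multiplies the polynomial by y = 1/h, so the difference quotient
      is again in the family and tends to 0.\<close>
    have "(exp_poly p (0 + h) - exp_poly p 0) / h = exp_poly (pCons 0 p) h" for h
      by (auto simp: exp_poly_def field_simps)
    then have "((\<lambda>h. (exp_poly p (0 + h) - exp_poly p 0) / h) \<longlongrightarrow> 0) (at 0)"
      using exp_poly_tendsto[of "pCons 0 p"] by simp
    then show ?thesis unfolding 3 DERIV_def by (simp add: exp_poly_def)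
  qed
qed

definition ramp :: "real \<Rightarrow> real" where
  "ramp x = (if x > 0 then exp (- inverse x) else 0)"

lemma smooth_ramp [intro, simp]: "smooth ramp"
proof -
  define h where "h n = exp_poly (((\<lambda>p. [:0, 0, 1:] * (p - pderiv p)) ^^ n) 1)" for n
  have "(h n has_field_derivative h (Suc n) x) (at x)" for n x
    unfolding h_def using exp_poly_deriv by simp
  then have "smooth (h 0)" by (rule smooth_chain)
  moreover have "h 0 = ramp" by (auto simp: h_def ramp_def exp_poly_def fun_eq_iff)
  ultimately show ?thesis by simp
qed

lemma ramp_pos: "x > 0 \<Longrightarrow> ramp x > 0" and ramp_zero: "x \<le> 0 \<Longrightarrow> ramp x = 0"
  and ramp_nonneg: "ramp x \<ge> 0" and ramp_le_1: "ramp x \<le> 1"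
  by (auto simp: ramp_def)

definition step :: "real \<Rightarrow> real" where
  "step x = ramp x / (ramp x + ramp (1 - x))"

lemma step_denom_pos: "ramp x + ramp (1 - x) > 0"
  using ramp_pos[of x] ramp_pos[of "1 - x"] ramp_nonneg[of x] ramp_nonneg[of "1 - x"]
  by (cases "x > 0") (auto intro: add_pos_nonneg add_nonneg_pos)

lemma smooth_step [intro, simp]: "smooth step"
proof -
  have "smooth (\<lambda>x. ramp (1 - x))"
    by (intro smooth_compose_real[OF smooth_ramp] smooth_diff smooth_const smooth_linear[OF bounded_linear_ident])
  then have "smooth (\<lambda>x. ramp x / (ramp x + ramp (1 - x)))"
    using step_denom_pos by (intro smooth_divide smooth_add) (auto simp: less_le)
  then show ?thesis by (simp add: step_def[abs_def])
qed

lemma step_0: "x \<le> 0 \<Longrightarrow> step x = 0" and step_1: "x \<ge> 1 \<Longrightarrow> step x = 1"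
  using step_denom_pos[of x] by (auto simp: step_def ramp_zero)

lemma smooth_ident [intro, simp]: "smooth (\<lambda>x::real. x)"
  by (intro smooth_linear bounded_linear_ident)

lemma smooth_inner [intro]: "smooth (\<lambda>x. x \<bullet> b)"
  by (intro smooth_linear bounded_linear_inner_left)

lemma dd_real: "smooth f \<Longrightarrow> dd v f u = v * dd 1 f (u::real)"
  using linear_scale[OF dd_linear[of f u], of v 1] by simp

lemma smooth_DERIV:
  assumes "smooth f" shows "(f has_field_derivative dd 1 f u) (at (u::real))"
proof -
  have "(\<lambda>v. dd v f u) = (*) (dd 1 f u)"  proof
    fix v show "dd v f u = dd 1 f u * v" using dd_real[OF assms, of v u] by (simp add: mult.commute)
  qed
  then show ?thesis using smooth_has_derivative[OF assms, of u] by (simp add: has_field_derivative_def)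
qed

lemma dd_eq_DERIV: "(f has_field_derivative D) (at u) \<Longrightarrow> dd 1 f u = D"
  using dd_eqI[of f "(*) D" u 1] by (simp add: has_field_derivative_def)

section \<open>Smooth approximation of indicators of open sets\<close>

definition ball_bump :: "'a::euclidean_space \<Rightarrow> real \<Rightarrow> 'a \<Rightarrow> real" where
  "ball_bump p r x = ramp (r^2 - (x - p) \<bullet> (x - p))"

lemma smooth_ball_bump [intro]: "smooth (ball_bump p r)"
proof -
  have "smooth (\<lambda>x. \<Sum>b\<in>Basis. ((x - p) \<bullet> b) * ((x - p) \<bullet> b))"
    unfolding inner_diff_left by (intro smooth_sum smooth_mult smooth_diff smooth_inner smooth_const)
  then have "smooth (\<lambda>x. (x - p) \<bullet> (x - p))"
    by (simp add: euclidean_inner[symmetric])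
  then show ?thesis unfolding ball_bump_def[abs_def]
    by (intro smooth_compose_real[OF smooth_ramp] smooth_diff smooth_const)
qed

lemma ball_bump_pos: assumes "r > 0" "x \<in> ball p r" shows "ball_bump p r x > 0"
proof -
  have "norm (x - p) < r" using assms by (simp add: dist_norm norm_minus_commute)
  then have "(norm (x - p))^2 < r^2" by (intro power_strict_mono) auto
  then show ?thesis by (auto simp: ball_bump_def dot_square_norm intro!: ramp_pos)
qed

lemma ball_bump_zero: assumes "r > 0" "x \<notin> ball p r" shows "ball_bump p r x = 0"
proof -
  have "norm (x - p) \<ge> r" using assms by (simp add: dist_norm norm_minus_commute)
  then have "(norm (x - p))^2 \<ge> r^2" using assms by (intro power_mono) auto
  then show ?thesis by (auto simp: ball_bump_def dot_square_norm intro!: ramp_zero)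
qed

lemma ball_bump_nonneg: "ball_bump p r x \<ge> 0" and ball_bump_le_1: "ball_bump p r x \<le> 1"
  by (auto simp: ball_bump_def ramp_nonneg ramp_le_1)

text \<open>By Lindelof, U is covered by countably many balls whose closures lie in U. At a point of
  U some bump \<open>b m\<close> is positive, and the exponent n drives (1 - b m)^n to 0, which
  makes the product vanish in the limit. Only the first n balls enter \<open>\<phi> n\<close>, so
  its support is compact.\<close>

lemma open_indicator_approx:
  fixes U :: "'a::euclidean_space set"
  assumes "open U"
  obtains \<phi> :: "nat \<Rightarrow> 'a \<Rightarrow> real" where "\<And>n. test_fun U (\<phi> n)" "\<And>n x. 0 \<le> \<phi> n x" "\<And>n x. \<phi> n x \<le> 1"
    "\<And>x. (\<lambda>n. \<phi> n x) \<longlonglongrightarrow> indicator U x"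
proof (cases "U = {}")
  case True
  have "test_fun U (\<lambda>x. 0)" by (rule test_funI[of _ "{}"]) auto
  then show ?thesis using that[of "\<lambda>n x. 0"] True by simp
next
  case False
  define F where "F = {S. \<exists>p r. r > 0 \<and> S = ball p r \<and> cball p r \<subseteq> U}"
  obtain F' where F': "F' \<subseteq> F" "countable F'" "\<Union>F' = \<Union>F"
    using Lindelof[of F] by (auto simp: F_def)
  have UF: "\<Union>F = U"
  proof -
    have "\<exists>S\<in>F. x \<in> S" if "x \<in> U" for x
    proof -
      obtain r where "r > 0" "cball x r \<subseteq> U" using assms \<open>x \<in> U\<close> open_contains_cball by blast
      then show ?thesis by (intro bexI[of _ "ball x r"]) (auto simp: F_def)
    qed
    moreover have "S \<subseteq> U" if "S \<in> F" for S using that ball_subset_cball by (fastforce simp: F_def)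
    ultimately show ?thesis by blast
  qed
  then have "F' \<noteq> {}" using False F'(3) by auto
  define S where "S = from_nat_into F'"
  have "\<forall>k. \<exists>p r. r > 0 \<and> S k = ball p r \<and> cball p r \<subseteq> U"
    using from_nat_into[OF \<open>F' \<noteq> {}\<close>] F'(1) unfolding S_def F_def by blast
  then obtain p r where pr: "\<And>k. r k > 0" "\<And>k. S k = ball (p k) (r k)" "\<And>k. cball (p k) (r k) \<subseteq> U"
    by metis
  have US: "(\<Union>k. S k) = U"
    using range_from_nat_into[OF \<open>F' \<noteq> {}\<close> F'(2)] F'(3) UF by (simp add: S_def)
  define b where "b k = ball_bump (p k) (r k)" for k
  have b01: "0 \<le> 1 - b k x" "1 - b k x \<le> 1" for k x
    using ball_bump_nonneg ball_bump_le_1 by (auto simp: b_def)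
  define \<phi> where "\<phi> n x = 1 - (\<Prod>k<n. (1 - b k x) ^ n)" for n x
  have p01: "0 \<le> (\<Prod>k<n. (1 - b k x) ^ n)" "(\<Prod>k<n. (1 - b k x) ^ n) \<le> 1" for n x
    using b01 by (auto intro!: prod_nonneg prod_le_1 power_le_one)
  show ?thesis
  proof
    show "test_fun U (\<phi> n)" for n
    proof (rule test_funI[of _ "\<Union>k<n. cball (p k) (r k)"])
      show "smooth (\<phi> n)" unfolding \<phi>_def[abs_def] b_def
        by (intro smooth_diff smooth_const smooth_prod smooth_power smooth_ball_bump)
      show "\<phi> n x = 0" if "x \<notin> (\<Union>k<n. cball (p k) (r k))" for x
      proof -
        have "b k x = 0" if "k < n" for k
          unfolding b_def using that \<open>x \<notin> _\<close> pr(1)[of k] by (intro ball_bump_zero) force+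
        then show ?thesis by (simp add: \<phi>_def)
      qed
    next
      show "(\<Union>k<n. cball (p k) (r k)) \<subseteq> U" using pr(3) by blast
    qed auto
    show "0 \<le> \<phi> n x" "\<phi> n x \<le> 1" for n x using p01 by (auto simp: \<phi>_def)
    show "(\<lambda>n. \<phi> n x) \<longlonglongrightarrow> indicator U x" for x
    proof (cases "x \<in> U")
      case False
      have "b k x = 0" for k
        unfolding b_def using False US pr(1,2) by (intro ball_bump_zero) blast+
      then have "\<phi> n x = 0" for n by (simp add: \<phi>_def)
      then show ?thesis using False by simp
    next
      case True
      then obtain m where m: "x \<in> S m" using US by auto
      then have bm: "b m x > 0" unfolding b_def using pr by (intro ball_bump_pos) auto
      have le: "(\<Prod>k<n. (1 - b k x) ^ n) \<le> (1 - b m x) ^ n" if "n > m" for n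
      proof -
        have "(\<Prod>k<n. (1 - b k x) ^ n) = (1 - b m x) ^ n * (\<Prod>k\<in>{..<n} - {m}. (1 - b k x) ^ n)"
          using that by (intro prod.remove) auto
        also have "\<dots> \<le> (1 - b m x) ^ n * 1"
          using b01 by (intro mult_left_mono prod_le_1) (auto intro: power_le_one)
        finally show ?thesis by simp
      qed
      have "(\<lambda>n. \<Prod>k<n. (1 - b k x) ^ n) \<longlonglongrightarrow> 0"
      proof (rule tendsto_sandwich[of "\<lambda>_. 0"])
        show "(\<lambda>n. (1 - b m x) ^ n) \<longlonglongrightarrow> 0"
          using b01 bm by (intro LIMSEQ_power_zero) auto
        show "\<forall>\<^sub>F n in sequentially. (\<Prod>k<n. (1 - b k x) ^ n) \<le> (1 - b m x) ^ n"
          using eventually_gt_at_top[of m] by eventually_elim (rule le)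
      qed (use p01 in auto)
      then have "(\<lambda>n. \<phi> n x) \<longlonglongrightarrow> 1 - 0" unfolding \<phi>_def by (intro tendsto_intros)
      then show ?thesis using True by simp
    qed
  qed
qed

text \<open>The sets over which F has integral zero form a Dynkin system;
  \<open>UNIV \<in> G\<close> provides the complements. The generator is left open because open sets
  are needed in space and open rectangles in space-time.\<close>

lemma AE_zero_if_generator_integrals_zero:
  fixes F :: "'a::euclidean_space \<Rightarrow> real"
  assumes F: "integrable lborel F" and G: "Int_stable G" "sets borel = sigma_sets UNIV G" "UNIV \<in> G"
    and zero: "\<And>W. W \<in> G \<Longrightarrow> (LINT x:W|lborel. F x) = 0"
  shows "AE x in lborel. F x = 0"
proof -
  have si: "set_integrable lborel A F" if "A \<in> sets borel" for A
    unfolding set_integrable_def using that F by (intro integrable_mult_indicator) auto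
  have all: "(LINT x:A|lborel. F x) = 0" if "A \<in> sigma_sets UNIV G" for A
  proof (rule sigma_sets_induct_disjoint[OF _ _ that, where P="\<lambda>A. (LINT x:A|lborel. F x) = 0"])
    show "Int_stable G" by fact
    show "(LINT x:{}|lborel. F x) = 0" by (simp add: set_lebesgue_integral_def)
    show "(LINT x:A|lborel. F x) = 0" if "A \<in> G" for A using that zero by auto
    fix A :: "'a set" assume A: "A \<in> sigma_sets UNIV G" "(LINT x:A|lborel. F x) = 0"
    have Ab: "A \<in> sets borel" using A(1) G(2) by simp
    have "(LINT x:UNIV|lborel. F x) = (LINT x:A|lborel. F x) + (LINT x:UNIV - A|lborel. F x)"
      using set_integral_Un[of A "UNIV - A" lborel F] si Ab by auto
    then show "(LINT x:UNIV - A|lborel. F x) = 0" using A zero[OF G(3)] by simp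
  next
    fix A :: "nat \<Rightarrow> 'a set"
    assume A: "disjoint_family A" "range A \<subseteq> sigma_sets UNIV G" "\<And>i. (LINT x:A i|lborel. F x) = 0"
    have Ab: "A i \<in> sets borel" for i using A(2) G(2) by auto
    have "(LINT x:(\<Union>i. A i)|lborel. F x) = (\<Sum>i. LINT x:A i|lborel. F x)"
      using A(1) Ab si by (intro lebesgue_integral_countable_add) (auto simp: disjoint_family_on_def)
    then show "(LINT x:(\<Union>i. A i)|lborel. F x) = 0" by (simp add: A(3))
  qed auto
  have Fm[measurable]: "F \<in> borel_measurable lborel" using F by auto
  \<comment> \<open>The signs c = 1 and c = -1 treat the positive and the negative part: the
    integral of F over the set where c F is positive is zero.\<close>
  have *: "AE x in lborel. c * F x \<le> 0" for c
  proof -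
    let ?A = "{x. c * F x > 0}"
    have A: "?A \<in> sets borel" using Fm by measurable
    then have "?A \<in> sigma_sets UNIV G" using G(2) by simp
    from all[OF this] have "(\<integral>x. c * (indicator ?A x * F x) \<partial>lborel) = 0"
      by (simp add: set_lebesgue_integral_def)
    moreover have "integrable lborel (\<lambda>x. c * (indicator ?A x * F x))"
      using si[OF A] by (auto simp: set_integrable_def)
    moreover have "c * (indicator ?A x * F x) \<ge> 0" for x by (auto simp: indicator_def)
    ultimately have "AE x in lborel. c * (indicator ?A x * F x) = 0"
      by (subst (asm) integral_nonneg_eq_0_iff_AE) auto
    then show ?thesis by eventually_elim (auto simp: indicator_def split: if_splits)
  qed
  from *[of 1] *[of "-1"] show ?thesis by eventually_elim auto
qed

lemma AE_zero_if_open_integrals_zero: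
  fixes F :: "'a::euclidean_space \<Rightarrow> real"
  assumes F: "integrable lborel F" and zero: "\<And>W. open W \<Longrightarrow> (LINT x:W|lborel. F x) = 0"
  shows "AE x in lborel. F x = 0"
proof (rule AE_zero_if_generator_integrals_zero[OF F, of "{W. open W}"])
  show "Int_stable {W::'a set. open W}" by (auto simp: Int_stable_def)
  show "sets borel = sigma_sets UNIV {W::'a set. open W}" by (simp add: borel_def)
qed (use zero in auto)

text \<open>The indicator of an open subset of U is a bounded pointwise limit of test functions, so
  dominated convergence reduces the fundamental lemma to integrals over open sets. No mollification
  is involved.\<close>

lemma AE_zero_if_test_integrals_zero:
  fixes f :: "'a::euclidean_space \<Rightarrow> real"
  assumes U: "open U" and f: "set_integrable lborel U f"
    and zero: "\<And>\<phi>. test_fun U \<phi> \<Longrightarrow> (LINT x:U|lborel. f x * \<phi> x) = 0"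
  shows "AE x in lborel. x \<in> U \<longrightarrow> f x = 0"
proof -
  define F where "F x = indicator U x * f x" for x
  have F: "integrable lborel F" using f by (simp add: F_def[abs_def] set_integrable_def)
  have [measurable]: "F \<in> borel_measurable borel" using F by auto
  have "(LINT x:W|lborel. F x) = 0" if "open W" for W
  proof -
    have "open (W \<inter> U)" using that U by auto
    then obtain \<phi> where \<phi>: "\<And>n. test_fun (W \<inter> U) (\<phi> n)" "\<And>n x. 0 \<le> \<phi> n x" "\<And>n x. \<phi> n x \<le> 1"
      "\<And>x. (\<lambda>n. \<phi> n x) \<longlonglongrightarrow> indicator (W \<inter> U) x"
      using open_indicator_approx[of "W \<inter> U"] by metis
    have [measurable]: "\<phi> n \<in> borel_measurable borel" for n using \<phi>(1) test_fun_smooth smooth_borel by blast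
    have [measurable]: "W \<in> sets borel" "U \<in> sets borel" using that U by auto
    have "(\<lambda>n. \<integral>x. F x * \<phi> n x \<partial>lborel) \<longlonglongrightarrow> (\<integral>x. F x * indicator (W \<inter> U) x \<partial>lborel)"
    proof (rule integral_dominated_convergence[where w="\<lambda>x. \<bar>F x\<bar>"])
      show "AE x in lborel. (\<lambda>n. F x * \<phi> n x) \<longlonglongrightarrow> F x * indicator (W \<inter> U) x"
        using \<phi>(4) by (intro AE_I2 tendsto_intros)
      show "AE x in lborel. norm (F x * \<phi> n x) \<le> \<bar>F x\<bar>" for n
        using \<phi>(2,3) by (intro AE_I2) (auto simp: abs_mult intro!: mult_left_le)
      show "integrable lborel (\<lambda>x. \<bar>F x\<bar>)" using F by (rule integrable_abs)
    qed measurable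
    moreover have "(\<integral>x. F x * \<phi> n x \<partial>lborel) = 0" for n
      using zero[of "\<phi> n"] test_fun_mono[OF \<phi>(1)] by (simp add: set_lebesgue_integral_def F_def mult.assoc)
    ultimately have "(\<integral>x. F x * indicator (W \<inter> U) x \<partial>lborel) = 0"
      by (simp add: LIMSEQ_const_iff)
    moreover have "F x * indicator (W \<inter> U) x = indicator W x * F x" for x
      by (auto simp: F_def indicator_def)
    ultimately show ?thesis by (simp add: set_lebesgue_integral_def)
  qed
  then have "AE x in lborel. F x = 0" using AE_zero_if_open_integrals_zero[OF F] by blast
  then show ?thesis
    by eventually_elim (auto simp: F_def indicator_def split: if_splits)
qed

section \<open>Partitions of unity and truncations\<close>

lemma smooth_partition_of_unity:
  fixes K :: "'a::euclidean_space set"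
  assumes K: "compact K" and r: "\<And>p. p \<in> K \<Longrightarrow> r p > 0"
  obtains I \<kappa> where "finite I" "I \<subseteq> K" "\<And>p. p \<in> I \<Longrightarrow> smooth (\<kappa> p)"
    "\<And>p x. p \<in> I \<Longrightarrow> x \<notin> cball p (r p) \<Longrightarrow> \<kappa> p x = 0" "\<And>x. x \<in> K \<Longrightarrow> (\<Sum>p\<in>I. \<kappa> p x) = 1"
proof -
  have "K \<subseteq> (\<Union>p\<in>K. ball p (r p))" using r by auto
  then obtain I where I: "I \<subseteq> K" "finite I" "K \<subseteq> (\<Union>p\<in>I. ball p (r p))"
    using compactE_image[OF K, of K "\<lambda>p. ball p (r p)"] by auto
  define B where "B x = (\<Sum>p\<in>I. ball_bump p (r p) x)" for x
  have smB: "smooth B" unfolding B_def[abs_def] by (intro smooth_sum smooth_ball_bump)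
  have B0: "B x \<ge> 0" for x unfolding B_def by (intro sum_nonneg ball_bump_nonneg)
  have Bpos: "B x > 0" if "x \<in> K" for x
  proof -
    obtain p where p: "p \<in> I" "x \<in> ball p (r p)" using I(3) \<open>x \<in> K\<close> by blast
    have "0 < ball_bump p (r p) x" using p r I by (intro ball_bump_pos) auto
    also have "\<dots> \<le> B x" unfolding B_def
      by (rule member_le_sum) (use p I in \<open>auto simp: ball_bump_nonneg\<close>)
    finally show ?thesis .
  qed
  obtain \<delta> where \<delta>: "\<delta> > 0" "\<And>x. x \<in> K \<Longrightarrow> B x \<ge> \<delta>"
  proof (cases "K = {}")
    case True then show ?thesis using that[of 1] by auto
  next
    case False
    obtain x0 where "x0 \<in> K" "\<And>x. x \<in> K \<Longrightarrow> B x0 \<le> B x"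
      using continuous_attains_inf[OF K False smooth_continuous[OF smB]] by auto
    then show ?thesis using that[of "B x0"] Bpos by auto
  qed
  \<comment> \<open>B vanishes away from the balls and cannot serve as a denominator. The added term
    is positive wherever B is below \<delta> and is zero on K, so Z is positive everywhere and
    normalises the sum on K.\<close>
  define Z where "Z x = B x + ramp (\<delta> - B x)" for x
  have "smooth Z" unfolding Z_def[abs_def]
    by (intro smooth_add smB smooth_compose_real[OF smooth_ramp] smooth_diff smooth_const)
  moreover have Z: "Z x > 0" for x
    using B0[of x] ramp_pos[of "\<delta> - B x"] ramp_nonneg[of "\<delta> - B x"] \<delta>(1)
    unfolding Z_def by (cases "B x = 0") auto
  ultimately have "smooth (\<lambda>x. ball_bump p (r p) x / Z x)" for p
    by (intro smooth_divide smooth_ball_bump) (auto simp: less_le)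
  moreover have "(\<Sum>p\<in>I. ball_bump p (r p) x / Z x) = 1" if "x \<in> K" for x
    using \<delta>(2)[OF that] Bpos[OF that] by (simp add: sum_divide_distrib[symmetric] B_def[symmetric] Z_def ramp_zero)
  moreover have "ball_bump p (r p) x / Z x = 0" if "p \<in> I" "x \<notin> cball p (r p)" for p x
    using that I r ball_bump_zero[of "r p" x p] by auto
  ultimately show ?thesis using that[of I "\<lambda>p x. ball_bump p (r p) x / Z x"] I by blast
qed

text \<open>Weak equations are given for test functions that avoid T or that avoid 0. Splitting the
  constant 1 on [0, T] into two such pieces allows test functions that avoid neither end.\<close>

lemma time_partition:
  fixes T :: real assumes "T > 0"
  obtains \<theta>1 \<theta>2 where "test_fun {..<T} \<theta>1" "test_fun {0<..} \<theta>2" "\<theta>1 0 = 1"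
    "\<And>t. 0 \<le> t \<Longrightarrow> t \<le> T \<Longrightarrow> \<theta>1 t + \<theta>2 t = 1"
proof
  \<comment> \<open>m rises from 0 to 1 between T/3 and 2T/3. The factors
    \<open>step (t + 2)\<close> and \<open>step (T + 2 - t)\<close> equal 1 on [0, T] and only make
    the supports compact.\<close>
  define m where "m t = step (3 / T * t - 1)" for t
  have lin: "smooth (\<lambda>t::real. a * t + b)" for a b by (intro smooth_add smooth_mult smooth_const smooth_ident)
  have sm: "smooth (\<lambda>t. step (a * t + b))" for a b by (rule smooth_compose_real[OF smooth_step lin])
  have m: "smooth m" using sm[of "3/T" "-1"] by (simp add: m_def[abs_def])
  show "test_fun {..<T} (\<lambda>t. (1 - m t) * step (t + 2))"
  proof (rule test_funI[of _ "{-2..2*T/3}"])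
    show "smooth (\<lambda>t. (1 - m t) * step (t + 2))"
      using sm[of 1 2] m by (intro smooth_mult smooth_diff smooth_const) auto
    show "(1 - m t) * step (t + 2) = 0" if "t \<notin> {-2..2*T/3}" for t
    proof (cases "t < -2")
      case False
      then have "3 / T * t - 1 \<ge> 1" using that assms by (auto simp: field_simps)
      then show ?thesis by (simp add: m_def step_1)
    qed (simp add: step_0)
  qed (use assms in auto)
  show "test_fun {0<..} (\<lambda>t. m t * step (T + 2 - t))"
  proof (rule test_funI[of _ "{T/3..T+2}"])
    show "smooth (\<lambda>t. m t * step (T + 2 - t))"
      using sm[of "-1" "T + 2"] m by (intro smooth_mult) auto
    show "m t * step (T + 2 - t) = 0" if "t \<notin> {T/3..T+2}" for t
    proof (cases "t > T + 2")
      case False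
      then have "3 / T * t - 1 \<le> 0" using that assms by (auto simp: field_simps)
      then show ?thesis by (simp add: m_def step_0)
    qed (simp add: step_0)
  qed (use assms in auto)
  show "(1 - m 0) * step (0 + 2) = 1" by (simp add: m_def step_0 step_1)
  show "(1 - m t) * step (t + 2) + m t * step (T + 2 - t) = 1" if "0 \<le> t" "t \<le> T" for t
    using that by (simp add: step_1)
qed

text \<open>Smooth truncations of the identity near 0, used to cut a function off around its zero
  set. Their derivatives are bounded uniformly in n because the term with the derivative of
  \<open>step\<close> lives where (n + 1)^2 s^2 lies in [1, 2].\<close>

lemma truncation:
  obtains \<eta> :: "nat \<Rightarrow> real \<Rightarrow> real" and C where "\<And>n. smooth (\<eta> n)" "\<And>n s. \<bar>s\<bar> \<le> 1 / (n + 1) \<Longrightarrow> \<eta> n s = 0"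
    "\<And>n s. \<bar>\<eta> n s\<bar> \<le> C * \<bar>s\<bar>" "\<And>n s. \<bar>dd 1 (\<eta> n) s\<bar> \<le> C"
    "\<And>s. (\<lambda>n. \<eta> n s) \<longlonglongrightarrow> s" "\<And>s. s \<noteq> 0 \<Longrightarrow> (\<lambda>n. dd 1 (\<eta> n) s) \<longlonglongrightarrow> 1"
    "\<And>n. dd 1 (\<eta> n) 0 = 0"
proof -
  define st where "st = dd 1 step"
  have st0: "st u = 0" if "u < 0 \<or> u > 1" for u
  proof -
    have "dd 1 step u = dd 1 (\<lambda>u. 0) u" if "u < 0"
      by (rule dd_open_cong[of "{..<0}"]) (use that step_0 in auto)
    moreover have "dd 1 step u = dd 1 (\<lambda>u. 1) u" if "u > 1"
      by (rule dd_open_cong[of "{1<..}"]) (use that step_1 in auto)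
    ultimately show ?thesis using that by (auto simp: st_def)
  qed
  have "continuous_on {0..1} st" by (auto simp: st_def intro!: smooth_continuous smooth_dd)
  then have "bounded (st ` {0..1})" by (intro compact_imp_bounded compact_continuous_image) auto
  then obtain S where S: "\<And>u. u \<in> {0..1} \<Longrightarrow> \<bar>st u\<bar> \<le> S" unfolding bounded_iff by fastforce
  have S0: "S \<ge> 0" using S[of 0] by auto
  have stepb: "\<bar>step u\<bar> \<le> 1" for u
    using step_denom_pos[of u] ramp_nonneg[of u] ramp_nonneg[of "1-u"] by (auto simp: step_def abs_if field_simps)
  \<comment> \<open>The 1 bounds \<open>step\<close>. The other part of the derivative is 2 (u + 1)
    st(u), nonzero only for u in [0, 1] and hence at most 4 S.\<close>
  define C where "C = 1 + 4 * S"
  define a where "a n = (real n + 1)^2" for n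
  define \<eta> where "\<eta> n s = s * step (a n * s^2 + (-1))" for n s
  have sq: "smooth (\<lambda>s::real. a n * s^2 + (-1))" for n
    by (intro smooth_add smooth_mult smooth_const smooth_power smooth_ident)
  have sm: "smooth (\<eta> n)" for n unfolding \<eta>_def[abs_def]
    by (intro smooth_mult smooth_ident smooth_compose_real[OF smooth_step sq])
  have d: "dd 1 (\<eta> n) s = step (a n * s^2 + (-1)) + 2 * (a n * s^2) * st (a n * s^2 + (-1))" for n s
  proof -
    have "(step has_field_derivative st u) (at u)" for u
      unfolding st_def by (rule smooth_DERIV[OF smooth_step])
    moreover have "((\<lambda>s. a n * s^2 + (-1)) has_field_derivative a n * (2 * s)) (at s)"
      by (auto intro!: derivative_eq_intros)
    ultimately have "((\<lambda>s. step (a n * s^2 + (-1))) has_field_derivative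
        st (a n * s^2 + (-1)) * (a n * (2 * s))) (at s)"
      by (rule DERIV_chain2)
    from DERIV_mult[OF DERIV_ident this]
    have "(\<eta> n has_field_derivative (step (a n * s^2 + (-1)) + 2 * (a n * s^2) * st (a n * s^2 + (-1)))) (at s)"
      unfolding \<eta>_def[abs_def] by (simp add: power2_eq_square mult_ac)
    then show ?thesis by (rule dd_eq_DERIV)
  qed
  have db: "\<bar>dd 1 (\<eta> n) s\<bar> \<le> C" for n s
  proof -
    define u where "u = a n * s^2 + (-1)"
    have "\<bar>2 * (u + 1) * st u\<bar> \<le> 4 * S"
    proof (cases "u < 0 \<or> u > 1")
      case False
      then have "\<bar>2 * (u + 1)\<bar> * \<bar>st u\<bar> \<le> 4 * S" using S[of u] S0 by (intro mult_mono) auto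
      then show ?thesis by (simp add: abs_mult)
    qed (use st0[of u] S0 in auto)
    then show ?thesis unfolding d C_def using stepb[of u] by (auto simp: u_def)
  qed
  have ev: "\<forall>\<^sub>F n in sequentially. a n * s^2 + (-1) > 1" if "s \<noteq> 0" for s
  proof -
    have "\<forall>\<^sub>F n in sequentially. real n > 2 / s^2" using eventually_gt_at_top[of "nat \<lceil>2 / s^2\<rceil>"]
      by eventually_elim linarith
    then show ?thesis
    proof eventually_elim
      case (elim n)
      have "real n \<le> a n" by (auto simp: a_def power2_eq_square algebra_simps)
      then have "2 / s^2 < a n" using elim by linarith
      then show ?case using that by (simp add: field_simps)
    qed
  qed
  show ?thesis
  proof
    show "smooth (\<eta> n)" for n by (rule sm)
    show "\<bar>dd 1 (\<eta> n) s\<bar> \<le> C" for n s by (rule db)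
    show "dd 1 (\<eta> n) 0 = 0" for n by (simp add: d step_0)
    show "\<bar>\<eta> n s\<bar> \<le> C * \<bar>s\<bar>" for n s
    proof -
      have "\<bar>s\<bar> * \<bar>step (a n * s^2 + (-1))\<bar> \<le> \<bar>s\<bar> * C"
        using stepb[of "a n * s^2 + (-1)"] S0 by (intro mult_left_mono) (auto simp: C_def)
      then show ?thesis by (simp add: \<eta>_def abs_mult mult.commute)
    qed
    show "\<eta> n s = 0" if "\<bar>s\<bar> \<le> 1 / (n + 1)" for n s
    proof -
      have "s^2 \<le> (1 / (real n + 1))^2" using that abs_le_square_iff[of s "1 / (real n + 1)"] by (simp add: add.commute)
      then have "a n * s^2 \<le> a n * (1 / (real n + 1))^2" by (intro mult_left_mono) (auto simp: a_def)
      also have "\<dots> = 1" by (simp add: a_def field_simps)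
      finally show ?thesis by (simp add: \<eta>_def step_0)
    qed
    show "(\<lambda>n. \<eta> n s) \<longlonglongrightarrow> s" for s
    proof (cases "s = 0")
      case False
      have "\<forall>\<^sub>F n in sequentially. \<eta> n s = s"
        using ev[OF False] by eventually_elim (simp add: \<eta>_def step_1)
      then show ?thesis by (rule tendsto_eventually)
    qed (simp add: \<eta>_def)
    show "(\<lambda>n. dd 1 (\<eta> n) s) \<longlonglongrightarrow> 1" if "s \<noteq> 0" for s
    proof -
      have "\<forall>\<^sub>F n in sequentially. dd 1 (\<eta> n) s = 1"
        using ev[OF that] by eventually_elim (simp add: d step_1 st0)
      then show ?thesis by (rule tendsto_eventually)
    qed
  qed
qed

section \<open>The Hilbert space of square-integrable functions\<close>

definition sqi :: "('a::euclidean_space \<Rightarrow> real) \<Rightarrow> bool" where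
  "sqi f \<longleftrightarrow> f \<in> borel_measurable borel \<and> integrable lborel (\<lambda>x. (f x)^2)"

lemma sqi_measurable: "sqi f \<Longrightarrow> f \<in> borel_measurable borel"
  by (simp add: sqi_def)

lemma sqi_mult_integrable:
  assumes "sqi f" "sqi g" shows "integrable lborel (\<lambda>x. f x * g x)"
proof (rule Bochner_Integration.integrable_bound)
  show "integrable lborel (\<lambda>x. (f x)^2 + (g x)^2)"
    using assms by (auto simp: sqi_def)
  show "(\<lambda>x. f x * g x) \<in> borel_measurable lborel"
    using assms by (auto simp: sqi_def)
  have "\<bar>f x * g x\<bar> \<le> (f x)^2 + (g x)^2" for x
  proof -
    have "0 \<le> \<bar>f x\<bar> * \<bar>g x\<bar>" by simp
    then show ?thesis using sum_squares_bound[of "\<bar>f x\<bar>" "\<bar>g x\<bar>"] unfolding abs_mult power2_abs by linarith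
  qed
  then show "AE x in lborel. norm (f x * g x) \<le> norm ((f x)^2 + (g x)^2)" by simp
qed

lemma sqi_0 [simp]: "sqi (\<lambda>x. 0)"
  by (simp add: sqi_def)

lemma sqi_cmult: "sqi f \<Longrightarrow> sqi (\<lambda>x. c * f x)"
  by (auto simp: sqi_def power_mult_distrib)

lemma sqi_add:
  assumes "sqi f" "sqi g" shows "sqi (\<lambda>x. f x + g x)"
proof -
  have "integrable lborel (\<lambda>x. (f x)^2 + (g x)^2 + 2 * (f x * g x))"
    using assms sqi_mult_integrable[OF assms] by (auto simp: sqi_def)
  then show ?thesis using assms by (auto simp: sqi_def power2_sum mult.assoc)
qed

lemma sqi_minus: "sqi f \<Longrightarrow> sqi (\<lambda>x. - f x)"
  using sqi_cmult[of f "-1"] by simp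

lemma sqi_diff: "sqi f \<Longrightarrow> sqi g \<Longrightarrow> sqi (\<lambda>x. f x - g x)"
  using sqi_add[OF _ sqi_minus, of f g] by simp

lemma sqi_bound:
  assumes "sqi g" "f \<in> borel_measurable borel" "\<And>x. \<bar>f x\<bar> \<le> C * \<bar>g x\<bar>"
  shows "sqi f"
proof -
  have "integrable lborel (\<lambda>x. (f x)^2)"
  proof (rule Bochner_Integration.integrable_bound)
    show "integrable lborel (\<lambda>x. (C * g x)^2)"
      using sqi_cmult[OF assms(1), of C] by (simp add: sqi_def)
    show "(\<lambda>x. (f x)^2) \<in> borel_measurable lborel" using assms(2) by simp
    have "\<bar>f x\<bar> \<le> \<bar>C * g x\<bar>" for x
      using order_trans[OF assms(3)[of x] mult_right_mono[of C "\<bar>C\<bar>" "\<bar>g x\<bar>"]] by (simp add: abs_mult)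
    then have "(f x)^2 \<le> (C * g x)^2" for x using abs_le_square_iff by blast
    then show "AE x in lborel. norm ((f x)^2) \<le> norm ((C * g x)^2)" by simp
  qed
  with assms(2) show ?thesis by (simp add: sqi_def)
qed

\<comment> \<open>A type rather than a set of functions: projections, closures and adjoints are then
  stated once for the classes \<open>real_inner\<close> and \<open>complete_space\<close>, and apply
  also to products and vectors of such spaces.\<close>
quotient_type (overloaded) 'a l2 = "'a::euclidean_space \<Rightarrow> real" /
  partial: "\<lambda>f g. sqi f \<and> sqi g \<and> (AE x in lborel. f x = g x)"
proof (rule part_equivpI)
  show "\<exists>f::'a \<Rightarrow> real. sqi f \<and> sqi f \<and> (AE x in lborel. f x = f x)"
    by (rule exI[of _ "\<lambda>x. 0"]) simp
qed (auto simp: symp_def transp_def)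

instantiation l2 :: (euclidean_space) real_inner
begin

lift_definition zero_l2 :: "'a l2" is "\<lambda>x. 0" by simp
lift_definition plus_l2 :: "'a l2 \<Rightarrow> 'a l2 \<Rightarrow> 'a l2" is "\<lambda>f g x. f x + g x"
  by (auto intro: sqi_add)
lift_definition uminus_l2 :: "'a l2 \<Rightarrow> 'a l2" is "\<lambda>f x. - f x"
  by (auto intro: sqi_minus)
lift_definition minus_l2 :: "'a l2 \<Rightarrow> 'a l2 \<Rightarrow> 'a l2" is "\<lambda>f g x. f x - g x"
  by (auto intro: sqi_diff)
lift_definition scaleR_l2 :: "real \<Rightarrow> 'a l2 \<Rightarrow> 'a l2" is "\<lambda>c f x. c * f x"
  by (auto intro: sqi_cmult)
lift_definition inner_l2 :: "'a l2 \<Rightarrow> 'a l2 \<Rightarrow> real" is "\<lambda>f g. \<integral>x. f x * g x \<partial>lborel"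
proof -
  fix f1 f2 g1 g2 :: "'a \<Rightarrow> real"
  assume a: "sqi f1 \<and> sqi f2 \<and> (AE x in lborel. f1 x = f2 x)" "sqi g1 \<and> sqi g2 \<and> (AE x in lborel. g1 x = g2 x)"
  have "AE x in lborel. f1 x * g1 x = f2 x * g2 x" using a by auto
  then show "(\<integral>x. f1 x * g1 x \<partial>lborel) = (\<integral>x. f2 x * g2 x \<partial>lborel)"
    using a by (intro integral_cong_AE) (auto simp: sqi_def)
qed
definition norm_l2 :: "'a l2 \<Rightarrow> real" where "norm_l2 f = sqrt (inner f f)"
definition dist_l2 :: "'a l2 \<Rightarrow> 'a l2 \<Rightarrow> real" where "dist_l2 f g = norm (f - g)"
definition sgn_l2 :: "'a l2 \<Rightarrow> 'a l2" where "sgn_l2 f = inverse (norm f) *\<^sub>R f"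
definition uniformity_l2 :: "('a l2 \<times> 'a l2) filter" where
  "uniformity_l2 = (INF e\<in>{0 <..}. principal {(x, y). dist x y < e})"
definition open_l2 :: "'a l2 set \<Rightarrow> bool" where
  "open_l2 U \<longleftrightarrow> (\<forall>x\<in>U. eventually (\<lambda>(x', y). x' = x \<longrightarrow> y \<in> U) uniformity)"

instance
proof
  fix a b c :: "'a l2" and r s :: real
  show "a + b + c = a + (b + c)" by transfer (auto simp: add.assoc intro!: sqi_add)
  show "a + b = b + a" by transfer (auto simp: add.commute intro!: sqi_add)
  show "0 + a = a" by transfer auto
  show "- a + a = 0" by transfer auto
  show "a - b = a + - b" by transfer (auto intro: sqi_diff)
  show "r *\<^sub>R (a + b) = r *\<^sub>R a + r *\<^sub>R b" by transfer (auto simp: distrib_left intro!: sqi_add sqi_cmult)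
  show "(r + s) *\<^sub>R a = r *\<^sub>R a + s *\<^sub>R a"
    by transfer (auto simp: distrib_right intro!: sqi_add sqi_cmult)
  show "r *\<^sub>R s *\<^sub>R a = (r * s) *\<^sub>R a" by transfer (auto simp: mult.assoc intro!: sqi_cmult)
  show "1 *\<^sub>R a = a" by transfer auto
  show "dist a b = norm (a - b)" by (rule dist_l2_def)
  show "sgn a = inverse (norm a) *\<^sub>R a" by (rule sgn_l2_def)
  show "(uniformity :: ('a l2 \<times> 'a l2) filter) = (INF e\<in>{0 <..}. principal {(x, y). dist x y < e})"
    by (rule uniformity_l2_def)
  show "open U \<longleftrightarrow> (\<forall>x\<in>U. eventually (\<lambda>(x', y). x' = x \<longrightarrow> y \<in> U) uniformity)" for U :: "'a l2 set"
    by (rule open_l2_def)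
  show "inner a b = inner b a" by transfer (simp add: mult.commute)
  show "inner (a + b) c = inner a c + inner b c"
    by transfer (auto simp: distrib_right sqi_mult_integrable)
  show "inner (r *\<^sub>R a) b = r * inner a b" by transfer (simp add: mult.assoc)
  show "0 \<le> inner a a" by transfer simp
  show "inner a a = 0 \<longleftrightarrow> a = 0"
  proof transfer
    fix f :: "'a \<Rightarrow> real" assume f: "sqi f \<and> sqi f \<and> (AE x in lborel. f x = f x)"
    have "(\<integral>x. f x * f x \<partial>lborel) = 0 \<longleftrightarrow> (AE x in lborel. f x * f x = 0)"
      using f sqi_mult_integrable[of f f] by (intro integral_nonneg_eq_0_iff_AE) auto
    then show "((\<integral>x. f x * f x \<partial>lborel) = 0) = (sqi f \<and> sqi (\<lambda>x. 0) \<and> (AE x in lborel. f x = 0))"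
      using f by simp
  qed
  show "norm a = sqrt (inner a a)" by (rule norm_l2_def)
qed

end

text \<open>The default value 0 makes the map total; it carries no information about a function that
  fails \<open>sqi\<close>.\<close>

lift_definition cls :: "('a::euclidean_space \<Rightarrow> real) \<Rightarrow> 'a l2" is "\<lambda>f. if sqi f then f else (\<lambda>x. 0)"
  by auto

lemma cls_exists: "\<exists>f. sqi f \<and> u = cls f"
  by transfer auto

lemma cls_zero: "cls (\<lambda>x. 0) = 0"
  by transfer auto

lemma cls_eq_iff: "sqi f \<Longrightarrow> sqi g \<Longrightarrow> cls f = cls g \<longleftrightarrow> (AE x in lborel. f x = g x)"
  by transfer auto

lemma cls_add: "sqi f \<Longrightarrow> sqi g \<Longrightarrow> cls (\<lambda>x. f x + g x) = cls f + cls g"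
  by transfer (auto intro: sqi_add)

lemma cls_diff: "sqi f \<Longrightarrow> sqi g \<Longrightarrow> cls (\<lambda>x. f x - g x) = cls f - cls g"
  by transfer (auto intro: sqi_diff)

lemma cls_cmult: "sqi f \<Longrightarrow> cls (\<lambda>x. c * f x) = c *\<^sub>R cls f"
  by transfer (auto intro: sqi_cmult)

lemma inner_cls: "sqi f \<Longrightarrow> sqi g \<Longrightarrow> inner (cls f) (cls g) = (\<integral>x. f x * g x \<partial>lborel)"
  by transfer auto

lemma norm_cls_diff:
  assumes "sqi f" "sqi g" shows "(norm (cls f - cls g))^2 = (\<integral>x. (f x - g x)^2 \<partial>lborel)"
  unfolding power2_norm_eq_inner cls_diff[OF assms, symmetric] inner_cls[OF sqi_diff sqi_diff, OF assms assms]
  by (simp add: power2_eq_square)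

text \<open>The weight 2^k turns a finite sum of squares into geometric decay of the increments. It
  is small enough for the integrals to be summable when the squared L2 norms decay like
  (1/4)^k.\<close>

lemma geometric_increments_convergent:
  fixes a :: "nat \<Rightarrow> real"
  assumes "(\<Sum>k. ennreal (2 ^ k * (a (Suc k) - a k)^2)) \<noteq> \<infinity>"
  shows "convergent a"
proof -
  define S where "S = (\<Sum>k. ennreal (2 ^ k * (a (Suc k) - a k)^2))"
  define C where "C = enn2real S"
  have C: "S = ennreal C" "C \<ge> 0"
    using assms unfolding S_def[symmetric] C_def by (simp_all add: less_top)
  have bd: "\<bar>a (Suc k) - a k\<bar> \<le> sqrt C * (sqrt (1/2)) ^ k" for k
  proof -
    have "ennreal (2 ^ k * (a (Suc k) - a k)^2) \<le> ennreal C"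
      using sum_le_suminf[of "\<lambda>k. ennreal (2 ^ k * (a (Suc k) - a k)^2)" "{k}"] unfolding C(1)[symmetric] S_def
      by (simp only: sum.insert sum.empty finite.intros empty_iff add_0_right summableI zero_le simp_thms)
    then have "2 ^ k * (a (Suc k) - a k)^2 \<le> C" using C(2) by simp
    then have "(a (Suc k) - a k)^2 \<le> C * (1/2) ^ k" by (simp add: field_simps power_divide)
    then have "sqrt ((a (Suc k) - a k)^2) \<le> sqrt (C * (1/2) ^ k)" by (rule real_sqrt_le_mono)
    then show ?thesis unfolding real_sqrt_abs real_sqrt_mult real_sqrt_power[of "1/2"] .
  qed
  have "summable (\<lambda>k. sqrt C * (sqrt (1/2)) ^ k)"
    by (intro summable_mult summable_geometric) (simp add: real_less_lsqrt)
  then have "summable (\<lambda>k. a (Suc k) - a k)"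
    by (rule summable_comparison_test') (use bd in simp)
  then have "convergent (\<lambda>n. (\<Sum>k<n. a (Suc k) - a k) + a 0)"
    by (intro convergent_add convergent_const) (simp add: summable_iff_convergent)
  then show ?thesis by (simp add: sum_lessThan_telescope)
qed

text \<open>Riesz-Fischer: a subsequence with distances below (1/2)^k converges almost everywhere,
  and Fatou's lemma transfers these rates to its distance from the pointwise limit.\<close>

instance l2 :: (euclidean_space) complete_space
proof
  fix X :: "nat \<Rightarrow> 'a l2" assume "Cauchy X"
  then have "\<exists>N. \<forall>m\<ge>N. \<forall>n\<ge>N. dist (X m) (X n) < (1/2) ^ k" for k
    by (intro metric_CauchyD) auto
  then obtain N where N: "\<And>k m n. m \<ge> N k \<Longrightarrow> n \<ge> N k \<Longrightarrow> dist (X m) (X n) < (1/2) ^ k"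
    by metis
  \<comment> \<open>The sum is one index that is large enough for all tolerances up to k at
    once.\<close>
  define s where "s k = (\<Sum>i\<le>k. N i)" for k
  have sN: "N k \<le> s m" if "k \<le> m" for k m
    unfolding s_def using that by (intro member_le_sum) auto
  have ds: "dist (X (s m)) (X (s n)) < (1/2) ^ k" if "k \<le> m" "k \<le> n" for k m n
    using that sN N by blast
  obtain g where g: "\<And>k. sqi (g k)" "\<And>k. X (s k) = cls (g k)"
    using cls_exists[of "X (s _)"] by metis
  have gm[measurable]: "g k \<in> borel_measurable borel" for k using g(1) sqi_measurable by blast
  have ig: "integrable lborel (\<lambda>x. (g m x - g n x)^2)" for m n
    using sqi_diff[OF g(1) g(1), of m n] by (simp add: sqi_def)
  have nn: "(\<integral>\<^sup>+x. ennreal ((g m x - g n x)^2) \<partial>lborel) \<le> ennreal ((1/4) ^ k)" if "k \<le> m" "k \<le> n" for k m n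
  proof -
    have "(norm (X (s m) - X (s n)))^2 \<le> ((1/2) ^ k)^2"
      using ds[OF that] by (intro power_mono) (auto simp: dist_norm)
    also have "\<dots> = (1/4 :: real) ^ k" by (simp add: power_mult[symmetric] power2_eq_square power_mult_distrib[symmetric])
    finally show ?thesis
      using ig by (subst nn_integral_eq_integral) (auto simp: g(2) norm_cls_diff[OF g(1) g(1)])
  qed
  have "(\<integral>\<^sup>+x. (\<Sum>k. ennreal (2 ^ k * (g (Suc k) x - g k x)^2)) \<partial>lborel) =
      (\<Sum>k. \<integral>\<^sup>+x. ennreal (2 ^ k * (g (Suc k) x - g k x)^2) \<partial>lborel)"
    by (rule nn_integral_suminf) measurable
  also have "\<dots> \<le> (\<Sum>k. ennreal ((1/2) ^ k))"
  proof (rule suminf_le)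
    fix k
    have "(\<integral>\<^sup>+x. ennreal (2 ^ k * (g (Suc k) x - g k x)^2) \<partial>lborel)
        = ennreal (2 ^ k) * (\<integral>\<^sup>+x. ennreal ((g (Suc k) x - g k x)^2) \<partial>lborel)"
      by (subst nn_integral_cmult[symmetric]) (auto simp: ennreal_mult)
    also have "\<dots> \<le> ennreal (2 ^ k) * ennreal ((1/4) ^ k)"
      by (intro mult_left_mono nn) auto
    also have "\<dots> = ennreal ((1/2) ^ k)"
      by (simp add: ennreal_mult[symmetric] power_mult_distrib[symmetric])
    finally show "(\<integral>\<^sup>+x. ennreal (2 ^ k * (g (Suc k) x - g k x)^2) \<partial>lborel) \<le> ennreal ((1/2) ^ k)" .
  qed auto
  also have "\<dots> < \<infinity>"
  proof -
    have "(\<Sum>k. ennreal ((1/2) ^ k)) = ennreal (\<Sum>k. (1/2) ^ k)"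
      by (rule suminf_ennreal2) (auto intro: summable_geometric)
    then show ?thesis by simp
  qed
  finally have "AE x in lborel. (\<Sum>k. ennreal (2 ^ k * (g (Suc k) x - g k x)^2)) \<noteq> \<infinity>"
    by (intro nn_integral_noteq_infinite) auto
  then have conv: "AE x in lborel. convergent (\<lambda>k. g k x)"
    by eventually_elim (rule geometric_increments_convergent)
  define h where "h x = lim (\<lambda>k. g k x)" for x
  have [measurable]: "h \<in> borel_measurable borel" unfolding h_def[abs_def] by measurable
  have fat: "(\<integral>\<^sup>+x. ennreal ((g k x - h x)^2) \<partial>lborel) \<le> ennreal ((1/4) ^ k)" for k
  proof -
    have "(\<integral>\<^sup>+x. ennreal ((g k x - h x)^2) \<partial>lborel) = (\<integral>\<^sup>+x. liminf (\<lambda>m. ennreal ((g k x - g m x)^2)) \<partial>lborel)"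
    proof (rule nn_integral_cong_AE)
      show "AE x in lborel. ennreal ((g k x - h x)^2) = liminf (\<lambda>m. ennreal ((g k x - g m x)^2))"
        using conv
      proof eventually_elim
        case (elim x)
        then have "(\<lambda>m. g m x) \<longlonglongrightarrow> h x" by (simp add: h_def convergent_LIMSEQ_iff)
        then have "(\<lambda>m. ennreal ((g k x - g m x)^2)) \<longlonglongrightarrow> ennreal ((g k x - h x)^2)"
          by (intro tendsto_ennrealI tendsto_intros)
        then show ?case by (intro lim_imp_Liminf[symmetric]) auto
      qed
    qed
    also have "\<dots> \<le> liminf (\<lambda>m. \<integral>\<^sup>+x. ennreal ((g k x - g m x)^2) \<partial>lborel)"
      by (rule nn_integral_liminf) measurable
    also have "\<dots> \<le> limsup (\<lambda>m. \<integral>\<^sup>+x. ennreal ((g k x - g m x)^2) \<partial>lborel)"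
      by (rule Liminf_le_Limsup) simp
    also have "\<dots> \<le> ennreal ((1/4) ^ k)"
    proof (rule Limsup_bounded)
      show "\<forall>\<^sub>F m in sequentially. (\<integral>\<^sup>+x. ennreal ((g k x - g m x)^2) \<partial>lborel) \<le> ennreal ((1/4) ^ k)"
        using eventually_ge_at_top[of k] by eventually_elim (rule nn, auto)
    qed
    finally show ?thesis .
  qed
  have id: "integrable lborel (\<lambda>x. (g k x - h x)^2)" for k
    by (rule integrableI_bounded) (use fat[of k] in \<open>auto intro: le_less_trans\<close>)
  \<comment> \<open>Only differences from h are estimated; h is square integrable as
    \<open>g 0\<close> minus such a difference.\<close>
  then have "sqi (\<lambda>x. g 0 x - h x)" by (simp add: sqi_def)
  then have h: "sqi h" using sqi_diff[OF g(1)[of 0]] by fastforce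
  have dh: "dist (X (s k)) (cls h) \<le> (1/2) ^ k" for k
  proof -
    have "ennreal ((norm (cls (g k) - cls h))^2) \<le> ennreal ((1/4) ^ k)"
      using fat[of k] nn_integral_eq_integral[OF id[of k]] by (simp add: norm_cls_diff[OF g(1) h])
    then have "(norm (cls (g k) - cls h))^2 \<le> (1/4) ^ k" by simp
    also have "\<dots> = ((1/2 :: real) ^ k)^2" by (simp add: power_mult[symmetric] power2_eq_square power_mult_distrib[symmetric])
    finally show ?thesis unfolding dist_norm g(2) by (rule power2_le_imp_le) simp
  qed
  have "X \<longlonglongrightarrow> cls h"
  proof (rule metric_LIMSEQ_I)
    fix e :: real assume "e > 0"
    then obtain k where k: "(1/2 :: real) ^ k < e / 2" using real_arch_pow_inv[of "e/2" "1/2"] by auto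
    have "dist (X n) (cls h) < e" if "n \<ge> s k" for n
    proof -
      have "dist (X n) (X (s k)) < (1/2) ^ k" using N[of k n "s k"] sN[of k k] that by auto
      then show ?thesis using dh[of k] k dist_triangle[of "X n" "cls h" "X (s k)"] by linarith
    qed
    then show "\<exists>no. \<forall>n\<ge>no. dist (X n) (cls h) < e" by blast
  qed
  then show "convergent X" by (auto simp: convergent_def)
qed

subsection \<open>Orthogonal projection\<close>

text \<open>A minimising sequence for the distance to S is Cauchy by the parallelogram law, applied
  to the midpoint of two of its members.\<close>

lemma orthogonal_projection:
  fixes S :: "'h::{real_inner, complete_space} set"
  assumes S: "subspace S" "closed S"
  obtains p where "p \<in> S" "\<And>y. y \<in> S \<Longrightarrow> inner (x - p) y = 0"
proof -
  define d where "d = Inf ((\<lambda>y. (norm (x - y))^2) ` S)"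
  have bdd: "bdd_below ((\<lambda>y. (norm (x - y))^2) ` S)" by (rule bdd_belowI2[of _ 0]) simp
  have ne: "S \<noteq> {}" using S(1) subspace_0 by blast
  have dle: "d \<le> (norm (x - y))^2" if "y \<in> S" for y
    unfolding d_def using that by (intro cINF_lower bdd)
  have "\<exists>y\<in>S. (norm (x - y))^2 < d + 1 / (real n + 1)" for n
    using cINF_less_iff[OF ne bdd, of "d + 1 / (real n + 1)"] by (auto simp: d_def)
  then obtain y where y: "\<And>n. y n \<in> S" "\<And>n. (norm (x - y n))^2 < d + 1 / (real n + 1)" by metis
  have par: "(norm (y m - y n))^2 \<le> 2 / (real m + 1) + 2 / (real n + 1)" for m n
  proof -
    have "(1/2) *\<^sub>R (y m + y n) \<in> S" using S(1) y(1) by (simp add: subspace_add subspace_scale)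
    from dle[OF this] have "4 * d \<le> 4 * (norm (x - (1/2) *\<^sub>R (y m + y n)))^2" by simp
    also have "\<dots> = 2 * (norm (x - y m))^2 + 2 * (norm (x - y n))^2 - (norm (y m - y n))^2"
      by (simp add: power2_norm_eq_inner inner_diff_left inner_diff_right inner_add_left inner_add_right
          inner_commute algebra_simps)
    finally show ?thesis using y(2)[of m] y(2)[of n] by simp
  qed
  have "Cauchy y"
  proof (rule metric_CauchyI)
    fix e :: real assume e: "e > 0"
    obtain M where M: "real M > 4 / e^2" using reals_Archimedean2 by blast
    have "dist (y m) (y n) < e" if "m \<ge> M" "n \<ge> M" for m n
    proof -
      have "2 / (real m + 1) \<le> 2 / (real M + 1)" "2 / (real n + 1) \<le> 2 / (real M + 1)"
        using that by (auto intro!: divide_left_mono)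
      then have "(norm (y m - y n))^2 \<le> 4 / (real M + 1)" using par[of m n] by simp
      also have "\<dots> < e^2"
      proof -
        have e2: "e^2 > 0" using e by simp
        then have "4 < real M * e^2" using M by (simp add: field_simps)
        then have "4 < real M * e^2 + 1 * e^2" using e2 by linarith
        then have "4 < (real M + 1) * e^2" by (simp add: distrib_right)
        then show ?thesis by (simp add: pos_divide_less_eq mult.commute)
      qed
      finally show ?thesis using e by (simp add: dist_norm power_less_imp_less_base)
    qed
    then show "\<exists>M. \<forall>m\<ge>M. \<forall>n\<ge>M. dist (y m) (y n) < e" by blast
  qed
  then obtain p where p: "y \<longlonglongrightarrow> p" using Cauchy_convergent convergent_def by blast
  have pS: "p \<in> S" using closed_sequentially[OF S(2) _ p] y(1) by blast
  have "(norm (x - p))^2 \<le> d"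
  proof (rule LIMSEQ_le)
    show "(\<lambda>n. (norm (x - y n))^2) \<longlonglongrightarrow> (norm (x - p))^2" by (intro tendsto_intros p)
    show "(\<lambda>n. d + 1 / (real n + 1)) \<longlonglongrightarrow> d"
      using tendsto_add[OF tendsto_const LIMSEQ_inverse_real_of_nat, of d] by (simp add: inverse_eq_divide add.commute)
    show "\<exists>N. \<forall>n\<ge>N. (norm (x - y n))^2 \<le> d + 1 / (real n + 1)" using y(2) less_imp_le by blast
  qed
  have "inner (x - p) z = 0" if z: "z \<in> S" for z
  proof (rule ccontr)
    assume nz: "inner (x - p) z \<noteq> 0"
    then have z0: "inner z z > 0" by auto
    \<comment> \<open>The minimiser of the quadratic |x - p - t z|^2; with a nonzero inner product
      it would bring the distance below the infimum d.\<close>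
    define t where "t = inner (x - p) z / inner z z"
    have "p + t *\<^sub>R z \<in> S" using S(1) pS z by (simp add: subspace_add subspace_scale)
    from dle[OF this] have "(norm (x - p))^2 \<le> (norm (x - p - t *\<^sub>R z))^2"
      using order_trans[OF \<open>(norm (x - p))^2 \<le> d\<close>] by (simp only: diff_diff_eq)
    also have "\<dots> = (norm (x - p))^2 - 2 * t * inner (x - p) z + t * t * inner z z"
      by (simp add: power2_norm_eq_inner inner_diff_left inner_diff_right inner_commute algebra_simps)
    finally have "2 * t * inner (x - p) z \<le> t * t * inner z z" by simp
    moreover have "t * inner z z = inner (x - p) z" using z0 by (simp add: t_def)
    ultimately have "t * inner (x - p) z \<le> 0" by (simp add: mult.assoc)
    moreover have "t * inner (x - p) z > 0"
      using nz z0 by (auto simp: t_def zero_less_divide_iff zero_less_mult_iff linorder_neq_iff)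
    ultimately show False by simp
  qed
  then show ?thesis using that pS by blast
qed

lemma riesz_representation:
  fixes F :: "'h::{real_inner, complete_space} \<Rightarrow> real"
  assumes "bounded_linear F"
  obtains w where "\<And>x. F x = inner w x"
proof (cases "\<exists>x. F x \<noteq> 0")
  case False
  then show ?thesis using that[of 0] by auto
next
  case True
  interpret bounded_linear F by fact
  obtain x0 where x0: "F x0 \<noteq> 0" using True by blast
  let ?K = "{x. F x = 0}"
  have "subspace ?K" by (auto simp: subspace_def add zero scale)
  moreover have "closed ?K" by (intro closed_Collect_eq continuous_on_const linear_continuous_on assms)
  ultimately obtain p where p: "p \<in> ?K" "\<And>y. y \<in> ?K \<Longrightarrow> inner (x0 - p) y = 0"
    by (rule orthogonal_projection[of ?K x0]) blast
  define n where "n = x0 - p"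
  have Fn: "F n \<noteq> 0" using p x0 by (simp add: n_def diff)
  then have nn: "inner n n \<noteq> 0" using zero by auto
  have "F x = inner ((F n / inner n n) *\<^sub>R n) x" for x
  proof -
    have "x - (F x / F n) *\<^sub>R n \<in> ?K" using Fn by (simp add: diff scale)
    from p(2)[OF this] have "inner n x = F x / F n * inner n n" by (simp add: n_def inner_diff_right)
    then show ?thesis using nn Fn by (simp add: field_simps)
  qed
  then show ?thesis using that by blast
qed

text \<open>Provides the time average of a class below as an adjoint, so that no representative has
  to be integrated slice by slice.\<close>

lemma adjoint_exists:
  fixes A :: "'g::{real_inner, complete_space} \<Rightarrow> 'h::real_inner"
  assumes "bounded_linear A"
  shows "\<exists>B. \<forall>u v. inner (B u) v = inner u (A v)"
proof -
  have "\<exists>w. \<forall>v. inner w v = inner u (A v)" for u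
  proof -
    have "bounded_linear (\<lambda>v. inner u (A v))"
      using bounded_linear_compose[OF bounded_linear_inner_right assms] .
    then show ?thesis by (rule riesz_representation) metis
  qed
  then show ?thesis by metis
qed

lemma closure_subspace:
  fixes S :: "'h::real_normed_vector set"
  assumes "subspace S" shows "subspace (closure S)"
  unfolding subspace_def
proof (intro conjI ballI allI)
  show "0 \<in> closure S" using subspace_0[OF assms] closure_subset by blast
  fix x assume "x \<in> closure S"
  then obtain f where f: "\<And>n. f n \<in> S" "f \<longlonglongrightarrow> x" unfolding closure_sequential by blast
  show "c *\<^sub>R x \<in> closure S" for c
    unfolding closure_sequential
    by (rule exI[of _ "\<lambda>n. c *\<^sub>R f n"]) (auto intro!: tendsto_intros f subspace_scale assms)
  fix y assume "y \<in> closure S"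
  then obtain g where g: "\<And>n. g n \<in> S" "g \<longlonglongrightarrow> y" unfolding closure_sequential by blast
  show "x + y \<in> closure S"
    unfolding closure_sequential
    by (rule exI[of _ "\<lambda>n. f n + g n"]) (auto intro!: tendsto_intros f g subspace_add assms)
qed

text \<open>The density principle of the whole proof: x minus its projection onto the closure of S
  stays in W and is orthogonal to S, hence is zero.\<close>

lemma closure_if_orthogonal_trivial:
  fixes S W :: "'h::{real_inner, complete_space} set"
  assumes S: "subspace S" and W: "subspace W" "closed W" and SW: "S \<subseteq> W"
    and trivial: "\<And>y. y \<in> W \<Longrightarrow> (\<And>s. s \<in> S \<Longrightarrow> inner y s = 0) \<Longrightarrow> y = 0"
    and x: "x \<in> W"
  shows "x \<in> closure S"
proof -
  have cl: "subspace (closure S)" using S by (rule closure_subspace)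
  obtain p where p: "p \<in> closure S" "\<And>y. y \<in> closure S \<Longrightarrow> inner (x - p) y = 0"
    using orthogonal_projection[OF cl closed_closure, of x] by metis
  have "p \<in> W" using p(1) closure_minimal[OF SW W(2)] by blast
  then have "x - p \<in> W" using W(1) x subspace_diff by blast
  then have "x - p = 0" using p(2) closure_subset by (intro trivial) blast+
  then show ?thesis using p(1) by simp
qed

lemma orthogonal_complement_closed_subspace:
  fixes C :: "'h::real_inner set"
  shows "subspace {x. \<forall>c\<in>C. inner x c = 0}" "closed {x. \<forall>c\<in>C. inner x c = 0}"
proof -
  show "subspace {x. \<forall>c\<in>C. inner x c = 0}" by (auto simp: subspace_def inner_add_left)
  have "{x. \<forall>c\<in>C. inner x c = 0} = (\<Inter>c\<in>C. {x. inner x c = 0})" by auto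
  then show "closed {x. \<forall>c\<in>C. inner x c = 0}"
    by (auto intro!: closed_INT closed_Collect_eq continuous_intros)
qed

section \<open>Functions on a domain and integration by parts\<close>

text \<open>Extension by zero. Square-integrable functions on any domain become members of one type,
  and the domain is remembered by the closed subspace \<open>supp_l2\<close>.\<close>

definition emb :: "'a::euclidean_space set \<Rightarrow> ('a \<Rightarrow> real) \<Rightarrow> 'a l2" where
  "emb S f = cls (\<lambda>x. indicator S x * f x)"

definition supp_l2 :: "'a::euclidean_space set \<Rightarrow> 'a l2 set" where
  "supp_l2 S = {emb S f | f. L2 S f}"

lemma L2_iff_sqi: "L2 S f \<longleftrightarrow> sqi (\<lambda>x. indicator S x * f x)"
proof -
  have "(indicator S x * f x)^2 = indicator S x * (f x)^2" for x by (auto simp: indicator_def)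
  then show ?thesis by (simp add: L2_def sqi_def set_borel_measurable_def set_integrable_def)
qed

lemma emb_cong: "(\<And>x. x \<in> S \<Longrightarrow> f x = g x) \<Longrightarrow> emb S f = emb S g"
  unfolding emb_def by (intro arg_cong[of _ _ cls]) (auto simp: indicator_def)

lemma inner_emb:
  assumes "L2 S f" "L2 S g" shows "inner (emb S f) (emb S g) = ip S f g"
proof -
  have eq: "indicator S x * f x * (indicator S x * g x) = indicator S x * (f x * g x)" for x
    by (auto simp: indicator_def)
  show ?thesis
    unfolding emb_def inner_cls[OF assms[unfolded L2_iff_sqi]] eq ip_def set_lebesgue_integral_def real_scaleR_def
    by (rule refl)
qed

lemma ip_commute: "ip S f g = ip S g f"
  by (simp add: ip_def mult.commute)

lemma norm_emb: "L2 S f \<Longrightarrow> (norm (emb S f))^2 = ip S f f"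
  by (simp add: power2_norm_eq_inner inner_emb)

lemma L2_zero [simp]: "L2 S (\<lambda>x. 0)" and emb_zero [simp]: "emb S (\<lambda>x. 0) = 0"
  by (simp_all add: L2_iff_sqi emb_def cls_zero)

lemma L2_add: "L2 S f \<Longrightarrow> L2 S g \<Longrightarrow> L2 S (\<lambda>x. f x + g x)"
  and L2_diff: "L2 S f \<Longrightarrow> L2 S g \<Longrightarrow> L2 S (\<lambda>x. f x - g x)"
  and L2_cmult: "L2 S f \<Longrightarrow> L2 S (\<lambda>x. c * f x)"
  unfolding L2_iff_sqi distrib_left right_diff_distrib mult.left_commute[of _ c]
  by (fact sqi_add sqi_diff sqi_cmult)+

lemma emb_add: "L2 S f \<Longrightarrow> L2 S g \<Longrightarrow> emb S (\<lambda>x. f x + g x) = emb S f + emb S g"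
  and emb_diff: "L2 S f \<Longrightarrow> L2 S g \<Longrightarrow> emb S (\<lambda>x. f x - g x) = emb S f - emb S g"
  and emb_cmult: "L2 S f \<Longrightarrow> emb S (\<lambda>x. c * f x) = c *\<^sub>R emb S f"
  unfolding L2_iff_sqi emb_def distrib_left right_diff_distrib mult.left_commute[of _ c]
  by (fact cls_add cls_diff cls_cmult)+

lemma L2_sum: "(\<And>i. i \<in> I \<Longrightarrow> L2 S (f i)) \<Longrightarrow> L2 S (\<lambda>x. \<Sum>i\<in>I. f i x)"
  by (induction I rule: infinite_finite_induct) (auto intro: L2_add)

lemma emb_sum: "(\<And>i. i \<in> I \<Longrightarrow> L2 S (f i)) \<Longrightarrow> emb S (\<lambda>x. \<Sum>i\<in>I. f i x) = (\<Sum>i\<in>I. emb S (f i))"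
  by (induction I rule: infinite_finite_induct) (auto simp: emb_add L2_sum)

lemma emb_in_supp [intro]: "L2 S f \<Longrightarrow> emb S f \<in> supp_l2 S"
  by (auto simp: supp_l2_def)

lemma supp_l2E: assumes "u \<in> supp_l2 S" obtains f where "L2 S f" "u = emb S f"
  using assms by (auto simp: supp_l2_def)

lemma emb_eq_0_iff: "L2 S f \<Longrightarrow> emb S f = 0 \<longleftrightarrow> (AE x in lborel. x \<in> S \<longrightarrow> f x = 0)"
  unfolding emb_def L2_iff_sqi cls_zero[symmetric]
  by (subst cls_eq_iff) (auto intro!: arg_cong[of _ _ "\<lambda>P. almost_everywhere lborel P"] simp: indicator_def fun_eq_iff)

lemma L2_cls: "S \<in> sets borel \<Longrightarrow> sqi f \<Longrightarrow> L2 S f"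
  unfolding L2_iff_sqi by (rule sqi_bound[of f _ 1]) (auto simp: sqi_def indicator_def)

text \<open>Written as an orthogonal complement, the space is visibly a closed subspace, and
  membership of an adjoint such as \<open>avg\<close> can be checked by inner products.\<close>

lemma supp_l2_orthogonal:
  assumes S: "S \<in> sets borel"
  shows "supp_l2 S = {u. \<forall>c\<in>{cls f | f. sqi f \<and> (\<forall>x\<in>S. f x = 0)}. inner u c = 0}"
proof safe
  fix u f assume "u \<in> supp_l2 S" and f: "sqi f" "\<forall>x\<in>S. f x = 0"
  then obtain g where g: "L2 S g" "u = emb S g" by (auto elim: supp_l2E)
  have eq: "indicator S x * g x * f x = 0" for x using f(2) by (auto simp: indicator_def)
  show "inner u (cls f) = 0"
    unfolding g(2) emb_def inner_cls[OF g(1)[unfolded L2_iff_sqi] f(1)] eq by simp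
next
  fix u assume u: "\<forall>c\<in>{cls f | f. sqi f \<and> (\<forall>x\<in>S. f x = 0)}. inner u c = 0"
  obtain g where g: "sqi g" "u = cls g" using cls_exists by blast
  have gS: "L2 S g" using L2_cls[OF S g(1)] .
  let ?f = "\<lambda>x. g x - indicator S x * g x"
  have f: "sqi ?f" using g(1) gS[unfolded L2_iff_sqi] by (rule sqi_diff)
  have c: "cls ?f = u - emb S g" using g gS by (simp add: cls_diff L2_iff_sqi emb_def)
  have "\<forall>x\<in>S. ?f x = 0" by simp
  then have "inner u (cls ?f) = 0" using u f by blast
  moreover have "inner (emb S g) (cls ?f) = 0"
  proof -
    have eq: "indicator S x * g x * ?f x = 0" for x by (auto simp: indicator_def)
    show ?thesis unfolding emb_def inner_cls[OF gS[unfolded L2_iff_sqi] f] eq by simp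
  qed
  ultimately have "inner (cls ?f) (cls ?f) = 0" by (simp add: c inner_diff_left)
  then have "u = emb S g" by (simp add: c)
  then show "u \<in> supp_l2 S" using gS by auto
qed

lemma subspace_supp: "S \<in> sets borel \<Longrightarrow> subspace (supp_l2 S)"
  unfolding supp_l2_orthogonal by (rule orthogonal_complement_closed_subspace)

lemma closed_supp: "S \<in> sets borel \<Longrightarrow> closed (supp_l2 S)"
  unfolding supp_l2_orthogonal by (rule orthogonal_complement_closed_subspace)

lemma bounded_emeasure_finite: "bounded S \<Longrightarrow> S \<in> sets borel \<Longrightarrow> emeasure lborel (S::'a::euclidean_space set) < \<infinity>"
proof -
  assume "bounded S" "S \<in> sets borel"
  then obtain r where "\<forall>x\<in>S. norm x \<le> r" unfolding bounded_iff by blast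
  then have r: "S \<subseteq> cball 0 r" by auto
  have "emeasure lborel S \<le> emeasure lborel (cball (0::'a) r)" using r by (intro emeasure_mono) auto
  also have "\<dots> < \<infinity>" by (intro emeasure_bounded_finite) auto
  finally show ?thesis .
qed

lemma L2_bounded:
  assumes "bounded S" "S \<in> sets borel" "f \<in> borel_measurable borel" "\<And>x. x \<in> S \<Longrightarrow> \<bar>f x\<bar> \<le> C"
  shows "L2 S f"
  unfolding L2_iff_sqi
proof (rule sqi_bound[of "indicator S" _ C])
  have "(indicator S x :: real)^2 = indicator S x" for x by (auto simp: indicator_def)
  then show "sqi (indicator S :: 'a \<Rightarrow> real)"
    using assms(2) bounded_emeasure_finite[OF assms(1,2)] by (auto simp: sqi_def integrable_indicator_iff)
  show "(\<lambda>x. indicator S x * f x) \<in> borel_measurable borel" using assms(2,3) by measurable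
  show "\<bar>indicator S x * f x\<bar> \<le> C * \<bar>indicator S x\<bar>" for x
    using assms(4)[of x] by (auto simp: indicator_def)
qed

lemma continuous_bounded_on:
  fixes f :: "'a::euclidean_space \<Rightarrow> real"
  assumes "bounded S" "continuous_on UNIV f"
  obtains C where "C \<ge> 0" "\<And>x. x \<in> S \<Longrightarrow> \<bar>f x\<bar> \<le> C"
proof -
  have "compact (closure S)" using assms(1) by (simp add: compact_closure)
  then have "bounded (f ` closure S)"
    using assms(2) by (intro compact_imp_bounded compact_continuous_image) (auto intro: continuous_on_subset)
  then obtain C where "\<forall>x\<in>closure S. \<bar>f x\<bar> \<le> C" unfolding bounded_iff by fastforce
  then have "\<bar>f x\<bar> \<le> max C 0" if "x \<in> S" for x using that closure_subset[of S] by fastforce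
  then show ?thesis using that[of "max C 0"] by auto
qed

lemma L2_smooth:
  assumes "bounded S" "S \<in> sets borel" "smooth f" shows "L2 S f"
proof -
  obtain C where "\<And>x. x \<in> S \<Longrightarrow> \<bar>f x\<bar> \<le> C"
    using continuous_bounded_on[OF assms(1) smooth_continuous[OF assms(3)]] by metis
  then show ?thesis using assms smooth_borel by (intro L2_bounded) auto
qed

lemma L2_mult:
  assumes "L2 S f" "g \<in> borel_measurable borel" "\<And>x. x \<in> S \<Longrightarrow> \<bar>g x\<bar> \<le> C"
  shows "L2 S (\<lambda>x. g x * f x)"
proof -
  let ?F = "\<lambda>x. indicator S x * f x"
  have "(\<lambda>x. indicator S x * (g x * f x)) = (\<lambda>x. g x * ?F x)" by (auto simp: fun_eq_iff)
  moreover have "(\<lambda>x. g x * ?F x) \<in> borel_measurable borel"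
    by (rule borel_measurable_times[OF assms(2) sqi_measurable[OF assms(1)[unfolded L2_iff_sqi]]])
  moreover have "\<bar>g x * ?F x\<bar> \<le> C * \<bar>?F x\<bar>" for x
    using assms(3)[of x] by (cases "x \<in> S") (simp_all add: abs_mult mult_right_mono)
  ultimately show ?thesis unfolding L2_iff_sqi
    using sqi_bound[OF assms(1)[unfolded L2_iff_sqi], of "\<lambda>x. g x * ?F x" C] by metis
qed

lemma L2_mult_smooth:
  assumes "bounded S" "L2 S f" "smooth g" shows "L2 S (\<lambda>x. g x * f x)"
proof -
  obtain C where "\<And>x. x \<in> S \<Longrightarrow> \<bar>g x\<bar> \<le> C"
    using continuous_bounded_on[OF assms(1) smooth_continuous[OF assms(3)]] by metis
  then show ?thesis using assms(2) smooth_borel[OF assms(3)] by (intro L2_mult)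
qed

lemma L2_test:
  assumes "test_fun U \<phi>" and that: "S \<in> sets borel" shows "L2 S \<phi>"
proof -
  obtain K where K: "compact K" "\<And>x. x \<notin> K \<Longrightarrow> \<phi> x = 0" using test_funE[OF assms(1)] by metis
  have "L2 K \<phi>" using K test_fun_smooth[OF assms(1)] by (intro L2_smooth) (auto simp: compact_imp_bounded compact_imp_closed)
  moreover have "(\<lambda>x. indicator K x * \<phi> x) = \<phi>" using K(2) by (auto simp: indicator_def fun_eq_iff)
  ultimately show ?thesis using that by (intro L2_cls) (simp_all add: L2_iff_sqi)
qed

lemma L2_mult_integrable:
  assumes "L2 S f" "L2 S g" shows "integrable lborel (\<lambda>x. indicator S x * (f x * g x))"
proof -
  have eq: "indicator S x * f x * (indicator S x * g x) = indicator S x * (f x * g x)" for x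
    by (auto simp: indicator_def)
  show ?thesis using sqi_mult_integrable[OF assms[unfolded L2_iff_sqi]] unfolding eq .
qed

lemma L2_integrable:
  assumes "bounded S" "S \<in> sets borel" "L2 S f" shows "integrable lborel (\<lambda>x. indicator S x * f x)"
  using L2_mult_integrable[OF assms(3) L2_smooth[OF assms(1,2) smooth_const], of 1] by simp

lemma l2_zero_if_test:
  assumes U: "open U" "bounded U" and u: "u \<in> supp_l2 U"
    and zero: "\<And>\<phi>. test_fun U \<phi> \<Longrightarrow> inner u (emb U \<phi>) = 0"
  shows "u = 0"
proof -
  obtain f where f: "L2 U f" "u = emb U f" using u by (rule supp_l2E)
  have Ub: "U \<in> sets borel" using U by auto
  have "AE x in lborel. x \<in> U \<longrightarrow> f x = 0"
  proof (rule AE_zero_if_test_integrals_zero[OF U(1)])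
    show "set_integrable lborel U f" using L2_integrable[OF U(2) Ub f(1)] by (simp add: set_integrable_def)
    show "(LINT x:U|lborel. f x * \<phi> x) = 0" if "test_fun U \<phi>" for \<phi>
      using zero[OF that] inner_emb[OF f(1) L2_test[OF that Ub]] by (simp add: f(2) ip_def)
  qed
  then show ?thesis using f emb_eq_0_iff by blast
qed

section \<open>Integration by parts along directions of invariance\<close>

lemma integral_translate:
  fixes f :: "'a::euclidean_space \<Rightarrow> real"
  assumes "f \<in> borel_measurable borel"
  shows "(\<integral>x. f (c + x) \<partial>lborel) = (\<integral>x. f x \<partial>lborel)"
proof -
  have "(\<integral>x. f x \<partial>lborel) = (\<integral>x. f x \<partial>distr lborel borel ((+) c))" by (simp add: lborel_distr_plus)
  also have "\<dots> = (\<integral>x. f (c + x) \<partial>lborel)" using assms by (intro integral_distr) auto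
  finally show ?thesis by simp
qed

lemma integrable_translate:
  fixes f :: "'a::euclidean_space \<Rightarrow> real"
  assumes "integrable lborel f" shows "integrable lborel (\<lambda>x. f (c + x))"
proof -
  have "integrable (distr lborel borel ((+) c)) f" using assms by (simp add: lborel_distr_plus)
  then show ?thesis using assms by (subst (asm) integrable_distr_eq) auto
qed

lemma smooth_line_DERIV:
  assumes "smooth m" shows "((\<lambda>s. m (x + s *\<^sub>R u)) has_field_derivative dd u m (x + s *\<^sub>R u)) (at s)"
proof -
  have "((\<lambda>s. m (x + s *\<^sub>R u)) has_derivative (\<lambda>h. dd (h *\<^sub>R u) m (x + s *\<^sub>R u))) (at s)"
    by (rule has_derivative_compose[OF _ smooth_has_derivative[OF assms]]) (auto intro!: derivative_eq_intros)
  moreover have "dd (h *\<^sub>R u) m y = dd u m y * h" for h y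
    using linear_scale[OF dd_linear[OF assms, of y], of h u] by (simp add: mult.commute)
  ultimately show ?thesis by (simp add: has_field_derivative_def)
qed

lemma difference_quotient_bound:
  assumes "smooth m" "\<And>x. \<bar>dd u m x\<bar> \<le> M" "h > 0"
  shows "\<bar>(m (x + h *\<^sub>R u) - m x) / h\<bar> \<le> M"
proof -
  obtain z where "m (x + h *\<^sub>R u) - m (x + 0 *\<^sub>R u) = (h - 0) * dd u m (x + z *\<^sub>R u)"
    using MVT2[of 0 h "\<lambda>s. m (x + s *\<^sub>R u)" "\<lambda>s. dd u m (x + s *\<^sub>R u)"] smooth_line_DERIV[OF assms(1)] assms(3)
    by blast
  then show ?thesis using assms(2)[of "x + z *\<^sub>R u"] assms(3) by simp
qed

text \<open>By translation invariance the difference quotients of m in direction u have integral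
  zero against B, and they converge boundedly inside a fixed ball. With B the indicator of a time
  slab and u a spatial direction this is integration by parts without a boundary.\<close>

lemma integral_dd_zero:
  fixes m :: "'a::euclidean_space \<Rightarrow> real"
  assumes m: "test_fun UNIV m" and B: "B \<in> borel_measurable borel" "\<And>x. \<bar>B x\<bar> \<le> b"
    and inv: "\<And>h x. B (x + h *\<^sub>R u) = B x"
  shows "(\<integral>x. B x * dd u m x \<partial>lborel) = 0"
proof -
  have sm: "smooth m" using m by (rule test_fun_smooth)
  have mb[measurable]: "m \<in> borel_measurable borel" by (rule smooth_borel[OF sm])
  note B(1)[measurable]
  have b0: "b \<ge> 0" using B(2)[of 0] by linarith
  obtain K where K: "compact K" "\<And>x. x \<notin> K \<Longrightarrow> m x = 0" using test_funE[OF m] by metis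
  obtain R where R: "\<And>x. x \<in> K \<Longrightarrow> norm x \<le> R" using compact_imp_bounded[OF K(1)] by (auto simp: bounded_iff)
  obtain M where M: "\<And>x. \<bar>dd u m x\<bar> \<le> M" "M \<ge> 0" using test_fun_bounded[OF test_fun_dd[OF m]] by metis
  define h where "h n = 1 / (real n + 1)" for n
  have h: "h n > 0" "h n \<le> 1" for n by (auto simp: h_def)
  have hl: "h \<longlonglongrightarrow> 0" unfolding h_def[abs_def] using LIMSEQ_inverse_real_of_nat by (simp add: inverse_eq_divide add.commute)
  define D where "D n x = (m (x + h n *\<^sub>R u) - m x) / h n" for n x
  have [measurable]: "(\<lambda>x. m (x + c)) \<in> borel_measurable borel" for c
    using measurable_compose[OF _ mb, of "\<lambda>x. x + c" borel] by simp
  have [measurable]: "D n \<in> borel_measurable borel" for n unfolding D_def[abs_def] by measurable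
  have im: "integrable lborel (\<lambda>x. B x * m x)"
  proof (rule Bochner_Integration.integrable_bound)
    have "L2 K m" using L2_test[OF m, of K] K(1) by (auto simp: compact_imp_closed)
    then have "integrable lborel (\<lambda>x. indicator K x * m x)"
      by (intro L2_integrable) (auto simp: compact_imp_bounded compact_imp_closed K(1))
    moreover have "(\<lambda>x. indicator K x * m x) = m" using K(2) by (auto simp: indicator_def fun_eq_iff)
    ultimately show "integrable lborel (\<lambda>x. b * m x)" by simp
    show "AE x in lborel. norm (B x * m x) \<le> norm (b * m x)"
      using B(2) b0 by (auto simp: abs_mult intro!: mult_right_mono)
  qed measurable
  have "(\<integral>x. B x * D n x \<partial>lborel) = 0" for n
  proof -
    have "B (h n *\<^sub>R u + x) * m (h n *\<^sub>R u + x) = B x * m (x + h n *\<^sub>R u)" for x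
      using inv[of x "h n"] by (simp add: add.commute)
    then have "(\<integral>x. B x * m (x + h n *\<^sub>R u) \<partial>lborel) = (\<integral>x. B x * m x \<partial>lborel)"
      "integrable lborel (\<lambda>x. B x * m (x + h n *\<^sub>R u))"
      using integral_translate[of "\<lambda>x. B x * m x" "h n *\<^sub>R u"] integrable_translate[OF im, of "h n *\<^sub>R u"] by simp_all
    moreover have "B x * D n x = (1 / h n) * (B x * m (x + h n *\<^sub>R u) - B x * m x)" for x
      by (simp add: D_def right_diff_distrib diff_divide_distrib)
    ultimately show ?thesis using im by simp
  qed
  moreover have "(\<lambda>n. \<integral>x. B x * D n x \<partial>lborel) \<longlonglongrightarrow> (\<integral>x. B x * dd u m x \<partial>lborel)"
  \<comment> \<open>Since \<open>h n \<le> 1\<close>, the support of m and all its shifts lie in the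
    ball of radius R + |u|; there the mean value theorem bounds the quotients by M.\<close>
  proof (rule integral_dominated_convergence[where w="\<lambda>x. (b * M) * indicator (cball 0 (R + norm u)) x"])
    show "(\<lambda>x. B x * dd u m x) \<in> borel_measurable lborel"
      using smooth_borel[OF smooth_dd[OF sm], of u] by measurable
    show "integrable lborel (\<lambda>x. b * M * indicator (cball (0::'a) (R + norm u)) x)"
      using bounded_emeasure_finite[of "cball (0::'a) (R + norm u)"]
      by (intro integrable_mult_right) (auto simp: integrable_indicator_iff)
    show "AE x in lborel. (\<lambda>n. B x * D n x) \<longlonglongrightarrow> B x * dd u m x"
    proof (intro AE_I2 tendsto_mult tendsto_const)
      fix x
      have "((\<lambda>s. (m (x + s *\<^sub>R u) - m x) / s) \<longlongrightarrow> dd u m x) (at 0)"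
        using smooth_line_DERIV[OF sm, of x u 0] by (simp add: DERIV_def)
      moreover have "filterlim h (at 0) sequentially"
        using hl h by (intro filterlim_atI) (auto simp: less_le)
      ultimately show "(\<lambda>n. D n x) \<longlonglongrightarrow> dd u m x"
        unfolding D_def using filterlim_compose by blast
    qed
    show "AE x in lborel. norm (B x * D n x) \<le> b * M * indicator (cball 0 (R + norm u)) x" for n
    proof (intro AE_I2)
      fix x
      show "norm (B x * D n x) \<le> b * M * indicator (cball 0 (R + norm u)) x"
      proof (cases "x \<in> cball 0 (R + norm u)")
        case True
        have "\<bar>D n x\<bar> \<le> M" unfolding D_def by (rule difference_quotient_bound[OF sm M(1) h(1)])
        then have "\<bar>B x\<bar> * \<bar>D n x\<bar> \<le> b * M" using B(2)[of x] b0 by (intro mult_mono) auto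
        then show ?thesis using True by (simp add: abs_mult)
      next
        case False
        then have nx: "norm x > R + norm u" by simp
        then have "x \<notin> K" using R[of x] norm_ge_zero[of u] by auto
        moreover have "x + h n *\<^sub>R u \<notin> K"
        proof
          assume "x + h n *\<^sub>R u \<in> K"
          then have "norm (x + h n *\<^sub>R u) \<le> R" by (rule R)
          moreover have "norm (h n *\<^sub>R u) \<le> norm u" using h[of n] by (simp add: mult_left_le_one_le)
          ultimately show False using nx norm_triangle_ineq4[of "x + h n *\<^sub>R u" "h n *\<^sub>R u"] by simp
        qed
        ultimately show ?thesis using False by (simp add: D_def K(2))
      qed
    qed
  qed measurable
  ultimately show ?thesis by (simp add: LIMSEQ_const_iff)
qed

lemma integral_by_parts:
  fixes f :: "'a::euclidean_space \<Rightarrow> real"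
  assumes f: "smooth f" and g: "test_fun UNIV g" and S: "S \<in> sets borel" "\<And>h x. x + h *\<^sub>R u \<in> S \<longleftrightarrow> x \<in> S"
  shows "ip S f (dd u g) = - ip S (dd u f) g"
proof -
  have sg: "smooth g" using g by (rule test_fun_smooth)
  obtain K where K: "compact K" "\<And>x. x \<notin> K \<Longrightarrow> g x = 0" "\<And>x. x \<notin> K \<Longrightarrow> dd u g x = 0"
    using test_funE[OF g] by metis
  have Kb: "bounded K" "K \<in> sets borel" using K(1) by (auto simp: compact_imp_bounded compact_imp_closed)
  have i: "integrable lborel (\<lambda>x. indicator S x * (p x * q x))"
    if "smooth p" "smooth q" "\<And>x. x \<notin> K \<Longrightarrow> q x = 0" for p q
  proof -
    have "integrable lborel (\<lambda>x. indicator K x * (p x * q x))"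
      using that by (intro L2_mult_integrable L2_smooth Kb)
    then have iK: "integrable lborel (\<lambda>x. indicator S x *\<^sub>R (indicator K x * (p x * q x)))"
      using S(1) by (intro integrable_mult_indicator) auto
    have eq: "indicator S x *\<^sub>R (indicator K x * (p x * q x)) = indicator S x * (p x * q x)" for x
      using that(3)[of x] by (auto simp: indicator_def)
    show ?thesis using iK unfolding eq .
  qed
  have "0 = (\<integral>x. indicator S x * dd u (\<lambda>x. f x * g x) x \<partial>lborel)"
    by (rule integral_dd_zero[symmetric, of _ _ 1])
      (use test_fun_mult_left[OF g f] S in \<open>auto simp: indicator_def\<close>)
  also have "\<dots> = (\<integral>x. indicator S x * (f x * dd u g x) + indicator S x * (dd u f x * g x) \<partial>lborel)"
    by (simp add: dd_mult f sg distrib_left)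
  also have "\<dots> = ip S f (dd u g) + ip S (dd u f) g"
    unfolding ip_def set_lebesgue_integral_def real_scaleR_def
    by (intro Bochner_Integration.integral_add i f sg smooth_dd K)
  finally show ?thesis by simp
qed

section \<open>Tensor products and time averages\<close>

definition tensor :: "(real \<Rightarrow> real) \<Rightarrow> ('a \<Rightarrow> real) \<Rightarrow> real \<times> 'a \<Rightarrow> real" where
  "tensor \<eta> f z = \<eta> (fst z) * f (snd z)"

lemma borel_measurable_fst_compose: "f \<in> borel_measurable borel \<Longrightarrow>
    (\<lambda>z::'a::euclidean_space \<times> 'b::euclidean_space. f (fst z)) \<in> borel_measurable borel"
  and borel_measurable_snd_compose: "g \<in> borel_measurable borel \<Longrightarrow>
    (\<lambda>z::'a::euclidean_space \<times> 'b::euclidean_space. g (snd z)) \<in> borel_measurable borel"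
  using measurable_compose[OF borel_measurable_continuous_onI[OF continuous_on_fst[OF continuous_on_id]], of f borel]
    measurable_compose[OF borel_measurable_continuous_onI[OF continuous_on_snd[OF continuous_on_id]], of g borel]
  by (simp_all add: id_def)

lemma tensor_integral:
  fixes b :: "'b::euclidean_space \<Rightarrow> real"
  assumes "integrable lborel a" "integrable lborel b"
  shows "integrable lborel (tensor a b)" and "(\<integral>z. tensor a b z \<partial>lborel) = (\<integral>t. a t \<partial>lborel) * (\<integral>x. b x \<partial>lborel)"
proof -
  have ab: "a \<in> borel_measurable borel" "b \<in> borel_measurable borel"
    using assms by (auto dest: borel_measurable_integrable)
  have i: "integrable (lborel \<Otimes>\<^sub>M lborel) (tensor a b)"
  proof (rule lborel_pair.Fubini_integrable)
    show "tensor a b \<in> borel_measurable (lborel \<Otimes>\<^sub>M lborel)"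
      unfolding lborel_prod tensor_def[abs_def] measurable_lborel2
      by (intro borel_measurable_times borel_measurable_fst_compose borel_measurable_snd_compose ab)
    show "integrable lborel (\<lambda>x. \<integral>y. norm (tensor a b (x, y)) \<partial>lborel)"
      using assms by (simp add: tensor_def abs_mult)
    show "AE x in lborel. integrable lborel (\<lambda>y. tensor a b (x, y))"
      using assms by (simp add: tensor_def)
  qed
  then show "integrable lborel (tensor a b)" by (simp add: lborel_prod)
  have "(\<integral>z. tensor a b z \<partial>(lborel \<Otimes>\<^sub>M lborel)) = (\<integral>x. (\<integral>y. tensor a b (x, y) \<partial>lborel) \<partial>lborel)"
    using lborel_pair.integral_fst'[OF i] by simp
  then show "(\<integral>z. tensor a b z \<partial>lborel) = (\<integral>t. a t \<partial>lborel) * (\<integral>x. b x \<partial>lborel)"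
    by (simp add: lborel_prod tensor_def)
qed

lemma tensor_sqi:
  fixes b :: "'b::euclidean_space \<Rightarrow> real"
  assumes "sqi a" "sqi b" shows "sqi (tensor a b)"
proof -
  have "(\<lambda>z. (tensor a b z)^2) = tensor (\<lambda>t. (a t)^2) (\<lambda>x. (b x)^2)"
    by (simp add: tensor_def power_mult_distrib fun_eq_iff)
  moreover have "tensor a b \<in> borel_measurable borel" unfolding tensor_def[abs_def]
    using assms by (intro borel_measurable_times borel_measurable_fst_compose borel_measurable_snd_compose)
      (auto simp: sqi_def)
  moreover have "integrable lborel (tensor (\<lambda>t. (a t)^2) (\<lambda>x. (b x)^2))"
    using assms by (intro tensor_integral) (auto simp: sqi_def)
  ultimately show ?thesis unfolding sqi_def by simp
qed

lemma indicator_cyl: "indicator (cyl T \<Omega>) z = (indicator {0<..<T} (fst z) * indicator \<Omega> (snd z) :: real)"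
  by (cases z) (auto simp: cyl_def indicator_def)

lemma L2_tensor:
  assumes "L2 {0<..<T} \<eta>" "L2 \<Omega> f" shows "L2 (cyl T \<Omega>) (tensor \<eta> f)"
proof -
  have "(\<lambda>z. indicator (cyl T \<Omega>) z * tensor \<eta> f z) =
      tensor (\<lambda>t. indicator {0<..<T} t * \<eta> t) (\<lambda>x. indicator \<Omega> x * f x)"
    by (auto simp: indicator_cyl tensor_def fun_eq_iff)
  then show ?thesis using tensor_sqi[OF assms[unfolded L2_iff_sqi]] unfolding L2_iff_sqi by simp
qed

lemma ip_tensor:
  assumes "L2 {0<..<T} \<eta>" "L2 \<Omega> f" "L2 {0<..<T} \<xi>" "L2 \<Omega> g"
  shows "ip (cyl T \<Omega>) (tensor \<eta> f) (tensor \<xi> g) = ip {0<..<T} \<eta> \<xi> * ip \<Omega> f g"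
proof -
  have "(\<lambda>z. indicator (cyl T \<Omega>) z * (tensor \<eta> f z * tensor \<xi> g z)) =
      tensor (\<lambda>t. indicator {0<..<T} t * (\<eta> t * \<xi> t)) (\<lambda>x. indicator \<Omega> x * (f x * g x))"
    by (auto simp: indicator_cyl tensor_def fun_eq_iff)
  then show ?thesis
    using tensor_integral(2)[OF L2_mult_integrable[OF assms(1,3)] L2_mult_integrable[OF assms(2,4)]]
    by (simp add: ip_def set_lebesgue_integral_def)
qed

lemma smooth_slice: "smooth \<theta> \<Longrightarrow> smooth (\<lambda>x. \<theta> (t::real, x::real^'d))"
  using smooth_affine[of "\<lambda>x. (0, x)" \<theta> "(t, 0)"] by (simp add: bounded_linear_Pair bounded_linear_zero bounded_linear_ident)

lemma dd_slice: "smooth \<theta> \<Longrightarrow> dd u (\<lambda>x. \<theta> (t::real, x::real^'d)) x = dd (0, u) \<theta> (t, x)"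
  using dd_affine[of "\<lambda>x. (0, x)" \<theta> u "(t, 0)"]
  by (simp add: bounded_linear_Pair bounded_linear_zero bounded_linear_ident fun_eq_iff)

lemma test_fun_slice:
  assumes "test_fun (S \<times> \<Omega>) \<theta>" shows "test_fun \<Omega> (\<lambda>x. \<theta> (t::real, x::real^'d))"
proof -
  obtain K where K: "compact K" "K \<subseteq> S \<times> \<Omega>" "\<And>z. z \<notin> K \<Longrightarrow> \<theta> z = 0" using test_funE[OF assms] by metis
  show ?thesis
  proof (rule test_funI[of _ "snd ` K"])
    show "compact (snd ` K)" using K(1) by (intro compact_continuous_image continuous_intros)
    show "\<theta> (t, x) = 0" if "x \<notin> snd ` K" for x using K(3)[of "(t, x)"] that by force
  qed (use K smooth_slice test_fun_smooth[OF assms] in auto)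
qed

lemma smooth_fst_compose: "smooth \<eta> \<Longrightarrow> smooth (\<lambda>z::real \<times> (real^'d). \<eta> (fst z))"
  using smooth_affine[of fst \<eta> 0] by (simp add: bounded_linear_fst)

lemma smooth_snd_compose: "smooth f \<Longrightarrow> smooth (\<lambda>z::real \<times> (real^'d). f (snd z))"
  using smooth_affine[of snd f 0] by (simp add: bounded_linear_snd)

lemma smooth_tensor: "smooth \<eta> \<Longrightarrow> smooth f \<Longrightarrow> smooth (tensor \<eta> (f::real^'d \<Rightarrow> real))"
  unfolding tensor_def[abs_def] by (intro smooth_mult smooth_fst_compose smooth_snd_compose)

lemma dd_fst_compose: "smooth \<eta> \<Longrightarrow> dd u (\<lambda>z::real \<times> (real^'d). \<eta> (fst z)) = (\<lambda>z. dd (fst u) \<eta> (fst z))"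
  using dd_affine[of fst \<eta> u 0] by (simp only: bounded_linear_fst add_0_right)

lemma dd_snd_compose: "smooth f \<Longrightarrow> dd u (\<lambda>z::real \<times> (real^'d). f (snd z)) = (\<lambda>z. dd (snd u) f (snd z))"
  using dd_affine[of snd f u 0] by (simp only: bounded_linear_snd add_0_right)

lemma dt_tensor: "smooth \<eta> \<Longrightarrow> smooth f \<Longrightarrow> dt (tensor \<eta> (f::real^'d \<Rightarrow> real)) = tensor (dd 1 \<eta>) f"
  and dx_tensor: "smooth \<eta> \<Longrightarrow> smooth f \<Longrightarrow> dx i (tensor \<eta> f) = tensor \<eta> (dd (axis i 1) f)"
  by (simp_all add: dt_eq_dd dx_eq_dd tensor_def[abs_def] dd_mult[OF smooth_fst_compose smooth_snd_compose]
      dd_fst_compose dd_snd_compose dd_zero)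

lemma test_fun_tensor:
  assumes "test_fun S \<eta>" "test_fun \<Omega> (f::real^'d \<Rightarrow> real)" shows "test_fun (S \<times> \<Omega>) (tensor \<eta> f)"
proof -
  obtain K where K: "compact K" "K \<subseteq> S" "\<And>z. z \<notin> K \<Longrightarrow> \<eta> z = 0" using test_funE[OF assms(1)] by metis
  obtain L where L: "compact L" "L \<subseteq> \<Omega>" "\<And>z. z \<notin> L \<Longrightarrow> f z = 0" using test_funE[OF assms(2)] by metis
  show ?thesis
  proof (rule test_funI[of _ "K \<times> L"])
    show "tensor \<eta> f z = 0" if "z \<notin> K \<times> L" for z using that K L by (cases z) (auto simp: tensor_def)
  qed (use K L assms in \<open>auto intro!: smooth_tensor compact_Times dest: test_fun_smooth\<close>)
qed

section \<open>Integration over the space-time cylinder\<close>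

locale cylinder =
  fixes \<Omega> :: "(real^'d) set" and T :: real
  assumes op: "open \<Omega>" and bd: "bounded \<Omega>" and T: "T > 0"
begin

lemma cyl_open: "open (cyl T \<Omega>)" and cyl_bounded: "bounded (cyl T \<Omega>)" and cyl_borel: "cyl T \<Omega> \<in> sets borel"
  and dom_borel: "\<Omega> \<in> sets borel"
  using op bd by (auto simp: cyl_def open_Times bounded_Times intro!: borel_open)

lemma L2_cyl_smooth: "smooth f \<Longrightarrow> L2 (cyl T \<Omega>) f"
  and L2_dom_smooth: "smooth g \<Longrightarrow> L2 \<Omega> g"
  and L2_time_smooth: "smooth \<eta> \<Longrightarrow> L2 {0<..<T} \<eta>"
  using cyl_bounded cyl_borel bd dom_borel by (auto intro: L2_smooth)

lemma ip_cyl_fst: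
  assumes "L2 (cyl T \<Omega>) a" "L2 (cyl T \<Omega>) b"
  shows "ip (cyl T \<Omega>) a b = (\<integral>t. indicator {0<..<T} t * ip \<Omega> (\<lambda>x. a (t, x)) (\<lambda>x. b (t, x)) \<partial>lborel)"
proof -
  have i: "integrable (lborel \<Otimes>\<^sub>M lborel) (\<lambda>z. indicator (cyl T \<Omega>) z * (a z * b z))"
    using L2_mult_integrable[OF assms] by (simp add: lborel_prod)
  have "ip (cyl T \<Omega>) a b = (\<integral>z. indicator (cyl T \<Omega>) z * (a z * b z) \<partial>(lborel \<Otimes>\<^sub>M lborel))"
    by (simp add: ip_def set_lebesgue_integral_def lborel_prod)
  also have "\<dots> = (\<integral>t. (\<integral>x. indicator (cyl T \<Omega>) (t, x) * (a (t, x) * b (t, x)) \<partial>lborel) \<partial>lborel)"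
    using lborel_pair.integral_fst'[OF i] by simp
  finally show ?thesis
    by (simp add: indicator_cyl mult.assoc ip_def set_lebesgue_integral_def)
qed

lemma ip_cyl_snd:
  assumes "L2 (cyl T \<Omega>) a" "L2 (cyl T \<Omega>) b"
  shows "ip (cyl T \<Omega>) a b = (\<integral>x. indicator \<Omega> x * ip {0<..<T} (\<lambda>t. a (t, x)) (\<lambda>t. b (t, x)) \<partial>lborel)"
proof -
  let ?F = "\<lambda>t x. indicator (cyl T \<Omega>) (t, x) * (a (t, x) * b (t, x))"
  have eq: "case_prod ?F = (\<lambda>z. indicator (cyl T \<Omega>) z * (a z * b z))" by auto
  have i: "integrable (lborel \<Otimes>\<^sub>M lborel) (case_prod ?F)"
    unfolding eq using L2_mult_integrable[OF assms] by (simp add: lborel_prod)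
  have "ip (cyl T \<Omega>) a b = (\<integral>z. case_prod ?F z \<partial>(lborel \<Otimes>\<^sub>M lborel))"
    unfolding eq by (simp add: ip_def set_lebesgue_integral_def lborel_prod)
  also have "\<dots> = (\<integral>x. (\<integral>t. ?F t x \<partial>lborel) \<partial>lborel)"
    using lborel_pair.integral_snd[OF i] by (rule sym)
  finally show ?thesis
    by (simp add: indicator_cyl mult.assoc mult.left_commute[of "indicator {0<..<T} _"] ip_def set_lebesgue_integral_def)
qed

text \<open>Fubini and the fundamental theorem of calculus on each vertical segment. Only m is
  differentiated, so f may be any square-integrable function; this is what products of a weight in
  time with an element of H10 require.\<close>

lemma time_integration:
  assumes f: "L2 \<Omega> f" and m: "smooth m" and mT: "\<And>x. x \<in> \<Omega> \<Longrightarrow> m (T, x) = 0"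
  shows "ip (cyl T \<Omega>) (tensor (\<lambda>t. 1) f) (dt m) = - ip \<Omega> f (\<lambda>x. m (0, x))"
proof -
  have L: "L2 (cyl T \<Omega>) (tensor (\<lambda>t. 1) f)" "L2 (cyl T \<Omega>) (dt m)"
    using L2_tensor[OF L2_time_smooth[OF smooth_const] f] L2_cyl_smooth[OF smooth_dt[OF m]] by blast+
  have ftc: "(\<integral>t. indicator {0<..<T} t * dt m (t, x) \<partial>lborel) = m (T, x) - m (0, x)" for x
  proof -
    have "(\<integral>t. dt m (t, x) * indicator {0..T} t \<partial>lborel) = m (T, x) - m (0, x)"
    proof (rule integral_FTC_Icc_real)
      show "DERIV (\<lambda>t. m (t, x)) t :> dt m (t, x)" for t
        using smooth_line_DERIV[OF m, of "(0, x)" "(1, 0)" t] by (simp add: dt_eq_dd)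
      have "isCont (dt m) (t, x)" for t using m by (intro smooth_isCont) auto
      then show "isCont (\<lambda>t. dt m (t, x)) t" for t
        by (intro isCont_o2[of t "\<lambda>t. (t, x)" "dt m"] continuous_intros)
    qed (use T in simp)
    moreover have "(\<integral>t. dt m (t, x) * indicator {0..T} t \<partial>lborel) = (\<integral>t. indicator {0<..<T} t * dt m (t, x) \<partial>lborel)"
    proof (rule integral_cong_AE)
      have "(\<lambda>t. dt m (t, x)) \<in> borel_measurable borel"
        by (intro borel_measurable_continuous_onI continuous_on_compose2[OF smooth_continuous[of "dt m" UNIV]])
          (use m in \<open>auto intro!: continuous_intros\<close>)
      then show "(\<lambda>t. dt m (t, x) * indicator {0..T} t) \<in> borel_measurable lborel"
        "(\<lambda>t. indicator {0<..<T} t * dt m (t, x)) \<in> borel_measurable lborel" by simp_all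
      show "AE t in lborel. dt m (t, x) * indicator {0..T} t = indicator {0<..<T} t * dt m (t, x)"
        using AE_lborel_singleton[of 0] AE_lborel_singleton[of T] by eventually_elim (auto simp: indicator_def)
    qed
    ultimately show ?thesis by simp
  qed
  have "ip (cyl T \<Omega>) (tensor (\<lambda>t. 1) f) (dt m) = (\<integral>x. indicator \<Omega> x * (f x * (m (T, x) - m (0, x))) \<partial>lborel)"
    unfolding ip_cyl_snd[OF L]
    by (simp add: tensor_def ip_def set_lebesgue_integral_def mult.left_commute[of "indicator {0<..<T} _"] ftc)
  also have "\<dots> = (\<integral>x. - (indicator \<Omega> x * (f x * m (0, x))) \<partial>lborel)"
    using mT by (intro Bochner_Integration.integral_cong) (auto simp: indicator_def)
  finally show ?thesis by (simp add: ip_def set_lebesgue_integral_def)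
qed

text \<open>An identity in space that holds on every time slice is integrated against the weight
  \<eta>.\<close>

lemma ip_tensor_test_cong:
  assumes L: "L2 (cyl T \<Omega>) (tensor \<eta> f)" "L2 (cyl T \<Omega>) (tensor \<eta> g)" "L2 (cyl T \<Omega>) \<theta>" "L2 (cyl T \<Omega>) \<zeta>"
    and eq: "\<And>t. ip \<Omega> f (\<lambda>x. \<theta> (t, x)) = ip \<Omega> g (\<lambda>x. \<zeta> (t, x))"
  shows "ip (cyl T \<Omega>) (tensor \<eta> f) \<theta> = ip (cyl T \<Omega>) (tensor \<eta> g) \<zeta>"
proof -
  have c: "ip \<Omega> (\<lambda>x. tensor \<eta> f (t, x)) h = \<eta> t * ip \<Omega> f h" for f t h
    by (simp add: tensor_def ip_def set_lebesgue_integral_def mult.assoc mult.left_commute[of "indicator \<Omega> _"])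
  show ?thesis unfolding ip_cyl_fst[OF L(1,3)] ip_cyl_fst[OF L(2,4)] c eq ..
qed

text \<open>The tensor product acts on functions, so a representative is chosen;
  \<open>tens_cls\<close> shows that for smooth weights the class does not depend on it.\<close>

definition tens :: "(real \<Rightarrow> real) \<Rightarrow> (real^'d) l2 \<Rightarrow> (real \<times> (real^'d)) l2" where
  "tens \<eta> u = emb (cyl T \<Omega>) (tensor \<eta> (SOME f. sqi f \<and> u = cls f))"

lemma norm_emb_tensor:
  "smooth \<eta> \<Longrightarrow> L2 \<Omega> f \<Longrightarrow> (norm (emb (cyl T \<Omega>) (tensor \<eta> f)))^2 = ip {0<..<T} \<eta> \<eta> * ip \<Omega> f f"
  by (simp add: norm_emb L2_tensor L2_time_smooth ip_tensor)

lemma tensor_diff: "tensor \<eta> (\<lambda>x. f x - g x) = (\<lambda>z. tensor \<eta> f z - tensor \<eta> g z)"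
  and tensor_add: "tensor \<eta> (\<lambda>x. f x + g x) = (\<lambda>z. tensor \<eta> f z + tensor \<eta> g z)"
  and tensor_cmult: "tensor \<eta> (\<lambda>x. c * f x) = (\<lambda>z. c * tensor \<eta> f z)"
  by (auto simp: tensor_def fun_eq_iff algebra_simps)

text \<open>Two representatives differ by a function of norm zero, and the norm of a tensor product
  factors.\<close>

lemma tens_cls:
  assumes \<eta>: "smooth \<eta>" and f: "sqi f" shows "tens \<eta> (cls f) = emb (cyl T \<Omega>) (tensor \<eta> f)"
proof -
  define g where "g = (SOME g. sqi g \<and> cls f = cls g)"
  have g: "sqi g" "cls f = cls g" using someI_ex[of "\<lambda>g. sqi g \<and> cls f = cls g"] f by (auto simp: g_def)
  have fg: "L2 \<Omega> f" "L2 \<Omega> g" using L2_cls dom_borel f g by auto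
  have d: "L2 \<Omega> (\<lambda>x. g x - f x)" using fg by (intro L2_diff)
  have "AE x in lborel. f x = g x" using g f cls_eq_iff by blast
  then have "emb \<Omega> (\<lambda>x. g x - f x) = 0" unfolding emb_eq_0_iff[OF d] by eventually_elim simp
  then have "ip \<Omega> (\<lambda>x. g x - f x) (\<lambda>x. g x - f x) = 0" using norm_emb[OF d] by simp
  then have "(norm (emb (cyl T \<Omega>) (tensor \<eta> (\<lambda>x. g x - f x))))^2 = 0"
    using norm_emb_tensor[OF \<eta> d] by simp
  then have "emb (cyl T \<Omega>) (tensor \<eta> g) - emb (cyl T \<Omega>) (tensor \<eta> f) = 0"
    using fg \<eta> by (simp add: tensor_diff emb_diff L2_tensor L2_time_smooth)
  then show ?thesis by (simp add: tens_def g_def)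
qed

lemma tens_emb:
  assumes \<eta>: "smooth \<eta>" and f: "L2 \<Omega> f" shows "tens \<eta> (emb \<Omega> f) = emb (cyl T \<Omega>) (tensor \<eta> f)"
  unfolding emb_def[of \<Omega>] tens_cls[OF \<eta> f[unfolded L2_iff_sqi]]
  by (rule emb_cong) (auto simp: cyl_def tensor_def)

lemma
  assumes \<eta>: "smooth \<eta>" shows bounded_linear_tens: "bounded_linear (tens \<eta>)"
    and norm_tens: "norm (tens \<eta> u) \<le> sqrt (ip {0<..<T} \<eta> \<eta>) * norm u"
proof -
  have nt: "norm (tens \<eta> u) \<le> sqrt (ip {0<..<T} \<eta> \<eta>) * norm u" for u
  proof -
    obtain f where f: "sqi f" "u = cls f" using cls_exists by blast
    have fL: "L2 \<Omega> f" using L2_cls dom_borel f by auto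
    have p: "ip {0<..<T} \<eta> \<eta> \<ge> 0" by (simp add: norm_emb[OF L2_time_smooth[OF \<eta>], symmetric])
    have "ip \<Omega> f f \<le> (\<integral>x. f x * f x \<partial>lborel)"
      unfolding ip_def set_lebesgue_integral_def
      using L2_mult_integrable[OF fL fL] sqi_mult_integrable[OF f(1) f(1)]
      by (intro integral_mono) (auto simp: indicator_def)
    then have "ip \<Omega> f f \<le> (norm u)^2" by (simp add: f(2) power2_norm_eq_inner inner_cls[OF f(1) f(1)])
    then have "(norm (tens \<eta> u))^2 \<le> ip {0<..<T} \<eta> \<eta> * (norm u)^2"
      using p by (simp add: f(2) tens_cls[OF \<eta> f(1)] norm_emb_tensor[OF \<eta> fL] mult_left_mono)
    also have "\<dots> = (sqrt (ip {0<..<T} \<eta> \<eta>) * norm u)^2" using p by (simp add: power_mult_distrib)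
    finally show ?thesis by (rule power2_le_imp_le) (use p in simp)
  qed
  then show "norm (tens \<eta> u) \<le> sqrt (ip {0<..<T} \<eta> \<eta>) * norm u" .
  show "bounded_linear (tens \<eta>)"
  proof (rule bounded_linear_intro)
    fix u v :: "(real^'d) l2" and r
    obtain f where f: "sqi f" "u = cls f" using cls_exists by blast
    obtain g where g: "sqi g" "v = cls g" using cls_exists by blast
    have L: "L2 \<Omega> f" "L2 \<Omega> g" using L2_cls dom_borel f g by auto
    show "tens \<eta> (u + v) = tens \<eta> u + tens \<eta> v"
      using f g L \<eta> by (simp add: cls_add[symmetric] tens_cls sqi_add tensor_add emb_add L2_tensor L2_time_smooth)
    show "tens \<eta> (r *\<^sub>R u) = r *\<^sub>R tens \<eta> u"
      using f L \<eta> by (simp add: cls_cmult[symmetric] tens_cls sqi_cmult tensor_cmult emb_cmult L2_tensor L2_time_smooth)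
    show "norm (tens \<eta> u) \<le> norm u * sqrt (ip {0<..<T} \<eta> \<eta>)" using nt[of u] by (simp add: mult.commute)
  qed
qed

lemma tens_linear_time:
  assumes \<eta>: "smooth \<eta>" "smooth \<xi>"
  shows "tens (\<lambda>t. a * \<eta> t + b * \<xi> t) u = a *\<^sub>R tens \<eta> u + b *\<^sub>R tens \<xi> u"
proof -
  obtain f where f: "sqi f" "u = cls f" using cls_exists by blast
  have L: "L2 \<Omega> f" using L2_cls dom_borel f by auto
  have s: "smooth (\<lambda>t. a * \<eta> t + b * \<xi> t)" by (intro smooth_add smooth_mult smooth_const \<eta>)
  have "tensor (\<lambda>t. a * \<eta> t + b * \<xi> t) f = (\<lambda>z. a * tensor \<eta> f z + b * tensor \<xi> f z)"
    by (auto simp: tensor_def fun_eq_iff algebra_simps)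
  then show ?thesis
    using L \<eta> by (simp add: f tens_cls[OF s] tens_cls emb_add emb_cmult L2_cmult L2_tensor L2_time_smooth)
qed

text \<open>The adjoint of \<^term>\<open>tens \<eta>\<close> is the average over time with weight \<^term>\<open>\<eta>\<close>.\<close>

definition avg :: "(real \<Rightarrow> real) \<Rightarrow> (real \<times> (real^'d)) l2 \<Rightarrow> (real^'d) l2" where
  "avg \<eta> = (SOME B. \<forall>u v. inner (B u) v = inner u (tens \<eta> v))"

lemma avg_inner: "smooth \<eta> \<Longrightarrow> inner (avg \<eta> F) v = inner F (tens \<eta> v)"
  unfolding avg_def using someI_ex[OF adjoint_exists[OF bounded_linear_tens]] by blast

lemma l2_eqI: "(\<And>v. inner u v = inner w v) \<Longrightarrow> u = (w :: 'h::real_inner)"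
proof -
  assume *: "\<And>v. inner u v = inner w v"
  have "inner (u - w) (u - w) = 0" using *[of "u - w"] by (simp add: inner_diff_left)
  then show "u = w" by simp
qed

lemma avg_diff: "smooth \<eta> \<Longrightarrow> avg \<eta> (F - G) = avg \<eta> F - avg \<eta> G"
  by (rule l2_eqI) (simp add: avg_inner inner_diff_left)

lemma avg_linear_time:
  "smooth \<eta> \<Longrightarrow> smooth \<xi> \<Longrightarrow> avg (\<lambda>t. a * \<eta> t + b * \<xi> t) F = a *\<^sub>R avg \<eta> F + b *\<^sub>R avg \<xi> F"
  by (rule l2_eqI) (simp add: avg_inner inner_add_left inner_add_right tens_linear_time smooth_add smooth_mult)

lemma avg_emb: "smooth \<eta> \<Longrightarrow> L2 (cyl T \<Omega>) F \<Longrightarrow> L2 \<Omega> g \<Longrightarrow>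
    inner (avg \<eta> (emb (cyl T \<Omega>) F)) (emb \<Omega> g) = ip (cyl T \<Omega>) F (tensor \<eta> g)"
  by (simp add: avg_inner tens_emb inner_emb L2_tensor L2_time_smooth)

lemma avg_supp: assumes "smooth \<eta>" shows "avg \<eta> F \<in> supp_l2 \<Omega>"
  unfolding supp_l2_orthogonal[OF dom_borel]
proof safe
  fix f assume f: "sqi f" "\<forall>x\<in>\<Omega>. f x = 0"
  have "emb (cyl T \<Omega>) (tensor \<eta> f) = emb (cyl T \<Omega>) (\<lambda>z. 0)"
    by (rule emb_cong) (use f in \<open>auto simp: cyl_def tensor_def\<close>)
  then show "inner (avg \<eta> F) (cls f) = 0" using f by (simp add: avg_inner assms tens_cls)
qed

lemma norm_avg: assumes "smooth \<eta>" shows "norm (avg \<eta> F) \<le> sqrt (ip {0<..<T} \<eta> \<eta>) * norm F"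
proof (cases "avg \<eta> F = 0")
  case True
  have "ip {0<..<T} \<eta> \<eta> \<ge> 0" by (simp add: norm_emb[OF L2_time_smooth[OF assms], symmetric])
  then show ?thesis using True by simp
next
  case False
  have "norm (avg \<eta> F) * norm (avg \<eta> F) = inner F (tens \<eta> (avg \<eta> F))"
    by (simp add: avg_inner[OF assms, symmetric] power2_norm_eq_inner[symmetric] power2_eq_square)
  also have "\<dots> \<le> norm F * norm (tens \<eta> (avg \<eta> F))" by (rule norm_cauchy_schwarz)
  also have "\<dots> \<le> norm F * (sqrt (ip {0<..<T} \<eta> \<eta>) * norm (avg \<eta> F))"
    by (intro mult_left_mono norm_tens assms) simp
  finally show ?thesis using False by (simp add: mult_ac)
qed

lemma ip_time_bound:
  assumes \<eta>: "smooth \<eta>" and c: "\<And>t. t \<in> {0<..<T} \<Longrightarrow> \<bar>\<eta> t\<bar> \<le> c"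
  shows "ip {0<..<T} \<eta> \<eta> \<le> c^2 * T"
proof -
  have "ip {0<..<T} \<eta> \<eta> \<le> (\<integral>t. c^2 * indicator {0<..<T} t \<partial>lborel)"
    unfolding ip_def set_lebesgue_integral_def real_scaleR_def
  proof (rule integral_mono)
    show "integrable lborel (\<lambda>t. indicator {0<..<T} t * (\<eta> t * \<eta> t))"
      by (intro L2_mult_integrable L2_time_smooth \<eta>)
    show "integrable lborel (\<lambda>t. c^2 * indicator {0<..<T} t)"
      using bounded_emeasure_finite[of "{0<..<T}"] by (intro integrable_mult_right) (simp add: integrable_indicator_iff)
    show "indicator {0<..<T} t * (\<eta> t * \<eta> t) \<le> c^2 * indicator {0<..<T} t" for t
      using power_mono[OF c[of t], of 2] by (auto simp: indicator_def power2_eq_square)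
  qed
  also have "\<dots> = c^2 * T" using T by simp
  finally show ?thesis .
qed

text \<open>The bound on \<open>avg\<close> sees only the values of the weight inside the time
  interval. This provides the end condition of the energy estimate.\<close>

lemma avg_zero: assumes "smooth \<eta>" "\<And>t. t \<in> {0<..<T} \<Longrightarrow> \<eta> t = 0" shows "avg \<eta> F = 0"
proof -
  have "ip {0<..<T} \<eta> \<eta> \<le> 0^2 * T" by (rule ip_time_bound) (use assms in auto)
  moreover have "ip {0<..<T} \<eta> \<eta> \<ge> 0" by (simp add: norm_emb[OF L2_time_smooth[OF assms(1)], symmetric])
  ultimately have "ip {0<..<T} \<eta> \<eta> = 0" by simp
  then show ?thesis using norm_avg[OF assms(1), of F] by simp
qed

text \<open>By Lindelof every open set is a countable union of the open rectangles it
  contains.\<close>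

lemma sigma_sets_open_rectangles:
  "sets borel = sigma_sets UNIV {A \<times> B | A B. open (A :: real set) \<and> open (B :: (real^'d) set)}"
  (is "_ = sigma_sets UNIV ?G")
proof
  have "W \<in> sigma_sets UNIV ?G" if "open W" for W
  proof -
    let ?F = "{S \<in> ?G. S \<subseteq> W}"
    obtain F' where F': "F' \<subseteq> ?F" "countable F'" "\<Union>F' = \<Union>?F"
      by (rule Lindelof[of ?F]) (auto intro: open_Times)
    have "W \<subseteq> \<Union>?F"
    proof
      fix z assume "z \<in> W"
      then obtain A B where "open A" "open B" "z \<in> A \<times> B" "A \<times> B \<subseteq> W" using \<open>open W\<close> open_prod_elim by metis
      then show "z \<in> \<Union>?F" by blast
    qed
    moreover have "\<Union>?F \<subseteq> W" by blast
    ultimately have "W = \<Union>F'" unfolding F'(3) by (rule equalityI)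
    moreover have "F' \<subseteq> sigma_sets UNIV ?G" using F'(1) by (auto intro: sigma_sets.Basic)
    then have "\<Union>F' \<in> sigma_sets UNIV ?G"
      using F'(2) by (intro sigma_algebra.countable_Union[OF sigma_algebra_sigma_sets]) auto
    ultimately show ?thesis by simp
  qed
  then show "sets borel \<subseteq> sigma_sets UNIV ?G"
  proof -
    have "{W. open W} \<subseteq> sigma_sets UNIV ?G" using \<open>\<And>W. open W \<Longrightarrow> W \<in> sigma_sets UNIV ?G\<close> by blast
    then have "sigma_sets UNIV {W. open W} \<subseteq> sigma_sets UNIV ?G" by (rule sigma_sets_mono)
    then show ?thesis by (simp add: borel_def)
  qed
  show "sigma_sets UNIV ?G \<subseteq> sets borel"
    by (rule sets.sigma_sets_subset[of _ borel, simplified]) (auto intro!: borel_open open_Times)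
qed

text \<open>An average paired with the indicator of B is an integral against a product of a weight
  and that indicator. Letting the weights tend to the indicator of A gives integral zero over each
  open rectangle A x B, and these generate the Borel sets.\<close>

lemma l2_zero_if_avg_zero:
  assumes F: "F \<in> supp_l2 (cyl T \<Omega>)" and zero: "\<And>\<eta>. test_fun {0<..<T} \<eta> \<Longrightarrow> avg \<eta> F = 0"
  shows "F = 0"
proof -
  obtain f where f: "L2 (cyl T \<Omega>) f" "F = emb (cyl T \<Omega>) f" using F by (rule supp_l2E)
  let ?f = "\<lambda>z. indicator (cyl T \<Omega>) z * f z"
  have fi: "integrable lborel ?f" using L2_integrable[OF cyl_bounded cyl_borel f(1)] .
  have "AE z in lborel. ?f z = 0"
  proof (rule AE_zero_if_generator_integrals_zero[OF fi _ sigma_sets_open_rectangles])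
    show "Int_stable {A \<times> B | A B. open (A :: real set) \<and> open (B :: (real^'d) set)}"
      unfolding Int_stable_def by (auto simp: Times_Int_Times) (metis open_Int)
    show "UNIV \<in> {A \<times> B | A B. open (A :: real set) \<and> open (B :: (real^'d) set)}"
      by (auto intro!: exI[of _ UNIV])
    fix W assume "W \<in> {A \<times> B | A B. open (A :: real set) \<and> open (B :: (real^'d) set)}"
    then obtain A B where W: "W = A \<times> B" "open A" "open B" by auto
    obtain \<eta> where \<eta>: "\<And>n. test_fun ({0<..<T} \<inter> A) (\<eta> n)" "\<And>n t. 0 \<le> \<eta> n t" "\<And>n t. \<eta> n t \<le> 1"
      "\<And>t. (\<lambda>n. \<eta> n t) \<longlonglongrightarrow> indicator ({0<..<T} \<inter> A) t"
      using open_indicator_approx[of "{0<..<T} \<inter> A"] W by (metis open_Int open_greaterThanLessThan)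
    have sm: "smooth (\<eta> n)" for n using \<eta>(1) test_fun_smooth by blast
    let ?b = "indicator B :: real^'d \<Rightarrow> real"
    have bL: "L2 \<Omega> ?b" by (rule L2_bounded[OF bd dom_borel, of _ 1]) (use W in \<open>auto simp: indicator_def\<close>)
    have "(\<lambda>n. \<integral>z. ?f z * tensor (\<eta> n) ?b z \<partial>lborel) \<longlonglongrightarrow> (\<integral>z. ?f z * tensor (indicator ({0<..<T} \<inter> A)) ?b z \<partial>lborel)"
    proof (rule integral_dominated_convergence[where w="\<lambda>z. \<bar>?f z\<bar>"])
      have fb: "?f \<in> borel_measurable borel" using fi by (auto dest: borel_measurable_integrable)
      have tb: "tensor \<xi> ?b \<in> borel_measurable borel" if "\<xi> \<in> borel_measurable borel" for \<xi>
        unfolding tensor_def[abs_def] using that W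
        by (intro borel_measurable_times borel_measurable_fst_compose borel_measurable_snd_compose) auto
      show "(\<lambda>z. ?f z * tensor (indicator ({0<..<T} \<inter> A)) ?b z) \<in> borel_measurable lborel"
        unfolding measurable_lborel2 using W(2)
        by (intro borel_measurable_times[OF fb tb] borel_measurable_indicator borel_open open_Int open_greaterThanLessThan)
      show "(\<lambda>z. ?f z * tensor (\<eta> n) ?b z) \<in> borel_measurable lborel" for n
        unfolding measurable_lborel2 by (rule borel_measurable_times[OF fb tb[OF smooth_borel[OF sm]]])
      show "integrable lborel (\<lambda>z. \<bar>?f z\<bar>)" by (rule integrable_abs[OF fi])
      show "AE z in lborel. (\<lambda>n. ?f z * tensor (\<eta> n) ?b z) \<longlonglongrightarrow> ?f z * tensor (indicator ({0<..<T} \<inter> A)) ?b z"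
        unfolding tensor_def by (intro AE_I2 tendsto_intros \<eta>(4))
      have "\<bar>tensor (\<eta> n) ?b z\<bar> \<le> 1" for n z using \<eta>(2,3)[of n "fst z"] by (auto simp: tensor_def indicator_def)
      then show "AE z in lborel. norm (?f z * tensor (\<eta> n) ?b z) \<le> \<bar>?f z\<bar>" for n
        by (intro AE_I2) (auto simp: abs_mult mult_left_le)
    qed
    moreover have "(\<integral>z. ?f z * tensor (\<eta> n) ?b z \<partial>lborel) = 0" for n
    proof -
      have "avg (\<eta> n) F = 0" by (rule zero) (use test_fun_mono[OF \<eta>(1)] in auto)
      then have "ip (cyl T \<Omega>) f (tensor (\<eta> n) ?b) = 0" using avg_emb[OF sm f(1) bL, of n] by (simp add: f(2))
      then show ?thesis by (simp add: ip_def set_lebesgue_integral_def mult.assoc)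
    qed
    ultimately have "(\<integral>z. ?f z * tensor (indicator ({0<..<T} \<inter> A)) ?b z \<partial>lborel) = 0"
      by (simp add: LIMSEQ_const_iff)
    moreover have "?f z * tensor (indicator ({0<..<T} \<inter> A)) ?b z = indicator W z * ?f z" for z
      by (cases z) (auto simp: cyl_def tensor_def indicator_def W)
    ultimately show "(LINT z:W|lborel. ?f z) = 0" by (simp add: set_lebesgue_integral_def)
  qed
  then have "AE z in lborel. z \<in> cyl T \<Omega> \<longrightarrow> f z = 0" by eventually_elim (auto simp: indicator_def split: if_splits)
  then show ?thesis using f emb_eq_0_iff by blast
qed

end

section \<open>Convolution and Green's formula on Lipschitz domains\<close>

lemma dd_expand:
  fixes f :: "'a::euclidean_space \<Rightarrow> real"
  assumes "smooth f" shows "dd h f y = (\<Sum>b\<in>Basis. (h \<bullet> b) * dd b f y)"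
proof -
  have "dd h f y = dd (\<Sum>b\<in>Basis. (h \<bullet> b) *\<^sub>R b) f y" by (simp add: euclidean_representation)
  also have "\<dots> = (\<Sum>b\<in>Basis. dd ((h \<bullet> b) *\<^sub>R b) f y)" by (rule linear_sum[OF dd_linear[OF assms]])
  also have "\<dots> = (\<Sum>b\<in>Basis. (h \<bullet> b) * dd b f y)"
    by (intro sum.cong refl) (use linear_scale[OF dd_linear[OF assms, of y]] in simp)
  finally show ?thesis .
qed

lemma smooth_mvt:
  assumes "smooth f" obtains s where "0 < s" "s < 1" "f (x + h) - f x = dd h f (x + s *\<^sub>R h)"
proof -
  obtain z where "0 < z" "z < 1" "f (x + 1 *\<^sub>R h) - f (x + 0 *\<^sub>R h) = (1 - 0) * dd h f (x + z *\<^sub>R h)"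
    using MVT2[of 0 1 "\<lambda>s. f (x + s *\<^sub>R h)" "\<lambda>s. dd h f (x + s *\<^sub>R h)"] smooth_line_DERIV[OF assms] by auto
  then show ?thesis using that by simp
qed

lemma test_fun_lipschitz:
  assumes "test_fun U f" obtains L where "L \<ge> 0" "\<And>x h. \<bar>f (x + h) - f x\<bar> \<le> L * norm h"
proof -
  have sf: "smooth f" by (rule test_fun_smooth[OF assms])
  have "\<exists>M. (\<forall>x. \<bar>dd b f x\<bar> \<le> M) \<and> M \<ge> 0" for b
    by (rule test_fun_bounded[OF test_fun_dd[OF assms, of b]]) blast
  then obtain M where M: "\<And>b x. \<bar>dd b f x\<bar> \<le> M b" "\<And>b. M b \<ge> 0" by metis
  show ?thesis
  proof
    show "(\<Sum>b\<in>Basis. M b) \<ge> 0" by (intro sum_nonneg M)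
    show "\<bar>f (x + h) - f x\<bar> \<le> (\<Sum>b\<in>Basis. M b) * norm h" for x h
    proof -
      obtain s where s: "f (x + h) - f x = dd h f (x + s *\<^sub>R h)" using smooth_mvt[OF sf] by metis
      have "\<bar>f (x + h) - f x\<bar> \<le> (\<Sum>b\<in>Basis. \<bar>(h \<bullet> b) * dd b f (x + s *\<^sub>R h)\<bar>)"
        unfolding s dd_expand[OF sf, of h] by (rule sum_abs)
      also have "\<dots> \<le> (\<Sum>b\<in>Basis. norm h * M b)"
        unfolding abs_mult by (intro sum_mono mult_mono M Basis_le_norm) auto
      finally show ?thesis by (simp add: sum_distrib_left mult.commute)
    qed
  qed
qed

text \<open>A quadratic remainder that is uniform in x allows differentiation under the integral in
  \<open>conv\<close> and under the average in \<open>avg\<close> by a single norm estimate.\<close>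

lemma test_fun_taylor:
  assumes "test_fun U f" obtains C where "C \<ge> 0" "\<And>x h. \<bar>f (x + h) - f x - dd h f x\<bar> \<le> C * (norm h)^2"
proof -
  have sf: "smooth f" by (rule test_fun_smooth[OF assms])
  have "\<exists>L. L \<ge> 0 \<and> (\<forall>x h. \<bar>dd b f (x + h) - dd b f x\<bar> \<le> L * norm h)" for b
    by (rule test_fun_lipschitz[OF test_fun_dd[OF assms, of b]]) blast
  then obtain L where L: "\<And>b. L b \<ge> 0" "\<And>b x h. \<bar>dd b f (x + h) - dd b f x\<bar> \<le> L b * norm h" by metis
  show ?thesis
  proof
    show "(\<Sum>b\<in>Basis. L b) \<ge> 0" by (intro sum_nonneg L)
    show "\<bar>f (x + h) - f x - dd h f x\<bar> \<le> (\<Sum>b\<in>Basis. L b) * (norm h)^2" for x h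
    proof -
      obtain s where s: "0 < s" "s < 1" "f (x + h) - f x = dd h f (x + s *\<^sub>R h)" using smooth_mvt[OF sf] by metis
      have "f (x + h) - f x - dd h f x = (\<Sum>b\<in>Basis. (h \<bullet> b) * (dd b f (x + s *\<^sub>R h) - dd b f x))"
        unfolding s(3) dd_expand[OF sf, of h] by (simp add: sum_subtractf[symmetric] right_diff_distrib)
      also have "\<bar>\<dots>\<bar> \<le> (\<Sum>b\<in>Basis. \<bar>(h \<bullet> b) * (dd b f (x + s *\<^sub>R h) - dd b f x)\<bar>)" by (rule sum_abs)
      also have "\<dots> \<le> (\<Sum>b\<in>Basis. norm h * (L b * norm h))"
        unfolding abs_mult
      proof (intro sum_mono mult_mono)
        fix b :: 'a assume b: "b \<in> Basis"
        show "\<bar>h \<bullet> b\<bar> \<le> norm h" using b by (rule Basis_le_norm)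
        have "\<bar>dd b f (x + s *\<^sub>R h) - dd b f x\<bar> \<le> L b * norm (s *\<^sub>R h)" by (rule L)
        also have "\<dots> \<le> L b * norm h" using s L(1) by (intro mult_left_mono) (auto simp: mult_left_le_one_le)
        finally show "\<bar>dd b f (x + s *\<^sub>R h) - dd b f x\<bar> \<le> L b * norm h" .
      qed auto
      finally show ?thesis by (simp add: sum_distrib_left sum_distrib_right power2_eq_square mult_ac)
    qed
  qed
qed

section \<open>Convolution and correlation\<close>

definition conv :: "('a::euclidean_space \<Rightarrow> real) \<Rightarrow> ('a \<Rightarrow> real) \<Rightarrow> 'a \<Rightarrow> real" where
  "conv \<rho> H x = (\<integral>y. \<rho> (x - y) * H y \<partial>lborel)"

lemma integrable_bounded_mult:
  fixes f :: "'a::euclidean_space \<Rightarrow> real"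
  assumes "integrable lborel H" "f \<in> borel_measurable borel" "\<And>x. \<bar>f x\<bar> \<le> M"
  shows "integrable lborel (\<lambda>x. f x * H x)"
proof (rule Bochner_Integration.integrable_bound)
  show "integrable lborel (\<lambda>x. M * H x)" using assms(1) by simp
  show "(\<lambda>x. f x * H x) \<in> borel_measurable lborel" using assms(1,2) by auto
  have "\<bar>f x\<bar> \<le> \<bar>M\<bar>" for x using assms(3)[of x] by linarith
  then show "AE x in lborel. norm (f x * H x) \<le> norm (M * H x)" by (auto simp: abs_mult mult_right_mono)
qed

lemma test_fun_reflect:
  assumes "test_fun UNIV \<rho>"
  shows "smooth (\<lambda>y. \<rho> (x - y))" "dd u (\<lambda>y. \<rho> (x - y)) y = - dd u \<rho> (x - y)"
proof -
  have b: "bounded_linear (\<lambda>y::'a. - y)" by (intro bounded_linear_minus bounded_linear_ident)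
  show "smooth (\<lambda>y. \<rho> (x - y))" using smooth_affine[OF b test_fun_smooth[OF assms], of x] by simp
  show "dd u (\<lambda>y. \<rho> (x - y)) y = - dd u \<rho> (x - y)"
    using dd_affine[OF b test_fun_smooth[OF assms], of u x] dd_uminus[OF test_fun_smooth[OF assms]] by (simp add: fun_eq_iff)
qed

lemma conv_integrable:
  assumes "test_fun UNIV \<rho>" "integrable lborel H" shows "integrable lborel (\<lambda>y. \<rho> (x - y) * H y)"
proof -
  obtain M where "\<And>x. \<bar>\<rho> x\<bar> \<le> M" using test_fun_bounded[OF assms(1)] by metis
  then show ?thesis by (intro integrable_bounded_mult[of _ _ M] assms(2) smooth_borel test_fun_reflect(1)[OF assms(1)]) simp
qed

lemma conv_has_derivative:
  assumes \<rho>: "test_fun UNIV \<rho>" and H: "integrable lborel H"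
  shows "(conv \<rho> H has_derivative (\<lambda>u. conv (dd u \<rho>) H x)) (at x)"
proof -
  have s\<rho>: "smooth \<rho>" by (rule test_fun_smooth[OF \<rho>])
  obtain C where C: "C \<ge> 0" "\<And>x h. \<bar>\<rho> (x + h) - \<rho> x - dd h \<rho> x\<bar> \<le> C * (norm h)^2"
    using test_fun_taylor[OF \<rho>] by metis
  have i: "integrable lborel (\<lambda>y. dd u \<rho> (x - y) * H y)" for u by (rule conv_integrable[OF test_fun_dd[OF \<rho>] H])
  have lin: "linear (\<lambda>u. conv (dd u \<rho>) H x)"
    using linear_add[OF dd_linear[OF s\<rho>]] linear_scale[OF dd_linear[OF s\<rho>]] i
    by (intro linearI) (simp_all add: conv_def distrib_right mult.assoc)
  let ?I = "\<integral>y. \<bar>H y\<bar> \<partial>lborel"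
  show ?thesis
  proof (rule has_derivativeI_sandwich[where e=1 and H="\<lambda>y. (C * ?I) * norm (y - x)"])
    show "bounded_linear (\<lambda>u. conv (dd u \<rho>) H x)" using lin linear_conv_bounded_linear by blast
    show "((\<lambda>y. C * ?I * norm (y - x)) \<longlongrightarrow> 0) (at x)"
    proof -
      have "((\<lambda>y. C * ?I * norm (y - x)) \<longlongrightarrow> C * ?I * norm (x - x)) (at x)" by (intro tendsto_intros)
      then show ?thesis by simp
    qed
    fix y assume y: "y \<noteq> x"
    define h where "h = y - x"
    have xh: "(x - z) + h = y - z" for z by (simp add: h_def)
    have "conv \<rho> H y - conv \<rho> H x - conv (dd h \<rho>) H x =
        (\<integral>z. (\<rho> (y - z) - \<rho> (x - z) - dd h \<rho> (x - z)) * H z \<partial>lborel)"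
      using conv_integrable[OF \<rho> H] i by (simp add: conv_def left_diff_distrib)
    moreover have "norm (\<integral>z. (\<rho> (y - z) - \<rho> (x - z) - dd h \<rho> (x - z)) * H z \<partial>lborel)
        \<le> (\<integral>z. (C * (norm h)^2) * \<bar>H z\<bar> \<partial>lborel)"
    proof (rule Bochner_Integration.integral_norm_bound_integral)
      show "integrable lborel (\<lambda>z. (\<rho> (y - z) - \<rho> (x - z) - dd h \<rho> (x - z)) * H z)"
        using conv_integrable[OF \<rho> H] i by (simp add: left_diff_distrib)
      show "integrable lborel (\<lambda>z. C * (norm h)^2 * \<bar>H z\<bar>)" using H by simp
      show "norm ((\<rho> (y - z) - \<rho> (x - z) - dd h \<rho> (x - z)) * H z) \<le> C * (norm h)^2 * \<bar>H z\<bar>" for z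
        using C(2)[of "x - z" h] unfolding xh by (simp add: abs_mult mult_right_mono)
    qed
    ultimately have "norm (conv \<rho> H y - conv \<rho> H x - conv (dd h \<rho>) H x) \<le> C * (norm h)^2 * ?I" by simp
    then show "norm (conv \<rho> H y - conv \<rho> H x - conv (dd (y - x) \<rho>) H x) / norm (y - x) \<le> C * ?I * norm (y - x)"
      using y by (simp add: h_def divide_le_eq power2_eq_square mult_ac)
  qed simp
qed

lemma smooth_conv:
  assumes \<rho>: "test_fun UNIV \<rho>" and H: "integrable lborel H"
  shows "smooth (conv \<rho> H)" "dd u (conv \<rho> H) = conv (dd u \<rho>) H"
proof -
  have "Ck k (conv \<rho> H)" if "test_fun UNIV \<rho>" for k \<rho>
    using that
  proof (induction k arbitrary: \<rho>)
    case 0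
    have "isCont (conv \<rho> H) x" for x by (rule has_derivative_continuous[OF conv_has_derivative[OF 0 H]])
    then show ?case by (simp add: continuous_on_eq_continuous_at)
  next
    case (Suc k)
    show ?case
      by (rule Ck_SucI[where D="\<lambda>u. conv (dd u \<rho>) H"])
        (rule conv_has_derivative[OF Suc.prems H], rule Suc.IH[OF test_fun_dd[OF Suc.prems]])
  qed
  then show "smooth (conv \<rho> H)" using \<rho> by (simp add: smooth_def)
  show "dd u (conv \<rho> H) = conv (dd u \<rho>) H"
    by (rule ext) (rule dd_eqI[OF conv_has_derivative[OF \<rho> H]])
qed

text \<open>Fubini after the substitution x = y + u. The kernel survives only as a weight on the
  correlation of F and H, so a statement for many kernels becomes a statement about one function of
  the shift u.\<close>

lemma conv_pairing:
  fixes F H \<rho> :: "'a::euclidean_space \<Rightarrow> real"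
  assumes F: "integrable lborel F" and H: "integrable lborel H" and \<rho>: "test_fun UNIV \<rho>"
  shows "integrable lborel (\<lambda>u. \<rho> u * (\<integral>y. F (y + u) * H y \<partial>lborel))"
    and "(\<integral>x. F x * conv \<rho> H x \<partial>lborel) = (\<integral>u. \<rho> u * (\<integral>y. F (y + u) * H y \<partial>lborel) \<partial>lborel)"
proof -
  have [measurable]: "F \<in> borel_measurable borel" "H \<in> borel_measurable borel" "\<rho> \<in> borel_measurable borel"
    using F H smooth_borel[OF test_fun_smooth[OF \<rho>]] by auto
  obtain M where M: "\<And>x. \<bar>\<rho> x\<bar> \<le> M" "M \<ge> 0" using test_fun_bounded[OF \<rho>] by metis
  have bm: "borel_measurable (lborel \<Otimes>\<^sub>M lborel) = (borel_measurable (borel \<Otimes>\<^sub>M borel) :: ('a \<times> 'a \<Rightarrow> real) set)"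
    by (rule measurable_cong_sets) (auto intro!: sets_pair_measure_cong)
  have i1: "integrable (lborel \<Otimes>\<^sub>M lborel) (\<lambda>z. F (fst z) * (\<rho> (fst z - snd z) * H (snd z)))"
  proof (rule Bochner_Integration.integrable_bound)
    show "integrable (lborel \<Otimes>\<^sub>M lborel) (\<lambda>z. M * (F (fst z) * H (snd z)))"
    proof (rule integrable_mult_right, rule lborel_pair.Fubini_integrable)
      show "(\<lambda>z. F (fst z) * H (snd z)) \<in> borel_measurable (lborel \<Otimes>\<^sub>M lborel)" unfolding bm by measurable
    qed (use F H in \<open>simp_all add: abs_mult\<close>)
    show "(\<lambda>z. F (fst z) * (\<rho> (fst z - snd z) * H (snd z))) \<in> borel_measurable (lborel \<Otimes>\<^sub>M lborel)"
      unfolding bm by measurable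
    show "AE z in lborel \<Otimes>\<^sub>M lborel. norm (F (fst z) * (\<rho> (fst z - snd z) * H (snd z))) \<le> norm (M * (F (fst z) * H (snd z)))"
    proof (intro AE_I2)
      fix z
      have "\<bar>\<rho> (fst z - snd z)\<bar> * (\<bar>F (fst z)\<bar> * \<bar>H (snd z)\<bar>) \<le> M * (\<bar>F (fst z)\<bar> * \<bar>H (snd z)\<bar>)"
        by (intro mult_right_mono M) simp
      then show "norm (F (fst z) * (\<rho> (fst z - snd z) * H (snd z))) \<le> norm (M * (F (fst z) * H (snd z)))"
        using M(2) by (simp add: abs_mult mult_ac)
    qed
  qed
  have b1: "(\<integral>u. \<bar>\<rho> u * F (y + u)\<bar> \<partial>lborel) \<le> M * (\<integral>x. \<bar>F x\<bar> \<partial>lborel)"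
    and b2: "integrable lborel (\<lambda>u. \<rho> u * F (y + u))" for y
  proof -
    have t: "integrable lborel (\<lambda>u. F (y + u))" by (rule integrable_translate[OF F])
    show i: "integrable lborel (\<lambda>u. \<rho> u * F (y + u))" by (rule integrable_bounded_mult[OF t _ M(1)]) simp
    have "(\<integral>u. \<bar>\<rho> u * F (y + u)\<bar> \<partial>lborel) \<le> (\<integral>u. M * \<bar>F (y + u)\<bar> \<partial>lborel)"
      by (rule integral_mono[OF integrable_abs[OF i] integrable_mult_right[OF integrable_abs[OF t]]])
        (simp add: abs_mult mult_right_mono M)
    also have "\<dots> = M * (\<integral>x. \<bar>F x\<bar> \<partial>lborel)" using integral_translate[of "\<lambda>x. \<bar>F x\<bar>" y] by simp
    finally show "(\<integral>u. \<bar>\<rho> u * F (y + u)\<bar> \<partial>lborel) \<le> M * (\<integral>x. \<bar>F x\<bar> \<partial>lborel)" .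
  qed
  let ?g = "\<lambda>y u. H y * (\<rho> u * F (y + u))"
  have i2: "integrable (lborel \<Otimes>\<^sub>M lborel) (case_prod ?g)"
  proof (rule lborel_pair.Fubini_integrable)
    show "case_prod ?g \<in> borel_measurable (lborel \<Otimes>\<^sub>M lborel)" unfolding bm by measurable
    show "AE y in lborel. integrable lborel (\<lambda>u. case_prod ?g (y, u))" using b2 by simp
    show "integrable lborel (\<lambda>y. \<integral>u. norm (case_prod ?g (y, u)) \<partial>lborel)"
    proof (rule Bochner_Integration.integrable_bound)
      show "integrable lborel (\<lambda>y. (M * (\<integral>x. \<bar>F x\<bar> \<partial>lborel)) * H y)" using H by simp
      show "(\<lambda>y. \<integral>u. norm (case_prod ?g (y, u)) \<partial>lborel) \<in> borel_measurable lborel" by measurable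
      show "AE y in lborel. norm (\<integral>u. norm (case_prod ?g (y, u)) \<partial>lborel) \<le> norm ((M * (\<integral>x. \<bar>F x\<bar> \<partial>lborel)) * H y)"
      proof (intro AE_I2)
        fix y
        have "(\<integral>u. norm (case_prod ?g (y, u)) \<partial>lborel) = \<bar>H y\<bar> * (\<integral>u. \<bar>\<rho> u * F (y + u)\<bar> \<partial>lborel)"
          by (simp add: abs_mult)
        also have "\<dots> \<le> \<bar>H y\<bar> * (M * (\<integral>x. \<bar>F x\<bar> \<partial>lborel))" by (intro mult_left_mono b1) simp
        finally show "norm (\<integral>u. norm (case_prod ?g (y, u)) \<partial>lborel) \<le> norm ((M * (\<integral>x. \<bar>F x\<bar> \<partial>lborel)) * H y)"
          using M(2) by (simp add: abs_mult mult_ac)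
      qed
    qed
  qed
  have inner: "(\<integral>y. ?g y u \<partial>lborel) = \<rho> u * (\<integral>y. F (y + u) * H y \<partial>lborel)" for u
  proof -
    have "(\<integral>y. ?g y u \<partial>lborel) = (\<integral>y. \<rho> u * (F (y + u) * H y) \<partial>lborel)"
      by (intro Bochner_Integration.integral_cong) (simp_all add: mult_ac)
    then show ?thesis by simp
  qed
  show "integrable lborel (\<lambda>u. \<rho> u * (\<integral>y. F (y + u) * H y \<partial>lborel))"
    using lborel_pair.integrable_snd[OF i2] unfolding inner .
  have i1': "integrable (lborel \<Otimes>\<^sub>M lborel) (\<lambda>(x, y). F x * (\<rho> (x - y) * H y))"
    using i1 by (simp add: case_prod_beta')
  have "(\<integral>x. F x * conv \<rho> H x \<partial>lborel) = (\<integral>x. (\<integral>y. F x * (\<rho> (x - y) * H y) \<partial>lborel) \<partial>lborel)"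
    by (simp add: conv_def)
  also have "\<dots> = (\<integral>y. (\<integral>x. F x * (\<rho> (x - y) * H y) \<partial>lborel) \<partial>lborel)"
    by (rule lborel_pair.Fubini_integral[symmetric, OF i1'])
  also have "\<dots> = (\<integral>y. (\<integral>u. ?g y u \<partial>lborel) \<partial>lborel)"
  proof (rule Bochner_Integration.integral_cong[OF refl])
    fix y
    have "(\<integral>x. F x * (\<rho> (x - y) * H y) \<partial>lborel) = (\<integral>u. F (y + u) * (\<rho> ((y + u) - y) * H y) \<partial>lborel)"
      by (rule integral_translate[symmetric]) measurable
    also have "\<dots> = (\<integral>u. ?g y u \<partial>lborel)" by (intro Bochner_Integration.integral_cong) (simp_all add: mult_ac)
    finally show "(\<integral>x. F x * (\<rho> (x - y) * H y) \<partial>lborel) = (\<integral>u. ?g y u \<partial>lborel)" .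
  qed
  also have "\<dots> = (\<integral>u. (\<integral>y. ?g y u \<partial>lborel) \<partial>lborel)"
    by (rule lborel_pair.Fubini_integral[symmetric, OF i2])
  finally have "(\<integral>x. F x * conv \<rho> H x \<partial>lborel) = (\<integral>u. (\<integral>y. ?g y u \<partial>lborel) \<partial>lborel)" .
  then show "(\<integral>x. F x * conv \<rho> H x \<partial>lborel) = (\<integral>u. \<rho> u * (\<integral>y. F (y + u) * H y \<partial>lborel) \<partial>lborel)"
    by (simp only: inner)
qed

text \<open>A function orthogonal to all test functions vanishes, so density needs no mollification.\<close>

lemma test_fun_dense:
  assumes U: "open U" "bounded U" and u: "u \<in> supp_l2 U"
  shows "u \<in> closure {emb U \<phi> | \<phi>. test_fun U \<phi>}"
proof (rule closure_if_orthogonal_trivial[of _ "supp_l2 U"])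
  have Ub: "U \<in> sets borel" using U by auto
  show "subspace {emb U \<phi> | \<phi>. test_fun U \<phi>}"
    unfolding subspace_def
  proof safe
    have "test_fun U (\<lambda>x. 0)" by (rule test_funI[of _ "{}"]) auto
    then show "\<exists>\<phi>. 0 = emb U \<phi> \<and> test_fun U \<phi>" by (intro exI[of _ "\<lambda>x. 0"]) simp
    fix \<phi> assume \<phi>: "test_fun U \<phi>"
    show "\<exists>\<psi>. c *\<^sub>R emb U \<phi> = emb U \<psi> \<and> test_fun U \<psi>" for c
      using \<phi> L2_test[OF \<phi> Ub] test_fun_mult_left[OF \<phi> smooth_const[of c]]
      by (intro exI[of _ "\<lambda>x. c * \<phi> x"]) (simp add: emb_cmult)
    fix \<psi> assume \<psi>: "test_fun U \<psi>"
    show "\<exists>\<theta>. emb U \<phi> + emb U \<psi> = emb U \<theta> \<and> test_fun U \<theta>"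
      using L2_test[OF \<phi> Ub] L2_test[OF \<psi> Ub] test_fun_add[OF \<phi> \<psi>]
      by (intro exI[of _ "\<lambda>x. \<phi> x + \<psi> x"]) (simp add: emb_add)
  qed
  show "{emb U \<phi> | \<phi>. test_fun U \<phi>} \<subseteq> supp_l2 U" using L2_test[OF _ Ub] by blast
  show "y = 0" if "y \<in> supp_l2 U" "\<And>s. s \<in> {emb U \<phi> | \<phi>. test_fun U \<phi>} \<Longrightarrow> inner y s = 0" for y
    using that by (intro l2_zero_if_test[OF U]) blast+
next
  have Ub: "U \<in> sets borel" using U by auto
  show "subspace (supp_l2 U)" "closed (supp_l2 U)" "u \<in> supp_l2 U"
    by (rule subspace_supp[OF Ub], rule closed_supp[OF Ub], rule u)
qed

text \<open>Translation is isometric in L2, so replacing F by a nearby test function costs the same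
  small error for all shifts; for a test function the correlation is Lipschitz. This continuity
  takes the place of convergence of mollifications.\<close>

lemma correlation_continuous:
  fixes F H :: "'a::euclidean_space \<Rightarrow> real"
  assumes U: "open U" "bounded U" and F: "sqi F" "\<And>x. x \<notin> U \<Longrightarrow> F x = 0" and H: "sqi H" "integrable lborel H"
  shows "continuous_on UNIV (\<lambda>u. \<integral>y. F (y + u) * H y \<partial>lborel)"
proof -
  let ?C = "\<lambda>F u. \<integral>y. F (y + u) * H y \<partial>lborel"
  have Ub: "U \<in> sets borel" using U by auto
  have tr: "sqi (\<lambda>y. F (y + u))" "(\<integral>y. (F (y + u))^2 \<partial>lborel) = (\<integral>y. (F y)^2 \<partial>lborel)"
    if "sqi F" for F :: "'a \<Rightarrow> real" and u
  proof -
    have m: "F \<in> borel_measurable borel" "integrable lborel (\<lambda>y. (F y)^2)" using that by (auto simp: sqi_def)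
    have "(\<lambda>y. F (y + u)) \<in> borel_measurable borel"
      using measurable_compose[OF _ m(1), of "\<lambda>x. x + u" borel] by simp
    then show "sqi (\<lambda>y. F (y + u))"
      using integrable_translate[OF m(2), of u] by (simp add: sqi_def add.commute)
    show "(\<integral>y. (F (y + u))^2 \<partial>lborel) = (\<integral>y. (F y)^2 \<partial>lborel)"
      using integral_translate[of "\<lambda>y. (F y)^2" u] m(1) by (simp add: add.commute)
  qed
  have ntr: "norm (cls (\<lambda>y. F (y + u))) = norm (cls F)" if "sqi F" for F :: "'a \<Rightarrow> real" and u
    using tr[OF that, of u] that by (simp add: norm_eq_sqrt_inner inner_cls power2_eq_square)
  have C: "?C F u = inner (cls (\<lambda>y. F (y + u))) (cls H)" if "sqi F" for F u
    using tr(1)[OF that] H(1) by (simp add: inner_cls)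
  have Fe: "emb U F = cls F" unfolding emb_def using F(2) by (intro arg_cong[of _ _ cls]) (auto simp: indicator_def fun_eq_iff)
  show ?thesis
    unfolding continuous_on_iff
  proof (intro ballI allI impI)
    fix u :: 'a and e :: real assume e: "e > 0"
    \<comment> \<open>The summand 1 keeps the divisor positive when H vanishes; the constant J below
      is built in the same way.\<close>
    define N where "N = norm (cls H) + 1"
    have N: "N > 0" unfolding N_def by (simp add: add_nonneg_pos)
    have "emb U F \<in> closure {emb U \<phi> | \<phi>. test_fun U \<phi>}"
      using L2_cls[OF Ub F(1)] by (intro test_fun_dense[OF U]) auto
    moreover have "e / (3 * N) > 0" using e N by simp
    ultimately obtain \<phi> where \<phi>: "test_fun U \<phi>" "dist (emb U \<phi>) (emb U F) < e / (3 * N)"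
      unfolding closure_approachable by blast
    have \<phi>e: "emb U \<phi> = cls \<phi>" unfolding emb_def using test_fun_outside[OF \<phi>(1)]
      by (intro arg_cong[of _ _ cls]) (auto simp: indicator_def fun_eq_iff)
    have \<phi>s: "sqi \<phi>" using L2_test[OF \<phi>(1), of UNIV] by (simp add: L2_iff_sqi)
    have near: "\<bar>?C F v - ?C \<phi> v\<bar> < e / 3" for v
    proof -
      have "?C F v - ?C \<phi> v = inner (cls (\<lambda>y. F (y + v) - \<phi> (y + v))) (cls H)"
        unfolding C[OF F(1)] C[OF \<phi>s] using tr(1)[OF F(1)] tr(1)[OF \<phi>s] by (simp add: cls_diff inner_diff_left)
      then have "\<bar>?C F v - ?C \<phi> v\<bar> \<le> norm (cls (\<lambda>y. F (y + v) - \<phi> (y + v))) * norm (cls H)"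
        by (simp only: Cauchy_Schwarz_ineq2)
      also have "norm (cls (\<lambda>y. F (y + v) - \<phi> (y + v))) = norm (cls F - cls \<phi>)"
        using ntr[OF sqi_diff[OF F(1) \<phi>s], of v] F(1) \<phi>s by (simp add: cls_diff)
      also have "norm (cls F - cls \<phi>) * norm (cls H) \<le> e / (3 * N) * norm (cls H)"
        using \<phi>(2) by (intro mult_right_mono) (auto simp: Fe \<phi>e dist_norm norm_minus_commute)
      also have "\<dots> < e / (3 * N) * N" using e N by (intro mult_strict_left_mono) (auto simp: N_def)
      also have "\<dots> = e / 3" using N by simp
      finally show ?thesis .
    qed
    obtain L where L: "L \<ge> 0" "\<And>x h. \<bar>\<phi> (x + h) - \<phi> x\<bar> \<le> L * norm h" using test_fun_lipschitz[OF \<phi>(1)] by metis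
    define J where "J = L * (\<integral>y. \<bar>H y\<bar> \<partial>lborel) + 1"
    have J: "J > 0" unfolding J_def using L(1) by (intro add_nonneg_pos mult_nonneg_nonneg) auto
    have lip: "\<bar>?C \<phi> v - ?C \<phi> u\<bar> \<le> J * norm (v - u)" for v
    proof -
      have ii: "integrable lborel (\<lambda>y. \<phi> (y + w) * H y)" for w using sqi_mult_integrable[OF tr(1)[OF \<phi>s] H(1)] .
      have "?C \<phi> v - ?C \<phi> u = (\<integral>y. (\<phi> (y + v) - \<phi> (y + u)) * H y \<partial>lborel)"
        using ii by (simp add: left_diff_distrib)
      also have "norm \<dots> \<le> (\<integral>y. (L * norm (v - u)) * \<bar>H y\<bar> \<partial>lborel)"
      proof (rule Bochner_Integration.integral_norm_bound_integral)
        show "integrable lborel (\<lambda>y. (\<phi> (y + v) - \<phi> (y + u)) * H y)" using ii by (simp add: left_diff_distrib)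
        show "integrable lborel (\<lambda>y. L * norm (v - u) * \<bar>H y\<bar>)" using H(2) by simp
        show "norm ((\<phi> (y + v) - \<phi> (y + u)) * H y) \<le> L * norm (v - u) * \<bar>H y\<bar>" for y
          using L(2)[of "y + u" "v - u"] by (simp add: abs_mult mult_right_mono)
      qed
      also have "\<dots> = L * (\<integral>y. \<bar>H y\<bar> \<partial>lborel) * norm (v - u)" by simp
      also have "\<dots> \<le> J * norm (v - u)" unfolding J_def by (intro mult_right_mono) auto
      finally show ?thesis by simp
    qed
    show "\<exists>d>0. \<forall>v\<in>UNIV. dist v u < d \<longrightarrow> dist (?C F v) (?C F u) < e"
    proof (intro exI[of _ "e / (3 * J)"] conjI ballI impI)
      show "e / (3 * J) > 0" using e J by simp
      fix v assume "dist v u < e / (3 * J)"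
      then have "J * norm (v - u) < e / 3" using J by (simp add: dist_norm field_simps)
      then have "\<bar>?C \<phi> v - ?C \<phi> u\<bar> < e / 3" using lip[of v] by linarith
      then show "dist (?C F v) (?C F u) < e" using near[of v] near[of u] unfolding dist_real_def by linarith
    qed
  qed
qed

section \<open>Green's formula for functions with zero boundary values\<close>

lemma ip_cong: "(\<And>x. x \<in> S \<Longrightarrow> f x = f' x) \<Longrightarrow> (\<And>x. x \<in> S \<Longrightarrow> g x = g' x) \<Longrightarrow> ip S f g = ip S f' g'"
  unfolding ip_def set_lebesgue_integral_def by (intro Bochner_Integration.integral_cong) (auto simp: indicator_def)

lemma ip_add_right: "L2 S f \<Longrightarrow> L2 S g \<Longrightarrow> L2 S h \<Longrightarrow> ip S f (\<lambda>x. g x + h x) = ip S f g + ip S f h"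
  and ip_diff_right: "L2 S f \<Longrightarrow> L2 S g \<Longrightarrow> L2 S h \<Longrightarrow> ip S f (\<lambda>x. g x - h x) = ip S f g - ip S f h"
  and ip_add_left: "L2 S f \<Longrightarrow> L2 S g \<Longrightarrow> L2 S h \<Longrightarrow> ip S (\<lambda>x. g x + h x) f = ip S g f + ip S h f"
  and ip_diff_left: "L2 S f \<Longrightarrow> L2 S g \<Longrightarrow> L2 S h \<Longrightarrow> ip S (\<lambda>x. g x - h x) f = ip S g f - ip S h f"
  by (simp_all add: inner_emb[symmetric] L2_add L2_diff emb_add emb_diff inner_add_right inner_diff_right
      inner_add_left inner_diff_left)

lemma ip_sum_right: "L2 S f \<Longrightarrow> (\<And>i. i \<in> I \<Longrightarrow> L2 S (g i)) \<Longrightarrow> ip S f (\<lambda>x. \<Sum>i\<in>I. g i x) = (\<Sum>i\<in>I. ip S f (g i))"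
  by (simp add: inner_emb[symmetric] L2_sum emb_sum inner_sum_right)

lemma zero_if_AE_zero_continuous:
  fixes C :: "'a::euclidean_space \<Rightarrow> real"
  assumes C: "continuous_on UNIV C" and W: "open W" and ae: "AE x in lborel. x \<in> W \<longrightarrow> C x = 0" and x: "x \<in> W"
  shows "C x = 0"
proof -
  have "AE x\<in>W in lebesgue. x \<in> {x. C x = 0}"
    using AE_completion[OF ae] by simp
  moreover have "closed {x. C x = 0}" by (intro closed_Collect_eq C continuous_on_const)
  ultimately have "x \<in> {x. C x = 0}" using mem_closed_if_AE_lebesgue_open[OF W _ _ x] by blast
  then show ?thesis by simp
qed

text \<open>The cone may be taken uniform near \<^term>\<open>p\<close> because its aperture depends only on the Lipschitz constant.\<close>

lemma inward_cone:
  fixes \<Omega> :: "(real^'d) set"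
  assumes lip: "lipschitz_domain \<Omega>" and p: "p \<in> closure \<Omega>"
  obtains r W where "r > 0" "open W" "bounded W" "0 \<in> closure W"
    "\<And>x u. x \<in> closure \<Omega> \<Longrightarrow> x \<in> cball p r \<Longrightarrow> u \<in> W \<Longrightarrow> x + u \<in> \<Omega>"
proof (cases "p \<in> \<Omega>")
  case True
  have "open \<Omega>" using lip by (simp add: lipschitz_domain_def)
  then obtain \<rho> where \<rho>: "\<rho> > 0" "cball p \<rho> \<subseteq> \<Omega>" using True open_contains_cball by blast
  show ?thesis
  proof
    show "\<rho> / 2 > 0" "open (ball 0 (\<rho> / 2) :: (real^'d) set)" "bounded (ball 0 (\<rho> / 2) :: (real^'d) set)" using \<rho> by auto
    show "(0::real^'d) \<in> closure (ball 0 (\<rho> / 2))" using \<rho> closure_subset by force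
    fix x u :: "real^'d" assume "x \<in> cball p (\<rho> / 2)" and u: "u \<in> ball 0 (\<rho> / 2)"
    then have "dist p (x + u) \<le> \<rho>"
      using norm_triangle_ineq4[of "p - x" u] by (simp add: dist_norm diff_diff_eq)
    then show "x + u \<in> \<Omega>" using \<rho> by auto
  qed
next
  case False
  then have "p \<in> frontier \<Omega>" using p lip by (simp add: frontier_def lipschitz_domain_def interior_open)
  then have "\<exists>U A (k::'d) (g::real^'d \<Rightarrow> real) (L::real). open U \<and> p \<in> U \<and> orthogonal_transformation A \<and>
        L-lipschitz_on UNIV g \<and> (\<forall>y z. (\<forall>j. j \<noteq> k \<longrightarrow> y $ j = z $ j) \<longrightarrow> g y = g z) \<and>
        (\<forall>y\<in>U. y \<in> \<Omega> \<longleftrightarrow> (A y) $ k < g (A y))"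
    using lip unfolding lipschitz_domain_def by blast
  then obtain U and A :: "real^'d \<Rightarrow> real^'d" and k :: 'd and g :: "real^'d \<Rightarrow> real" and L :: real
    where U: "open U" "p \<in> U" and A: "orthogonal_transformation A"
      and g: "L-lipschitz_on UNIV g" "\<forall>y z. (\<forall>j. j \<noteq> k \<longrightarrow> y $ j = z $ j) \<longrightarrow> g y = g z"
      and Om: "\<forall>y\<in>U. y \<in> \<Omega> \<longleftrightarrow> (A y) $ k < g (A y)"
    by (elim exE conjE)
  obtain \<rho> where \<rho>: "\<rho> > 0" "cball p \<rho> \<subseteq> U" using U open_contains_cball by blast
  have lA: "linear A" using A by (rule orthogonal_transformation_linear)
  have cA: "continuous_on S A" for S using lA linear_continuous_on linear_conv_bounded_linear by blast
  have L0: "L \<ge> 0" using g(1) lipschitz_on_nonneg by blast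
  have cg: "continuous_on UNIV g" using g(1) by (rule lipschitz_on_continuous_on)
  \<comment> \<open>\<open>P\<close> deletes the coordinate k, on which g does not depend. Along a
    shift u in \<open>W\<close> the function g changes by at most L times the norm of
    \<open>P (A u)\<close>, while the coordinate k drops by more than that.\<close>
  define P where "P y = y - y $ k *\<^sub>R axis k 1" for y :: "real^'d"
  define W where "W = {u. norm u < \<rho> / 2 \<and> (A u) $ k < - L * norm (P (A u))}"
  obtain e where e: "A e = - axis k 1"
    using orthogonal_transformation_surj[OF A] unfolding surj_def by metis
  have "norm e = 1" using orthogonal_transformation_norm[OF A, of e] by (simp add: e)
  show ?thesis
  proof
    show "\<rho> / 2 > 0" using \<rho> by simp
    have "W = {u. norm u < \<rho> / 2} \<inter> {u. (A u) $ k < - L * norm (P (A u))}" by (auto simp: W_def)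
    also have "open \<dots>" unfolding P_def
      by (intro open_Int open_Collect_less continuous_intros cA)
    finally show "open W" .
    show "bounded W" by (rule bounded_subset[of "ball 0 (\<rho> / 2)"]) (auto simp: W_def)
    \<comment> \<open>Points on the axis of the cone that tend to its vertex; the 3 keeps their
      norms below \<rho>/2.\<close>
    define u where "u n = (\<rho> / (real n + 3)) *\<^sub>R e" for n
    have "u n \<in> W" for n
    proof -
      have "A (u n) = - (\<rho> / (real n + 3)) *\<^sub>R axis k 1" by (simp add: u_def linear_scale[OF lA] e)
      then have "(A (u n)) $ k = - (\<rho> / (real n + 3))" "P (A (u n)) = 0" by (simp_all add: P_def axis_def)
      moreover have "\<rho> / (real n + 3) < \<rho> / 2" using \<rho> by (intro divide_strict_left_mono) auto
      then have "norm (u n) < \<rho> / 2" using \<rho> \<open>norm e = 1\<close> by (simp add: u_def)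
      moreover have "\<rho> / (real n + 3) > 0" using \<rho> by simp
      ultimately show ?thesis unfolding W_def by (simp only: mem_Collect_eq norm_zero mult_zero_right) simp
    qed
    moreover have "u \<longlonglongrightarrow> 0"
    proof -
      have "filterlim (\<lambda>n. real n + 3) at_top sequentially"
        by (intro filterlim_tendsto_add_at_top[OF tendsto_const, of _ _ 3, simplified add.commute]
            filterlim_real_sequentially)
      then have "(\<lambda>n. \<rho> / (real n + 3)) \<longlonglongrightarrow> 0"
        by (intro tendsto_divide_0[OF tendsto_const] filterlim_at_top_imp_at_infinity)
      then have "(\<lambda>n. (\<rho> / (real n + 3)) *\<^sub>R e) \<longlonglongrightarrow> 0 *\<^sub>R e" by (intro tendsto_intros)
      then show ?thesis by (simp add: u_def[abs_def])
    qed
    ultimately show "0 \<in> closure W" unfolding closure_sequential by blast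
    fix x w :: "real^'d" assume x: "x \<in> closure \<Omega>" "x \<in> cball p (\<rho> / 2)" and w: "w \<in> W"
    have xU: "x \<in> U" using x(2) \<rho> by (auto dest!: subsetD[of _ _ x])
    have "dist p (x + w) \<le> \<rho>"
      using norm_triangle_ineq4[of "p - x" w] x(2) w by (simp add: dist_norm diff_diff_eq W_def)
    then have xwU: "x + w \<in> U" using \<rho>(2) by auto
    \<comment> \<open>On the closure only the weak inequality remains; the strict drop along the
      cone restores strictness after the shift.\<close>
    have le: "(A x) $ k \<le> g (A x)"
    proof -
      obtain y where y: "\<And>n. y n \<in> \<Omega>" "y \<longlonglongrightarrow> x" using x(1) unfolding closure_sequential by blast
      have "\<forall>\<^sub>F n in sequentially. y n \<in> U" using y(2) U(1) xU by (rule topological_tendstoD)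
      then have "\<forall>\<^sub>F n in sequentially. (A (y n)) $ k \<le> g (A (y n))"
        by eventually_elim (use Om y(1) in \<open>auto intro: less_imp_le\<close>)
      moreover have "isCont A x" using cA[of UNIV] by (simp add: continuous_on_eq_continuous_at)
      then have Ay: "(\<lambda>n. A (y n)) \<longlonglongrightarrow> A x" using y(2) by (rule isCont_tendsto_compose)
      moreover have "isCont g (A x)" using cg by (simp add: continuous_on_eq_continuous_at)
      then have "(\<lambda>n. g (A (y n))) \<longlonglongrightarrow> g (A x)" using Ay by (rule isCont_tendsto_compose)
      ultimately show ?thesis using tendsto_le[OF sequentially_bot _ tendsto_vec_nth[OF Ay, of k]] by blast
    qed
    have "g (A x + A w) = g (A x + P (A w))" by (rule g(2)[rule_format]) (auto simp: P_def axis_def)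
    moreover have "\<bar>g (A x + P (A w)) - g (A x)\<bar> \<le> L * norm (P (A w))"
      using lipschitz_onD[OF g(1), of "A x + P (A w)" "A x"] by (simp add: dist_norm)
    moreover have "(A w) $ k < - L * norm (P (A w))" using w by (simp add: W_def)
    ultimately have "(A x) $ k + (A w) $ k < g (A x + A w)" using le by linarith
    then show "x + w \<in> \<Omega>" using Om[rule_format, OF xwU] by (simp add: linear_add[OF lA])
  qed
qed

text \<open>For kernels supported in the cone \<^term>\<open>W\<close> the mollified function is a test function on the
  domain.  This shows that a continuous correlation function of the shift vanishes on \<^term>\<open>W\<close>, hence at
  the shift \<open>0\<close>, which is the claim.\<close>

lemma green_local:
  fixes \<Omega> :: "(real^'d) set" and z q \<kappa> :: "real^'d \<Rightarrow> real" and G \<zeta> :: "'d \<Rightarrow> real^'d \<Rightarrow> real"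
  assumes op: "open \<Omega>" and bd: "bounded \<Omega>"
    and L2: "L2 \<Omega> z" "\<And>i. L2 \<Omega> (G i)" "L2 \<Omega> q" "\<And>i. L2 \<Omega> (\<zeta> i)"
    and grad: "\<And>\<tau> i. smooth \<tau> \<Longrightarrow> ip \<Omega> (G i) \<tau> = - ip \<Omega> z (dd (axis i 1) \<tau>)"
    and div: "\<And>w. test_fun \<Omega> w \<Longrightarrow> ip \<Omega> q w = - (\<Sum>i\<in>UNIV. ip \<Omega> (\<zeta> i) (dd (axis i 1) w))"
    and \<kappa>: "smooth \<kappa>" "\<And>x. x \<notin> cball p r \<Longrightarrow> \<kappa> x = 0"
    and W: "open W" "bounded W" "0 \<in> closure W"
    and cone: "\<And>x u. x \<in> closure \<Omega> \<Longrightarrow> x \<in> cball p r \<Longrightarrow> u \<in> W \<Longrightarrow> x + u \<in> \<Omega>"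
  shows "ip \<Omega> q (\<lambda>x. \<kappa> x * z x) + (\<Sum>i\<in>UNIV. ip \<Omega> (\<zeta> i) (\<lambda>x. \<kappa> x * G i x + dd (axis i 1) \<kappa> x * z x)) = 0"
proof -
  have Ob: "\<Omega> \<in> sets borel" using op by auto
  define ext where "ext f x = indicator \<Omega> x * f x" for f :: "real^'d \<Rightarrow> real" and x
  have ext: "sqi (ext f)" "integrable lborel (ext f)" "\<And>x. x \<notin> \<Omega> \<Longrightarrow> ext f x = 0" if "L2 \<Omega> f" for f
    using that L2_integrable[OF bd Ob that] by (auto simp: ext_def[abs_def] L2_iff_sqi)
  have ext_ip: "(\<integral>x. ext f x * h x \<partial>lborel) = ip \<Omega> f h" for f h
    by (simp add: ext_def ip_def set_lebesgue_integral_def mult.assoc)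
  have ext_ext: "(\<integral>x. ext f x * ext h x \<partial>lborel) = ip \<Omega> f h" for f h
    unfolding ext_ip by (rule ip_cong) (auto simp: ext_def)
  define h0 where "h0 x = \<kappa> x * z x" for x
  define h where "h i x = \<kappa> x * G i x + dd (axis i 1) \<kappa> x * z x" for i x
  have h0: "L2 \<Omega> h0" unfolding h0_def[abs_def] by (intro L2_mult_smooth bd L2 \<kappa>)
  have h: "L2 \<Omega> (h i)" for i unfolding h_def[abs_def] by (intro L2_add L2_mult_smooth bd L2 \<kappa> smooth_dd)
  \<comment> \<open>The left-hand side of the claim with q and \<zeta> evaluated at points shifted
    by u; its value at u = 0 is the claim itself.\<close>
  define C where "C u = (\<integral>y. ext q (y + u) * ext h0 y \<partial>lborel) + (\<Sum>i\<in>UNIV. \<integral>y. ext (\<zeta> i) (y + u) * ext (h i) y \<partial>lborel)" for u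
  have Cc: "continuous_on UNIV C" unfolding C_def[abs_def]
    by (intro continuous_on_add continuous_on_sum correlation_continuous[OF op bd] ext L2 h0 h)
  have zero: "(\<integral>u. \<rho> u * C u \<partial>lborel) = 0" if \<rho>: "test_fun W \<rho>" for \<rho>
  proof -
    have \<rho>U: "test_fun UNIV \<rho>" using test_fun_mono[OF \<rho>] by blast
    define w where "w = conv \<rho> (ext h0)"
    have sw: "smooth w" unfolding w_def by (rule smooth_conv[OF \<rho>U ext(2)[OF h0]])
    obtain N where N: "compact N" "N \<subseteq> W" "\<And>x. x \<notin> N \<Longrightarrow> \<rho> x = 0" using test_funE[OF \<rho>] by metis
    let ?K = "closure \<Omega> \<inter> cball p r"
    have K: "compact ?K" using bd by (intro compact_Int_closed) (auto simp: compact_closure)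
    \<comment> \<open>The support of w lies in the sum of \<open>?K\<close>, the part of the closure
      near p, and the support N of the kernel. Since N lies in the cone W, this compact sum lies in
      \<Omega>, so \<open>div\<close> applies to w.\<close>
    have wt: "test_fun \<Omega> w"
    proof (rule test_funI[OF sw])
      show "compact {x + y | x y. x \<in> ?K \<and> y \<in> N}" by (rule compact_sums[OF K N(1)])
      show "{x + y | x y. x \<in> ?K \<and> y \<in> N} \<subseteq> \<Omega>" using cone N(2) by blast
      fix x assume x: "x \<notin> {x + y | x y. x \<in> ?K \<and> y \<in> N}"
      have z: "\<rho> (x - y) * ext h0 y = 0" for y
      proof (cases "y \<in> ?K")
        case True
        have "x - y \<notin> N"
        proof
          assume "x - y \<in> N"
          then have "\<exists>a b. x = a + b \<and> a \<in> ?K \<and> b \<in> N" using True by (intro exI[of _ y] exI[of _ "x - y"]) auto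
          with x show False by blast
        qed
        then show ?thesis using N(3) by simp
      next
        case False
        then have "y \<notin> \<Omega> \<or> y \<notin> cball p r" using closure_subset by blast
        then show ?thesis using \<kappa>(2)[of y] by (auto simp: ext_def h0_def)
      qed
      show "w x = 0" unfolding w_def conv_def z by simp
    qed
    \<comment> \<open>Here the zero boundary values of z enter: \<open>grad\<close> admits the
      reflected kernel times \<kappa>, which need not vanish on the boundary. Hence extending
      \<kappa> z by zero creates no boundary term in its gradient.\<close>
    have dw: "dd (axis i 1) w = conv \<rho> (ext (h i))" for i
    proof
      fix x
      let ?\<rho> = "\<lambda>y. \<rho> (x - y)"
      have s: "smooth ?\<rho>" by (rule test_fun_reflect(1)[OF \<rho>U])
      have st: "smooth (\<lambda>y. ?\<rho> y * \<kappa> y)" by (intro smooth_mult s \<kappa>)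
      have d: "dd (axis i 1) (\<lambda>y. ?\<rho> y * \<kappa> y) = (\<lambda>y. ?\<rho> y * dd (axis i 1) \<kappa> y - dd (axis i 1) \<rho> (x - y) * \<kappa> y)"
        unfolding dd_mult[OF s \<kappa>(1)] test_fun_reflect(2)[OF \<rho>U] by simp
      have s2: "smooth (\<lambda>y. dd (axis i 1) \<rho> (x - y))" by (rule test_fun_reflect(1)[OF test_fun_dd[OF \<rho>U]])
      have conv_ip: "conv f (ext k) x = ip \<Omega> k (\<lambda>y. f (x - y))" for f k
        by (simp add: conv_def ext_def ip_def set_lebesgue_integral_def mult_ac)
      have "dd (axis i 1) w x = ip \<Omega> h0 (\<lambda>y. dd (axis i 1) \<rho> (x - y))"
        unfolding w_def smooth_conv(2)[OF \<rho>U ext(2)[OF h0]] conv_ip ..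
      also have "\<dots> = ip \<Omega> z (\<lambda>y. dd (axis i 1) \<rho> (x - y) * \<kappa> y)"
        by (simp add: ip_def h0_def mult_ac)
      also have "\<dots> = ip \<Omega> z (\<lambda>y. ?\<rho> y * dd (axis i 1) \<kappa> y) - ip \<Omega> z (dd (axis i 1) (\<lambda>y. ?\<rho> y * \<kappa> y))"
        unfolding d by (subst ip_diff_right) (auto intro!: L2 L2_smooth bd Ob smooth_mult s s2 \<kappa> smooth_dd)
      also have "\<dots> = ip \<Omega> z (\<lambda>y. ?\<rho> y * dd (axis i 1) \<kappa> y) + ip \<Omega> (G i) (\<lambda>y. ?\<rho> y * \<kappa> y)"
        using grad[OF st] by simp
      also have "\<dots> = ip \<Omega> ?\<rho> (\<lambda>y. dd (axis i 1) \<kappa> y * z y) + ip \<Omega> ?\<rho> (\<lambda>y. \<kappa> y * G i y)"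
        by (simp add: ip_def mult_ac)
      also have "\<dots> = ip \<Omega> ?\<rho> (h i)"
        unfolding h_def
        by (subst ip_add_right[OF L2_smooth[OF bd Ob s] L2_mult_smooth[OF bd L2(2) \<kappa>(1)]
              L2_mult_smooth[OF bd L2(1) smooth_dd[OF \<kappa>(1)]]]) (rule add.commute)
      also have "\<dots> = conv \<rho> (ext (h i)) x" unfolding conv_ip by (rule ip_commute)
      finally show "dd (axis i 1) w x = conv \<rho> (ext (h i)) x" .
    qed
    have "0 = ip \<Omega> q w + (\<Sum>i\<in>UNIV. ip \<Omega> (\<zeta> i) (dd (axis i 1) w))" using div[OF wt] by simp
    also have "\<dots> = (\<integral>x. ext q x * conv \<rho> (ext h0) x \<partial>lborel) + (\<Sum>i\<in>UNIV. \<integral>x. ext (\<zeta> i) x * conv \<rho> (ext (h i)) x \<partial>lborel)"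
      unfolding ext_ip dw by (simp add: w_def)
    also have "\<dots> = (\<integral>u. \<rho> u * (\<integral>y. ext q (y + u) * ext h0 y \<partial>lborel) \<partial>lborel)
        + (\<Sum>i\<in>UNIV. \<integral>u. \<rho> u * (\<integral>y. ext (\<zeta> i) (y + u) * ext (h i) y \<partial>lborel) \<partial>lborel)"
      using conv_pairing(2)[OF ext(2) ext(2) \<rho>U, OF L2(3) h0] conv_pairing(2)[OF ext(2) ext(2) \<rho>U, OF L2(4) h] by simp
    also have "\<dots> = (\<integral>u. \<rho> u * C u \<partial>lborel)"
      using conv_pairing(1)[OF ext(2) ext(2) \<rho>U, OF L2(3) h0] conv_pairing(1)[OF ext(2) ext(2) \<rho>U, OF L2(4) h]
      by (simp add: C_def distrib_left sum_distrib_left)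
    finally show ?thesis by simp
  qed
  have Wb: "W \<in> sets borel" using W by auto
  have "AE u in lborel. u \<in> W \<longrightarrow> C u = 0"
  proof (rule AE_zero_if_test_integrals_zero[OF W(1)])
    obtain c where "\<And>u. u \<in> W \<Longrightarrow> \<bar>C u\<bar> \<le> c" using continuous_bounded_on[OF W(2) Cc] by metis
    then have "L2 W C" by (intro L2_bounded[OF W(2) Wb] borel_measurable_continuous_onI Cc)
    then show "set_integrable lborel W C" using L2_integrable[OF W(2) Wb] by (simp add: set_integrable_def)
    show "(LINT u:W|lborel. C u * \<rho> u) = 0" if "test_fun W \<rho>" for \<rho>
    proof -
      have eq: "indicator W u *\<^sub>R (C u * \<rho> u) = \<rho> u * C u" for u
        using test_fun_outside[OF that, of u] by (auto simp: indicator_def)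
      show ?thesis unfolding set_lebesgue_integral_def eq by (rule zero[OF that])
    qed
  qed
  \<comment> \<open>Continuity first removes the exceptional null set inside W and then reaches the
    vertex 0 of the cone, which lies in the closure of W.\<close>
  then have "W \<subseteq> {u. C u = 0}" using zero_if_AE_zero_continuous[OF Cc W(1)] by blast
  moreover have "closed {u. C u = 0}" by (intro closed_Collect_eq Cc continuous_on_const)
  ultimately have "0 \<in> {u. C u = 0}" using closure_minimal[of W] W(3) by blast
  then have "C 0 = 0" by simp
  then show ?thesis unfolding C_def add_0_right ext_ext h0_def[abs_def] h_def[abs_def] .
qed

text \<open>A partition of unity subordinate to the balls of \<open>inward_cone\<close> localises
  the formula; the terms in which a derivative falls on a cut-off add up to the derivative of the
  constant 1.\<close>

lemma green:
  fixes \<Omega> :: "(real^'d) set" and z q :: "real^'d \<Rightarrow> real" and G \<zeta> :: "'d \<Rightarrow> real^'d \<Rightarrow> real"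
  assumes lip: "lipschitz_domain \<Omega>" and bd: "bounded \<Omega>"
    and L2: "L2 \<Omega> z" "\<And>i. L2 \<Omega> (G i)" "L2 \<Omega> q" "\<And>i. L2 \<Omega> (\<zeta> i)"
    and grad: "\<And>\<tau> i. smooth \<tau> \<Longrightarrow> ip \<Omega> (G i) \<tau> = - ip \<Omega> z (dd (axis i 1) \<tau>)"
    and div: "\<And>w. test_fun \<Omega> w \<Longrightarrow> ip \<Omega> q w = - (\<Sum>i\<in>UNIV. ip \<Omega> (\<zeta> i) (dd (axis i 1) w))"
  shows "ip \<Omega> q z + (\<Sum>i\<in>UNIV. ip \<Omega> (\<zeta> i) (G i)) = 0"
proof -
  have op: "open \<Omega>" using lip by (simp add: lipschitz_domain_def)
  define P where "P p r W \<longleftrightarrow> r > 0 \<and> open W \<and> bounded W \<and> 0 \<in> closure W \<and>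
      (\<forall>x u. x \<in> closure \<Omega> \<longrightarrow> x \<in> cball p r \<longrightarrow> u \<in> W \<longrightarrow> x + u \<in> \<Omega>)" for p :: "real^'d" and r :: real and W
  have P: "\<exists>c. P p (fst c) (snd c)" if "p \<in> closure \<Omega>" for p
  proof (rule inward_cone[OF lip that])
    fix r W assume "r > 0" "open W" "bounded W" "0 \<in> closure W"
      "\<And>x u. x \<in> closure \<Omega> \<Longrightarrow> x \<in> cball p r \<Longrightarrow> u \<in> W \<Longrightarrow> x + u \<in> \<Omega>"
    then show ?thesis unfolding P_def by (intro exI[of _ "(r, W)"]) simp
  qed
  define c where "c p = (SOME c. P p (fst c) (snd c))" for p
  define r where "r p = fst (c p)" for p
  define W where "W p = snd (c p)" for p
  have "P p (r p) (W p)" if "p \<in> closure \<Omega>" for p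
    using someI_ex[OF P[OF that]] by (simp add: c_def r_def W_def)
  then have rW: "\<And>p. p \<in> closure \<Omega> \<Longrightarrow> r p > 0" "\<And>p. p \<in> closure \<Omega> \<Longrightarrow> open (W p)"
    "\<And>p. p \<in> closure \<Omega> \<Longrightarrow> bounded (W p)" "\<And>p. p \<in> closure \<Omega> \<Longrightarrow> 0 \<in> closure (W p)"
    "\<And>p x u. p \<in> closure \<Omega> \<Longrightarrow> x \<in> closure \<Omega> \<Longrightarrow> x \<in> cball p (r p) \<Longrightarrow> u \<in> W p \<Longrightarrow> x + u \<in> \<Omega>"
    unfolding P_def by blast+
  have "compact (closure \<Omega>)" using bd by (simp add: compact_closure)
  then obtain I \<kappa> where I: "finite I" "I \<subseteq> closure \<Omega>" and \<kappa>: "\<And>p. p \<in> I \<Longrightarrow> smooth (\<kappa> p)"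
    "\<And>p x. p \<in> I \<Longrightarrow> x \<notin> cball p (r p) \<Longrightarrow> \<kappa> p x = 0" "\<And>x. x \<in> closure \<Omega> \<Longrightarrow> (\<Sum>p\<in>I. \<kappa> p x) = 1"
    using smooth_partition_of_unity[of "closure \<Omega>" r] rW(1) by metis
  have one: "(\<Sum>p\<in>I. \<kappa> p x) = 1" if "x \<in> \<Omega>" for x using \<kappa>(3) that closure_subset by blast
  have dd_one: "(\<Sum>p\<in>I. dd u (\<kappa> p) x) = 0" if "x \<in> \<Omega>" for u x
  proof -
    have "(\<Sum>p\<in>I. dd u (\<kappa> p) x) = dd u (\<lambda>x. \<Sum>p\<in>I. \<kappa> p x) x" by (simp add: dd_sum \<kappa>(1))
    also have "\<dots> = dd u (\<lambda>x. 1) x" by (rule dd_open_cong[OF op that one])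
    finally show ?thesis by simp
  qed
  have "0 = (\<Sum>p\<in>I. ip \<Omega> q (\<lambda>x. \<kappa> p x * z x) + (\<Sum>i\<in>UNIV. ip \<Omega> (\<zeta> i) (\<lambda>x. \<kappa> p x * G i x + dd (axis i 1) (\<kappa> p) x * z x)))"
  proof (rule sum.neutral[symmetric], rule ballI)
    fix p assume p: "p \<in> I"
    then have pc: "p \<in> closure \<Omega>" using I by auto
    show "ip \<Omega> q (\<lambda>x. \<kappa> p x * z x) + (\<Sum>i\<in>UNIV. ip \<Omega> (\<zeta> i) (\<lambda>x. \<kappa> p x * G i x + dd (axis i 1) (\<kappa> p) x * z x)) = 0"
      by (rule green_local[where p=p and r="r p" and W="W p", OF op bd L2 grad div \<kappa>(1)[OF p] \<kappa>(2)[OF p]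
            rW(2)[OF pc] rW(3)[OF pc] rW(4)[OF pc] rW(5)[OF pc]])
  qed
  also have "\<dots> = (\<Sum>p\<in>I. ip \<Omega> q (\<lambda>x. \<kappa> p x * z x))
      + (\<Sum>i\<in>UNIV. \<Sum>p\<in>I. ip \<Omega> (\<zeta> i) (\<lambda>x. \<kappa> p x * G i x + dd (axis i 1) (\<kappa> p) x * z x))"
    by (simp add: sum.distrib sum.swap[of _ I])
  also have "(\<Sum>p\<in>I. ip \<Omega> q (\<lambda>x. \<kappa> p x * z x)) = ip \<Omega> q (\<lambda>x. \<Sum>p\<in>I. \<kappa> p x * z x)"
    by (rule ip_sum_right[symmetric]) (intro L2_mult_smooth bd L2 \<kappa>)+
  also have "\<dots> = ip \<Omega> q z" by (rule ip_cong) (simp_all add: sum_distrib_right[symmetric] one)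
  finally have total: "0 = ip \<Omega> q z
      + (\<Sum>i\<in>UNIV. \<Sum>p\<in>I. ip \<Omega> (\<zeta> i) (\<lambda>x. \<kappa> p x * G i x + dd (axis i 1) (\<kappa> p) x * z x))" .
  have "(\<Sum>p\<in>I. ip \<Omega> (\<zeta> i) (\<lambda>x. \<kappa> p x * G i x + dd (axis i 1) (\<kappa> p) x * z x)) = ip \<Omega> (\<zeta> i) (G i)" for i
  proof -
    have "(\<Sum>p\<in>I. ip \<Omega> (\<zeta> i) (\<lambda>x. \<kappa> p x * G i x + dd (axis i 1) (\<kappa> p) x * z x))
        = ip \<Omega> (\<zeta> i) (\<lambda>x. \<Sum>p\<in>I. \<kappa> p x * G i x + dd (axis i 1) (\<kappa> p) x * z x)"
      by (rule ip_sum_right[symmetric]) (intro L2_add L2_mult_smooth bd L2 \<kappa> smooth_dd | assumption)+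
    also have "\<dots> = ip \<Omega> (\<zeta> i) (G i)"
      by (rule ip_cong) (simp_all add: sum.distrib sum_distrib_right[symmetric] one dd_one)
    finally show ?thesis .
  qed
  then show ?thesis using total by simp
qed

section \<open>Smooth pairs satisfy the constraint\<close>

lemma ip_tendsto:
  assumes a: "L2 S a" and b: "L2 S b" and an: "\<And>n. an n \<in> borel_measurable borel" and a': "a' \<in> borel_measurable borel"
    and bound: "\<And>n x. x \<in> S \<Longrightarrow> \<bar>an n x\<bar> \<le> C * \<bar>a x\<bar>"
    and lim: "\<And>x. x \<in> S \<Longrightarrow> (\<lambda>n. an n x) \<longlonglongrightarrow> a' x"
  shows "(\<lambda>n. ip S (an n) b) \<longlonglongrightarrow> ip S a' b"
  unfolding ip_def set_lebesgue_integral_def real_scaleR_def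
proof (rule integral_dominated_convergence[where w="\<lambda>x. \<bar>C\<bar> * \<bar>indicator S x * (a x * b x)\<bar>"])
  have bm: "(\<lambda>x. indicator S x * b x) \<in> borel_measurable borel" using b by (simp add: L2_iff_sqi sqi_def)
  show "(\<lambda>x. indicator S x * (a' x * b x)) \<in> borel_measurable lborel"
    using borel_measurable_times[OF a' bm] by (simp add: mult_ac)
  show "(\<lambda>x. indicator S x * (an n x * b x)) \<in> borel_measurable lborel" for n
    using borel_measurable_times[OF an bm] by (simp add: mult_ac)
  show "integrable lborel (\<lambda>x. \<bar>C\<bar> * \<bar>indicator S x * (a x * b x)\<bar>)"
    by (intro integrable_mult_right integrable_abs L2_mult_integrable a b)
  show "AE x in lborel. (\<lambda>n. indicator S x * (an n x * b x)) \<longlonglongrightarrow> indicator S x * (a' x * b x)"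
  proof (intro AE_I2)
    fix x show "(\<lambda>n. indicator S x * (an n x * b x)) \<longlonglongrightarrow> indicator S x * (a' x * b x)"
    proof (cases "x \<in> S")
      case True
      show ?thesis by (intro tendsto_intros lim True)
    qed simp
  qed
  show "AE x in lborel. norm (indicator S x * (an n x * b x)) \<le> \<bar>C\<bar> * \<bar>indicator S x * (a x * b x)\<bar>" for n
  proof (intro AE_I2)
    fix x show "norm (indicator S x * (an n x * b x)) \<le> \<bar>C\<bar> * \<bar>indicator S x * (a x * b x)\<bar>"
    proof (cases "x \<in> S")
      case True
      have "\<bar>an n x\<bar> \<le> \<bar>C\<bar> * \<bar>a x\<bar>"
        using order_trans[OF bound[OF True, of n] mult_right_mono[of C "\<bar>C\<bar>" "\<bar>a x\<bar>"]] by simp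
      then have "\<bar>an n x\<bar> * \<bar>b x\<bar> \<le> \<bar>C\<bar> * \<bar>a x\<bar> * \<bar>b x\<bar>" by (intro mult_right_mono) auto
      then show ?thesis using True by (simp add: abs_mult mult.assoc)
    qed simp
  qed
qed

text \<open>Schwarz's theorem: the second difference is symmetric in u and v, and two applications
  of the mean value theorem evaluate it as either mixed derivative at a point near x.\<close>

lemma dd_symmetric:
  assumes f: "smooth f" shows "dd u (dd v f) x = dd v (dd u f) x"
proof -
  have key: "\<exists>s t. 0 < s \<and> s < h \<and> 0 < t \<and> t < h \<and>
      f (x + h *\<^sub>R u + h *\<^sub>R v) - f (x + h *\<^sub>R u) - f (x + h *\<^sub>R v) + f x = h * h * dd v (dd u f) (x + s *\<^sub>R u + t *\<^sub>R v)"
    if h: "h > 0" for h u v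
  proof -
    have s1: "((\<lambda>s. f (x + s *\<^sub>R u + h *\<^sub>R v) - f (x + s *\<^sub>R u)) has_field_derivative
        dd u f (x + s *\<^sub>R u + h *\<^sub>R v) - dd u f (x + s *\<^sub>R u)) (at s)" for s
      using DERIV_diff[OF smooth_line_DERIV[OF f, of "x + h *\<^sub>R v" u s] smooth_line_DERIV[OF f, of x u s]]
      by (simp add: algebra_simps)
    obtain s where s: "0 < s" "s < h" "(f (x + h *\<^sub>R u + h *\<^sub>R v) - f (x + h *\<^sub>R u)) - (f (x + 0 *\<^sub>R u + h *\<^sub>R v) - f (x + 0 *\<^sub>R u))
        = (h - 0) * (dd u f (x + s *\<^sub>R u + h *\<^sub>R v) - dd u f (x + s *\<^sub>R u))"
      using MVT2[of 0 h "\<lambda>s. f (x + s *\<^sub>R u + h *\<^sub>R v) - f (x + s *\<^sub>R u)"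
          "\<lambda>s. dd u f (x + s *\<^sub>R u + h *\<^sub>R v) - dd u f (x + s *\<^sub>R u)", OF h s1] by blast
    obtain t where t: "0 < t" "t < h" "dd u f (x + s *\<^sub>R u + h *\<^sub>R v) - dd u f (x + s *\<^sub>R u + 0 *\<^sub>R v)
        = (h - 0) * dd v (dd u f) (x + s *\<^sub>R u + t *\<^sub>R v)"
      using MVT2[of 0 h "\<lambda>t. dd u f (x + s *\<^sub>R u + t *\<^sub>R v)" "\<lambda>t. dd v (dd u f) (x + s *\<^sub>R u + t *\<^sub>R v)",
          OF h smooth_line_DERIV[OF smooth_dd[OF f]]] by blast
    have "f (x + h *\<^sub>R u + h *\<^sub>R v) - f (x + h *\<^sub>R u) - f (x + h *\<^sub>R v) + f x = h * h * dd v (dd u f) (x + s *\<^sub>R u + t *\<^sub>R v)"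
      using s(3) t(3) by (simp add: algebra_simps)
    then show ?thesis using s t by blast
  qed
  have lim: "(\<lambda>n. g (x + a n *\<^sub>R u + b n *\<^sub>R v)) \<longlonglongrightarrow> g x"
    if g: "smooth g" and ab: "\<And>n. 0 < a n \<and> a n < 1 / (real n + 1) \<and> 0 < b n \<and> b n < 1 / (real n + 1)" for g a b u v
  proof -
    have l0: "(\<lambda>n. 1 / (real n + 1)) \<longlonglongrightarrow> 0"
      using LIMSEQ_inverse_real_of_nat by (simp add: inverse_eq_divide add.commute)
    have al: "a \<longlonglongrightarrow> 0" by (rule tendsto_sandwich[OF _ _ tendsto_const l0]) (use ab in \<open>auto intro!: always_eventually less_imp_le\<close>)
    have bl: "b \<longlonglongrightarrow> 0" by (rule tendsto_sandwich[OF _ _ tendsto_const l0]) (use ab in \<open>auto intro!: always_eventually less_imp_le\<close>)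
    have "(\<lambda>n. x + a n *\<^sub>R u + b n *\<^sub>R v) \<longlonglongrightarrow> x + 0 *\<^sub>R u + 0 *\<^sub>R v" by (intro tendsto_intros al bl)
    then have "(\<lambda>n. x + a n *\<^sub>R u + b n *\<^sub>R v) \<longlonglongrightarrow> x" by simp
    then show ?thesis by (rule isCont_tendsto_compose[OF smooth_isCont[OF g]])
  qed
  have hp: "1 / (real n + 1) > 0" for n by simp
  obtain a b where ab: "\<And>n. 0 < a n \<and> a n < 1 / (real n + 1) \<and> 0 < b n \<and> b n < 1 / (real n + 1) \<and>
      f (x + (1 / (real n + 1)) *\<^sub>R u + (1 / (real n + 1)) *\<^sub>R v) - f (x + (1 / (real n + 1)) *\<^sub>R u) - f (x + (1 / (real n + 1)) *\<^sub>R v) + f x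
      = (1 / (real n + 1)) * (1 / (real n + 1)) * dd v (dd u f) (x + a n *\<^sub>R u + b n *\<^sub>R v)"
    using key[OF hp, where u=u and v=v] by metis
  obtain c d where cd: "\<And>n. 0 < c n \<and> c n < 1 / (real n + 1) \<and> 0 < d n \<and> d n < 1 / (real n + 1) \<and>
      f (x + (1 / (real n + 1)) *\<^sub>R v + (1 / (real n + 1)) *\<^sub>R u) - f (x + (1 / (real n + 1)) *\<^sub>R v) - f (x + (1 / (real n + 1)) *\<^sub>R u) + f x
      = (1 / (real n + 1)) * (1 / (real n + 1)) * dd u (dd v f) (x + c n *\<^sub>R v + d n *\<^sub>R u)"
    using key[OF hp, where u=v and v=u] by metis
  have "dd v (dd u f) (x + a n *\<^sub>R u + b n *\<^sub>R v) = dd u (dd v f) (x + c n *\<^sub>R v + d n *\<^sub>R u)" for n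
  proof -
    define h where "h = 1 / (real n + 1)"
    have h: "h > 0" by (simp add: h_def)
    have "h * h * dd v (dd u f) (x + a n *\<^sub>R u + b n *\<^sub>R v) = h * h * dd u (dd v f) (x + c n *\<^sub>R v + d n *\<^sub>R u)"
      using ab[of n] cd[of n] unfolding h_def[symmetric] by (simp add: algebra_simps)
    then show ?thesis using h by simp
  qed
  moreover have "(\<lambda>n. dd v (dd u f) (x + a n *\<^sub>R u + b n *\<^sub>R v)) \<longlonglongrightarrow> dd v (dd u f) x"
    by (rule lim) (use ab f in auto)
  moreover have "(\<lambda>n. dd u (dd v f) (x + c n *\<^sub>R v + d n *\<^sub>R u)) \<longlonglongrightarrow> dd u (dd v f) x"
    by (rule lim) (use cd f in auto)
  ultimately show ?thesis by (simp add: LIMSEQ_unique)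
qed

context cylinder
begin

text \<open>The test function may be nonzero at both ends of the time interval: the slab
  \<open>?S\<close> is invariant under shifts in space, and \<phi> has compact support in \<Omega>,
  so no boundary is met.\<close>

lemma space_ibp:
  assumes m: "smooth m" and \<phi>: "test_fun (X \<times> \<Omega>) \<phi>"
  shows "ip (cyl T \<Omega>) (dx i m) \<phi> = - ip (cyl T \<Omega>) m (dx i \<phi>)"
proof -
  let ?S = "{0<..<T} \<times> (UNIV :: (real^'d) set)"
  have cut: "ip (cyl T \<Omega>) a b = ip ?S a b" if "\<And>z. snd z \<notin> \<Omega> \<Longrightarrow> b z = 0" for a b
    unfolding ip_def set_lebesgue_integral_def
  proof (rule Bochner_Integration.integral_cong[OF refl])
    fix z show "indicator (cyl T \<Omega>) z *\<^sub>R (a z * b z) = indicator ?S z *\<^sub>R (a z * b z)"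
      using that[of z] by (cases z) (auto simp: indicator_def cyl_def)
  qed
  have "ip ?S m (dd (0, axis i 1) \<phi>) = - ip ?S (dd (0, axis i 1) m) \<phi>"
  proof (rule integral_by_parts[OF m])
    show "test_fun UNIV \<phi>" using test_fun_mono[OF \<phi>] by blast
    show "?S \<in> sets borel" by (intro borel_open open_Times) auto
  qed auto
  moreover have "\<phi> z = 0" "dx i \<phi> z = 0" if "snd z \<notin> \<Omega>" for z
    using test_fun_outside[OF \<phi>, of z] test_fun_outside[OF test_fun_dx[OF \<phi>], of z i] that by (cases z, auto)+
  ultimately show ?thesis by (simp add: cut dx_eq_dd)
qed

lemma time_ibp:
  assumes m: "smooth m" and \<phi>: "smooth \<phi>" "\<And>x. x \<in> \<Omega> \<Longrightarrow> \<phi> (T, x) = 0"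
  shows "ip (cyl T \<Omega>) (dt m) \<phi> = - ip (cyl T \<Omega>) m (dt \<phi>) - ip \<Omega> (\<lambda>x. m (0, x)) (\<lambda>x. \<phi> (0, x))"
proof -
  have "ip (cyl T \<Omega>) (tensor (\<lambda>t. 1) (\<lambda>x. 1)) (dt (\<lambda>z. m z * \<phi> z)) = - ip \<Omega> (\<lambda>x. 1) (\<lambda>x. m (0, x) * \<phi> (0, x))"
    by (rule time_integration) (use m \<phi> L2_dom_smooth[OF smooth_const] in auto)
  also have "ip (cyl T \<Omega>) (tensor (\<lambda>t. 1) (\<lambda>x. 1)) (dt (\<lambda>z. m z * \<phi> z))
      = ip (cyl T \<Omega>) (tensor (\<lambda>t. 1) (\<lambda>x. 1)) (\<lambda>z. m z * dt \<phi> z + dt m z * \<phi> z)"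
    by (simp add: dt_eq_dd dd_mult m \<phi>)
  also have "\<dots> = ip (cyl T \<Omega>) (tensor (\<lambda>t. 1) (\<lambda>x. 1)) (\<lambda>z. m z * dt \<phi> z) + ip (cyl T \<Omega>) (tensor (\<lambda>t. 1) (\<lambda>x. 1)) (\<lambda>z. dt m z * \<phi> z)"
    by (rule ip_add_right) (intro L2_cyl_smooth smooth_tensor smooth_const smooth_mult m \<phi> smooth_dt)+
  finally show ?thesis by (simp add: ip_def tensor_def)
qed

lemma test_fun_outside_T: "test_fun ({..<T} \<times> \<Omega>) \<phi> \<Longrightarrow> \<phi> (T, x) = 0"
  by (rule test_fun_outside) auto

lemma smooth_isV:
  assumes w: "smooth w" and \<tau>: "\<And>i. smooth (\<lambda>z. \<tau> z $ i)"
  shows "isV \<Omega> T w \<tau> (\<lambda>z. dt w z - (\<Sum>i\<in>UNIV. dx i (\<lambda>z. \<tau> z $ i) z)) (\<lambda>z. \<chi> i. dt (\<lambda>z. \<tau> z $ i) z - dx i w z)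
    (\<lambda>x. w (0, x)) (\<lambda>x. \<tau> (0, x))"
  unfolding isV_def L2v_def
proof (intro conjI allI impI)
  show "L2 (cyl T \<Omega>) w" "L2 (cyl T \<Omega>) (\<lambda>z. \<tau> z $ i)" for i by (intro L2_cyl_smooth w \<tau>)+
  have sd: "smooth (\<lambda>z. \<Sum>i\<in>UNIV. dx i (\<lambda>z. \<tau> z $ i) z)" by (intro smooth_sum smooth_dx \<tau>)
  show "L2 (cyl T \<Omega>) (\<lambda>z. dt w z - (\<Sum>i\<in>UNIV. dx i (\<lambda>z. \<tau> z $ i) z))"
    by (intro L2_cyl_smooth smooth_diff smooth_dt w sd)
  show "L2 (cyl T \<Omega>) (\<lambda>z. (\<chi> i. dt (\<lambda>z. \<tau> z $ i) z - dx i w z) $ i)" for i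
    unfolding vec_lambda_beta by (intro L2_cyl_smooth smooth_diff smooth_dt smooth_dx w \<tau>)
  show "L2 \<Omega> (\<lambda>x. w (0, x))" "L2 \<Omega> (\<lambda>x. \<tau> (0, x) $ i)" for i
    using smooth_slice[OF w] smooth_slice[OF \<tau>] by (auto intro: L2_dom_smooth)
  fix \<phi> assume \<phi>: "test_fun ({..<T} \<times> \<Omega>) \<phi>"
  have s\<phi>: "smooth \<phi>" by (rule test_fun_smooth[OF \<phi>])
  note L = L2_cyl_smooth[OF s\<phi>] L2_cyl_smooth[OF smooth_dt[OF w]] L2_cyl_smooth[OF smooth_dx[OF \<tau>]] L2_cyl_smooth[OF sd]
  have "ip (cyl T \<Omega>) (\<lambda>z. dt w z - (\<Sum>i\<in>UNIV. dx i (\<lambda>z. \<tau> z $ i) z)) \<phi>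
      = ip (cyl T \<Omega>) (dt w) \<phi> - ip (cyl T \<Omega>) (\<lambda>z. \<Sum>i\<in>UNIV. dx i (\<lambda>z. \<tau> z $ i) z) \<phi>"
    by (rule ip_diff_left) (intro L)+
  also have "ip (cyl T \<Omega>) (\<lambda>z. \<Sum>i\<in>UNIV. dx i (\<lambda>z. \<tau> z $ i) z) \<phi> = (\<Sum>i\<in>UNIV. ip (cyl T \<Omega>) (dx i (\<lambda>z. \<tau> z $ i)) \<phi>)"
    unfolding ip_commute[of _ _ \<phi>] by (rule ip_sum_right) (intro L)+
  also have "\<dots> = - (\<Sum>i\<in>UNIV. ip (cyl T \<Omega>) (\<lambda>z. \<tau> z $ i) (dx i \<phi>))"
    by (simp add: space_ibp[OF \<tau> \<phi>] sum_negf)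
  also have "ip (cyl T \<Omega>) (dt w) \<phi> = - ip (cyl T \<Omega>) w (dt \<phi>) - ip \<Omega> (\<lambda>x. w (0, x)) (\<lambda>x. \<phi> (0, x))"
    by (rule time_ibp[OF w s\<phi>]) (rule test_fun_outside_T[OF \<phi>])
  finally show "ip (cyl T \<Omega>) (\<lambda>z. dt w z - (\<Sum>i\<in>UNIV. dx i (\<lambda>z. \<tau> z $ i) z)) \<phi> = - ip (cyl T \<Omega>) w (dt \<phi>)
      + (\<Sum>i\<in>UNIV. ip (cyl T \<Omega>) (\<lambda>z. \<tau> z $ i) (dx i \<phi>)) - ip \<Omega> (\<lambda>x. w (0, x)) (\<lambda>x. \<phi> (0, x))" by simp
  fix i
  have "ip (cyl T \<Omega>) (\<lambda>z. dt (\<lambda>z. \<tau> z $ i) z - dx i w z) \<phi> = ip (cyl T \<Omega>) (dt (\<lambda>z. \<tau> z $ i)) \<phi> - ip (cyl T \<Omega>) (dx i w) \<phi>"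
    by (rule ip_diff_left) (intro L2_cyl_smooth s\<phi> smooth_dt smooth_dx w \<tau>)+
  also have "ip (cyl T \<Omega>) (dt (\<lambda>z. \<tau> z $ i)) \<phi> = - ip (cyl T \<Omega>) (\<lambda>z. \<tau> z $ i) (dt \<phi>) - ip \<Omega> (\<lambda>x. \<tau> (0, x) $ i) (\<lambda>x. \<phi> (0, x))"
    by (rule time_ibp[OF \<tau> s\<phi>]) (rule test_fun_outside_T[OF \<phi>])
  finally show "ip (cyl T \<Omega>) (\<lambda>z. (\<chi> i. dt (\<lambda>z. \<tau> z $ i) z - dx i w z) $ i) \<phi> = - ip (cyl T \<Omega>) (\<lambda>z. \<tau> z $ i) (dt \<phi>)
      + ip (cyl T \<Omega>) w (dx i \<phi>) - ip \<Omega> (\<lambda>x. \<tau> (0, x) $ i) (\<lambda>x. \<phi> (0, x))"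
    by (simp add: space_ibp[OF w \<phi>])
qed

section \<open>Elements of \<open>Y\<close> tested against smooth functions\<close>

lemma ip_limit:
  assumes a: "L2 S a" "\<And>k. L2 S (ak k)" "L2 S b" and lim: "(\<lambda>k. ip S (\<lambda>z. a z - ak k z) (\<lambda>z. a z - ak k z)) \<longlonglongrightarrow> 0"
  shows "(\<lambda>k. ip S (ak k) b) \<longlonglongrightarrow> ip S a b"
proof -
  have "ip S (\<lambda>z. a z - ak k z) (\<lambda>z. a z - ak k z) = (norm (emb S a - emb S (ak k)))^2" for k
    using a by (simp add: norm_emb[symmetric] L2_diff emb_diff)
  then have "(\<lambda>k. sqrt ((norm (emb S a - emb S (ak k)))^2)) \<longlonglongrightarrow> sqrt 0" using lim by (intro tendsto_real_sqrt) simp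
  then have "(\<lambda>k. dist (emb S (ak k)) (emb S a)) \<longlonglongrightarrow> 0" by (simp add: dist_norm norm_minus_commute)
  then have "(\<lambda>k. emb S (ak k)) \<longlonglongrightarrow> emb S a" by (rule tendsto_dist_iff[THEN iffD2])
  then have "(\<lambda>k. inner (emb S (ak k)) (emb S b)) \<longlonglongrightarrow> inner (emb S a) (emb S b)" by (intro tendsto_intros)
  then show ?thesis using a by (simp add: inner_emb)
qed

lemma isY_L2:
  assumes "isY \<Omega> T \<phi> p pp G Gt L G0"
  shows "L2 (cyl T \<Omega>) \<phi>" "L2 (cyl T \<Omega>) p" "L2 (cyl T \<Omega>) (\<lambda>z. G z $ i)" "L2 (cyl T \<Omega>) (\<lambda>z. Gt z $ i)"
    "L2 (cyl T \<Omega>) L" "L2 \<Omega> (\<lambda>x. G0 x $ i)"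
  using assms unfolding isY_def L2v_def by (elim conjE, blast)+

text \<open>True for the approximating test functions by \<open>space_ibp\<close>. The defining sum
  of squared errors has nonnegative terms, so each of them tends to 0 and both identities pass to
  the limit.\<close>

lemma isY_grad:
  assumes Y: "isY \<Omega> T \<phi> p pp G Gt L G0" and \<psi>: "test_fun (UNIV \<times> \<Omega>) \<psi>"
  shows "ip (cyl T \<Omega>) (\<lambda>z. G z $ i) \<psi> = - ip (cyl T \<Omega>) \<phi> (dx i \<psi>)"
    and "ip (cyl T \<Omega>) (\<lambda>z. Gt z $ i) \<psi> = - ip (cyl T \<Omega>) p (dx i \<psi>)"
proof -
  note L = isY_L2[OF Y]
  let ?e = "\<lambda>a b. ip (cyl T \<Omega>) (\<lambda>z. a z - b z) (\<lambda>z. a z - b z)"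
  have "\<exists>\<psi>k. (\<forall>k. test_fun (UNIV \<times> \<Omega>) (\<psi>k k)) \<and>
    (\<lambda>k. ?e \<phi> (\<psi>k k) + ?e p (dt (\<psi>k k)) + (\<Sum>i\<in>UNIV. ?e (\<lambda>z. G z $ i) (dx i (\<psi>k k)) + ?e (\<lambda>z. Gt z $ i) (dx i (dt (\<psi>k k))))) \<longlonglongrightarrow> 0"
    using Y unfolding isY_def by (elim conjE)
  then obtain \<psi>k where tk: "\<And>k. test_fun (UNIV \<times> \<Omega>) (\<psi>k k)"
    and lim: "(\<lambda>k. ?e \<phi> (\<psi>k k) + ?e p (dt (\<psi>k k)) + (\<Sum>i\<in>UNIV. ?e (\<lambda>z. G z $ i) (dx i (\<psi>k k)) + ?e (\<lambda>z. Gt z $ i) (dx i (dt (\<psi>k k))))) \<longlonglongrightarrow> 0"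
    by blast
  have sk: "smooth (\<psi>k k)" for k by (rule test_fun_smooth[OF tk])
  have Lk: "L2 (cyl T \<Omega>) (\<psi>k k)" "L2 (cyl T \<Omega>) (dt (\<psi>k k))" "L2 (cyl T \<Omega>) (dx i (\<psi>k k))" "L2 (cyl T \<Omega>) (dx i (dt (\<psi>k k)))" for k i
    by (intro L2_cyl_smooth smooth_dt smooth_dx sk)+
  have e0: "?e a b \<ge> 0" for a b by (simp add: ip_def set_lebesgue_integral_def)
  have s0: "(\<Sum>i\<in>UNIV. ?e (\<lambda>z. G z $ i) (dx i (\<psi>k k)) + ?e (\<lambda>z. Gt z $ i) (dx i (dt (\<psi>k k)))) \<ge> 0" for k
    by (intro sum_nonneg add_nonneg_nonneg e0)
  have si: "?e (\<lambda>z. G z $ i) (dx i (\<psi>k k)) + ?e (\<lambda>z. Gt z $ i) (dx i (dt (\<psi>k k))) \<le>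
      (\<Sum>i\<in>UNIV. ?e (\<lambda>z. G z $ i) (dx i (\<psi>k k)) + ?e (\<lambda>z. Gt z $ i) (dx i (dt (\<psi>k k))))" for k i
    by (rule member_le_sum) (auto intro!: add_nonneg_nonneg e0)
  have l: "(\<lambda>k. ?e \<phi> (\<psi>k k)) \<longlonglongrightarrow> 0" "(\<lambda>k. ?e p (dt (\<psi>k k))) \<longlonglongrightarrow> 0"
    "(\<lambda>k. ?e (\<lambda>z. G z $ i) (dx i (\<psi>k k))) \<longlonglongrightarrow> 0" "(\<lambda>k. ?e (\<lambda>z. Gt z $ i) (dx i (dt (\<psi>k k)))) \<longlonglongrightarrow> 0"
  proof -
    have sw: "f \<longlonglongrightarrow> 0" if "\<And>k. 0 \<le> f k"
      "\<And>k. f k \<le> ?e \<phi> (\<psi>k k) + ?e p (dt (\<psi>k k)) + (\<Sum>i\<in>UNIV. ?e (\<lambda>z. G z $ i) (dx i (\<psi>k k)) + ?e (\<lambda>z. Gt z $ i) (dx i (dt (\<psi>k k))))" for f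
      by (rule tendsto_sandwich[OF _ _ tendsto_const lim]) (intro always_eventually allI that)+
    show "(\<lambda>k. ?e \<phi> (\<psi>k k)) \<longlonglongrightarrow> 0"
    proof (rule sw)
      fix k show "?e \<phi> (\<psi>k k) \<ge> 0" by (rule e0)
      show "?e \<phi> (\<psi>k k) \<le> ?e \<phi> (\<psi>k k) + ?e p (dt (\<psi>k k)) + (\<Sum>i\<in>UNIV. ?e (\<lambda>z. G z $ i) (dx i (\<psi>k k)) + ?e (\<lambda>z. Gt z $ i) (dx i (dt (\<psi>k k))))"
        using s0[of k] e0[of p "dt (\<psi>k k)"] by linarith
    qed
    show "(\<lambda>k. ?e p (dt (\<psi>k k))) \<longlonglongrightarrow> 0"
    proof (rule sw)
      fix k show "?e p (dt (\<psi>k k)) \<ge> 0" by (rule e0)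
      show "?e p (dt (\<psi>k k)) \<le> ?e \<phi> (\<psi>k k) + ?e p (dt (\<psi>k k)) + (\<Sum>i\<in>UNIV. ?e (\<lambda>z. G z $ i) (dx i (\<psi>k k)) + ?e (\<lambda>z. Gt z $ i) (dx i (dt (\<psi>k k))))"
        using s0[of k] e0[of \<phi> "\<psi>k k"] by linarith
    qed
    show "(\<lambda>k. ?e (\<lambda>z. G z $ i) (dx i (\<psi>k k))) \<longlonglongrightarrow> 0"
    proof (rule sw)
      fix k show "?e (\<lambda>z. G z $ i) (dx i (\<psi>k k)) \<ge> 0" by (rule e0)
      show "?e (\<lambda>z. G z $ i) (dx i (\<psi>k k)) \<le> ?e \<phi> (\<psi>k k) + ?e p (dt (\<psi>k k)) + (\<Sum>i\<in>UNIV. ?e (\<lambda>z. G z $ i) (dx i (\<psi>k k)) + ?e (\<lambda>z. Gt z $ i) (dx i (dt (\<psi>k k))))"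
        using si[where i=i and k=k] e0[of \<phi> "\<psi>k k"] e0[of p "dt (\<psi>k k)"] e0[of "\<lambda>z. Gt z $ i" "dx i (dt (\<psi>k k))"] by linarith
    qed
    show "(\<lambda>k. ?e (\<lambda>z. Gt z $ i) (dx i (dt (\<psi>k k)))) \<longlonglongrightarrow> 0"
    proof (rule sw)
      fix k show "?e (\<lambda>z. Gt z $ i) (dx i (dt (\<psi>k k))) \<ge> 0" by (rule e0)
      show "?e (\<lambda>z. Gt z $ i) (dx i (dt (\<psi>k k))) \<le> ?e \<phi> (\<psi>k k) + ?e p (dt (\<psi>k k)) + (\<Sum>i\<in>UNIV. ?e (\<lambda>z. G z $ i) (dx i (\<psi>k k)) + ?e (\<lambda>z. Gt z $ i) (dx i (dt (\<psi>k k))))"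
        using si[where i=i and k=k] e0[of \<phi> "\<psi>k k"] e0[of p "dt (\<psi>k k)"] e0[of "\<lambda>z. G z $ i" "dx i (\<psi>k k)"] by linarith
    qed
  qed
  have \<psi>L: "L2 (cyl T \<Omega>) \<psi>" "L2 (cyl T \<Omega>) (dx i \<psi>)"
    by (intro L2_cyl_smooth smooth_dx test_fun_smooth[OF \<psi>])+
  have "(\<lambda>k. ip (cyl T \<Omega>) (dx i (\<psi>k k)) \<psi>) \<longlonglongrightarrow> ip (cyl T \<Omega>) (\<lambda>z. G z $ i) \<psi>"
    by (rule ip_limit[OF L(3) Lk(3) \<psi>L(1) l(3)])
  moreover have "(\<lambda>k. - ip (cyl T \<Omega>) (\<psi>k k) (dx i \<psi>)) \<longlonglongrightarrow> - ip (cyl T \<Omega>) \<phi> (dx i \<psi>)"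
    by (intro tendsto_minus ip_limit[OF L(1) Lk(1) \<psi>L(2) l(1)])
  ultimately show "ip (cyl T \<Omega>) (\<lambda>z. G z $ i) \<psi> = - ip (cyl T \<Omega>) \<phi> (dx i \<psi>)"
    unfolding space_ibp[OF sk \<psi>] by (rule LIMSEQ_unique)
  have "(\<lambda>k. ip (cyl T \<Omega>) (dx i (dt (\<psi>k k))) \<psi>) \<longlonglongrightarrow> ip (cyl T \<Omega>) (\<lambda>z. Gt z $ i) \<psi>"
    by (rule ip_limit[OF L(4) Lk(4) \<psi>L(1) l(4)])
  moreover have "(\<lambda>k. - ip (cyl T \<Omega>) (dt (\<psi>k k)) (dx i \<psi>)) \<longlonglongrightarrow> - ip (cyl T \<Omega>) p (dx i \<psi>)"
    by (intro tendsto_minus ip_limit[OF L(2) Lk(2) \<psi>L(2) l(2)])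
  ultimately show "ip (cyl T \<Omega>) (\<lambda>z. Gt z $ i) \<psi> = - ip (cyl T \<Omega>) p (dx i \<psi>)"
    unfolding space_ibp[OF smooth_dt[OF sk] \<psi>] by (rule LIMSEQ_unique)
qed

text \<open>The second part says that the gradient has value zero at T. It follows from \<phi>(T) =
  0: the space derivative is moved to the test function, exchanged there with dt, and moved
  back.\<close>

lemma isY_time_compact:
  assumes Y: "isY \<Omega> T \<phi> p pp G Gt L G0"
  shows "test_fun ({..<T} \<times> \<Omega>) \<psi> \<Longrightarrow> ip (cyl T \<Omega>) (\<lambda>z. Gt z $ i) \<psi> =
      - ip (cyl T \<Omega>) (\<lambda>z. G z $ i) (dt \<psi>) - ip \<Omega> (\<lambda>x. G0 x $ i) (\<lambda>x. \<psi> (0, x))"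
    and "test_fun ({0<..} \<times> \<Omega>) \<psi> \<Longrightarrow> ip (cyl T \<Omega>) (\<lambda>z. Gt z $ i) \<psi> = - ip (cyl T \<Omega>) (\<lambda>z. G z $ i) (dt \<psi>)"
proof -
  have "\<forall>\<psi>. test_fun ({..<T} \<times> \<Omega>) \<psi> \<longrightarrow> (\<forall>i.
        ip (cyl T \<Omega>) (\<lambda>z. Gt z $ i) \<psi> = - ip (cyl T \<Omega>) (\<lambda>z. G z $ i) (dt \<psi>) - ip \<Omega> (\<lambda>x. G0 x $ i) (\<lambda>x. \<psi> (0, x)))"
    using Y unfolding isY_def by (elim conjE)
  then show "test_fun ({..<T} \<times> \<Omega>) \<psi> \<Longrightarrow> ip (cyl T \<Omega>) (\<lambda>z. Gt z $ i) \<psi> =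
      - ip (cyl T \<Omega>) (\<lambda>z. G z $ i) (dt \<psi>) - ip \<Omega> (\<lambda>x. G0 x $ i) (\<lambda>x. \<psi> (0, x))" by blast
  have pt: "\<forall>\<psi>. test_fun ({0<..} \<times> \<Omega>) \<psi> \<longrightarrow>
        ip (cyl T \<Omega>) p \<psi> = - ip (cyl T \<Omega>) \<phi> (dt \<psi>) \<and> ip (cyl T \<Omega>) pp \<psi> = - ip (cyl T \<Omega>) p (dt \<psi>)"
    using Y unfolding isY_def by (elim conjE)
  assume \<psi>: "test_fun ({0<..} \<times> \<Omega>) \<psi>"
  have \<psi>U: "test_fun (UNIV \<times> \<Omega>) \<psi>" by (rule test_fun_mono[OF \<psi>]) auto
  have "ip (cyl T \<Omega>) (\<lambda>z. Gt z $ i) \<psi> = - ip (cyl T \<Omega>) p (dx i \<psi>)" by (rule isY_grad(2)[OF Y \<psi>U])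
  also have "\<dots> = ip (cyl T \<Omega>) \<phi> (dt (dx i \<psi>))" using pt test_fun_dx[OF \<psi>] by simp
  also have "dt (dx i \<psi>) = dx i (dt \<psi>)"
    unfolding dt_eq_dd dx_eq_dd by (rule ext) (rule dd_symmetric[OF test_fun_smooth[OF \<psi>]])
  also have "ip (cyl T \<Omega>) \<phi> (dx i (dt \<psi>)) = - ip (cyl T \<Omega>) (\<lambda>z. G z $ i) (dt \<psi>)"
    using isY_grad(1)[OF Y test_fun_dt[OF \<psi>U]] by simp
  finally show "ip (cyl T \<Omega>) (\<lambda>z. Gt z $ i) \<psi> = - ip (cyl T \<Omega>) (\<lambda>z. G z $ i) (dt \<psi>)" .
qed

text \<open>Here m is restricted neither in time nor in space. The partition of [0, T] separates the
  two ends of the interval; cut-offs \<kappa> n in space are removed by dominated convergence, which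
  needs no bound on their derivatives because only time is differentiated.\<close>

lemma isY_time:
  assumes Y: "isY \<Omega> T \<phi> p pp G Gt L G0" and m: "smooth m"
  shows "ip (cyl T \<Omega>) (dt m) (\<lambda>z. G z $ i) + ip (cyl T \<Omega>) m (\<lambda>z. Gt z $ i) + ip \<Omega> (\<lambda>x. m (0, x)) (\<lambda>x. G0 x $ i) = 0"
proof -
  note L = isY_L2[OF Y]
  obtain \<theta>1 \<theta>2 where \<theta>: "test_fun {..<T} \<theta>1" "test_fun {0<..} \<theta>2" "\<theta>1 0 = 1"
    "\<And>t. 0 \<le> t \<Longrightarrow> t \<le> T \<Longrightarrow> \<theta>1 t + \<theta>2 t = 1" using time_partition[OF T] by metis
  obtain \<kappa> where \<kappa>: "\<And>n. test_fun \<Omega> (\<kappa> n)" "\<And>n x. 0 \<le> \<kappa> n x" "\<And>n x. \<kappa> n x \<le> 1"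
    "\<And>x. (\<lambda>n. \<kappa> n x) \<longlonglongrightarrow> indicator \<Omega> x" using open_indicator_approx[OF op] by metis
  have s\<kappa>: "smooth (\<kappa> n)" for n by (rule test_fun_smooth[OF \<kappa>(1)])
  have s\<theta>: "smooth \<theta>1" "smooth \<theta>2" using \<theta> test_fun_smooth by blast+
  let ?k = "\<lambda>n (z :: real \<times> (real^'d)). \<kappa> n (snd z)"
  have zero: "ip (cyl T \<Omega>) (\<lambda>z. ?k n z * dt m z) (\<lambda>z. G z $ i) + ip (cyl T \<Omega>) (\<lambda>z. ?k n z * m z) (\<lambda>z. Gt z $ i)
      + ip \<Omega> (\<lambda>x. \<kappa> n x * m (0, x)) (\<lambda>x. G0 x $ i) = 0" for n
  proof -
    define m1 where "m1 z = tensor \<theta>1 (\<kappa> n) z * m z" for z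
    define m2 where "m2 z = tensor \<theta>2 (\<kappa> n) z * m z" for z
    have t1: "test_fun ({..<T} \<times> \<Omega>) m1" unfolding m1_def[abs_def]
      by (intro test_fun_mult m test_fun_tensor[OF \<theta>(1) \<kappa>(1)])
    have t2: "test_fun ({0<..} \<times> \<Omega>) m2" unfolding m2_def[abs_def]
      by (intro test_fun_mult m test_fun_tensor[OF \<theta>(2) \<kappa>(1)])
    have s: "smooth m1" "smooth m2" using t1 t2 test_fun_smooth by blast+
    have sum: "m1 z + m2 z = ?k n z * m z" if "z \<in> cyl T \<Omega>" for z
      using \<theta>(4)[of "fst z"] that by (cases z) (auto simp: m1_def m2_def tensor_def cyl_def distrib_right[symmetric])
    have dsum: "dt m1 z + dt m2 z = ?k n z * dt m z" if z: "z \<in> cyl T \<Omega>" for z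
    proof -
      have "dt m1 z + dt m2 z = dd (1, 0) (\<lambda>z. m1 z + m2 z) z" by (simp add: dt_eq_dd dd_add s)
      also have "\<dots> = dd (1, 0) (\<lambda>z. ?k n z * m z) z" by (rule dd_open_cong[OF cyl_open z sum])
      also have "\<dots> = ?k n z * dt m z"
        by (simp add: dd_mult smooth_snd_compose s\<kappa> m dd_snd_compose dd_zero dt_eq_dd)
      finally show ?thesis .
    qed
    have e1: "ip (cyl T \<Omega>) (dt m1) (\<lambda>z. G z $ i) + ip (cyl T \<Omega>) m1 (\<lambda>z. Gt z $ i) + ip \<Omega> (\<lambda>x. m1 (0, x)) (\<lambda>x. G0 x $ i) = 0"
      using isY_time_compact(1)[OF Y t1, of i] unfolding ip_commute[of _ "\<lambda>z. Gt z $ i"] ip_commute[of _ "\<lambda>z. G z $ i"]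
        ip_commute[of _ "\<lambda>z. G0 z $ i"] by linarith
    have e2: "ip (cyl T \<Omega>) (dt m2) (\<lambda>z. G z $ i) + ip (cyl T \<Omega>) m2 (\<lambda>z. Gt z $ i) = 0"
      using isY_time_compact(2)[OF Y t2, of i] unfolding ip_commute[of _ "\<lambda>z. Gt z $ i"] ip_commute[of _ "\<lambda>z. G z $ i"]
      by linarith
    have "ip (cyl T \<Omega>) (dt m1) (\<lambda>z. G z $ i) + ip (cyl T \<Omega>) (dt m2) (\<lambda>z. G z $ i) = ip (cyl T \<Omega>) (\<lambda>z. dt m1 z + dt m2 z) (\<lambda>z. G z $ i)"
      by (rule ip_add_left[symmetric]) (intro L L2_cyl_smooth smooth_dt s)+
    also have "\<dots> = ip (cyl T \<Omega>) (\<lambda>z. ?k n z * dt m z) (\<lambda>z. G z $ i)" by (rule ip_cong) (simp_all add: dsum)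
    finally have f1: "ip (cyl T \<Omega>) (dt m1) (\<lambda>z. G z $ i) + ip (cyl T \<Omega>) (dt m2) (\<lambda>z. G z $ i)
      = ip (cyl T \<Omega>) (\<lambda>z. ?k n z * dt m z) (\<lambda>z. G z $ i)" .
    have "ip (cyl T \<Omega>) m1 (\<lambda>z. Gt z $ i) + ip (cyl T \<Omega>) m2 (\<lambda>z. Gt z $ i) = ip (cyl T \<Omega>) (\<lambda>z. m1 z + m2 z) (\<lambda>z. Gt z $ i)"
      by (rule ip_add_left[symmetric]) (intro L L2_cyl_smooth s)+
    also have "\<dots> = ip (cyl T \<Omega>) (\<lambda>z. ?k n z * m z) (\<lambda>z. Gt z $ i)" by (rule ip_cong) (simp_all add: sum)
    finally have f2: "ip (cyl T \<Omega>) m1 (\<lambda>z. Gt z $ i) + ip (cyl T \<Omega>) m2 (\<lambda>z. Gt z $ i)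
      = ip (cyl T \<Omega>) (\<lambda>z. ?k n z * m z) (\<lambda>z. Gt z $ i)" .
    have f3: "ip \<Omega> (\<lambda>x. m1 (0, x)) (\<lambda>x. G0 x $ i) = ip \<Omega> (\<lambda>x. \<kappa> n x * m (0, x)) (\<lambda>x. G0 x $ i)"
      by (rule ip_cong) (simp_all add: m1_def tensor_def \<theta>(3))
    show ?thesis using e1 e2 f1 f2 f3 by linarith
  qed
  have bk: "?k n \<in> borel_measurable borel" for n by (intro borel_measurable_snd_compose smooth_borel s\<kappa>)
  have lk: "(\<lambda>n. \<kappa> n x) \<longlonglongrightarrow> 1" if "x \<in> \<Omega>" for x using \<kappa>(4)[of x] that by simp
  have ak: "\<bar>\<kappa> n x\<bar> \<le> 1" for n x using \<kappa>(2,3)[of n x] by simp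
  have lim: "(\<lambda>n. ip (cyl T \<Omega>) (\<lambda>z. ?k n z * a z) b) \<longlonglongrightarrow> ip (cyl T \<Omega>) a b" if a: "smooth a" and b: "L2 (cyl T \<Omega>) b" for a b
  proof (rule ip_tendsto[OF L2_cyl_smooth[OF a] b, where C=1])
    show "(\<lambda>z. ?k n z * a z) \<in> borel_measurable borel" for n by (intro borel_measurable_times bk smooth_borel a)
    show "a \<in> borel_measurable borel" by (rule smooth_borel[OF a])
    show "\<bar>?k n z * a z\<bar> \<le> 1 * \<bar>a z\<bar>" for n z unfolding abs_mult by (intro mult_right_mono ak) simp
    show "(\<lambda>n. ?k n z * a z) \<longlonglongrightarrow> a z" if "z \<in> cyl T \<Omega>" for z
      using tendsto_mult_right[OF lk[of "snd z"], of "a z"] that by (cases z) (simp add: cyl_def)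
  qed
  have sl: "smooth (\<lambda>x. m (0, x))" by (rule smooth_slice[OF m])
  have lim0: "(\<lambda>n. ip \<Omega> (\<lambda>x. \<kappa> n x * m (0, x)) (\<lambda>x. G0 x $ i)) \<longlonglongrightarrow> ip \<Omega> (\<lambda>x. m (0, x)) (\<lambda>x. G0 x $ i)"
  proof (rule ip_tendsto[OF L2_dom_smooth[OF sl] L(6), where C=1])
    show "(\<lambda>x. \<kappa> n x * m (0, x)) \<in> borel_measurable borel" for n by (intro borel_measurable_times smooth_borel s\<kappa> sl)
    show "(\<lambda>x. m (0, x)) \<in> borel_measurable borel" by (rule smooth_borel[OF sl])
    show "\<bar>\<kappa> n x * m (0, x)\<bar> \<le> 1 * \<bar>m (0, x)\<bar>" for n x unfolding abs_mult by (intro mult_right_mono ak) simp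
    show "(\<lambda>n. \<kappa> n x * m (0, x)) \<longlonglongrightarrow> m (0, x)" if "x \<in> \<Omega>" for x
      using tendsto_mult_right[OF lk[OF that], of "m (0, x)"] by simp
  qed
  from tendsto_add[OF tendsto_add[OF lim[OF smooth_dt[OF m] isY_L2(3)[OF Y, of i]] lim[OF m isY_L2(4)[OF Y, of i]]] lim0]
  show ?thesis unfolding zero by (simp add: LIMSEQ_const_iff)
qed

text \<open>The gradient of \<^term>\<open>w\<close> vanishes almost everywhere on the zero set of \<^term>\<open>w\<close>: both sides are
  limits of the same integrals of truncations of \<^term>\<open>w\<close>.\<close>

lemma vanishing_gradient:
  assumes w: "smooth w" and e: "\<And>n. smooth (\<eta> n)" "\<And>n s. \<bar>\<eta> n s\<bar> \<le> C * \<bar>s\<bar>" "\<And>n s. \<bar>dd 1 (\<eta> n) s\<bar> \<le> C"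
    "\<And>s. (\<lambda>n. \<eta> n s) \<longlonglongrightarrow> s" "\<And>s. s \<noteq> 0 \<Longrightarrow> (\<lambda>n. dd 1 (\<eta> n) s) \<longlonglongrightarrow> 1" "\<And>n. dd 1 (\<eta> n) 0 = 0"
    and b: "L2 (cyl T \<Omega>) b"
  shows "ip (cyl T \<Omega>) (\<lambda>z. if w z = 0 then 0 else dx i w z) b = ip (cyl T \<Omega>) (dx i w) b"
proof -
  let ?g = "\<lambda>z. if w z = 0 then 0 else dx i w z"
  have sd: "smooth (dx i w)" by (intro smooth_dx w)
  have gb: "?g \<in> borel_measurable borel"
  proof -
    have [measurable]: "w \<in> borel_measurable borel" "dx i w \<in> borel_measurable borel"
      by (intro smooth_borel smooth_dx w)+
    show ?thesis by measurable
  qed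
  obtain c where c: "\<And>z. z \<in> cyl T \<Omega> \<Longrightarrow> \<bar>dx i w z\<bar> \<le> c" "c \<ge> 0"
    using continuous_bounded_on[OF cyl_bounded smooth_continuous[OF sd]] by metis
  have Lg: "L2 (cyl T \<Omega>) ?g" by (rule L2_bounded[OF cyl_bounded cyl_borel gb, of c]) (use c in auto)
  have Ld: "L2 (cyl T \<Omega>) (dx i w)" by (rule L2_cyl_smooth[OF sd])
  have gL: "L2 (cyl T \<Omega>) (\<lambda>z. ?g z - dx i w z)" by (rule L2_diff[OF Lg Ld])
  have "ip (cyl T \<Omega>) ?g \<psi> = ip (cyl T \<Omega>) (dx i w) \<psi>" if \<psi>: "test_fun (cyl T \<Omega>) \<psi>" for \<psi>
  proof -
    have \<psi>': "test_fun ({0<..<T} \<times> \<Omega>) \<psi>" using \<psi> by (simp add: cyl_def)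
    have s\<psi>: "smooth \<psi>" by (rule test_fun_smooth[OF \<psi>])
    have sn: "smooth (\<lambda>z. \<eta> n (w z))" for n by (rule smooth_compose_real[OF e(1) w])
    have dn: "dx i (\<lambda>z. \<eta> n (w z)) = (\<lambda>z. dd 1 (\<eta> n) (w z) * dx i w z)" for n
      by (simp add: dx_eq_dd dd_compose_real e(1) w)
    have 1: "(\<lambda>n. ip (cyl T \<Omega>) (dx i (\<lambda>z. \<eta> n (w z))) \<psi>) \<longlonglongrightarrow> ip (cyl T \<Omega>) ?g \<psi>"
    proof (rule ip_tendsto[OF Ld L2_cyl_smooth[OF s\<psi>], where C=C])
      show "dx i (\<lambda>z. \<eta> n (w z)) \<in> borel_measurable borel" for n by (intro smooth_borel smooth_dx sn)
      show "?g \<in> borel_measurable borel" by (rule gb)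
      show "\<bar>dx i (\<lambda>z. \<eta> n (w z)) z\<bar> \<le> C * \<bar>dx i w z\<bar>" for n z
        unfolding dn abs_mult by (intro mult_right_mono e) simp
      show "(\<lambda>n. dx i (\<lambda>z. \<eta> n (w z)) z) \<longlonglongrightarrow> ?g z" for z
        using tendsto_mult_right[OF e(5)[of "w z"], of "dx i w z"] by (simp add: dn e(6))
    qed
    have 2: "(\<lambda>n. ip (cyl T \<Omega>) (\<lambda>z. \<eta> n (w z)) (dx i \<psi>)) \<longlonglongrightarrow> ip (cyl T \<Omega>) w (dx i \<psi>)"
      by (rule ip_tendsto[OF L2_cyl_smooth[OF w] L2_cyl_smooth[OF smooth_dx[OF s\<psi>]], where C=C])
        (intro smooth_borel sn w e)+
    have "(\<lambda>n. ip (cyl T \<Omega>) (dx i (\<lambda>z. \<eta> n (w z))) \<psi>) \<longlonglongrightarrow> - ip (cyl T \<Omega>) w (dx i \<psi>)"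
      unfolding space_ibp[OF sn \<psi>'] by (rule tendsto_minus[OF 2])
    then have "ip (cyl T \<Omega>) ?g \<psi> = - ip (cyl T \<Omega>) w (dx i \<psi>)" using 1 LIMSEQ_unique by blast
    then show ?thesis by (simp add: space_ibp[OF w \<psi>'])
  qed
  then have "emb (cyl T \<Omega>) (\<lambda>z. ?g z - dx i w z) = 0"
    using Lg Ld L2_test[OF _ cyl_borel]
    by (intro l2_zero_if_test[OF cyl_open cyl_bounded emb_in_supp[OF gL]])
      (simp add: inner_emb[OF gL] ip_diff_left)
  then have "emb (cyl T \<Omega>) ?g = emb (cyl T \<Omega>) (dx i w)" by (simp add: emb_diff[OF Lg Ld])
  then show ?thesis using inner_emb[OF Lg b] inner_emb[OF Ld b] by simp
qed

text \<open>The function w vanishes on the lateral boundary but not near it, so it is no admissible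
  test for the weak Laplacian. Cutting off its small values by \<open>\<eta> n\<close> makes it one.
  In the limit the gradients converge to that of w only off the zero set of w, whence
  \<open>vanishing_gradient\<close>.\<close>

lemma isY_space:
  assumes Y: "isY \<Omega> T \<phi> p pp G Gt L G0" and w: "smooth w"
    and bc: "\<And>t x. t \<in> {0<..<T} \<Longrightarrow> x \<in> frontier \<Omega> \<Longrightarrow> w (t, x) = 0"
  shows "ip (cyl T \<Omega>) w L + (\<Sum>i\<in>UNIV. ip (cyl T \<Omega>) (dx i w) (\<lambda>z. G z $ i)) = 0"
proof -
  note LY = isY_L2[OF Y]
  obtain \<eta> :: "nat \<Rightarrow> real \<Rightarrow> real" and C where e: "\<And>n. smooth (\<eta> n)" "\<And>n s. \<bar>s\<bar> \<le> 1 / (n + 1) \<Longrightarrow> \<eta> n s = 0"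
    "\<And>n s. \<bar>\<eta> n s\<bar> \<le> C * \<bar>s\<bar>" "\<And>n s. \<bar>dd 1 (\<eta> n) s\<bar> \<le> C"
    "\<And>s. (\<lambda>n. \<eta> n s) \<longlonglongrightarrow> s" "\<And>s. s \<noteq> 0 \<Longrightarrow> (\<lambda>n. dd 1 (\<eta> n) s) \<longlonglongrightarrow> 1" "\<And>n. dd 1 (\<eta> n) 0 = 0"
    by (rule truncation) blast
  obtain \<xi> where x: "\<And>n. test_fun {0<..<T} (\<xi> n)" "\<And>n t. 0 \<le> \<xi> n t" "\<And>n t. \<xi> n t \<le> 1"
    "\<And>t. (\<lambda>n. \<xi> n t) \<longlonglongrightarrow> indicator {0<..<T} t" using open_indicator_approx[OF open_greaterThanLessThan] by metis
  have sx: "smooth (\<xi> n)" for n by (rule test_fun_smooth[OF x(1)])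
  have C0: "C \<ge> 0" using e(4)[of 0 0] by linarith
  \<comment> \<open>The factor \<open>\<xi> n\<close> keeps the support away from both ends of the
    time interval; space derivatives do not touch it.\<close>
  define f where "f n z = \<xi> n (fst z) * \<eta> n (w z)" for n z
  have sf: "smooth (f n)" for n unfolding f_def[abs_def]
    by (intro smooth_mult smooth_fst_compose sx smooth_compose_real[OF e(1) w])
  have df: "dx i (f n) = (\<lambda>z. \<xi> n (fst z) * (dd 1 (\<eta> n) (w z) * dx i w z))" for n i
    unfolding f_def[abs_def] dx_eq_dd
    by (simp add: dd_mult smooth_fst_compose sx smooth_compose_real[OF e(1) w] dd_fst_compose dd_zero dd_compose_real e(1) w)
  have zero: "ip (cyl T \<Omega>) L (f n) + (\<Sum>i\<in>UNIV. ip (cyl T \<Omega>) (\<lambda>z. G z $ i) (dx i (f n))) = 0" for n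
  proof -
    define \<psi> where "\<psi> z = (if z \<in> cyl T \<Omega> then f n z else 0)" for z
    obtain N where N: "compact N" "N \<subseteq> {0<..<T}" "\<And>t. t \<notin> N \<Longrightarrow> \<xi> n t = 0" using test_funE[OF x(1)] by metis
    \<comment> \<open>A compact set outside which \<psi> vanishes. The values of w on it are bounded
      away from 0, so it does not meet the lateral boundary.\<close>
    let ?K = "(N \<times> closure \<Omega>) \<inter> {z. \<bar>w z\<bar> \<ge> 1 / (n + 1)}"
    have cw: "continuous_on UNIV w" by (rule smooth_continuous[OF w])
    have K: "compact ?K"
      using bd N(1) by (intro compact_Int_closed compact_Times closed_Collect_le continuous_intros cw) (auto simp: compact_closure)
    have KQ: "?K \<subseteq> cyl T \<Omega>"
    proof
      fix z assume z: "z \<in> ?K"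
      obtain t y where ty: "z = (t, y)" by (cases z)
      have "t \<in> {0<..<T}" "y \<in> closure \<Omega>" "w (t, y) \<noteq> 0" using z N(2) by (auto simp: ty)
      moreover from this have "y \<notin> frontier \<Omega>" using bc by blast
      ultimately have "y \<in> \<Omega>" using op by (auto simp: frontier_def interior_open)
      then show "z \<in> cyl T \<Omega>" using \<open>t \<in> {0<..<T}\<close> by (simp add: ty cyl_def)
    qed
    have \<psi>0: "\<psi> z = 0" if "z \<notin> ?K" for z
    proof (cases "z \<in> cyl T \<Omega>")
      case True
      then have "fst z \<notin> N \<or> \<bar>w z\<bar> \<le> 1 / (n + 1)"
        using that closure_subset[of \<Omega>] by (cases z) (auto simp: cyl_def)
      then show ?thesis using N(3) e(2) by (auto simp: \<psi>_def f_def)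
    qed (simp add: \<psi>_def)
    \<comment> \<open>The open sets \<open>cyl T \<Omega>\<close> and the complement of
      \<open>?K\<close> cover the whole space; \<psi> is \<open>f n\<close> on the first and 0 on
      the second.\<close>
    have "smooth \<psi>"
    proof (rule smooth_locally)
      fix z show "\<exists>S g. open S \<and> z \<in> S \<and> smooth g \<and> (\<forall>y\<in>S. \<psi> y = g y)"
      proof (cases "z \<in> cyl T \<Omega>")
        case True
        then show ?thesis using cyl_open sf by (intro exI[of _ "cyl T \<Omega>"] exI[of _ "f n"]) (auto simp: \<psi>_def)
      next
        case False
        then have "z \<in> - ?K" using KQ by blast
        moreover have "open (- ?K)" using K compact_imp_closed by blast
        ultimately show ?thesis using \<psi>0 by (intro exI[of _ "- ?K"] exI[of _ "\<lambda>z. 0"]) auto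
      qed
    qed
    then have t\<psi>: "test_fun (cyl T \<Omega>) \<psi>" by (rule test_funI[OF _ K KQ]) (rule \<psi>0)
    then have t\<psi>': "test_fun (UNIV \<times> \<Omega>) \<psi>" by (rule test_fun_mono) (auto simp: cyl_def)
    have "\<forall>\<psi>. test_fun (cyl T \<Omega>) \<psi> \<longrightarrow>
        ip (cyl T \<Omega>) L \<psi> = ip (cyl T \<Omega>) \<phi> (\<lambda>z. \<Sum>i\<in>UNIV. dx i (dx i \<psi>) z)"
      using Y unfolding isY_def by (elim conjE)
    then have "ip (cyl T \<Omega>) L \<psi> = ip (cyl T \<Omega>) \<phi> (\<lambda>z. \<Sum>i\<in>UNIV. dx i (dx i \<psi>) z)" using t\<psi> by blast
    also have "\<dots> = (\<Sum>i\<in>UNIV. ip (cyl T \<Omega>) \<phi> (dx i (dx i \<psi>)))"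
      by (rule ip_sum_right[OF LY(1)]) (intro L2_cyl_smooth smooth_dx test_fun_smooth[OF t\<psi>])
    also have "\<dots> = - (\<Sum>i\<in>UNIV. ip (cyl T \<Omega>) (\<lambda>z. G z $ i) (dx i \<psi>))"
      by (simp add: isY_grad(1)[OF Y test_fun_dx[OF t\<psi>']] sum_negf)
    finally have "ip (cyl T \<Omega>) L \<psi> + (\<Sum>i\<in>UNIV. ip (cyl T \<Omega>) (\<lambda>z. G z $ i) (dx i \<psi>)) = 0" by simp
    moreover have "ip (cyl T \<Omega>) L \<psi> = ip (cyl T \<Omega>) L (f n)" by (rule ip_cong) (simp_all add: \<psi>_def)
    moreover have "ip (cyl T \<Omega>) (\<lambda>z. G z $ i) (dx i \<psi>) = ip (cyl T \<Omega>) (\<lambda>z. G z $ i) (dx i (f n))" for i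
    proof (rule ip_cong[OF refl])
      fix z assume z: "z \<in> cyl T \<Omega>"
      show "dx i \<psi> z = dx i (f n) z" unfolding dx_eq_dd
        by (rule dd_open_cong[OF cyl_open z]) (simp add: \<psi>_def)
    qed
    ultimately show ?thesis by simp
  qed
  have x1: "(\<lambda>n. \<xi> n (fst z)) \<longlonglongrightarrow> 1" if "z \<in> cyl T \<Omega>" for z
    using x(4)[of "fst z"] that by (cases z) (auto simp: cyl_def)
  have ax: "\<bar>\<xi> n t\<bar> \<le> 1" for n t using x(2,3)[of n t] by simp
  have l1: "(\<lambda>n. ip (cyl T \<Omega>) (f n) L) \<longlonglongrightarrow> ip (cyl T \<Omega>) w L"
  proof (rule ip_tendsto[OF L2_cyl_smooth[OF w] LY(5), where C=C])
    show "f n \<in> borel_measurable borel" for n by (rule smooth_borel[OF sf])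
    show "w \<in> borel_measurable borel" by (rule smooth_borel[OF w])
    show "\<bar>f n z\<bar> \<le> C * \<bar>w z\<bar>" for n z
      using mult_mono[OF ax[of n "fst z"] e(3)[of n "w z"]] by (simp add: f_def abs_mult)
    show "(\<lambda>n. f n z) \<longlonglongrightarrow> w z" if "z \<in> cyl T \<Omega>" for z
      using tendsto_mult[OF x1[OF that] e(5)[of "w z"]] by (simp add: f_def)
  qed
  have l2': "(\<lambda>n. ip (cyl T \<Omega>) (dx i (f n)) (\<lambda>z. G z $ i)) \<longlonglongrightarrow>
      ip (cyl T \<Omega>) (\<lambda>z. if w z = 0 then 0 else dx i w z) (\<lambda>z. G z $ i)" for i
  proof (rule ip_tendsto[OF L2_cyl_smooth[OF smooth_dx[OF w]] LY(3), where C=C])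
    show "dx i (f n) \<in> borel_measurable borel" for n by (intro smooth_borel smooth_dx sf)
    show "(\<lambda>z. if w z = 0 then 0 else dx i w z) \<in> borel_measurable borel"
    proof -
      have [measurable]: "w \<in> borel_measurable borel" "dx i w \<in> borel_measurable borel"
        by (intro smooth_borel smooth_dx w)+
      show ?thesis by measurable
    qed
    show "\<bar>dx i (f n) z\<bar> \<le> C * \<bar>dx i w z\<bar>" for n z
    proof -
      have "\<bar>\<xi> n (fst z)\<bar> * \<bar>dd 1 (\<eta> n) (w z)\<bar> \<le> 1 * C" by (intro mult_mono ax e) (use C0 in auto)
      then have "\<bar>\<xi> n (fst z)\<bar> * \<bar>dd 1 (\<eta> n) (w z)\<bar> * \<bar>dx i w z\<bar> \<le> 1 * C * \<bar>dx i w z\<bar>" by (intro mult_right_mono) auto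
      then show ?thesis by (simp add: df abs_mult mult.assoc)
    qed
    show "(\<lambda>n. dx i (f n) z) \<longlonglongrightarrow> (if w z = 0 then 0 else dx i w z)" if "z \<in> cyl T \<Omega>" for z
      using tendsto_mult[OF x1[OF that] tendsto_mult_right[OF e(6)[of "w z"], of "dx i w z"]] by (simp add: df e(7))
  qed
  have vg: "ip (cyl T \<Omega>) (\<lambda>z. if w z = 0 then 0 else dx i w z) (\<lambda>z. G z $ i) = ip (cyl T \<Omega>) (dx i w) (\<lambda>z. G z $ i)" for i
    by (rule vanishing_gradient[OF w e(1) e(3) e(4) e(5) e(6) e(7) LY(3)])
  have l2: "(\<lambda>n. ip (cyl T \<Omega>) (dx i (f n)) (\<lambda>z. G z $ i)) \<longlonglongrightarrow> ip (cyl T \<Omega>) (dx i w) (\<lambda>z. G z $ i)" for i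
    using l2'[of i] unfolding vg[of i] .
  have "(\<lambda>n. ip (cyl T \<Omega>) (f n) L + (\<Sum>i\<in>UNIV. ip (cyl T \<Omega>) (dx i (f n)) (\<lambda>z. G z $ i))) \<longlonglongrightarrow>
      ip (cyl T \<Omega>) w L + (\<Sum>i\<in>UNIV. ip (cyl T \<Omega>) (dx i w) (\<lambda>z. G z $ i))"
    by (intro tendsto_add l1 tendsto_sum l2)
  moreover have "ip (cyl T \<Omega>) (f n) L + (\<Sum>i\<in>UNIV. ip (cyl T \<Omega>) (dx i (f n)) (\<lambda>z. G z $ i)) = 0" for n
  proof -
    have "(\<Sum>i\<in>UNIV. ip (cyl T \<Omega>) (dx i (f n)) (\<lambda>z. G z $ i)) = (\<Sum>i\<in>UNIV. ip (cyl T \<Omega>) (\<lambda>z. G z $ i) (dx i (f n)))"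
      by (intro sum.cong refl ip_commute)
    then show ?thesis using zero[of n] ip_commute[of "cyl T \<Omega>" "f n" L] by linarith
  qed
  ultimately show ?thesis by (simp add: LIMSEQ_const_iff)
qed

text \<open>The form splits: the terms that contain \<tau> vanish by \<open>isY_time\<close>, those
  that contain w by \<open>isY_space\<close>.\<close>

lemma smooth_pair_inV0:
  assumes "smooth_pair_bc \<Omega> T w \<tau>" and Y: "isY \<Omega> T \<phi> p pp G Gt L G0"
  shows "D_form \<Omega> T w \<tau> (\<lambda>z. \<chi> i. dt (\<lambda>z. \<tau> z $ i) z - dx i w z) (\<lambda>x. \<tau> (0, x)) G Gt L G0 = 0"
proof -
  have w: "smooth w" and \<tau>: "\<And>i. smooth (\<lambda>z. \<tau> z $ i)"
    and bc: "\<And>t x. t \<in> {0<..<T} \<Longrightarrow> x \<in> frontier \<Omega> \<Longrightarrow> w (t, x) = 0"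
    using assms(1) by (auto simp: smooth_pair_bc_def)
  note LY = isY_L2[OF Y]
  have h: "ip (cyl T \<Omega>) (\<lambda>z. dt (\<lambda>z. \<tau> z $ i) z - dx i w z) (\<lambda>z. G z $ i)
      = ip (cyl T \<Omega>) (dt (\<lambda>z. \<tau> z $ i)) (\<lambda>z. G z $ i) - ip (cyl T \<Omega>) (dx i w) (\<lambda>z. G z $ i)" for i
    by (rule ip_diff_left) (intro LY L2_cyl_smooth smooth_dt smooth_dx w \<tau>)+
  have "(\<Sum>i\<in>UNIV. ip (cyl T \<Omega>) (dt (\<lambda>z. \<tau> z $ i)) (\<lambda>z. G z $ i) + ip (cyl T \<Omega>) (\<lambda>z. \<tau> z $ i) (\<lambda>z. Gt z $ i)
      + ip \<Omega> (\<lambda>x. \<tau> (0, x) $ i) (\<lambda>x. G0 x $ i)) = 0"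
    by (rule sum.neutral) (use isY_time[OF Y \<tau>] in blast)
  then show ?thesis
    using isY_space[OF Y w bc] by (simp add: D_form_def ipv_def h sum.distrib sum_subtractf)
qed

end

section \<open>Orthogonality to smooth pairs implies vanishing\<close>

context cylinder
begin

text \<open>Only the product must vanish at T. The rule therefore serves weights that are zero there
  as well as test functions that are.\<close>

lemma tensor_time:
  assumes \<eta>: "smooth \<eta>" and f: "L2 \<Omega> f" and \<theta>: "smooth \<theta>" and T0: "\<And>x. x \<in> \<Omega> \<Longrightarrow> \<eta> T * \<theta> (T, x) = 0"
  shows "ip (cyl T \<Omega>) (tensor (dd 1 \<eta>) f) \<theta> = - ip (cyl T \<Omega>) (tensor \<eta> f) (dt \<theta>) - \<eta> 0 * ip \<Omega> f (\<lambda>x. \<theta> (0, x))"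
proof -
  let ?m = "\<lambda>z. \<eta> (fst z) * \<theta> z" and ?f = "tensor (\<lambda>t. 1) f"
  have sf: "smooth (\<lambda>z::real \<times> (real^'d). \<eta> (fst z))" by (rule smooth_fst_compose[OF \<eta>])
  have dm: "dt ?m = (\<lambda>z. \<eta> (fst z) * dt \<theta> z + dd 1 \<eta> (fst z) * \<theta> z)"
    by (simp add: dt_eq_dd dd_mult sf \<theta> dd_fst_compose \<eta>)
  have "ip (cyl T \<Omega>) ?f (dt ?m) = - ip \<Omega> f (\<lambda>x. ?m (0, x))"
    by (rule time_integration[OF f smooth_mult[OF sf \<theta>]]) (simp add: T0)
  also have "ip (cyl T \<Omega>) ?f (dt ?m) = ip (cyl T \<Omega>) ?f (\<lambda>z. \<eta> (fst z) * dt \<theta> z) + ip (cyl T \<Omega>) ?f (\<lambda>z. dd 1 \<eta> (fst z) * \<theta> z)"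
    unfolding dm by (rule ip_add_right[OF L2_tensor[OF L2_time_smooth[OF smooth_const] f]])
      (intro L2_cyl_smooth smooth_mult sf \<theta> smooth_dt smooth_fst_compose smooth_dd \<eta>)+
  also have "ip (cyl T \<Omega>) ?f (\<lambda>z. \<eta> (fst z) * dt \<theta> z) = ip (cyl T \<Omega>) (tensor \<eta> f) (dt \<theta>)"
    by (simp add: ip_def tensor_def mult_ac)
  also have "ip (cyl T \<Omega>) ?f (\<lambda>z. dd 1 \<eta> (fst z) * \<theta> z) = ip (cyl T \<Omega>) (tensor (dd 1 \<eta>) f) \<theta>"
    by (simp add: ip_def tensor_def mult_ac)
  also have "ip \<Omega> f (\<lambda>x. ?m (0, x)) = \<eta> 0 * ip \<Omega> f (\<lambda>x. \<theta> (0, x))"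
    by (simp add: ip_def set_lebesgue_integral_def mult.left_commute[of _ "\<eta> 0"])
  finally show ?thesis by simp
qed

text \<open>The space H10 as the graph of its gradient. The inner product of the surrounding product
  space is then that of H1, so an orthogonal projection onto this closed set solves an elliptic
  problem.\<close>

definition h10_graph :: "((real^'d) l2 \<times> ((real^'d) l2 ^ 'd)) set" where
  "h10_graph = closure {(emb \<Omega> w, \<chi> i. emb \<Omega> (dd (axis i 1) w)) | w. test_fun \<Omega> w}"

lemma test_graph_in: "test_fun \<Omega> w \<Longrightarrow> (emb \<Omega> w, \<chi> i. emb \<Omega> (dd (axis i 1) w)) \<in> h10_graph"
  unfolding h10_graph_def by (rule subsetD[OF closure_subset], rule CollectI, rule exI[of _ w]) simp

lemma h10_subspace: "subspace h10_graph"
  unfolding h10_graph_def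
proof (rule closure_subspace, unfold subspace_def, safe)
  have t0: "test_fun \<Omega> (\<lambda>x. 0)" by (rule test_funI[of _ "{}"]) auto
  show "\<exists>w. 0 = (emb \<Omega> w, \<chi> i. emb \<Omega> (dd (axis i 1) w)) \<and> test_fun \<Omega> w"
    by (rule exI[of _ "\<lambda>x. 0"]) (simp add: t0 zero_prod_def vec_eq_iff)
  fix w assume w: "test_fun \<Omega> w"
  note sw = test_fun_smooth[OF w]
  show "\<exists>w'. c *\<^sub>R (emb \<Omega> w, \<chi> i. emb \<Omega> (dd (axis i 1) w)) = (emb \<Omega> w', \<chi> i. emb \<Omega> (dd (axis i 1) w')) \<and> test_fun \<Omega> w'" for c
    by (rule exI[of _ "\<lambda>x. c * w x"])
      (simp add: test_fun_mult_left[OF w] dd_cmult sw emb_cmult L2_dom_smooth smooth_dd vec_eq_iff)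
  fix w' assume w': "test_fun \<Omega> w'"
  note sw' = test_fun_smooth[OF w']
  show "\<exists>w''. (emb \<Omega> w, \<chi> i. emb \<Omega> (dd (axis i 1) w)) + (emb \<Omega> w', \<chi> i. emb \<Omega> (dd (axis i 1) w')) =
      (emb \<Omega> w'', \<chi> i. emb \<Omega> (dd (axis i 1) w'')) \<and> test_fun \<Omega> w''"
    by (rule exI[of _ "\<lambda>x. w x + w' x"])
      (simp add: test_fun_add[OF w w'] dd_add sw sw' emb_add L2_dom_smooth smooth_dd vec_eq_iff)
qed

lemma h10_closed_induct:
  assumes "x \<in> h10_graph" "closed {x. P x}" "\<And>w. test_fun \<Omega> w \<Longrightarrow> P (emb \<Omega> w, \<chi> i. emb \<Omega> (dd (axis i 1) w))"
  shows "P x"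
proof -
  have "h10_graph \<subseteq> {x. P x}" unfolding h10_graph_def by (rule closure_minimal) (use assms in auto)
  then show ?thesis using assms(1) by blast
qed

lemma h10_supp:
  assumes "(u, U) \<in> h10_graph" shows "u \<in> supp_l2 \<Omega>" "U $ i \<in> supp_l2 \<Omega>"
proof -
  have "fst (u, U) \<in> supp_l2 \<Omega> \<and> (\<forall>i. snd (u, U) $ i \<in> supp_l2 \<Omega>)"
  proof (rule h10_closed_induct[OF assms])
    have eq: "{x :: (real^'d) l2 \<times> ((real^'d) l2 ^ 'd). fst x \<in> supp_l2 \<Omega> \<and> (\<forall>i. snd x $ i \<in> supp_l2 \<Omega>)}
        = (fst -` supp_l2 \<Omega>) \<inter> (\<Inter>i. (\<lambda>x. snd x $ i) -` supp_l2 \<Omega>)" by auto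
    show "closed {x :: (real^'d) l2 \<times> ((real^'d) l2 ^ 'd). fst x \<in> supp_l2 \<Omega> \<and> (\<forall>i. snd x $ i \<in> supp_l2 \<Omega>)}"
      unfolding eq by (intro closed_Int closed_INT ballI closed_vimage closed_supp dom_borel continuous_intros)
  qed (auto intro!: L2_dom_smooth smooth_dd dest: test_fun_smooth)
  then show "u \<in> supp_l2 \<Omega>" "U $ i \<in> supp_l2 \<Omega>" by auto
qed

lemma ip_test_by_parts:
  assumes w: "test_fun \<Omega> w" and \<tau>: "smooth \<tau>"
  shows "ip \<Omega> (dd u w) \<tau> = - ip \<Omega> w (dd u \<tau>)"
proof -
  have cut: "ip \<Omega> a b = ip UNIV a b" if "\<And>x. x \<notin> \<Omega> \<Longrightarrow> b x = 0" for a b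
    unfolding ip_def set_lebesgue_integral_def
    by (rule Bochner_Integration.integral_cong[OF refl]) (use that in \<open>auto simp: indicator_def\<close>)
  have "ip UNIV \<tau> (dd u w) = - ip UNIV (dd u \<tau>) w"
    by (rule integral_by_parts[OF \<tau> test_fun_mono[OF w]]) auto
  then have "ip \<Omega> \<tau> (dd u w) = - ip \<Omega> (dd u \<tau>) w"
    using cut test_fun_outside[OF w] test_fun_outside[OF test_fun_dd[OF w]] by simp
  then show ?thesis by (simp add: ip_commute)
qed

text \<open>Passes to the closure from test functions w, for which \<tau> may be any smooth function
  because w has compact support in \<Omega>.\<close>

lemma h10_gradient:
  assumes U: "(u, U) \<in> h10_graph" and \<tau>: "smooth \<tau>"
  shows "inner (U $ i) (emb \<Omega> \<tau>) = - inner u (emb \<Omega> (dd (axis i 1) \<tau>))"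
proof -
  have "inner (snd (u, U) $ i) (emb \<Omega> \<tau>) = - inner (fst (u, U)) (emb \<Omega> (dd (axis i 1) \<tau>))"
  proof (rule h10_closed_induct[OF U])
    show "closed {x :: (real^'d) l2 \<times> ((real^'d) l2 ^ 'd). inner (snd x $ i) (emb \<Omega> \<tau>) = - inner (fst x) (emb \<Omega> (dd (axis i 1) \<tau>))}"
      by (intro closed_Collect_eq continuous_intros)
    fix w assume w: "test_fun \<Omega> w"
    show "inner (snd (emb \<Omega> w, \<chi> i. emb \<Omega> (dd (axis i 1) w)) $ i) (emb \<Omega> \<tau>)
        = - inner (fst (emb \<Omega> w, \<chi> i. emb \<Omega> (dd (axis i 1) w))) (emb \<Omega> (dd (axis i 1) \<tau>))"
      using ip_test_by_parts[OF w \<tau>] by (simp add: inner_emb L2_dom_smooth smooth_dd \<tau> test_fun_smooth[OF w])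
  qed
  then show ?thesis by simp
qed

definition weak_laplacian :: "(real^'d) l2 \<Rightarrow> (real^'d) l2 \<Rightarrow> bool" where
  "weak_laplacian u L \<longleftrightarrow> L \<in> supp_l2 \<Omega> \<and> (\<forall>w. test_fun \<Omega> w \<longrightarrow>
     inner L (emb \<Omega> w) = (\<Sum>i\<in>UNIV. inner u (emb \<Omega> (dd (axis i 1) (dd (axis i 1) w)))))"

lemma tensor_diff_norm:
  assumes "smooth \<eta>" "L2 \<Omega> f" "L2 \<Omega> g"
  shows "ip (cyl T \<Omega>) (\<lambda>z. tensor \<eta> f z - tensor \<eta> g z) (\<lambda>z. tensor \<eta> f z - tensor \<eta> g z)
    = (norm (tens \<eta> (emb \<Omega> f - emb \<Omega> g)))^2"
proof -
  have "L2 \<Omega> (\<lambda>x. f x - g x)" using assms by (intro L2_diff)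
  then show ?thesis
    using assms by (simp add: emb_diff[symmetric] tens_emb tensor_diff[symmetric] norm_emb L2_tensor L2_time_smooth)
qed

text \<open>The source of elements of \<open>Y\<close>: a weight that vanishes near T times an
  element of H10 whose Laplacian is square integrable. The constraint \<open>D\<close> is exploited
  only through these products.\<close>

lemma tensor_isY:
  assumes \<eta>: "test_fun {..<T} \<eta>" and g: "(emb \<Omega> f, \<chi> i. emb \<Omega> (P i)) \<in> h10_graph"
    and L2: "L2 \<Omega> f" "\<And>i. L2 \<Omega> (P i)" "L2 \<Omega> l" and lap: "weak_laplacian (emb \<Omega> f) (emb \<Omega> l)"
  shows "isY \<Omega> T (tensor \<eta> f) (tensor (dd 1 \<eta>) f) (tensor (dd 1 (dd 1 \<eta>)) f) (\<lambda>z. \<chi> i. tensor \<eta> (P i) z)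
    (\<lambda>z. \<chi> i. tensor (dd 1 \<eta>) (P i) z) (tensor \<eta> l) (\<lambda>x. \<chi> i. \<eta> 0 * P i x)"
  unfolding isY_def L2v_def vec_lambda_beta
proof (intro conjI allI impI)
  have s: "smooth \<eta>" by (rule test_fun_smooth[OF \<eta>])
  note s1 = smooth_dd[OF s, of 1] and s2 = smooth_dd[OF smooth_dd[OF s, of 1], of 1]
  have \<eta>T: "\<eta> T = 0" "dd 1 \<eta> T = 0" using test_fun_outside[OF \<eta>] test_fun_outside[OF test_fun_dd[OF \<eta>]] by auto
  note LT = L2_tensor[OF L2_time_smooth]
  show "L2 (cyl T \<Omega>) (tensor \<eta> f)" "L2 (cyl T \<Omega>) (tensor (dd 1 \<eta>) f)" "L2 (cyl T \<Omega>) (tensor (dd 1 (dd 1 \<eta>)) f)"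
    "L2 (cyl T \<Omega>) (tensor \<eta> (P i))" "L2 (cyl T \<Omega>) (tensor (dd 1 \<eta>) (P i))" "L2 (cyl T \<Omega>) (tensor \<eta> l)"
    "L2 \<Omega> (\<lambda>x. \<eta> 0 * P i x)" for i
    by (intro LT L2_cmult s s1 s2 L2)+
  show "\<exists>\<psi>. (\<forall>k. test_fun (UNIV \<times> \<Omega>) (\<psi> k)) \<and>
        (\<lambda>k. ip (cyl T \<Omega>) (\<lambda>z. tensor \<eta> f z - \<psi> k z) (\<lambda>z. tensor \<eta> f z - \<psi> k z)
           + ip (cyl T \<Omega>) (\<lambda>z. tensor (dd 1 \<eta>) f z - dt (\<psi> k) z) (\<lambda>z. tensor (dd 1 \<eta>) f z - dt (\<psi> k) z)
           + (\<Sum>i\<in>UNIV. ip (cyl T \<Omega>) (\<lambda>z. tensor \<eta> (P i) z - dx i (\<psi> k) z) (\<lambda>z. tensor \<eta> (P i) z - dx i (\<psi> k) z)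
                 + ip (cyl T \<Omega>) (\<lambda>z. tensor (dd 1 \<eta>) (P i) z - dx i (dt (\<psi> k)) z) (\<lambda>z. tensor (dd 1 \<eta>) (P i) z - dx i (dt (\<psi> k)) z)))
        \<longlonglongrightarrow> 0"
  proof -
    \<comment> \<open>Products of the same weight with test functions that approximate in the graph
      of H10; \<open>tens\<close> is bounded for the weight and for its derivative, so all four
      kinds of terms converge.\<close>
    obtain X where X: "\<And>k. X k \<in> {(emb \<Omega> w, \<chi> i. emb \<Omega> (dd (axis i 1) w)) | w. test_fun \<Omega> w}"
      "X \<longlonglongrightarrow> (emb \<Omega> f, \<chi> i. emb \<Omega> (P i))"
      using g unfolding h10_graph_def closure_sequential by blast
    then have "\<forall>k. \<exists>w. X k = (emb \<Omega> w, \<chi> i. emb \<Omega> (dd (axis i 1) w)) \<and> test_fun \<Omega> w" by blast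
    then obtain w where w: "\<And>k. X k = (emb \<Omega> (w k), \<chi> i. emb \<Omega> (dd (axis i 1) (w k)))" "\<And>k. test_fun \<Omega> (w k)"
      by metis
    have sw: "smooth (w k)" for k by (rule test_fun_smooth[OF w(2)])
    have l1: "(\<lambda>k. emb \<Omega> (w k)) \<longlonglongrightarrow> emb \<Omega> f" using tendsto_fst[OF X(2)] by (simp add: w(1))
    have l2: "(\<lambda>k. emb \<Omega> (dd (axis i 1) (w k))) \<longlonglongrightarrow> emb \<Omega> (P i)" for i
      using tendsto_vec_nth[OF tendsto_snd[OF X(2)], of i] by (simp add: w(1))
    have l: "(\<lambda>k. (norm (tens \<xi> (a - b k)))^2) \<longlonglongrightarrow> 0" if "smooth \<xi>" "b \<longlonglongrightarrow> a" for \<xi> a b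
    proof -
      have "(\<lambda>k. (norm (tens \<xi> (a - b k)))^2) \<longlonglongrightarrow> (norm (tens \<xi> (a - a)))^2"
        by (intro tendsto_intros bounded_linear.tendsto[OF bounded_linear_tens[OF that(1)]] that(2))
      then show ?thesis by (simp add: linear_0[OF bounded_linear.linear[OF bounded_linear_tens[OF that(1)]]])
    qed
    have tt: "test_fun (UNIV \<times> \<Omega>) (tensor \<eta> (w k))" for k
      by (rule test_fun_tensor[OF test_fun_mono[OF \<eta>] w(2)]) simp
    have lim: "(\<lambda>k. (norm (tens \<eta> (emb \<Omega> f - emb \<Omega> (w k))))^2 + (norm (tens (dd 1 \<eta>) (emb \<Omega> f - emb \<Omega> (w k))))^2
      + (\<Sum>i\<in>UNIV. (norm (tens \<eta> (emb \<Omega> (P i) - emb \<Omega> (dd (axis i 1) (w k)))))^2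
          + (norm (tens (dd 1 \<eta>) (emb \<Omega> (P i) - emb \<Omega> (dd (axis i 1) (w k)))))^2)) \<longlonglongrightarrow> 0 + 0 + (\<Sum>i\<in>(UNIV::'d set). 0 + 0)"
      by (intro tendsto_add tendsto_sum l s s1 l1 l2)
    have Lw: "L2 \<Omega> (w k)" "L2 \<Omega> (dd (axis i 1) (w k))" for k i by (intro L2_dom_smooth smooth_dd sw)+
    show ?thesis
      by (rule exI[of _ "\<lambda>k. tensor \<eta> (w k)"])
        (use lim tt in \<open>simp add: dt_tensor dx_tensor s s1 sw smooth_dd tensor_diff_norm L2 Lw\<close>)
  qed
  fix \<theta>
  show "ip (cyl T \<Omega>) (tensor (dd 1 (dd 1 \<eta>)) f) \<theta> = - ip (cyl T \<Omega>) (tensor (dd 1 \<eta>) f) (dt \<theta>)" if "test_fun (cyl T \<Omega>) \<theta>"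
  proof -
    have "\<theta> (0, x) = 0" for x using test_fun_outside[OF that, of "(0, x)"] by (simp add: cyl_def)
    then show ?thesis using tensor_time[OF s1 L2(1) test_fun_smooth[OF that]] \<eta>T by (simp add: ip_def)
  qed
  show "ip (cyl T \<Omega>) (tensor (dd 1 \<eta>) f) \<theta> = - ip (cyl T \<Omega>) (tensor \<eta> f) (dt \<theta>)"
    "ip (cyl T \<Omega>) (tensor (dd 1 (dd 1 \<eta>)) f) \<theta> = - ip (cyl T \<Omega>) (tensor (dd 1 \<eta>) f) (dt \<theta>)" if "test_fun ({0<..} \<times> \<Omega>) \<theta>"
  proof -
    have "\<theta> (0, x) = 0" for x using test_fun_outside[OF that, of "(0, x)"] by simp
    then show "ip (cyl T \<Omega>) (tensor (dd 1 \<eta>) f) \<theta> = - ip (cyl T \<Omega>) (tensor \<eta> f) (dt \<theta>)"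
      "ip (cyl T \<Omega>) (tensor (dd 1 (dd 1 \<eta>)) f) \<theta> = - ip (cyl T \<Omega>) (tensor (dd 1 \<eta>) f) (dt \<theta>)"
      using tensor_time[OF s L2(1) test_fun_smooth[OF that]] tensor_time[OF s1 L2(1) test_fun_smooth[OF that]] \<eta>T
      by (simp_all add: ip_def)
  qed
  show "ip (cyl T \<Omega>) (tensor (dd 1 \<eta>) (P i)) \<theta> = - ip (cyl T \<Omega>) (tensor \<eta> (P i)) (dt \<theta>)
      - ip \<Omega> (\<lambda>x. \<eta> 0 * P i x) (\<lambda>x. \<theta> (0, x))" if "test_fun ({..<T} \<times> \<Omega>) \<theta>" for i
    using tensor_time[OF s L2(2) test_fun_smooth[OF that], of i] \<eta>T
    by (simp add: ip_def set_lebesgue_integral_def mult.assoc mult.left_commute[of _ "\<eta> 0"])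
  show "ip (cyl T \<Omega>) (tensor \<eta> l) \<theta> = ip (cyl T \<Omega>) (tensor \<eta> f) (\<lambda>z. \<Sum>i\<in>UNIV. dx i (dx i \<theta>) z)" if \<theta>: "test_fun (cyl T \<Omega>) \<theta>"
  proof (rule ip_tensor_test_cong)
    have s\<theta>: "smooth \<theta>" by (rule test_fun_smooth[OF \<theta>])
    show "L2 (cyl T \<Omega>) (tensor \<eta> l)" "L2 (cyl T \<Omega>) (tensor \<eta> f)" "L2 (cyl T \<Omega>) \<theta>"
      "L2 (cyl T \<Omega>) (\<lambda>z. \<Sum>i\<in>UNIV. dx i (dx i \<theta>) z)"
      by (intro LT s L2 L2_cyl_smooth smooth_sum smooth_dx s\<theta>)+
    fix t
    have w: "test_fun \<Omega> (\<lambda>x. \<theta> (t, x))" using test_fun_slice \<theta> unfolding cyl_def by blast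
    have sl: "smooth (\<lambda>x. \<theta> (t, x))" by (rule smooth_slice[OF s\<theta>])
    have d: "dd (axis i 1) (dd (axis i 1) (\<lambda>x. \<theta> (t, x))) = (\<lambda>x. dx i (dx i \<theta>) (t, x))" for i
    proof -
      have e: "dd (axis i 1) (\<lambda>x. \<theta> (t, x)) = (\<lambda>x. dx i \<theta> (t, x))" by (rule ext) (simp add: dd_slice[OF s\<theta>] dx_eq_dd)
      show ?thesis unfolding e
        by (rule ext, rule trans[OF dd_slice[OF smooth_dx[OF s\<theta>]]]) (simp only: dx_eq_dd[of i "dx i \<theta>"])
    qed
    have "ip \<Omega> l (\<lambda>x. \<theta> (t, x)) = (\<Sum>i\<in>UNIV. ip \<Omega> f (\<lambda>x. dx i (dx i \<theta>) (t, x)))"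
      using lap[unfolded weak_laplacian_def, THEN conjunct2, rule_format, OF w]
      unfolding d[symmetric] inner_emb[OF L2(3) L2_dom_smooth[OF sl]]
        inner_emb[OF L2(1) L2_dom_smooth[OF smooth_dd[OF smooth_dd[OF sl]]]] .
    also have "\<dots> = ip \<Omega> f (\<lambda>x. \<Sum>i\<in>UNIV. dx i (dx i \<theta>) (t, x))"
      by (rule ip_sum_right[symmetric, OF L2(1)]) (intro L2_dom_smooth smooth_slice smooth_dx s\<theta>)
    finally show "ip \<Omega> l (\<lambda>x. \<theta> (t, x)) = ip \<Omega> f (\<lambda>x. \<Sum>i\<in>UNIV. dx i (dx i \<theta>) (t, x))" .
  qed
qed

text \<open>Testing against all smooth functions, not only those of compact support in the domain, also
  encodes zero boundary values of \<open>z\<close>; the sign convention is \<open>G = grad z\<close>.\<close>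

definition zero_grad :: "(real^'d) l2 \<Rightarrow> ('d \<Rightarrow> (real^'d) l2) \<Rightarrow> bool" where
  "zero_grad z G \<longleftrightarrow> (\<forall>\<tau> i. smooth \<tau> \<longrightarrow> inner (G i) (emb \<Omega> \<tau>) = - inner z (emb \<Omega> (dd (axis i 1) \<tau>)))"

definition weak_div :: "('d \<Rightarrow> (real^'d) l2) \<Rightarrow> (real^'d) l2 \<Rightarrow> bool" where
  "weak_div \<zeta> q \<longleftrightarrow> (\<forall>w. test_fun \<Omega> w \<longrightarrow> inner q (emb \<Omega> w) = - (\<Sum>i\<in>UNIV. inner (\<zeta> i) (emb \<Omega> (dd (axis i 1) w))))"

lemma green_l2:
  assumes lip: "lipschitz_domain \<Omega>" and zG: "zero_grad z G" and \<zeta>q: "weak_div \<zeta> q"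
    and supp: "z \<in> supp_l2 \<Omega>" "\<And>i. G i \<in> supp_l2 \<Omega>" "q \<in> supp_l2 \<Omega>" "\<And>i. \<zeta> i \<in> supp_l2 \<Omega>"
  shows "inner q z + (\<Sum>i\<in>UNIV. inner (\<zeta> i) (G i)) = 0"
proof -
  obtain zf where z: "L2 \<Omega> zf" "z = emb \<Omega> zf" using supp(1) by (rule supp_l2E)
  obtain qf where q: "L2 \<Omega> qf" "q = emb \<Omega> qf" using supp(3) by (rule supp_l2E)
  have "\<forall>i. \<exists>f. L2 \<Omega> f \<and> G i = emb \<Omega> f" using supp(2) by (auto simp: supp_l2_def)
  then obtain Gf where G: "\<And>i. L2 \<Omega> (Gf i)" "\<And>i. G i = emb \<Omega> (Gf i)" by metis
  have "\<forall>i. \<exists>f. L2 \<Omega> f \<and> \<zeta> i = emb \<Omega> f" using supp(4) by (auto simp: supp_l2_def)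
  then obtain \<zeta>f where \<zeta>: "\<And>i. L2 \<Omega> (\<zeta>f i)" "\<And>i. \<zeta> i = emb \<Omega> (\<zeta>f i)" by metis
  have "ip \<Omega> qf zf + (\<Sum>i\<in>UNIV. ip \<Omega> (\<zeta>f i) (Gf i)) = 0"
  proof (rule green[OF lip bd z(1) G(1) q(1) \<zeta>(1)])
    show "ip \<Omega> (Gf i) \<tau> = - ip \<Omega> zf (dd (axis i 1) \<tau>)" if "smooth \<tau>" for \<tau> i
      using zG that by (simp add: zero_grad_def z G inner_emb L2_dom_smooth smooth_dd)
    show "ip \<Omega> qf w = - (\<Sum>i\<in>UNIV. ip \<Omega> (\<zeta>f i) (dd (axis i 1) w))" if "test_fun \<Omega> w" for w
    proof -
      note sw = test_fun_smooth[OF that]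
      show ?thesis
        using \<zeta>q[unfolded weak_div_def, rule_format, OF that]
        unfolding q \<zeta> inner_emb[OF q(1) L2_dom_smooth[OF sw]] inner_emb[OF \<zeta>(1) L2_dom_smooth[OF smooth_dd[OF sw]]] .
    qed
  qed
  then show ?thesis by (simp add: z q G \<zeta> inner_emb)
qed

text \<open>The part \<open>z\<close> of the residual of the projection onto the graph of \<open>H\<^sup>1\<^sub>0\<close> is tested with the solution
  \<open>\<psi> \<in> H\<^sup>1\<^sub>0\<close> of \<open>\<psi> - \<Delta>\<psi> = z\<close>, which is again a projection.\<close>

lemma zero_grad_from_laplacian_tests:
  fixes z :: "(real^'d) l2" and \<zeta> :: "((real^'d) l2 ^ 'd)"
  assumes supp: "z \<in> supp_l2 \<Omega>" "\<And>i. \<zeta> $ i \<in> supp_l2 \<Omega>"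
    and grad: "\<And>w i. test_fun \<Omega> w \<Longrightarrow> inner (\<zeta> $ i) (emb \<Omega> w) = - inner z (emb \<Omega> (dd (axis i 1) w))"
    and lap: "\<And>\<psi> P L. (\<psi>, P) \<in> h10_graph \<Longrightarrow> weak_laplacian \<psi> L \<Longrightarrow> inner \<zeta> P + inner z L = 0"
  shows "zero_grad z (($) \<zeta>)"
proof -
  have H: "subspace h10_graph" "closed h10_graph" using h10_subspace by (auto simp: h10_graph_def)
  \<comment> \<open>(u, U) is the H10 part of (z, \<zeta>); the goal is to show that nothing else is
    left.\<close>
  obtain u U where uU: "(u, U) \<in> h10_graph" "\<And>y. y \<in> h10_graph \<Longrightarrow> inner ((z, \<zeta>) - (u, U)) y = 0"
    using orthogonal_projection[OF H, of "(z, \<zeta>)"] by (metis surj_pair)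
  define z' where "z' = z - u"
  define \<zeta>' where "\<zeta>' = \<zeta> - U"
  have orth: "inner z' a + inner \<zeta>' b = 0" if "(a, b) \<in> h10_graph" for a b
    using uU(2)[OF that] by (simp add: z'_def \<zeta>'_def inner_Pair)
  obtain \<psi> P where \<psi>P: "(\<psi>, P) \<in> h10_graph" "\<And>y. y \<in> h10_graph \<Longrightarrow> inner ((z', 0) - (\<psi>, P)) y = 0"
    using orthogonal_projection[OF H, of "(z', 0)"] by (metis surj_pair)
  \<comment> \<open>With this L the projection property \<open>LP\<close> says that L is the weak
    Laplacian of \<psi>, that is, \<psi> solves \<psi> - L = z'.\<close>
  define L where "L = \<psi> - z'"
  have LP: "inner L a + inner P b = 0" if "(a, b) \<in> h10_graph" for a b
    using \<psi>P(2)[OF that] by (simp add: L_def inner_Pair inner_diff_left inner_minus_left)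
  have Ls: "L \<in> supp_l2 \<Omega>"
    unfolding L_def z'_def using supp(1) h10_supp(1)[OF \<psi>P(1)] h10_supp(1)[OF uU(1)] subspace_supp[OF dom_borel]
    by (intro subspace_diff) auto
  have "weak_laplacian \<psi> L"
    unfolding weak_laplacian_def
  proof (intro conjI allI impI Ls)
    fix w assume w: "test_fun \<Omega> w"
    have "inner L (emb \<Omega> w) = - (\<Sum>i\<in>UNIV. inner (P $ i) (emb \<Omega> (dd (axis i 1) w)))"
      using LP[OF test_graph_in[OF w]] by (simp add: inner_vec_def)
    also have "\<dots> = (\<Sum>i\<in>UNIV. inner \<psi> (emb \<Omega> (dd (axis i 1) (dd (axis i 1) w))))"
      by (simp add: h10_gradient[OF \<psi>P(1)] smooth_dd test_fun_smooth[OF w] sum_negf)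
    finally show "inner L (emb \<Omega> w) = (\<Sum>i\<in>UNIV. inner \<psi> (emb \<Omega> (dd (axis i 1) (dd (axis i 1) w))))" .
  qed
  from lap[OF \<psi>P(1) this] have "inner \<zeta> P + inner z L = 0" .
  \<comment> \<open>Green's formula inside H10. It subtracts the projection from the tested
    identity, so that only the residual (z', \<zeta>') remains.\<close>
  moreover have "inner U P + inner u L = 0" using LP[OF uU(1)] by (simp add: inner_commute)
  ultimately have "inner \<zeta>' P + inner z' L = 0" by (simp add: \<zeta>'_def z'_def inner_diff_left)
  moreover have "inner z' \<psi> + inner \<zeta>' P = 0" by (rule orth[OF \<psi>P(1)])
  \<comment> \<open>The difference of the two identities is the product of z' with \<psi> - L, which
    is z' itself.\<close>
  ultimately have "inner z' z' = 0" unfolding L_def inner_diff_right by linarith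
  then have zu: "z = u" by (simp add: z'_def)
  \<comment> \<open>Both are the interior gradient of the same function z = u, so test functions
    suffice to compare them.\<close>
  have "\<zeta> $ i - U $ i = 0" for i
  proof (rule l2_zero_if_test[OF op bd])
    show "\<zeta> $ i - U $ i \<in> supp_l2 \<Omega>"
      using supp(2)[of i] h10_supp(2)[OF uU(1), of i] subspace_supp[OF dom_borel] by (intro subspace_diff) auto
    fix w assume w: "test_fun \<Omega> w"
    show "inner (\<zeta> $ i - U $ i) (emb \<Omega> w) = 0"
      using grad[OF w] h10_gradient[OF uU(1) test_fun_smooth[OF w], of i] zu by (simp add: inner_diff_left)
  qed
  then have "\<zeta> = U" by (simp add: vec_eq_iff)
  then show ?thesis using h10_gradient[OF uU(1)] zu by (simp add: zero_grad_def)
qed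

text \<open>Differentiable in the shift although F has no regularity in time: the shift acts on the
  weight, and the Taylor remainder of \<eta> bounds the error in norm. The factor \<sigma> is the
  direction of the shift, later 1 and -1.\<close>

lemma avg_shift_derivative:
  assumes \<eta>: "test_fun UNIV \<eta>"
  shows "((\<lambda>s. avg (\<lambda>t. \<eta> (t + \<sigma> * s)) F) has_vector_derivative \<sigma> *\<^sub>R avg (\<lambda>t. dd 1 \<eta> (t + \<sigma> * s)) F) (at s)"
proof -
  have s\<eta>: "smooth \<eta>" by (rule test_fun_smooth[OF \<eta>])
  have sh: "smooth (\<lambda>t. f (t + c))" if "smooth f" for f and c :: real
    using smooth_affine[OF bounded_linear_ident that, of c] by simp
  obtain C where C: "C \<ge> 0" "\<And>x h. \<bar>\<eta> (x + h) - \<eta> x - dd h \<eta> x\<bar> \<le> C * (norm h)^2"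
    using test_fun_taylor[OF \<eta>] by metis
  let ?A = "\<lambda>s. avg (\<lambda>t. \<eta> (t + \<sigma> * s)) F" and ?D = "avg (\<lambda>t. dd 1 \<eta> (t + \<sigma> * s)) F"
  define M where "M = C * \<sigma>^2 * sqrt T * norm F"
  have M: "M \<ge> 0" using C(1) T by (simp add: M_def)
  show ?thesis
    unfolding has_vector_derivative_def
  proof (rule has_derivativeI_sandwich[where e=1 and H="\<lambda>r. M * norm (r - s)"])
    show "bounded_linear (\<lambda>h. h *\<^sub>R \<sigma> *\<^sub>R ?D)" by (intro bounded_linear_scaleR_left)
    have "((\<lambda>r. M * norm (r - s)) \<longlongrightarrow> M * norm (s - s)) (at s)" by (intro tendsto_intros)
    then show "((\<lambda>r. M * norm (r - s)) \<longlongrightarrow> 0) (at s)" by simp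
    fix r assume r: "r \<noteq> s"
    define h where "h = r - s"
    \<comment> \<open>The nested form a * f + b * g matches \<open>avg_linear_time\<close>.\<close>
    let ?f = "\<lambda>t. 1 * (1 * \<eta> (t + \<sigma> * r) + (- 1) * \<eta> (t + \<sigma> * s)) + (- (h * \<sigma>)) * dd 1 \<eta> (t + \<sigma> * s)"
    have eq: "?A r - ?A s - h *\<^sub>R \<sigma> *\<^sub>R ?D = avg ?f F"
      by (subst avg_linear_time, intro smooth_add smooth_mult smooth_const sh s\<eta>, intro sh smooth_dd s\<eta>,
          subst avg_linear_time, intro sh s\<eta>, intro sh s\<eta>) simp
    have sf: "smooth ?f" by (intro smooth_add smooth_mult smooth_const sh s\<eta> smooth_dd)
    have "\<bar>?f t\<bar> \<le> C * \<sigma>^2 * h^2" for t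
    proof -
      have e: "t + \<sigma> * r = (t + \<sigma> * s) + h * \<sigma>" by (simp add: h_def algebra_simps)
      have "?f t = \<eta> ((t + \<sigma> * s) + h * \<sigma>) - \<eta> (t + \<sigma> * s) - dd (h * \<sigma>) \<eta> (t + \<sigma> * s)"
        unfolding e using dd_real[OF s\<eta>, of "h * \<sigma>" "t + \<sigma> * s"] by simp
      then show ?thesis using C(2)[of "t + \<sigma> * s" "h * \<sigma>"] by (simp add: power_mult_distrib mult_ac)
    qed
    then have "ip {0<..<T} ?f ?f \<le> (C * \<sigma>^2 * h^2)^2 * T" by (intro ip_time_bound sf)
    then have "sqrt (ip {0<..<T} ?f ?f) \<le> sqrt ((C * \<sigma>^2 * h^2)^2 * T)" by (rule real_sqrt_le_mono)
    also have "\<dots> = C * \<sigma>^2 * h^2 * sqrt T" using C(1) by (simp add: real_sqrt_mult)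
    finally have "norm (avg ?f F) \<le> C * \<sigma>^2 * h^2 * sqrt T * norm F"
      using order_trans[OF norm_avg[OF sf] mult_right_mono] norm_ge_zero by blast
    then have "norm (?A r - ?A s - h *\<^sub>R \<sigma> *\<^sub>R ?D) \<le> M * h^2" unfolding eq by (simp add: M_def mult_ac)
    then show "norm (?A r - ?A s - (r - s) *\<^sub>R \<sigma> *\<^sub>R ?D) / norm (r - s) \<le> M * norm (r - s)"
      using r by (simp add: h_def divide_le_eq power2_eq_square mult.assoc)
  qed simp
qed

text \<open>The assumed identity says that the energy of the averages against the shifted weights satisfies
  \<open>E' = 2 E\<close>; it vanishes once the weight has left the time interval.\<close>

lemma energy_zero:
  fixes a :: "(real \<times> (real^'d)) l2" and b :: "'d \<Rightarrow> (real \<times> (real^'d)) l2"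
  assumes \<eta>: "test_fun UNIV \<eta>" and c: "c > 0" "\<And>t. t \<in> {0<..<T} \<Longrightarrow> \<eta> (t + \<sigma> * c) = 0"
    and id: "\<And>s. 0 \<le> s \<Longrightarrow> (let \<eta>s = (\<lambda>t. \<eta> (t + \<sigma> * s)); \<eta>s' = (\<lambda>t. dd 1 \<eta> (t + \<sigma> * s)) in
      inner (avg \<eta>s a) (avg \<eta>s a) + (\<Sum>i\<in>UNIV. inner (avg \<eta>s (b i)) (avg \<eta>s (b i)))
      = \<sigma> * (inner (avg \<eta>s' a) (avg \<eta>s a) + (\<Sum>i\<in>UNIV. inner (avg \<eta>s' (b i)) (avg \<eta>s (b i)))))"
  shows "avg \<eta> a = 0" "avg \<eta> (b i) = 0"
proof -
  let ?A = "\<lambda>s F. avg (\<lambda>t. \<eta> (t + \<sigma> * s)) F" and ?D = "\<lambda>s F. avg (\<lambda>t. dd 1 \<eta> (t + \<sigma> * s)) F"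
  have d: "((\<lambda>s. inner (?A s F) (?A s F)) has_real_derivative 2 * \<sigma> * inner (?D s F) (?A s F)) (at s)" for s F
  proof -
    have dv: "((\<lambda>s. ?A s F) has_vector_derivative \<sigma> *\<^sub>R ?D s F) (at s)" by (rule avg_shift_derivative[OF \<eta>])
    have eq: "inner (?A s F) (\<sigma> *\<^sub>R ?D s F) + inner (\<sigma> *\<^sub>R ?D s F) (?A s F) = 2 * \<sigma> * inner (?D s F) (?A s F)"
      using inner_commute[of "?A s F" "?D s F"] by simp
    show ?thesis
      using bounded_bilinear.has_vector_derivative[OF bounded_bilinear_inner dv dv]
      unfolding has_real_derivative_iff_has_vector_derivative eq .
  qed
  define E where "E s = inner (?A s a) (?A s a) + (\<Sum>i\<in>UNIV. inner (?A s (b i)) (?A s (b i)))" for s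
  define E' where "E' s = 2 * \<sigma> * inner (?D s a) (?A s a) + (\<Sum>i\<in>UNIV. 2 * \<sigma> * inner (?D s (b i)) (?A s (b i)))" for s
  have dE: "(E has_real_derivative E' s) (at s)" for s
    unfolding E_def[abs_def] E'_def by (intro DERIV_add DERIV_sum d)
  have E'E: "E' s = 2 * E s" if "s \<ge> 0" for s
    using id[OF that] by (simp add: E_def E'_def Let_def sum_distrib_left distrib_left mult_ac)
  have dF: "((\<lambda>s. E s * exp (- 2 * s)) has_real_derivative E' s * exp (- 2 * s) + E s * (exp (- 2 * s) * (- 2))) (at s)" for s
    by (auto intro!: derivative_eq_intros dE)
  \<comment> \<open>E' = 2 E makes the derivative of E(s) exp(-2 s) zero at the intermediate point,
    so E(0) = 0 follows from E(c) = 0.\<close>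
  obtain s where s: "0 < s" "s < c" "E c * exp (- 2 * c) - E 0 * exp (- 2 * 0)
      = (c - 0) * (E' s * exp (- 2 * s) + E s * (exp (- 2 * s) * (- 2)))"
    using MVT2[OF c(1), of "\<lambda>s. E s * exp (- 2 * s)" "\<lambda>s. E' s * exp (- 2 * s) + E s * (exp (- 2 * s) * (- 2))"] dF by blast
  have "smooth (\<lambda>t. \<eta> (t + \<sigma> * c))"
    using smooth_affine[OF bounded_linear_ident test_fun_smooth[OF \<eta>], of "\<sigma> * c"] by simp
  then have "?A c F = 0" for F by (rule avg_zero) (rule c(2))
  then have "E c = 0" by (simp add: E_def)
  then have "E 0 = 0" using s(3) E'E[of s] s(1) by simp
  then have "inner (avg \<eta> a) (avg \<eta> a) + (\<Sum>i\<in>UNIV. inner (avg \<eta> (b i)) (avg \<eta> (b i))) = 0" by (simp add: E_def)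
  then have "inner (avg \<eta> a) (avg \<eta> a) = 0 \<and> (\<Sum>i\<in>UNIV. inner (avg \<eta> (b i)) (avg \<eta> (b i))) = 0"
    by (subst (asm) add_nonneg_eq_0_iff) (auto intro: sum_nonneg)
  then show "avg \<eta> a = 0" "avg \<eta> (b i) = 0" by (auto simp: sum_nonneg_eq_0_iff)
qed

lemma test_fun_shift:
  assumes "test_fun S \<eta>" "\<And>t. t + c \<in> S \<Longrightarrow> t \<in> S'" shows "test_fun S' (\<lambda>t::real. \<eta> (t + c))"
proof -
  obtain K where K: "compact K" "K \<subseteq> S" "\<And>t. t \<notin> K \<Longrightarrow> \<eta> t = 0" using test_funE[OF assms(1)] by metis
  show ?thesis
  proof (rule test_funI[of _ "(\<lambda>t. t - c) ` K"])
    show "smooth (\<lambda>t. \<eta> (t + c))" using smooth_affine[OF bounded_linear_ident test_fun_smooth[OF assms(1)], of c] by simp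
    show "compact ((\<lambda>t. t - c) ` K)" using K(1) by (intro compact_continuous_image continuous_intros)
    show "(\<lambda>t. t - c) ` K \<subseteq> S'"
    proof
      fix t assume "t \<in> (\<lambda>t. t - c) ` K"
      then have "t + c \<in> K" by auto
      then show "t \<in> S'" using K(2) assms(2) by blast
    qed
    fix t assume "t \<notin> (\<lambda>t. t - c) ` K"
    then have "t + c \<notin> K" by force
    then show "\<eta> (t + c) = 0" by (rule K(3))
  qed
qed

lemma dd_shift: "smooth \<eta> \<Longrightarrow> dd 1 (\<lambda>t::real. \<eta> (t + c)) = (\<lambda>t. dd 1 \<eta> (t + c))"
  using dd_affine[OF bounded_linear_ident, of \<eta> 1 c] by simp

lemma supp_add: "x \<in> supp_l2 \<Omega> \<Longrightarrow> y \<in> supp_l2 \<Omega> \<Longrightarrow> x + y \<in> supp_l2 \<Omega>"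
  and supp_diff: "x \<in> supp_l2 \<Omega> \<Longrightarrow> y \<in> supp_l2 \<Omega> \<Longrightarrow> x - y \<in> supp_l2 \<Omega>"
  and supp_scale: "x \<in> supp_l2 \<Omega> \<Longrightarrow> c *\<^sub>R x \<in> supp_l2 \<Omega>"
  and supp_minus: "x \<in> supp_l2 \<Omega> \<Longrightarrow> - x \<in> supp_l2 \<Omega>"
  using subspace_supp[OF dom_borel] by (auto intro: subspace_add subspace_diff subspace_scale subspace_neg)

text \<open>\<open>V1\<close>, \<open>V2\<close> and \<open>D\<close> describe membership in V0;
  \<open>S1\<close> and \<open>S2\<close> are orthogonality to the pairs (w, 0) and to pairs with a
  single component m in the vector part. Tests that are products of a weight \<eta> and a function
  of space turn them into equations in space between averages, with \<open>dd 1 \<eta>\<close> in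
  place of a time derivative and \<eta>(0) in front of the initial values.\<close>

lemma orthogonal_vanish:
  fixes v g :: "(real \<times> (real^'d)) l2" and s h :: "'d \<Rightarrow> (real \<times> (real^'d)) l2"
    and v0 :: "(real^'d) l2" and s0 :: "'d \<Rightarrow> (real^'d) l2"
  assumes lip: "lipschitz_domain \<Omega>"
    and supp: "v \<in> supp_l2 (cyl T \<Omega>)" "g \<in> supp_l2 (cyl T \<Omega>)" "\<And>i. s i \<in> supp_l2 (cyl T \<Omega>)"
      "\<And>i. h i \<in> supp_l2 (cyl T \<Omega>)" "v0 \<in> supp_l2 \<Omega>" "\<And>i. s0 i \<in> supp_l2 \<Omega>"
    and V1: "\<And>\<phi>. test_fun ({..<T} \<times> \<Omega>) \<phi> \<Longrightarrow> inner v (emb (cyl T \<Omega>) (dt \<phi>)) - (\<Sum>i\<in>UNIV. inner (s i) (emb (cyl T \<Omega>) (dx i \<phi>)))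
      + inner g (emb (cyl T \<Omega>) \<phi>) + inner v0 (emb \<Omega> (\<lambda>x. \<phi> (0, x))) = 0"
    and V2: "\<And>\<phi> i. test_fun ({..<T} \<times> \<Omega>) \<phi> \<Longrightarrow> inner (s i) (emb (cyl T \<Omega>) (dt \<phi>)) - inner v (emb (cyl T \<Omega>) (dx i \<phi>))
      + inner (h i) (emb (cyl T \<Omega>) \<phi>) + inner (s0 i) (emb \<Omega> (\<lambda>x. \<phi> (0, x))) = 0"
    and D: "\<And>\<phi> p pp G Gt L G0. isY \<Omega> T \<phi> p pp G Gt L G0 \<Longrightarrow>
      (\<Sum>i\<in>UNIV. inner (h i) (emb (cyl T \<Omega>) (\<lambda>z. G z $ i))) + (\<Sum>i\<in>UNIV. inner (s i) (emb (cyl T \<Omega>) (\<lambda>z. Gt z $ i)))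
      - inner v (emb (cyl T \<Omega>) L) + (\<Sum>i\<in>UNIV. inner (s0 i) (emb \<Omega> (\<lambda>x. G0 x $ i))) = 0"
    and S1: "\<And>w. smooth w \<Longrightarrow> (\<And>t x. t \<in> {0<..<T} \<Longrightarrow> x \<in> frontier \<Omega> \<Longrightarrow> w (t, x) = 0) \<Longrightarrow>
      inner v (emb (cyl T \<Omega>) w) + inner g (emb (cyl T \<Omega>) (dt w)) - (\<Sum>i\<in>UNIV. inner (h i) (emb (cyl T \<Omega>) (dx i w)))
      + inner v0 (emb \<Omega> (\<lambda>x. w (0, x))) = 0"
    and S2: "\<And>m i. smooth m \<Longrightarrow> inner (s i) (emb (cyl T \<Omega>) m) - inner g (emb (cyl T \<Omega>) (dx i m))
      + inner (h i) (emb (cyl T \<Omega>) (dt m)) + inner (s0 i) (emb \<Omega> (\<lambda>x. m (0, x))) = 0"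
  shows "v = 0" "g = 0" "s i = 0" "h i = 0" "v0 = 0" "s0 i = 0"
proof -
  have tn: "inner F (emb (cyl T \<Omega>) (tensor \<eta> f)) = inner (avg \<eta> F) (emb \<Omega> f)" if "smooth \<eta>" "L2 \<Omega> f" for F \<eta> f
    using that by (simp add: avg_inner tens_emb)
  have t0: "emb \<Omega> (\<lambda>x. tensor \<eta> f (0, x)) = \<eta> 0 *\<^sub>R emb \<Omega> f" if "L2 \<Omega> f" for \<eta> f
    using emb_cmult[OF that, of "\<eta> 0"] by (simp add: tensor_def)
  \<comment> \<open>\<open>S2\<close> admits every smooth m. Freedom on the lateral boundary gives g
    zero boundary values; freedom of \<eta> at T means h(T) = 0.\<close>
  have zg: "zero_grad (avg \<eta> g) (\<lambda>i. - (avg \<eta> (s i) + avg (dd 1 \<eta>) (h i) + \<eta> 0 *\<^sub>R s0 i))" if \<eta>: "smooth \<eta>" for \<eta>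
    unfolding zero_grad_def
  proof (intro allI impI)
    fix \<tau> i assume \<tau>: "smooth (\<tau> :: real^'d \<Rightarrow> real)"
    note L = L2_dom_smooth[OF \<tau>] L2_dom_smooth[OF smooth_dd[OF \<tau>]]
    show "inner (- (avg \<eta> (s i) + avg (dd 1 \<eta>) (h i) + \<eta> 0 *\<^sub>R s0 i)) (emb \<Omega> \<tau>) = - inner (avg \<eta> g) (emb \<Omega> (dd (axis i 1) \<tau>))"
      using S2[OF smooth_tensor[OF \<eta> \<tau>], of i]
      unfolding dt_tensor[OF \<eta> \<tau>] dx_tensor[OF \<eta> \<tau>] tn[OF \<eta> L(1)] tn[OF \<eta> L(2)] tn[OF smooth_dd[OF \<eta>] L(1)] t0[OF L(1)]
      by (simp add: inner_add_left inner_diff_left)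
  qed
  \<comment> \<open>The test \<psi> vanishes on the boundary as \<open>S1\<close> demands; \<eta> is
    again free at T, which encodes g(T) = 0.\<close>
  have wdh: "weak_div (\<lambda>i. avg \<eta> (h i)) (- (avg \<eta> v + avg (dd 1 \<eta>) g + \<eta> 0 *\<^sub>R v0))" if \<eta>: "smooth \<eta>" for \<eta>
    unfolding weak_div_def
  proof (intro allI impI)
    fix \<psi> assume \<psi>t: "test_fun \<Omega> (\<psi> :: real^'d \<Rightarrow> real)"
    note \<psi> = test_fun_smooth[OF \<psi>t]
    note L = L2_dom_smooth[OF \<psi>] L2_dom_smooth[OF smooth_dd[OF \<psi>]]
    have bc: "tensor \<eta> \<psi> (t, x) = 0" if "x \<in> frontier \<Omega>" for t x
    proof -
      have "x \<notin> \<Omega>" using that op by (auto simp: frontier_def interior_open)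
      then show ?thesis using test_fun_outside[OF \<psi>t] by (simp add: tensor_def)
    qed
    show "inner (- (avg \<eta> v + avg (dd 1 \<eta>) g + \<eta> 0 *\<^sub>R v0)) (emb \<Omega> \<psi>) = - (\<Sum>i\<in>UNIV. inner (avg \<eta> (h i)) (emb \<Omega> (dd (axis i 1) \<psi>)))"
      using S1[OF smooth_tensor[OF \<eta> \<psi>] bc]
      unfolding dt_tensor[OF \<eta> \<psi>] dx_tensor[OF \<eta> \<psi>] tn[OF \<eta> L(1)] tn[OF \<eta> L(2)] tn[OF smooth_dd[OF \<eta>] L(1)] t0[OF L(1)]
      by (simp add: inner_add_left inner_diff_left)
  qed
  \<comment> \<open>\<open>V1\<close> says nothing about values at T, so the weight has to vanish
    near T.\<close>
  have wds: "weak_div (\<lambda>i. avg \<eta> (s i)) (- (avg \<eta> g + avg (dd 1 \<eta>) v + \<eta> 0 *\<^sub>R v0))" if \<eta>t: "test_fun {..<T} \<eta>" for \<eta>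
    unfolding weak_div_def
  proof (intro allI impI)
    fix \<psi> assume \<psi>t: "test_fun \<Omega> (\<psi> :: real^'d \<Rightarrow> real)"
    note \<psi> = test_fun_smooth[OF \<psi>t] and \<eta> = test_fun_smooth[OF \<eta>t]
    note L = L2_dom_smooth[OF \<psi>] L2_dom_smooth[OF smooth_dd[OF \<psi>]]
    show "inner (- (avg \<eta> g + avg (dd 1 \<eta>) v + \<eta> 0 *\<^sub>R v0)) (emb \<Omega> \<psi>) = - (\<Sum>i\<in>UNIV. inner (avg \<eta> (s i)) (emb \<Omega> (dd (axis i 1) \<psi>)))"
      using V1[OF test_fun_tensor[OF \<eta>t \<psi>t]]
      unfolding dt_tensor[OF \<eta> \<psi>] dx_tensor[OF \<eta> \<psi>] tn[OF \<eta> L(1)] tn[OF \<eta> L(2)] tn[OF smooth_dd[OF \<eta>] L(1)] t0[OF L(1)]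
      by (simp add: inner_add_left inner_diff_left)
  qed
  have zv: "zero_grad (avg \<eta> v) (\<lambda>i. - (avg \<eta> (h i) + avg (dd 1 \<eta>) (s i) + \<eta> 0 *\<^sub>R s0 i))" if \<eta>t: "test_fun {..<T} \<eta>" for \<eta>
  proof -
    note \<eta> = test_fun_smooth[OF \<eta>t]
    note \<eta>' = smooth_dd[OF \<eta>, of 1]
    \<comment> \<open>The candidate for the gradient, read off from \<open>V2\<close>. In the
      interior it is the gradient of the average of v; the zero boundary values come from
      \<open>D\<close>.\<close>
    define \<zeta> where "\<zeta> = (\<chi> i. - (avg \<eta> (h i) + avg (dd 1 \<eta>) (s i) + \<eta> 0 *\<^sub>R s0 i))"
    have "zero_grad (avg \<eta> v) (($) \<zeta>)"
    proof (rule zero_grad_from_laplacian_tests)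
      show "avg \<eta> v \<in> supp_l2 \<Omega>" by (rule avg_supp[OF \<eta>])
      show "\<zeta> $ i \<in> supp_l2 \<Omega>" for i
        unfolding \<zeta>_def vec_lambda_beta by (intro supp_minus supp_add supp_scale avg_supp \<eta> \<eta>' supp)
      show "inner (\<zeta> $ i) (emb \<Omega> \<psi>) = - inner (avg \<eta> v) (emb \<Omega> (dd (axis i 1) \<psi>))" if \<psi>t: "test_fun \<Omega> \<psi>" for \<psi> i
      proof -
        note \<psi> = test_fun_smooth[OF \<psi>t]
        note L = L2_dom_smooth[OF \<psi>] L2_dom_smooth[OF smooth_dd[OF \<psi>]]
        show ?thesis
          using V2[OF test_fun_tensor[OF \<eta>t \<psi>t], of i]
          unfolding dt_tensor[OF \<eta> \<psi>] dx_tensor[OF \<eta> \<psi>] tn[OF \<eta> L(1)] tn[OF \<eta> L(2)] tn[OF \<eta>' L(1)] t0[OF L(1)]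
          by (simp add: \<zeta>_def inner_add_left inner_diff_left)
      qed
      show "inner \<zeta> P + inner (avg \<eta> v) L = 0" if H: "(\<psi>, P) \<in> h10_graph" and lap: "weak_laplacian \<psi> L" for \<psi> P L
      proof -
        obtain f where f: "L2 \<Omega> f" "\<psi> = emb \<Omega> f" using h10_supp(1)[OF H] by (rule supp_l2E)
        obtain l where l: "L2 \<Omega> l" "L = emb \<Omega> l" using lap unfolding weak_laplacian_def by (elim conjE supp_l2E)
        have "\<forall>i. \<exists>p. L2 \<Omega> p \<and> P $ i = emb \<Omega> p" using h10_supp(2)[OF H] by (auto simp: supp_l2_def)
        then obtain p where p: "\<And>i. L2 \<Omega> (p i)" "\<And>i. P $ i = emb \<Omega> (p i)" by metis
        have P: "P = (\<chi> i. emb \<Omega> (p i))" by (simp add: vec_eq_iff p(2))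
        have Y: "isY \<Omega> T (tensor \<eta> f) (tensor (dd 1 \<eta>) f) (tensor (dd 1 (dd 1 \<eta>)) f) (\<lambda>z. \<chi> i. tensor \<eta> (p i) z)
          (\<lambda>z. \<chi> i. tensor (dd 1 \<eta>) (p i) z) (tensor \<eta> l) (\<lambda>x. \<chi> i. \<eta> 0 * p i x)"
          by (rule tensor_isY[OF \<eta>t _ f(1) p(1) l(1)]) (use H lap in \<open>simp_all add: P f(2) l(2)\<close>)
        have c: "emb \<Omega> (\<lambda>x. \<eta> 0 * p i x) = \<eta> 0 *\<^sub>R emb \<Omega> (p i)" for i by (rule emb_cmult[OF p(1)])
        have "(\<Sum>i\<in>UNIV. inner (avg \<eta> (h i)) (emb \<Omega> (p i))) + (\<Sum>i\<in>UNIV. inner (avg (dd 1 \<eta>) (s i)) (emb \<Omega> (p i)))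
          - inner (avg \<eta> v) (emb \<Omega> l) + (\<Sum>i\<in>UNIV. inner (s0 i) (\<eta> 0 *\<^sub>R emb \<Omega> (p i))) = 0"
          using D[OF Y] unfolding vec_lambda_beta tn[OF \<eta> p(1)] tn[OF \<eta>' p(1)] tn[OF \<eta> l(1)] c .
        then show ?thesis
          by (simp add: \<zeta>_def l(2) P inner_vec_def inner_add_left inner_diff_left sum.distrib sum_subtractf sum_negf)
      qed
    qed
    then show ?thesis by (simp add: \<zeta>_def zero_grad_def)
  qed
  \<comment> \<open>Weights that avoid T are shifted to the left, out through t = 0, where the
    difference has zero initial values.\<close>
  have step1: "avg \<eta> (g - v) = 0 \<and> avg \<eta> (h i - s i) = 0" if \<eta>t: "test_fun {..<T} \<eta>" for \<eta> i
  proof -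
    have \<eta>U: "test_fun UNIV \<eta>" by (rule test_fun_mono[OF \<eta>t]) simp
    have id: "let \<eta>s = (\<lambda>t. \<eta> (t + 1 * r)); \<eta>s' = (\<lambda>t. dd 1 \<eta> (t + 1 * r)) in
      inner (avg \<eta>s (g - v)) (avg \<eta>s (g - v)) + (\<Sum>i\<in>UNIV. inner (avg \<eta>s (h i - s i)) (avg \<eta>s (h i - s i)))
      = 1 * (inner (avg \<eta>s' (g - v)) (avg \<eta>s (g - v)) + (\<Sum>i\<in>UNIV. inner (avg \<eta>s' (h i - s i)) (avg \<eta>s (h i - s i))))"
      if r: "r \<ge> 0" for r
    proof -
      define \<xi> where "\<xi> t = \<eta> (t + r)" for t
      have \<xi>t: "test_fun {..<T} \<xi>" unfolding \<xi>_def[abs_def] by (rule test_fun_shift[OF \<eta>t]) (use r in auto)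
      note \<xi> = test_fun_smooth[OF \<xi>t]
      note \<xi>' = smooth_dd[OF \<xi>, of 1]
      have d\<xi>: "(\<lambda>t. dd 1 \<eta> (t + r)) = dd 1 \<xi>"
        unfolding \<xi>_def[abs_def] by (rule dd_shift[OF test_fun_smooth[OF \<eta>t], symmetric])

      have z: "zero_grad (avg \<xi> (g - v)) (\<lambda>i. avg \<xi> (h i - s i) - avg (dd 1 \<xi>) (h i - s i))"
        \<comment> \<open>Subtracting the two relations cancels the terms with \<xi>(0): the common
          initial value drops out of the difference.\<close>
        unfolding zero_grad_def
      proof (intro allI impI)
        fix \<tau> i assume \<tau>: "smooth (\<tau> :: real^'d \<Rightarrow> real)"
        show "inner (avg \<xi> (h i - s i) - avg (dd 1 \<xi>) (h i - s i)) (emb \<Omega> \<tau>) = - inner (avg \<xi> (g - v)) (emb \<Omega> (dd (axis i 1) \<tau>))"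
          using zg[OF \<xi>, unfolded zero_grad_def, rule_format, OF \<tau>, of i] zv[OF \<xi>t, unfolded zero_grad_def, rule_format, OF \<tau>, of i]
          unfolding avg_diff[OF \<xi>] avg_diff[OF \<xi>'] inner_diff_left inner_minus_left inner_add_left inner_scaleR_left
          by linarith
      qed

      have w: "weak_div (\<lambda>i. avg \<xi> (h i - s i)) (avg \<xi> (g - v) - avg (dd 1 \<xi>) (g - v))"
        unfolding weak_div_def
      proof (intro allI impI)
        fix w assume w: "test_fun \<Omega> w"
        show "inner (avg \<xi> (g - v) - avg (dd 1 \<xi>) (g - v)) (emb \<Omega> w) = - (\<Sum>i\<in>UNIV. inner (avg \<xi> (h i - s i)) (emb \<Omega> (dd (axis i 1) w)))"
          using wdh[OF \<xi>, unfolded weak_div_def, rule_format, OF w] wds[OF \<xi>t, unfolded weak_div_def, rule_format, OF w]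
          unfolding avg_diff[OF \<xi>] avg_diff[OF \<xi>'] inner_diff_left inner_minus_left inner_add_left inner_scaleR_left
            sum_subtractf by linarith
      qed
      \<comment> \<open>Green's formula applied to the average of the difference and its own fluxes;
        rearranged, it is the energy identity for the shift r.\<close>
      have "inner (avg \<xi> (g - v) - avg (dd 1 \<xi>) (g - v)) (avg \<xi> (g - v))
          + (\<Sum>i\<in>UNIV. inner (avg \<xi> (h i - s i)) (avg \<xi> (h i - s i) - avg (dd 1 \<xi>) (h i - s i))) = 0"
        by (rule green_l2[OF lip z w]) (intro supp_diff avg_supp \<xi> \<xi>')+
      then show ?thesis
        unfolding Let_def mult_1 d\<xi> \<xi>_def[abs_def, symmetric]
        by (simp add: inner_diff_left[of "avg \<xi> (g - v)"] inner_diff_right[of _ "avg \<xi> (h _ - s _)"] sum_subtractf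
            inner_commute[of "avg \<xi> (h _ - s _)" "avg (dd 1 \<xi>) (h _ - s _)"])
    qed
    \<comment> \<open>A shift by T moves the support of the weight to negative times.\<close>
    have out: "\<eta> (t + 1 * T) = 0" if "t \<in> {0<..<T}" for t
      by (rule test_fun_outside[OF \<eta>t]) (use that in auto)
    show ?thesis
      using energy_zero[where a="g - v" and b="\<lambda>i. h i - s i" and \<sigma>=1 and c=T, OF \<eta>U T out id] by blast
  qed
  have sub: "x - y \<in> supp_l2 (cyl T \<Omega>)" if "x \<in> supp_l2 (cyl T \<Omega>)" "y \<in> supp_l2 (cyl T \<Omega>)" for x y
    using subspace_supp[OF cyl_borel] that by (rule subspace_diff)
  have in_test: "test_fun {..<T} \<eta>" "test_fun {0<..} \<eta>" if "test_fun {0<..<T} \<eta>" for \<eta>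
    by (rule test_fun_mono[OF that], force)+
  have "g - v = 0" using step1 in_test(1) by (intro l2_zero_if_avg_zero sub supp) blast
  then have gv: "g = v" by simp
  have "h i - s i = 0" for i using step1 in_test(1) by (intro l2_zero_if_avg_zero sub supp) blast
  then have hs: "h i = s i" for i by simp
  \<comment> \<open>With g = v and h = s the equations that are free at T become equations for (v,
    s). The weights now avoid 0 and are shifted to the right, out through T.\<close>
  have step2: "avg \<eta> v = 0 \<and> avg \<eta> (s i) = 0" if \<eta>t: "test_fun {0<..} \<eta>" for \<eta> i
  proof -
    have \<eta>U: "test_fun UNIV \<eta>" by (rule test_fun_mono[OF \<eta>t]) simp
    have id: "let \<eta>s = (\<lambda>t. \<eta> (t + (- 1) * r)); \<eta>s' = (\<lambda>t. dd 1 \<eta> (t + (- 1) * r)) in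
      inner (avg \<eta>s v) (avg \<eta>s v) + (\<Sum>i\<in>UNIV. inner (avg \<eta>s (s i)) (avg \<eta>s (s i)))
      = (- 1) * (inner (avg \<eta>s' v) (avg \<eta>s v) + (\<Sum>i\<in>UNIV. inner (avg \<eta>s' (s i)) (avg \<eta>s (s i))))"
      if r: "r \<ge> 0" for r
    proof -
      define \<xi> where "\<xi> t = \<eta> (t + (- 1) * r)" for t
      have \<xi>t: "test_fun {0<..} \<xi>" unfolding \<xi>_def[abs_def] by (rule test_fun_shift[OF \<eta>t]) (use r in auto)
      note \<xi> = test_fun_smooth[OF \<xi>t]
      note \<xi>' = smooth_dd[OF \<xi>, of 1]
      \<comment> \<open>Removes the initial data, which are still unknown at this stage.\<close>
      have \<xi>0: "\<xi> 0 = 0" by (rule test_fun_outside[OF \<xi>t]) simp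
      have d\<xi>: "(\<lambda>t. dd 1 \<eta> (t + (- 1) * r)) = dd 1 \<xi>"
        unfolding \<xi>_def[abs_def] by (rule dd_shift[OF test_fun_smooth[OF \<eta>t], symmetric])
      have "inner (- (avg \<xi> v + avg (dd 1 \<xi>) v + \<xi> 0 *\<^sub>R v0)) (avg \<xi> v)
          + (\<Sum>i\<in>UNIV. inner (avg \<xi> (s i)) (- (avg \<xi> (s i) + avg (dd 1 \<xi>) (s i) + \<xi> 0 *\<^sub>R s0 i))) = 0"
        by (rule green_l2[OF lip zg[OF \<xi>, unfolded gv hs] wdh[OF \<xi>, unfolded gv hs]])
          (intro supp_minus supp_add supp_scale avg_supp \<xi> \<xi>' supp)+
      then show ?thesis
        unfolding Let_def d\<xi> \<xi>_def[abs_def, symmetric]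
        by (simp add: \<xi>0 inner_add_left[of "avg \<xi> v"] inner_add_right[of _ "avg \<xi> (s _)"] sum.distrib sum_negf
            inner_commute[of "avg \<xi> (s _)" "avg (dd 1 \<xi>) (s _)"] sum_subtractf inner_diff_right inner_diff_left)
    qed
    \<comment> \<open>A shift by T in the other direction moves the support to times after
      T.\<close>
    have out: "\<eta> (t + (- 1) * T) = 0" if "t \<in> {0<..<T}" for t
      by (rule test_fun_outside[OF \<eta>t]) (use that in auto)
    show ?thesis
      using energy_zero[where a=v and b=s and \<sigma>="- 1" and c=T, OF \<eta>U T out id] by blast
  qed
  show v: "v = 0" using step2 in_test(2) by (intro l2_zero_if_avg_zero supp) blast
  have s: "s i = 0" for i using step2 in_test(2) by (intro l2_zero_if_avg_zero supp) blast
  show "s i = 0" by (rule s)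
  show g0: "g = 0" using gv v by simp
  show "h i = 0" using hs s by simp
  have a0: "avg \<eta> 0 = 0" if "smooth \<eta>" for \<eta>
    using avg_diff[OF that, of 0 0] by simp
  \<comment> \<open>Once all unknowns in the cylinder vanish, the equation with the constant weight
    1 contains only the initial value.\<close>
  show "v0 = 0"
  proof (rule l2_zero_if_test[OF op bd supp(5)])
    fix w assume w: "test_fun \<Omega> w"
    show "inner v0 (emb \<Omega> w) = 0"
      using wdh[of "\<lambda>t. 1", unfolded weak_div_def, OF smooth_const, rule_format, OF w] by (simp add: v g0 hs s a0)
  qed
  show "s0 i = 0"
  proof (rule l2_zero_if_test[OF op bd supp(6)])
    fix w assume w: "test_fun \<Omega> w"
    show "inner (s0 i) (emb \<Omega> w) = 0"
      using zg[of "\<lambda>t. 1", unfolded zero_grad_def, OF smooth_const, rule_format, OF test_fun_smooth[OF w], of i]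
      by (simp add: g0 hs s a0)
  qed
qed

end

section \<open>Density\<close>

text \<open>The Hilbert space for (v, s), (g, h) and (v0, s0), nested in this order. Its product
  norm is the V-norm, so approximation in V becomes approximation in a product of L2 spaces.\<close>

type_synonym 'd qspace = "(real \<times> (real^'d)) l2 \<times> ((real \<times> (real^'d)) l2 ^ 'd)"
type_synonym 'd vspace = "('d qspace \<times> 'd qspace) \<times> ((real^'d) l2 \<times> ((real^'d) l2 ^ 'd))"

context cylinder
begin

definition vec6 :: "(real \<times> (real^'d) \<Rightarrow> real) \<Rightarrow> (real \<times> (real^'d) \<Rightarrow> real^'d) \<Rightarrow> (real \<times> (real^'d) \<Rightarrow> real)
    \<Rightarrow> (real \<times> (real^'d) \<Rightarrow> real^'d) \<Rightarrow> (real^'d \<Rightarrow> real) \<Rightarrow> (real^'d \<Rightarrow> real^'d) \<Rightarrow> 'd vspace" where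
  "vec6 v s g h v0 s0 = (((emb (cyl T \<Omega>) v, \<chi> i. emb (cyl T \<Omega>) (\<lambda>z. s z $ i)),
     (emb (cyl T \<Omega>) g, \<chi> i. emb (cyl T \<Omega>) (\<lambda>z. h z $ i))), (emb \<Omega> v0, \<chi> i. emb \<Omega> (\<lambda>x. s0 x $ i)))"

definition V_L2 :: "(real \<times> (real^'d) \<Rightarrow> real) \<Rightarrow> (real \<times> (real^'d) \<Rightarrow> real^'d) \<Rightarrow> (real \<times> (real^'d) \<Rightarrow> real)
    \<Rightarrow> (real \<times> (real^'d) \<Rightarrow> real^'d) \<Rightarrow> (real^'d \<Rightarrow> real) \<Rightarrow> (real^'d \<Rightarrow> real^'d) \<Rightarrow> bool" where
  "V_L2 v s g h v0 s0 \<longleftrightarrow> L2 (cyl T \<Omega>) v \<and> (\<forall>i. L2 (cyl T \<Omega>) (\<lambda>z. s z $ i)) \<and> L2 (cyl T \<Omega>) g \<and>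
     (\<forall>i. L2 (cyl T \<Omega>) (\<lambda>z. h z $ i)) \<and> L2 \<Omega> v0 \<and> (\<forall>i. L2 \<Omega> (\<lambda>x. s0 x $ i))"

text \<open>The inner products with these vectors are the weak equations that define \<open>isV\<close> and the form
  \<open>D_form\<close>.\<close>

definition test1 :: "(real \<times> (real^'d) \<Rightarrow> real) \<Rightarrow> 'd vspace" where
  "test1 \<phi> = (((emb (cyl T \<Omega>) (dt \<phi>), \<chi> i. - emb (cyl T \<Omega>) (dx i \<phi>)), (emb (cyl T \<Omega>) \<phi>, 0)), (emb \<Omega> (\<lambda>x. \<phi> (0, x)), 0))"

definition test2 :: "'d \<Rightarrow> (real \<times> (real^'d) \<Rightarrow> real) \<Rightarrow> 'd vspace" where
  "test2 i \<phi> = (((- emb (cyl T \<Omega>) (dx i \<phi>), axis i (emb (cyl T \<Omega>) (dt \<phi>))), (0, axis i (emb (cyl T \<Omega>) \<phi>))),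
     (0, axis i (emb \<Omega> (\<lambda>x. \<phi> (0, x)))))"

definition testD :: "(real \<times> (real^'d) \<Rightarrow> real^'d) \<Rightarrow> (real \<times> (real^'d) \<Rightarrow> real^'d) \<Rightarrow> (real \<times> (real^'d) \<Rightarrow> real)
    \<Rightarrow> (real^'d \<Rightarrow> real^'d) \<Rightarrow> 'd vspace" where
  "testD G Gt L G0 = (((- emb (cyl T \<Omega>) L, \<chi> i. emb (cyl T \<Omega>) (\<lambda>z. Gt z $ i)), (0, \<chi> i. emb (cyl T \<Omega>) (\<lambda>z. G z $ i))),
     (0, \<chi> i. emb \<Omega> (\<lambda>x. G0 x $ i)))"

definition V_tests :: "'d vspace set" where
  "V_tests = {test1 \<phi> | \<phi>. test_fun ({..<T} \<times> \<Omega>) \<phi>} \<union> {test2 i \<phi> | i \<phi>. test_fun ({..<T} \<times> \<Omega>) \<phi>}"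

definition D_tests :: "'d vspace set" where
  "D_tests = {testD G Gt L G0 | \<phi> p pp G Gt L G0. isY \<Omega> T \<phi> p pp G Gt L G0}"

text \<open>Excludes components outside the domains, which no test vector could detect.\<close>

definition supported :: "'d vspace set" where
  "supported = {x. fst (fst (fst x)) \<in> supp_l2 (cyl T \<Omega>) \<and> (\<forall>i. snd (fst (fst x)) $ i \<in> supp_l2 (cyl T \<Omega>)) \<and>
     fst (snd (fst x)) \<in> supp_l2 (cyl T \<Omega>) \<and> (\<forall>i. snd (snd (fst x)) $ i \<in> supp_l2 (cyl T \<Omega>)) \<and>
     fst (snd x) \<in> supp_l2 \<Omega> \<and> (\<forall>i. snd (snd x) $ i \<in> supp_l2 \<Omega>)}"

definition V0_vecs :: "'d vspace set" where
  "V0_vecs = supported \<inter> {x. \<forall>c \<in> V_tests \<union> D_tests. inner x c = 0}"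

lemma inner_test:
  fixes x :: "'d vspace"
  shows "x = (((v, s), (g, h)), (v0, s0)) \<Longrightarrow> inner x (test1 \<phi>) = inner v (emb (cyl T \<Omega>) (dt \<phi>))
      - (\<Sum>i\<in>UNIV. inner (s $ i) (emb (cyl T \<Omega>) (dx i \<phi>))) + inner g (emb (cyl T \<Omega>) \<phi>) + inner v0 (emb \<Omega> (\<lambda>x. \<phi> (0, x)))"
    and "x = (((v, s), (g, h)), (v0, s0)) \<Longrightarrow> inner x (test2 j \<phi>) = inner (s $ j) (emb (cyl T \<Omega>) (dt \<phi>))
      - inner v (emb (cyl T \<Omega>) (dx j \<phi>)) + inner (h $ j) (emb (cyl T \<Omega>) \<phi>) + inner (s0 $ j) (emb \<Omega> (\<lambda>x. \<phi> (0, x)))"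
    and "x = (((v, s), (g, h)), (v0, s0)) \<Longrightarrow> inner x (testD G Gt L G0) = (\<Sum>i\<in>UNIV. inner (h $ i) (emb (cyl T \<Omega>) (\<lambda>z. G z $ i)))
      + (\<Sum>i\<in>UNIV. inner (s $ i) (emb (cyl T \<Omega>) (\<lambda>z. Gt z $ i))) - inner v (emb (cyl T \<Omega>) L)
      + (\<Sum>i\<in>UNIV. inner (s0 $ i) (emb \<Omega> (\<lambda>x. G0 x $ i)))"
  by (simp_all add: test1_def test2_def testD_def inner_Pair inner_vec_def[of s] inner_vec_def[of h] inner_vec_def[of s0]
      inner_axis sum_negf)

lemma supported_subspace: "subspace supported"
  using subspace_supp[OF cyl_borel] subspace_supp[OF dom_borel]
  unfolding subspace_def supported_def by simp

lemma supported_closed: "closed supported"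
proof -
  have eq: "supported = (\<lambda>x. fst (fst (fst x))) -` supp_l2 (cyl T \<Omega>) \<inter> (\<Inter>i. (\<lambda>x. snd (fst (fst x)) $ i) -` supp_l2 (cyl T \<Omega>)) \<inter>
    (\<lambda>x. fst (snd (fst x))) -` supp_l2 (cyl T \<Omega>) \<inter> (\<Inter>i. (\<lambda>x. snd (snd (fst x)) $ i) -` supp_l2 (cyl T \<Omega>)) \<inter>
    (\<lambda>x. fst (snd x)) -` supp_l2 \<Omega> \<inter> (\<Inter>i. (\<lambda>x. snd (snd x) $ i) -` supp_l2 \<Omega>)"
    unfolding supported_def by auto
  show ?thesis unfolding eq
    by (intro closed_Int closed_INT ballI closed_vimage closed_supp dom_borel cyl_borel continuous_intros)
qed

lemma V0_vecs_subspace: "subspace V0_vecs" and V0_vecs_closed: "closed V0_vecs"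
  unfolding V0_vecs_def
  by (intro subspace_inter supported_subspace orthogonal_complement_closed_subspace,
      intro closed_Int supported_closed orthogonal_complement_closed_subspace)

lemma vec6_supported: "V_L2 v s g h v0 s0 \<Longrightarrow> vec6 v s g h v0 s0 \<in> supported"
  unfolding V_L2_def vec6_def supported_def by auto

lemma vec6_diff:
  "V_L2 v s g h v0 s0 \<Longrightarrow> V_L2 v' s' g' h' v0' s0' \<Longrightarrow>
   vec6 (\<lambda>z. v z - v' z) (\<lambda>z. s z - s' z) (\<lambda>z. g z - g' z) (\<lambda>z. h z - h' z) (\<lambda>z. v0 z - v0' z) (\<lambda>z. s0 z - s0' z)
   = vec6 v s g h v0 s0 - vec6 v' s' g' h' v0' s0'"
  by (simp add: V_L2_def vec6_def emb_diff vec_eq_iff)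

lemma V_L2_diff:
  "V_L2 v s g h v0 s0 \<Longrightarrow> V_L2 v' s' g' h' v0' s0' \<Longrightarrow>
   V_L2 (\<lambda>z. v z - v' z) (\<lambda>z. s z - s' z) (\<lambda>z. g z - g' z) (\<lambda>z. h z - h' z) (\<lambda>z. v0 z - v0' z) (\<lambda>z. s0 z - s0' z)"
  by (simp add: V_L2_def L2_diff)

lemma vec6_norm:
  assumes "V_L2 v s g h v0 s0"
  shows "(norm (vec6 v s g h v0 s0))^2 = ip (cyl T \<Omega>) v v + ipv (cyl T \<Omega>) s s + ip (cyl T \<Omega>) g g + ipv (cyl T \<Omega>) h h
    + ip \<Omega> v0 v0 + ipv \<Omega> s0 s0"
  using assms by (simp add: V_L2_def vec6_def power2_norm_eq_inner inner_Pair inner_vec_def inner_emb ipv_def)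

text \<open>Membership in V with its witnesses is a set of vanishing inner products, hence a linear
  condition that survives limits.\<close>

lemma isV_iff:
  "isV \<Omega> T v s g h v0 s0 \<longleftrightarrow> V_L2 v s g h v0 s0 \<and> (\<forall>c\<in>V_tests. inner (vec6 v s g h v0 s0) c = 0)"
proof (cases "V_L2 v s g h v0 s0")
  case True
  note L = True[unfolded V_L2_def]
  have eq1: "inner (vec6 v s g h v0 s0) (test1 \<phi>) = 0 \<longleftrightarrow>
        ip (cyl T \<Omega>) g \<phi> = - ip (cyl T \<Omega>) v (dt \<phi>) + (\<Sum>i\<in>UNIV. ip (cyl T \<Omega>) (\<lambda>z. s z $ i) (dx i \<phi>))
                          - ip \<Omega> v0 (\<lambda>x. \<phi> (0, x))" if \<phi>: "test_fun ({..<T} \<times> \<Omega>) \<phi>" for \<phi>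
  proof -
    note s\<phi> = test_fun_smooth[OF \<phi>]
    show ?thesis
      unfolding inner_test(1)[OF vec6_def]
      using L L2_cyl_smooth[OF s\<phi>] L2_cyl_smooth[OF smooth_dt[OF s\<phi>]] L2_cyl_smooth[OF smooth_dx[OF s\<phi>]]
        L2_dom_smooth[OF smooth_slice[OF s\<phi>]]
      by (auto simp: inner_emb)
  qed
  have eq2: "inner (vec6 v s g h v0 s0) (test2 i \<phi>) = 0 \<longleftrightarrow>
        ip (cyl T \<Omega>) (\<lambda>z. h z $ i) \<phi> = - ip (cyl T \<Omega>) (\<lambda>z. s z $ i) (dt \<phi>) + ip (cyl T \<Omega>) v (dx i \<phi>)
                          - ip \<Omega> (\<lambda>x. s0 x $ i) (\<lambda>x. \<phi> (0, x))" if \<phi>: "test_fun ({..<T} \<times> \<Omega>) \<phi>" for \<phi> i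
  proof -
    note s\<phi> = test_fun_smooth[OF \<phi>]
    show ?thesis
      unfolding inner_test(2)[OF vec6_def]
      using L L2_cyl_smooth[OF s\<phi>] L2_cyl_smooth[OF smooth_dt[OF s\<phi>]] L2_cyl_smooth[OF smooth_dx[OF s\<phi>]]
        L2_dom_smooth[OF smooth_slice[OF s\<phi>]]
      by (auto simp: inner_emb)
  qed
  have "(\<forall>c\<in>V_tests. inner (vec6 v s g h v0 s0) c = 0) \<longleftrightarrow> (\<forall>\<phi>. test_fun ({..<T} \<times> \<Omega>) \<phi> \<longrightarrow>
      inner (vec6 v s g h v0 s0) (test1 \<phi>) = 0 \<and> (\<forall>i. inner (vec6 v s g h v0 s0) (test2 i \<phi>) = 0))"
    unfolding V_tests_def by blast
  then show ?thesis
    using L by (simp add: isV_def L2v_def True eq1 eq2 cong: imp_cong)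
next
  case False
  then show ?thesis by (auto simp: isV_def L2v_def V_L2_def)
qed

lemma D_form_iff:
  assumes L: "V_L2 v s g h v0 s0" and Y: "isY \<Omega> T \<phi> p pp G Gt L G0"
  shows "D_form \<Omega> T v s h s0 G Gt L G0 = inner (vec6 v s g h v0 s0) (testD G Gt L G0)"
  unfolding inner_test(3)[OF vec6_def] D_form_def ipv_def
  using L[unfolded V_L2_def] isY_L2[OF Y] by (simp add: inner_emb)

lemma V0_vecs_iff:
  assumes L: "V_L2 v s g h v0 s0"
  shows "vec6 v s g h v0 s0 \<in> V0_vecs \<longleftrightarrow> isV \<Omega> T v s g h v0 s0 \<and>
    (\<forall>\<phi> p pp G Gt L G0. isY \<Omega> T \<phi> p pp G Gt L G0 \<longrightarrow> D_form \<Omega> T v s h s0 G Gt L G0 = 0)"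
proof -
  have "(\<forall>c\<in>D_tests. inner (vec6 v s g h v0 s0) c = 0) \<longleftrightarrow>
      (\<forall>\<phi> p pp G Gt L G0. isY \<Omega> T \<phi> p pp G Gt L G0 \<longrightarrow> inner (vec6 v s g h v0 s0) (testD G Gt L G0) = 0)"
    unfolding D_tests_def by blast
  also have "\<dots> \<longleftrightarrow> (\<forall>\<phi> p pp G Gt L G0. isY \<Omega> T \<phi> p pp G Gt L G0 \<longrightarrow> D_form \<Omega> T v s h s0 G Gt L G0 = 0)"
    using D_form_iff[OF L] by metis
  finally show ?thesis unfolding V0_vecs_def isV_iff using vec6_supported[OF L] L by blast
qed

section \<open>Uniqueness of the witnesses and the V-norm\<close>

lemma isV_unique:
  assumes "isV \<Omega> T v s g h v0 s0" "isV \<Omega> T v s g' h' v0' s0'"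
  shows "vec6 v s g h v0 s0 = vec6 v s g' h' v0' s0'"
proof -
  have L: "V_L2 v s g h v0 s0" "V_L2 v s g' h' v0' s0'" using assms by (auto simp: isV_iff)
  define x where "x = vec6 v s g h v0 s0 - vec6 v s g' h' v0' s0'"
  define dg where "dg = emb (cyl T \<Omega>) g - emb (cyl T \<Omega>) g'"
  define dh where "dh = (\<chi> i. emb (cyl T \<Omega>) (\<lambda>z. h z $ i)) - (\<chi> i. emb (cyl T \<Omega>) (\<lambda>z. h' z $ i))"
  define dv0 where "dv0 = emb \<Omega> v0 - emb \<Omega> v0'"
  define ds0 where "ds0 = (\<chi> i. emb \<Omega> (\<lambda>z. s0 z $ i)) - (\<chi> i. emb \<Omega> (\<lambda>z. s0' z $ i))"
  have x: "x = (((0, 0), (dg, dh)), (dv0, ds0))"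
    by (simp add: x_def vec6_def dg_def dh_def dv0_def ds0_def zero_prod_def)
  have "x \<in> supported" unfolding x_def using vec6_supported[OF L(1)] vec6_supported[OF L(2)]
    by (rule subspace_diff[OF supported_subspace])
  then have sup: "dg \<in> supp_l2 (cyl T \<Omega>)" "\<And>i. dh $ i \<in> supp_l2 (cyl T \<Omega>)" "dv0 \<in> supp_l2 \<Omega>" "\<And>i. ds0 $ i \<in> supp_l2 \<Omega>"
    by (auto simp: supported_def x)
  have "inner x c = 0" if "c \<in> V_tests" for c
    using assms that by (simp add: isV_iff x_def inner_diff_left)
  then have "inner x (test1 \<phi>) = 0" "inner x (test2 i \<phi>) = 0" if "test_fun ({..<T} \<times> \<Omega>) \<phi>" for \<phi> i
    using that unfolding V_tests_def by blast+
  then have t1: "inner dg (emb (cyl T \<Omega>) \<phi>) + inner dv0 (emb \<Omega> (\<lambda>x. \<phi> (0, x))) = 0"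
    and t2: "inner (dh $ i) (emb (cyl T \<Omega>) \<phi>) + inner (ds0 $ i) (emb \<Omega> (\<lambda>x. \<phi> (0, x))) = 0"
    if "test_fun ({..<T} \<times> \<Omega>) \<phi>" for \<phi> i
    using that unfolding inner_test[OF x] by auto
  have z0: "test_fun ({..<T} \<times> \<Omega>) \<phi>" "emb \<Omega> (\<lambda>x. \<phi> (0, x)) = 0" if "test_fun (cyl T \<Omega>) \<phi>" for \<phi>
  proof -
    show "test_fun ({..<T} \<times> \<Omega>) \<phi>" by (rule test_fun_mono[OF that]) (auto simp: cyl_def)
    have "\<phi> (0, x) = 0" for x by (rule test_fun_outside[OF that]) (simp add: cyl_def)
    then show "emb \<Omega> (\<lambda>x. \<phi> (0, x)) = 0" by simp
  qed
  \<comment> \<open>Test functions inside the cylinder do not see the initial values and determine g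
    and h first.\<close>
  have dg0: "dg = 0"
  proof (rule l2_zero_if_test[OF cyl_open cyl_bounded sup(1)])
    fix \<phi> assume \<phi>: "test_fun (cyl T \<Omega>) \<phi>"
    show "inner dg (emb (cyl T \<Omega>) \<phi>) = 0" using t1[OF z0(1)[OF \<phi>]] z0(2)[OF \<phi>] by simp
  qed
  have dh0: "dh $ i = 0" for i
  proof (rule l2_zero_if_test[OF cyl_open cyl_bounded sup(2)])
    fix \<phi> assume \<phi>: "test_fun (cyl T \<Omega>) \<phi>"
    show "inner (dh $ i) (emb (cyl T \<Omega>) \<phi>) = 0" using t2[OF z0(1)[OF \<phi>], of i] z0(2)[OF \<phi>] by simp
  qed
  \<comment> \<open>A weight with value 1 at time 0 turns any test function w in space into one
    whose initial slice is w; with \<open>dg\<close> and \<open>dh\<close> gone this isolates the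
    initial values.\<close>
  obtain \<theta> where \<theta>: "test_fun {..<T} \<theta>" "\<theta> 0 = 1" using time_partition[OF T] by metis
  have tt: "test_fun ({..<T} \<times> \<Omega>) (tensor \<theta> w)" "(\<lambda>x. tensor \<theta> w (0, x)) = w" if "test_fun \<Omega> w" for w
    using test_fun_tensor[OF \<theta>(1) that] by (auto simp: tensor_def \<theta>(2))
  have "dv0 = 0"
  proof (rule l2_zero_if_test[OF op bd sup(3)])
    fix w assume w: "test_fun \<Omega> w"
    show "inner dv0 (emb \<Omega> w) = 0" using t1[OF tt(1)[OF w]] unfolding tt(2)[OF w] dg0 by simp
  qed
  moreover have "ds0 $ i = 0" for i
  proof (rule l2_zero_if_test[OF op bd sup(4)])
    fix w assume w: "test_fun \<Omega> w"
    show "inner (ds0 $ i) (emb \<Omega> w) = 0" using t2[OF tt(1)[OF w], of i] unfolding tt(2)[OF w] dh0 by simp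
  qed
  ultimately have "x = 0" by (simp add: x dg0 dh0 zero_prod_def vec_eq_iff)
  then show ?thesis by (simp add: x_def)
qed

text \<open>The set behind the choice operator has exactly one element, since all witnesses of the
  same pair give the same vector.\<close>

lemma V_norm_eq:
  assumes V: "isV \<Omega> T v s g h v0 s0" shows "V_norm \<Omega> T v s = norm (vec6 v s g h v0 s0)"
proof -
  let ?R = "\<lambda>r. \<exists>g h v0 s0. isV \<Omega> T v s g h v0 s0 \<and>
      r = ip (cyl T \<Omega>) v v + ipv (cyl T \<Omega>) s s + ip (cyl T \<Omega>) g g + ipv (cyl T \<Omega>) h h + ip \<Omega> v0 v0 + ipv \<Omega> s0 s0"
  have unique: "r = (norm (vec6 v s g h v0 s0))^2" if R: "?R r" for r
  proof -
    obtain g' h' v0' s0' where V': "isV \<Omega> T v s g' h' v0' s0'"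
      and r: "r = ip (cyl T \<Omega>) v v + ipv (cyl T \<Omega>) s s + ip (cyl T \<Omega>) g' g' + ipv (cyl T \<Omega>) h' h' + ip \<Omega> v0' v0' + ipv \<Omega> s0' s0'"
      using R by blast
    have "V_L2 v s g' h' v0' s0'" using V' by (simp add: isV_iff)
    then show ?thesis using vec6_norm r isV_unique[OF V V'] by simp
  qed
  have "V_L2 v s g h v0 s0" using V by (simp add: isV_iff)
  then have "?R ((norm (vec6 v s g h v0 s0))^2)" using V vec6_norm by blast
  then have "?R (SOME r. ?R r)" by (rule someI[of ?R])
  then have "(SOME r. ?R r) = (norm (vec6 v s g h v0 s0))^2" by (rule unique)
  then show ?thesis by (simp add: V_norm_def)
qed

definition smooth_vec :: "(real \<times> (real^'d) \<Rightarrow> real) \<Rightarrow> (real \<times> (real^'d) \<Rightarrow> real^'d) \<Rightarrow> 'd vspace" where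
  "smooth_vec w \<tau> = vec6 w \<tau> (\<lambda>z. dt w z - (\<Sum>i\<in>UNIV. dx i (\<lambda>z. \<tau> z $ i) z)) (\<lambda>z. \<chi> i. dt (\<lambda>z. \<tau> z $ i) z - dx i w z)
    (\<lambda>x. w (0, x)) (\<lambda>x. \<tau> (0, x))"

lemma smooth_vec_L2:
  assumes "smooth w" "\<And>i. smooth (\<lambda>z. \<tau> z $ i)"
  shows "V_L2 w \<tau> (\<lambda>z. dt w z - (\<Sum>i\<in>UNIV. dx i (\<lambda>z. \<tau> z $ i) z)) (\<lambda>z. \<chi> i. dt (\<lambda>z. \<tau> z $ i) z - dx i w z)
    (\<lambda>x. w (0, x)) (\<lambda>x. \<tau> (0, x))"
  using smooth_isV[OF assms] by (simp add: isV_iff)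

lemma smooth_vec_eq:
  assumes w: "smooth w" and \<tau>: "\<And>i. smooth (\<lambda>z. \<tau> z $ i)"
  shows "smooth_vec w \<tau> = (((emb (cyl T \<Omega>) w, \<chi> i. emb (cyl T \<Omega>) (\<lambda>z. \<tau> z $ i)),
     (emb (cyl T \<Omega>) (dt w) - (\<Sum>i\<in>UNIV. emb (cyl T \<Omega>) (dx i (\<lambda>z. \<tau> z $ i))),
      \<chi> i. emb (cyl T \<Omega>) (dt (\<lambda>z. \<tau> z $ i)) - emb (cyl T \<Omega>) (dx i w))),
     (emb \<Omega> (\<lambda>x. w (0, x)), \<chi> i. emb \<Omega> (\<lambda>x. \<tau> (0, x) $ i)))"
proof -
  have L: "L2 (cyl T \<Omega>) (dt w)" "L2 (cyl T \<Omega>) (dx i w)" "L2 (cyl T \<Omega>) (dx i (\<lambda>z. \<tau> z $ j))"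
    "L2 (cyl T \<Omega>) (dt (\<lambda>z. \<tau> z $ j))" for i j
    by (intro L2_cyl_smooth smooth_dx smooth_dt w \<tau>)+
  have Ls: "L2 (cyl T \<Omega>) (\<lambda>z. \<Sum>i\<in>UNIV. dx i (\<lambda>z. \<tau> z $ i) z)" by (rule L2_sum) (rule L)
  show ?thesis by (simp add: smooth_vec_def vec6_def emb_diff L Ls emb_sum vec_eq_iff)
qed

definition smooth_vecs :: "'d vspace set" where
  "smooth_vecs = {smooth_vec w \<tau> | w \<tau>. smooth_pair_bc \<Omega> T w \<tau>}"

lemma smooth_vecs_subspace: "subspace smooth_vecs"
  unfolding subspace_def
proof (intro conjI ballI allI)
  have z: "smooth_pair_bc \<Omega> T (\<lambda>z. 0) (\<lambda>z. 0 :: real^'d)" by (simp add: smooth_pair_bc_def)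
  have "smooth_vec (\<lambda>z. 0) (\<lambda>z. 0) = 0"
    by (subst smooth_vec_eq) (simp_all add: dt_eq_dd dx_eq_dd zero_prod_def vec_eq_iff)
  then show "0 \<in> smooth_vecs" unfolding smooth_vecs_def using z by (metis (mono_tags, lifting) mem_Collect_eq)
  fix x assume "x \<in> smooth_vecs"
  then obtain w \<tau> where x: "x = smooth_vec w \<tau>" and p: "smooth_pair_bc \<Omega> T w \<tau>" by (auto simp: smooth_vecs_def)
  then have s: "smooth w" "\<And>i. smooth (\<lambda>z. \<tau> z $ i)" by (auto simp: smooth_pair_bc_def)
  note L = L2_cyl_smooth[OF s(1)] L2_cyl_smooth[OF s(2)] L2_cyl_smooth[OF smooth_dd[OF s(1)]] L2_cyl_smooth[OF smooth_dd[OF s(2)]]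
    L2_dom_smooth[OF smooth_slice[OF s(1)]] L2_dom_smooth[OF smooth_slice[OF s(2)]]
  show "c *\<^sub>R x \<in> smooth_vecs" for c
    unfolding smooth_vecs_def x
  proof (intro CollectI exI conjI)
    show "smooth_pair_bc \<Omega> T (\<lambda>z. c * w z) (\<lambda>z. c *\<^sub>R \<tau> z)" using p by (auto simp: smooth_pair_bc_def)
    have s': "smooth (\<lambda>z. c * w z)" "\<And>i. smooth (\<lambda>z. (c *\<^sub>R \<tau> z) $ i)" using s by auto
    show "c *\<^sub>R smooth_vec w \<tau> = smooth_vec (\<lambda>z. c * w z) (\<lambda>z. c *\<^sub>R \<tau> z)"
      unfolding smooth_vec_eq[OF s] smooth_vec_eq[OF s'] vector_scaleR_component real_scaleR_def dt_eq_dd dx_eq_dd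
      by (simp add: dd_cmult s emb_cmult L scaleR_sum_right scaleR_diff_right vec_eq_iff)
  qed
  fix x' assume "x' \<in> smooth_vecs"
  then obtain w' \<tau>' where x': "x' = smooth_vec w' \<tau>'" and p': "smooth_pair_bc \<Omega> T w' \<tau>'" by (auto simp: smooth_vecs_def)
  then have s': "smooth w'" "\<And>i. smooth (\<lambda>z. \<tau>' z $ i)" by (auto simp: smooth_pair_bc_def)
  note L' = L2_cyl_smooth[OF s'(1)] L2_cyl_smooth[OF s'(2)] L2_cyl_smooth[OF smooth_dd[OF s'(1)]] L2_cyl_smooth[OF smooth_dd[OF s'(2)]]
    L2_dom_smooth[OF smooth_slice[OF s'(1)]] L2_dom_smooth[OF smooth_slice[OF s'(2)]]
  show "x + x' \<in> smooth_vecs"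
    unfolding smooth_vecs_def x x'
  proof (intro CollectI exI conjI)
    show "smooth_pair_bc \<Omega> T (\<lambda>z. w z + w' z) (\<lambda>z. \<tau> z + \<tau>' z)" using p p' by (auto simp: smooth_pair_bc_def)
    have s'': "smooth (\<lambda>z. w z + w' z)" "\<And>i. smooth (\<lambda>z. (\<tau> z + \<tau>' z) $ i)" using s s' by auto
    show "smooth_vec w \<tau> + smooth_vec w' \<tau>' = smooth_vec (\<lambda>z. w z + w' z) (\<lambda>z. \<tau> z + \<tau>' z)"
      unfolding smooth_vec_eq[OF s] smooth_vec_eq[OF s'] smooth_vec_eq[OF s''] vector_add_component dt_eq_dd dx_eq_dd
      by (simp add: dd_add s s' emb_add L L' sum.distrib vec_eq_iff)
  qed
qed

lemma smooth_pair_V0: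
  assumes p: "smooth_pair_bc \<Omega> T w \<tau>"
  shows "isV \<Omega> T w \<tau> (\<lambda>z. dt w z - (\<Sum>i\<in>UNIV. dx i (\<lambda>z. \<tau> z $ i) z)) (\<lambda>z. \<chi> i. dt (\<lambda>z. \<tau> z $ i) z - dx i w z)
      (\<lambda>x. w (0, x)) (\<lambda>x. \<tau> (0, x)) \<and> (\<forall>\<phi> p pp G Gt L G0. isY \<Omega> T \<phi> p pp G Gt L G0 \<longrightarrow>
      D_form \<Omega> T w \<tau> (\<lambda>z. \<chi> i. dt (\<lambda>z. \<tau> z $ i) z - dx i w z) (\<lambda>x. \<tau> (0, x)) G Gt L G0 = 0)"
proof -
  have "smooth w" "\<And>i. smooth (\<lambda>z. \<tau> z $ i)" using p by (auto simp: smooth_pair_bc_def)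
  then show ?thesis using smooth_isV smooth_pair_inV0[OF p] by blast
qed

lemma smooth_vecs_V0: "smooth_vecs \<subseteq> V0_vecs"
proof
  fix x assume "x \<in> smooth_vecs"
  then obtain w \<tau> where p: "smooth_pair_bc \<Omega> T w \<tau>" and x: "x = smooth_vec w \<tau>" by (auto simp: smooth_vecs_def)
  have s: "smooth w" "\<And>i. smooth (\<lambda>z. \<tau> z $ i)" using p by (auto simp: smooth_pair_bc_def)
  show "x \<in> V0_vecs" unfolding x smooth_vec_def V0_vecs_iff[OF smooth_vec_L2[OF s]] by (rule smooth_pair_V0[OF p])
qed

text \<open>Pairs with one nonzero component are enough: their vectors reproduce the hypotheses
  \<open>S1\<close> and \<open>S2\<close> of \<open>orthogonal_vanish\<close> literally.\<close>

lemma V0_orthogonal_trivial: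
  assumes lip: "lipschitz_domain \<Omega>" and y: "y \<in> V0_vecs" and orth: "\<And>x. x \<in> smooth_vecs \<Longrightarrow> inner y x = 0"
  shows "y = 0"
proof -
  obtain v s g h v0 s0 where yv: "y = (((v, s), (g, h)), (v0, s0))" by (metis surj_pair)
  have c: "inner y c = 0" if "c \<in> V_tests \<union> D_tests" for c using y that by (auto simp: V0_vecs_def)
  have sup: "v \<in> supp_l2 (cyl T \<Omega>)" "g \<in> supp_l2 (cyl T \<Omega>)" "\<And>i. s $ i \<in> supp_l2 (cyl T \<Omega>)"
      "\<And>i. h $ i \<in> supp_l2 (cyl T \<Omega>)" "v0 \<in> supp_l2 \<Omega>" "\<And>i. s0 $ i \<in> supp_l2 \<Omega>"
    using y by (auto simp: V0_vecs_def supported_def yv)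
  have V1: "inner v (emb (cyl T \<Omega>) (dt \<phi>)) - (\<Sum>i\<in>UNIV. inner (s $ i) (emb (cyl T \<Omega>) (dx i \<phi>)))
      + inner g (emb (cyl T \<Omega>) \<phi>) + inner v0 (emb \<Omega> (\<lambda>x. \<phi> (0, x))) = 0" if "test_fun ({..<T} \<times> \<Omega>) \<phi>" for \<phi>
    unfolding inner_test(1)[OF yv, symmetric] by (rule c) (use that in \<open>auto simp: V_tests_def\<close>)
  have V2: "inner (s $ i) (emb (cyl T \<Omega>) (dt \<phi>)) - inner v (emb (cyl T \<Omega>) (dx i \<phi>))
      + inner (h $ i) (emb (cyl T \<Omega>) \<phi>) + inner (s0 $ i) (emb \<Omega> (\<lambda>x. \<phi> (0, x))) = 0" if "test_fun ({..<T} \<times> \<Omega>) \<phi>" for \<phi> i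
    unfolding inner_test(2)[OF yv, symmetric] by (rule c) (use that in \<open>auto simp: V_tests_def\<close>)
  have D: "(\<Sum>i\<in>UNIV. inner (h $ i) (emb (cyl T \<Omega>) (\<lambda>z. G z $ i))) + (\<Sum>i\<in>UNIV. inner (s $ i) (emb (cyl T \<Omega>) (\<lambda>z. Gt z $ i)))
      - inner v (emb (cyl T \<Omega>) L) + (\<Sum>i\<in>UNIV. inner (s0 $ i) (emb \<Omega> (\<lambda>x. G0 x $ i))) = 0"
    if "isY \<Omega> T \<phi> p pp G Gt L G0" for \<phi> p pp G Gt L G0
    unfolding inner_test(3)[OF yv, symmetric] by (rule c) (use that in \<open>auto simp: D_tests_def\<close>)
  have S1: "inner v (emb (cyl T \<Omega>) w) + inner g (emb (cyl T \<Omega>) (dt w)) - (\<Sum>i\<in>UNIV. inner (h $ i) (emb (cyl T \<Omega>) (dx i w)))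
      + inner v0 (emb \<Omega> (\<lambda>x. w (0, x))) = 0"
    if w: "smooth w" and bc: "\<And>t x. t \<in> {0<..<T} \<Longrightarrow> x \<in> frontier \<Omega> \<Longrightarrow> w (t, x) = 0" for w
  proof -
    have "smooth_pair_bc \<Omega> T w (\<lambda>z. 0)" using w bc by (simp add: smooth_pair_bc_def)
    then have "inner y (smooth_vec w (\<lambda>z. 0)) = 0" by (intro orth) (auto simp: smooth_vecs_def)
    moreover have "smooth_vec w (\<lambda>z. 0) = (((emb (cyl T \<Omega>) w, 0), (emb (cyl T \<Omega>) (dt w), \<chi> i. - emb (cyl T \<Omega>) (dx i w))),
        (emb \<Omega> (\<lambda>x. w (0, x)), 0))"
      by (subst smooth_vec_eq) (simp_all add: w dt_eq_dd[of "\<lambda>z. 0"] dx_eq_dd[of _ "\<lambda>z. 0"] vec_eq_iff)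
    ultimately show ?thesis by (simp add: yv inner_Pair inner_vec_def[of h] sum_negf)
  qed
  have S2: "inner (s $ i) (emb (cyl T \<Omega>) m) - inner g (emb (cyl T \<Omega>) (dx i m))
      + inner (h $ i) (emb (cyl T \<Omega>) (dt m)) + inner (s0 $ i) (emb \<Omega> (\<lambda>x. m (0, x))) = 0" if m: "smooth m" for m i
  proof -
    \<comment> \<open>A field with the single component m meets no boundary condition, because the
      scalar part of the pair is 0.\<close>
    define \<tau> where "\<tau> z = axis i (m z)" for z
    have \<tau>i: "(\<lambda>z. \<tau> z $ j) = (if j = i then m else (\<lambda>z. 0))" for j by (auto simp: \<tau>_def axis_def)
    have \<tau>0: "(\<lambda>x. \<tau> (0, x) $ j) = (if j = i then (\<lambda>x. m (0, x)) else (\<lambda>x. 0))" for j by (auto simp: \<tau>_def axis_def)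
    have sm: "smooth (\<lambda>z. \<tau> z $ j)" for j using m by (simp add: \<tau>i)
    have "smooth_pair_bc \<Omega> T (\<lambda>z. 0) \<tau>" using sm by (simp add: smooth_pair_bc_def)
    then have "inner y (smooth_vec (\<lambda>z. 0) \<tau>) = 0" by (intro orth) (auto simp: smooth_vecs_def)
    moreover have "smooth_vec (\<lambda>z. 0) \<tau> = (((0, axis i (emb (cyl T \<Omega>) m)), (- emb (cyl T \<Omega>) (dx i m), axis i (emb (cyl T \<Omega>) (dt m)))),
        (0, axis i (emb \<Omega> (\<lambda>x. m (0, x)))))"
    proof -
      have d0: "dt (\<lambda>z. 0) = (\<lambda>z. 0)" "dx j (\<lambda>z. 0) = (\<lambda>z. 0)" for j by (simp_all add: dt_eq_dd dx_eq_dd)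
      have "(\<Sum>j\<in>UNIV. emb (cyl T \<Omega>) (dx j (if j = i then m else (\<lambda>z. 0)))) = (\<Sum>j\<in>UNIV. if j = i then emb (cyl T \<Omega>) (dx j m) else 0)"
        by (intro sum.cong refl) (simp add: d0)
      then show ?thesis
        by (subst smooth_vec_eq[OF smooth_const sm]) (auto simp: \<tau>i \<tau>0 d0 vec_eq_iff axis_def)
    qed
    ultimately show ?thesis by (simp add: yv inner_Pair inner_axis)
  qed
  note rules = orthogonal_vanish[where s="($) s" and h="($) h" and ?s0.0="($) s0", OF lip sup V1 V2 D S1 S2]
  have "v = 0" by (rule rules(1); blast)
  moreover have "g = 0" by (rule rules(2); blast)
  moreover have "s $ i = 0" for i by (rule rules(3); blast)
  moreover have "h $ i = 0" for i by (rule rules(4); blast)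
  moreover have "v0 = 0" by (rule rules(5); blast)
  moreover have "s0 $ i = 0" for i by (rule rules(6); blast)
  ultimately show "y = 0" by (simp add: yv zero_prod_def vec_eq_iff)
qed

end

text \<open>Membership of the difference in V is part of the claim because \<open>V_norm\<close> is
  defined by a choice, whose value is meaningful only for members of V.\<close>

theorem theorem3p6:
  fixes \<Omega> :: "(real^'d) set" and T :: real
  assumes "polygonal_lipschitz_domain \<Omega>" and "T > 0"
  shows "(\<forall>w \<tau>. smooth_pair_bc \<Omega> T w \<tau> \<longrightarrow> inV0 \<Omega> T w \<tau>) \<and>
         (\<forall>v \<sigma>. inV0 \<Omega> T v \<sigma> \<longrightarrow> (\<forall>\<epsilon>>0. \<exists>w \<tau>. smooth_pair_bc \<Omega> T w \<tau> \<and>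
              inV \<Omega> T (\<lambda>z. v z - w z) (\<lambda>z. \<sigma> z - \<tau> z) \<and>
              V_norm \<Omega> T (\<lambda>z. v z - w z) (\<lambda>z. \<sigma> z - \<tau> z) < \<epsilon>))"
proof (intro conjI allI impI)
  have lip: "lipschitz_domain \<Omega>" and bd: "bounded \<Omega>"
    using assms(1) by (simp_all add: polygonal_lipschitz_domain_def)
  interpret cylinder \<Omega> T
    using lip bd assms(2) by unfold_locales (simp_all add: lipschitz_domain_def)
  show "inV0 \<Omega> T w \<tau>" if "smooth_pair_bc \<Omega> T w \<tau>" for w \<tau>
    using smooth_pair_V0[OF that] unfolding inV0_def by blast
  fix v \<sigma> \<epsilon> assume V0: "inV0 \<Omega> T v \<sigma>" and \<epsilon>: "\<epsilon> > (0::real)"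
  obtain g h v0 s0 where V: "isV \<Omega> T v \<sigma> g h v0 s0"
    and D: "\<forall>\<phi> p pp G Gt L G0. isY \<Omega> T \<phi> p pp G Gt L G0 \<longrightarrow> D_form \<Omega> T v \<sigma> h s0 G Gt L G0 = 0"
    using V0 unfolding inV0_def by blast
  have VL: "V_L2 v \<sigma> g h v0 s0" using V by (simp add: isV_iff)
  let ?x = "vec6 v \<sigma> g h v0 s0"
  have x: "?x \<in> V0_vecs" unfolding V0_vecs_iff[OF VL] using V D by blast
  have "?x \<in> closure smooth_vecs"
    by (rule closure_if_orthogonal_trivial[OF smooth_vecs_subspace V0_vecs_subspace V0_vecs_closed smooth_vecs_V0 _ x])
      (rule V0_orthogonal_trivial[OF lip])
  then obtain y where y: "y \<in> smooth_vecs" "dist y ?x < \<epsilon>"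
    using \<epsilon> unfolding closure_approachable by blast
  then obtain w \<tau> where p: "smooth_pair_bc \<Omega> T w \<tau>" and yw: "y = smooth_vec w \<tau>" by (auto simp: smooth_vecs_def)
  have s: "smooth w" "\<And>i. smooth (\<lambda>z. \<tau> z $ i)" using p by (auto simp: smooth_pair_bc_def)
  note WL = smooth_vec_L2[OF s]
  note eq = vec6_diff[OF VL WL]
  \<comment> \<open>The difference stays in a subspace all of whose vectors satisfy the weak
    equations. This supplies its witnesses, and with them its norm, as differences of the given
    ones.\<close>
  have "?x - smooth_vec w \<tau> \<in> V0_vecs"
    using x smooth_vecs_V0 y(1) V0_vecs_subspace unfolding yw by (blast intro: subspace_diff)
  then have isV: "isV \<Omega> T (\<lambda>z. v z - w z) (\<lambda>z. \<sigma> z - \<tau> z) (\<lambda>z. g z - (dt w z - (\<Sum>i\<in>UNIV. dx i (\<lambda>z. \<tau> z $ i) z)))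
      (\<lambda>z. h z - (\<chi> i. dt (\<lambda>z. \<tau> z $ i) z - dx i w z)) (\<lambda>x. v0 x - w (0, x)) (\<lambda>x. s0 x - \<tau> (0, x))"
    unfolding smooth_vec_def eq[symmetric] V0_vecs_iff[OF V_L2_diff[OF VL WL]] by blast
  have "V_norm \<Omega> T (\<lambda>z. v z - w z) (\<lambda>z. \<sigma> z - \<tau> z) = norm (?x - smooth_vec w \<tau>)"
    unfolding V_norm_eq[OF isV] eq smooth_vec_def ..
  also have "\<dots> < \<epsilon>" using y(2) by (simp add: yw dist_norm norm_minus_commute)
  finally show "\<exists>w \<tau>. smooth_pair_bc \<Omega> T w \<tau> \<and> inV \<Omega> T (\<lambda>z. v z - w z) (\<lambda>z. \<sigma> z - \<tau> z) \<and>
      V_norm \<Omega> T (\<lambda>z. v z - w z) (\<lambda>z. \<sigma> z - \<tau> z) < \<epsilon>"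
    using p isV unfolding inV_def by blast
qed

end
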